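(* Let $n$ be a power of a prime $p$, let $c$ be a divisor of $n+1$ and $d$ a divisor of $n^2-n+1$. Let $K$ be the following group of automorphisms of the GK-curve $\mathcal X$, of order $\frac{n^3+1}{cd}$: $$K=\left\{(X,Y,Z,T)\mapsto(b^{-1}X,\,bY,\,\lambda Z,\,T)\ \middle|\ b^{\frac{n+1}{c}}=1,\ \lambda^{\frac{n^2-n+1}{d}}=1\right\}.$$ Then the fixed field of $K$ in the function field $\mathbb K(x,y,z)$ of $\mathcal X$ is $\mathbb K(u,v,w)$, where $u=x^{\frac{n+1}{c}}$, $v=xy$, $w=z^{\frac{n^2-n+1}{d}}$, and the quotient curve $\mathcal X/K$ has the irreducible affine equations $$\mathcal X/K:\quad W^d=V\left(1+U^c+U^{2c}+\cdots+U^{(n-2)c}\right),\qquad V^{n+1}=U^{2c}-U^c.$$ The genus of $\mathcal X/K$ is $$g(\mathcal X/K)=\frac c2\left[(d-1)n^2+n-d-\gcd\Big(2,\frac{n+1}{c}\Big)\right]+1.$$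
   Context: Let $\mathbb K$ be the algebraic closure of $\mathbb F_{n^6}$. The GK-curve is taken in the non-singular model in $\mathbb P^3(\mathbb K)$ with homogeneous coordinates $(X,Y,Z,T)$ and affine equations ($T=1$) $$\mathcal X:\quad Z^{n^2-n+1}=Y\,\frac{X^{n^2}-X}{X^{n+1}-1},\qquad Y^{n+1}=X^{n+1}-1,$$ and $x,y,z$ denote its affine coordinate functions. The parameters $b,\lambda$ in the definition of $K$ range over $\mathbb K$. *)

theory Defs
  imports "HOL-Algebra.Algebra" "HOL-Algebra.Algebraic_Closure_Type" "HOL-Library.Cardinality"
begin

no_notation Polynomials.var (\<open>X\<index>\<close>)

section \<open>Function fields of algebraic sets\<close>

text \<open>
  The base field is a type \<open>'a::field\<close>; it is only instantiated with algebraically closed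
  fields, where polynomials may be identified with polynomial functions.  A rational function is
  a class of pairs \<open>(F, G)\<close>, read as \<open>F/G\<close>, drawn from a set \<open>D\<close> of admissible pairs, with
  \<open>F/G = F'/G'\<close> iff \<open>F G' - F' G\<close> vanishes on the set of points \<open>S\<close>.
\<close>

type_synonym ('p, 'a) ratfun = "(('p \<Rightarrow> 'a) \<times> ('p \<Rightarrow> 'a)) set"

definition frac_rel :: "'p set \<Rightarrow> (('p \<Rightarrow> 'a::field) \<times> ('p \<Rightarrow> 'a)) set
    \<Rightarrow> ((('p \<Rightarrow> 'a) \<times> ('p \<Rightarrow> 'a)) \<times> (('p \<Rightarrow> 'a) \<times> ('p \<Rightarrow> 'a))) set" where
  "frac_rel S D = {((F, G), (F', G')). (F, G) \<in> D \<and> (F', G') \<in> D \<and>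
                     (\<forall>s\<in>S. F s * G' s = F' s * G s)}"

definition frac :: "'p set \<Rightarrow> (('p \<Rightarrow> 'a::field) \<times> ('p \<Rightarrow> 'a)) set
    \<Rightarrow> ('p \<Rightarrow> 'a) \<Rightarrow> ('p \<Rightarrow> 'a) \<Rightarrow> ('p, 'a) ratfun" where
  "frac S D F G = frac_rel S D `` {(F, G)}"

definition frac_ring :: "'p set \<Rightarrow> (('p \<Rightarrow> 'a::field) \<times> ('p \<Rightarrow> 'a)) set
    \<Rightarrow> ('p, 'a) ratfun ring" where
  "frac_ring S D =
     \<lparr> carrier = D // frac_rel S D,
       monoid.mult = (\<lambda>f g. \<Union>(F, G)\<in>f. \<Union>(F', G')\<in>g.
          frac S D (\<lambda>s. F s * F' s) (\<lambda>s. G s * G' s)),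
       one = frac S D (\<lambda>s. 1) (\<lambda>s. 1),
       ring.zero = frac S D (\<lambda>s. 0) (\<lambda>s. 1),
       add = (\<lambda>f g. \<Union>(F, G)\<in>f. \<Union>(F', G')\<in>g.
          frac S D (\<lambda>s. F s * G' s + F' s * G s) (\<lambda>s. G s * G' s)) \<rparr>"

subsection \<open>Projective case\<close>

type_synonym 'a vec4 = "'a \<times> 'a \<times> 'a \<times> 'a"
type_synonym 'a ppoint = "'a vec4 set"

text \<open>The point \<open>(X:Y:Z:T)\<close> is the set of its homogeneous coordinate vectors.\<close>

definition ppoint :: "'a::field vec4 \<Rightarrow> 'a ppoint" where
  "ppoint = (\<lambda>(X, Y, Z, T). {(r * X, r * Y, r * Z, r * T) | r. r \<noteq> 0})"

definition form :: "nat \<Rightarrow> ('a::field vec4 \<Rightarrow> 'a) \<Rightarrow> bool" where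
  "form m F \<longleftrightarrow> (\<exists>a :: nat \<Rightarrow> nat \<Rightarrow> nat \<Rightarrow> 'a. F = (\<lambda>(X, Y, Z, T).
     \<Sum>i\<le>m. \<Sum>j\<le>m - i. \<Sum>k\<le>m - i - j. a i j k * X ^ i * Y ^ j * Z ^ k * T ^ (m - i - j - k)))"

definition projective_closure :: "('a::field \<times> 'a \<times> 'a) set \<Rightarrow> 'a ppoint set" where
  "projective_closure A = {ppoint v | v. v \<noteq> (0, 0, 0, 0) \<and>
     (\<forall>m F. form m F \<longrightarrow> (\<forall>(X, Y, Z)\<in>A. F (X, Y, Z, 1) = 0) \<longrightarrow> F v = 0)}"

definition proj_fractions ::
    "'a::field ppoint set \<Rightarrow> (('a vec4 \<Rightarrow> 'a) \<times> ('a vec4 \<Rightarrow> 'a)) set" where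
  "proj_fractions C = {(F, G). \<exists>m. form m F \<and> form m G \<and> (\<exists>v\<in>\<Union>C. G v \<noteq> 0)}"

definition proj_frac :: "'a::field ppoint set
    \<Rightarrow> ('a vec4 \<Rightarrow> 'a) \<Rightarrow> ('a vec4 \<Rightarrow> 'a) \<Rightarrow> ('a vec4, 'a) ratfun" where
  "proj_frac C = frac (\<Union>C) (proj_fractions C)"

definition proj_function_field :: "'a::field ppoint set \<Rightarrow> ('a vec4, 'a) ratfun ring" where
  "proj_function_field C = frac_ring (\<Union>C) (proj_fractions C)"

definition proj_const :: "'a::field ppoint set \<Rightarrow> 'a \<Rightarrow> ('a vec4, 'a) ratfun" where
  "proj_const C a = proj_frac C (\<lambda>v. a) (\<lambda>v. 1)"

text \<open>
  \<open>pullback C \<sigma> f\<close> is \<open>f \<circ> \<sigma>\<close>: the class of the \<open>F'/G'\<close> with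
  \<open>F'(P)/G'(P) = F(\<sigma> P)/G(\<sigma> P)\<close> for \<open>f = F/G\<close>; by homogeneity the choice of the
  coordinate vectors \<open>v\<close> of \<open>P\<close> and \<open>w\<close> of \<open>\<sigma> P\<close> is immaterial.
\<close>

definition pullback :: "'a::field ppoint set \<Rightarrow> ('a ppoint \<Rightarrow> 'a ppoint)
    \<Rightarrow> ('a vec4, 'a) ratfun \<Rightarrow> ('a vec4, 'a) ratfun" where
  "pullback C \<sigma> f = {(F', G') \<in> proj_fractions C.
     \<forall>(F, G)\<in>f. \<forall>P\<in>C. \<forall>v\<in>P. \<forall>w\<in>\<sigma> P. F' v * G w = F w * G' v}"

definition fixed_field :: "'a::field ppoint set \<Rightarrow> ('a ppoint \<Rightarrow> 'a ppoint) set
    \<Rightarrow> ('a vec4, 'a) ratfun set" where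
  "fixed_field C H = {f \<in> carrier (proj_function_field C). \<forall>\<sigma>\<in>H. pullback C \<sigma> f = f}"

text \<open>
  For a finite group \<open>H\<close> of automorphisms of a curve \<open>C\<close>, the quotient \<open>C/H\<close> is the
  non-singular curve, unique up to isomorphism, that has this function field.
\<close>

definition quotient_function_field ::
    "'a::field ppoint set \<Rightarrow> ('a ppoint \<Rightarrow> 'a ppoint) set \<Rightarrow> ('a vec4, 'a) ratfun ring" where
  "quotient_function_field C H = (proj_function_field C)\<lparr>carrier := fixed_field C H\<rparr>"

subsection \<open>Affine case\<close>

text \<open>\<open>'a poly poly poly\<close> is the polynomial ring in \<open>U, V, W\<close>, with \<open>U\<close> the innermost variable.\<close>

definition pU :: "'a::field poly poly poly" where "pU = [:[:[:0, 1:]:]:]"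
definition pV :: "'a::field poly poly poly" where "pV = [:[:0, 1:]:]"
definition pW :: "'a::field poly poly poly" where "pW = [:0, 1:]"

definition eval3 :: "'a::field poly poly poly \<Rightarrow> 'a \<times> 'a \<times> 'a \<Rightarrow> 'a" where
  "eval3 P = (\<lambda>(U, V, W). poly (poly (poly P [:[:W:]:]) [:V:]) U)"

definition zero_set :: "'a::field poly poly poly set \<Rightarrow> ('a \<times> 'a \<times> 'a) set" where
  "zero_set E = {s. \<forall>P\<in>E. eval3 P s = 0}"

definition aff_fractions :: "('a::field \<times> 'a \<times> 'a) set
    \<Rightarrow> (('a \<times> 'a \<times> 'a \<Rightarrow> 'a) \<times> ('a \<times> 'a \<times> 'a \<Rightarrow> 'a)) set" where
  "aff_fractions A = {(eval3 P, eval3 Q) | P Q. \<exists>s\<in>A. eval3 Q s \<noteq> 0}"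

definition aff_function_field ::
    "('a::field \<times> 'a \<times> 'a) set \<Rightarrow> ('a \<times> 'a \<times> 'a, 'a) ratfun ring" where
  "aff_function_field A = frac_ring A (aff_fractions A)"

definition aff_fun :: "('a::field \<times> 'a \<times> 'a) set
    \<Rightarrow> 'a poly poly poly \<Rightarrow> ('a \<times> 'a \<times> 'a, 'a) ratfun" where
  "aff_fun A P = frac A (aff_fractions A) (eval3 P) (\<lambda>s. 1)"

text \<open>
  A curve with function field \<open>F\<close>, in which \<open>\<kappa>\<close> embeds the constants, has the irreducible affine
  equations \<open>E = 0\<close> with coordinate functions \<open>u, v, w\<close> if \<open>E\<close> generates a prime ideal and the
  function field of the zero set of \<open>E\<close> is isomorphic to \<open>F\<close> over the constants, with \<open>U, V, W\<close>
  corresponding to \<open>u, v, w\<close>.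
\<close>

definition has_irreducible_affine_equations ::
    "'f ring \<Rightarrow> ('a::field \<Rightarrow> 'f) \<Rightarrow> 'f \<Rightarrow> 'f \<Rightarrow> 'f \<Rightarrow> 'a poly poly poly set \<Rightarrow> bool" where
  "has_irreducible_affine_equations F \<kappa> u v w E \<longleftrightarrow>
     primeideal (Idl\<^bsub>ring_of_type_algebra\<^esub> E) ring_of_type_algebra \<and>
     (\<exists>\<phi> \<in> ring_iso (aff_function_field (zero_set E)) F.
        (\<forall>a. \<phi> (aff_fun (zero_set E) [:[:[:a:]:]:]) = \<kappa> a) \<and>
        \<phi> (aff_fun (zero_set E) pU) = u \<and>
        \<phi> (aff_fun (zero_set E) pV) = v \<and>
        \<phi> (aff_fun (zero_set E) pW) = w)"


section \<open>Genus of a function field\<close>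

text \<open>
  \<open>F\<close> is a function field in one variable over an algebraically closed subfield \<open>k\<close>.  A place is
  represented by its valuation ring, and all places have degree one since \<open>k\<close> is algebraically
  closed.  As in Stichtenoth's book, the genus is the maximum of \<open>deg A - dim L(A) + 1\<close> over all
  divisors \<open>A\<close>.
\<close>

definition places :: "'f set \<Rightarrow> 'f ring \<Rightarrow> 'f set set" where
  "places k F = {P. subring P F \<and> k \<subset> P \<and> P \<subset> carrier F \<and>
     (\<forall>z\<in>carrier F. z \<noteq> \<zero>\<^bsub>F\<^esub> \<longrightarrow> z \<in> P \<or> inv\<^bsub>F\<^esub> z \<in> P)}"

definition uniformizer :: "'f ring \<Rightarrow> 'f set \<Rightarrow> 'f \<Rightarrow> bool" where
  "uniformizer F P t \<longleftrightarrow>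
     t \<in> P \<and> P - Units (F\<lparr>carrier := P\<rparr>) = {t \<otimes>\<^bsub>F\<^esub> a | a. a \<in> P}"

definition valuation :: "'f ring \<Rightarrow> 'f set \<Rightarrow> 'f \<Rightarrow> int" where
  "valuation F P z = (THE i. \<exists>t e. uniformizer F P t \<and> e \<in> Units (F\<lparr>carrier := P\<rparr>) \<and>
     z = (t [^]\<^bsub>F\<^esub> i) \<otimes>\<^bsub>F\<^esub> e)"

definition divisors :: "'f set \<Rightarrow> 'f ring \<Rightarrow> ('f set \<Rightarrow> int) set" where
  "divisors k F = {A. finite {P \<in> places k F. A P \<noteq> 0}}"

definition divisor_degree :: "'f set \<Rightarrow> 'f ring \<Rightarrow> ('f set \<Rightarrow> int) \<Rightarrow> int" where
  "divisor_degree k F A = (\<Sum>P | P \<in> places k F \<and> A P \<noteq> 0. A P)"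

definition riemann_roch_space :: "'f set \<Rightarrow> 'f ring \<Rightarrow> ('f set \<Rightarrow> int) \<Rightarrow> 'f set" where
  "riemann_roch_space k F A = {z \<in> carrier F.
     z = \<zero>\<^bsub>F\<^esub> \<or> (\<forall>P\<in>places k F. valuation F P z \<ge> - A P)}"

definition genus :: "'f set \<Rightarrow> 'f ring \<Rightarrow> int" where
  "genus k F = (GREATEST g. \<exists>A\<in>divisors k F.
     g = divisor_degree k F A - int (ring.dim F k (riemann_roch_space k F A)) + 1)"


section \<open>The GK curve\<close>

text \<open>
  The first equation is also correct where \<open>X ^ (n + 1) = 1\<close>: there \<open>Y = 0\<close> by the second
  equation, so both the polynomial quotient and the convention \<open>x / 0 = 0\<close> give \<open>Z = 0\<close>.
\<close>

definition gk_affine :: "nat \<Rightarrow> ('a::field \<times> 'a \<times> 'a) set" where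
  "gk_affine n = {(X, Y, Z).
     Z ^ (n\<^sup>2 - n + 1) = Y * ((X ^ n\<^sup>2 - X) / (X ^ (n + 1) - 1)) \<and>
     Y ^ (n + 1) = X ^ (n + 1) - 1}"

definition gk_curve :: "nat \<Rightarrow> 'a::field ppoint set" where
  "gk_curve n = projective_closure (gk_affine n)"

definition gk_x :: "nat \<Rightarrow> ('a::field vec4, 'a) ratfun" where
  "gk_x n = proj_frac (gk_curve n) (\<lambda>(X, Y, Z, T). X) (\<lambda>(X, Y, Z, T). T)"

definition gk_y :: "nat \<Rightarrow> ('a::field vec4, 'a) ratfun" where
  "gk_y n = proj_frac (gk_curve n) (\<lambda>(X, Y, Z, T). Y) (\<lambda>(X, Y, Z, T). T)"

definition gk_z :: "nat \<Rightarrow> ('a::field vec4, 'a) ratfun" where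
  "gk_z n = proj_frac (gk_curve n) (\<lambda>(X, Y, Z, T). Z) (\<lambda>(X, Y, Z, T). T)"

definition gk_group :: "nat \<Rightarrow> nat \<Rightarrow> nat \<Rightarrow> ('a::field ppoint \<Rightarrow> 'a ppoint) set" where
  "gk_group n c d =
     {restrict (image (\<lambda>(X, Y, Z, T). (inverse b * X, b * Y, l * Z, T))) (gk_curve n) | b l.
        b ^ ((n + 1) div c) = 1 \<and> l ^ ((n\<^sup>2 - n + 1) div d) = 1}"

end

theory Submission
  imports Defs "HOL-Number_Theory.Residues" "HOL-Computational_Algebra.Formal_Laurent_Series"
begin

text \<open>
  Since \<open>y\<close> is the quotient of \<open>z ^ (n\<^sup>2 - n + 1)\<close> by a polynomial in \<open>x\<close>, the function field is a
  Kummer extension \<open>z ^ (n ^ 3 + 1) = f(x)\<close> of \<open>k(x)\<close>, and \<open>f\<close> has a simple zero at \<open>1\<close>.  Expanding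
  there in the parameter \<open>z\<close> realises \<open>x, y, z\<close> as Laurent series, with Galois group
  \<open>z \<mapsto> \<eta> z\<close>.  Modulo the two equations every polynomial is a combination of the \<open>x ^ l * y ^ i * z ^ j\<close>
  with \<open>i \<le> n\<close> and \<open>j \<le> n\<^sup>2 - n\<close>, which are independent in the Laurent series; so the equations generate
  the ideal of the point \<open>(x, y, z)\<close>, and rational functions on the curve are determined by their
  Laurent series.

  Averaging over \<open>K\<close> keeps only the monomials that are products of powers of \<open>u, v, w\<close>, whence the
  fixed field.  It is of the same kind: \<open>w ^ (d * (n + 1)) = (u ^ (2 * c) - u ^ c) * S(u) ^ (n + 1)\<close>
  with \<open>S = 1 + U ^ c + \<dots> + U ^ ((n - 2) * c)\<close>, and the same argument gives its equations.

  For a Kummer extension \<open>w ^ N = f(u)\<close>, a zero of order \<open>m\<close> of \<open>f\<close> has \<open>gcd N m\<close> places above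
  it, given by explicit local rings.  The Galois group splits the functions with poles of order at
  most \<open>m\<close> above infinity into pieces \<open>a(u) * w ^ j\<close>, where \<open>a\<close> has a prescribed denominator and
  bounded degree.  This computes the dimensions for the multiples of the pole divisor of \<open>u\<close>; every divisor is
  dominated by such a multiple up to principal divisors, so they determine the genus, as the
  Riemann-Hurwitz expression in the \<open>gcd N m\<close>.
\<close>

section \<open>Ring homomorphisms and evaluation of polynomials\<close>

text \<open>The notions of function field, place and genus live on classes of pairs of functions and
  on ring records, where direct computation is awkward. All computations are therefore made inside
  one field type: a generic point in Laurent series turns a class into an element
  (\<open>nu\<close>), and places, valuations and dimensions are carried along this embedding.
  Laurent series suit because the substitutions X -> \<eta> X are automorphisms of the whole type,
  so no splitting field has to be constructed.

  Two groups must be kept apart. \<open>K\<close> moves x in general, so its fixed field is found by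
  averaging rather than inside the Galois group over k(x). The genus uses the cyclic group of k(u,
  w) over k(u), of order \<open>(n + 1) * d\<close>, induced by z -> \<eta> z. Both orders are prime
  to the characteristic, since \<open>n + 1\<close> and \<open>n^2 - n + 1\<close> are 1 in k; every
  character sum below rests on this.

  The genus is a maximum over all divisors, so Riemann-Hurwitz cannot simply be quoted: an upper
  bound is needed for each divisor, with genuinely finite dimensions, and one divisor that attains
  it.\<close>

definition ringhom :: "('a::comm_ring_1 \<Rightarrow> 'b::comm_ring_1) \<Rightarrow> bool" where
  "ringhom h \<longleftrightarrow> h 0 = 0 \<and> h 1 = 1 \<and> (\<forall>a b. h (a + b) = h a + h b) \<and> (\<forall>a b. h (a * b) = h a * h b)"

lemma ringhomI:
  assumes "h 0 = 0" "h 1 = 1" "\<And>a b. h (a + b) = h a + h b" "\<And>a b. h (a * b) = h a * h b"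
  shows "ringhom h"
  using assms by (simp add: ringhom_def)

lemma ringhom_simps:
  assumes "ringhom h"
  shows "h 0 = 0" "h 1 = 1" "h (a + b) = h a + h b" "h (a * b) = h a * h b"
  using assms by (simp_all add: ringhom_def)

lemma ringhom_uminus: "ringhom h \<Longrightarrow> h (- a) = - h a"
  by (metis ringhom_simps(1,3) add.right_inverse minus_unique)

lemma ringhom_diff: "ringhom h \<Longrightarrow> h (a - b) = h a - h b"
  by (metis diff_conv_add_uminus ringhom_simps(3) ringhom_uminus)

lemma ringhom_power: "ringhom h \<Longrightarrow> h (a ^ n) = h a ^ n"
  by (induction n) (simp_all add: ringhom_simps)

lemma ringhom_sum: "ringhom h \<Longrightarrow> h (sum f A) = (\<Sum>x\<in>A. h (f x))"
  by (induction A rule: infinite_finite_induct) (simp_all add: ringhom_simps)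

lemma ringhom_prod: "ringhom h \<Longrightarrow> h (prod f A) = (\<Prod>x\<in>A. h (f x))"
  by (induction A rule: infinite_finite_induct) (simp_all add: ringhom_simps)

lemma ringhom_of_nat: "ringhom h \<Longrightarrow> h (of_nat n) = of_nat n"
  by (induction n) (simp_all add: ringhom_simps)

lemma ringhom_eq_0_iff:
  fixes h :: "'a::field \<Rightarrow> 'b::field"
  assumes "ringhom h"
  shows "h a = 0 \<longleftrightarrow> a = 0"
  by (metis assms mult_eq_0_iff right_inverse ringhom_simps(1,2,4) zero_neq_one)

lemma ringhom_inverse:
  fixes h :: "'a::field \<Rightarrow> 'b::field"
  assumes "ringhom h"
  shows "h (inverse a) = inverse (h a)"
  by (metis assms inverse_unique inverse_zero right_inverse ringhom_simps(1,2,4))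

lemma ringhom_divide:
  fixes h :: "'a::field \<Rightarrow> 'b::field"
  assumes "ringhom h"
  shows "h (a / b) = h a / h b"
  by (simp add: divide_inverse assms ringhom_simps ringhom_inverse)

lemma ringhom_eq_iff:
  fixes h :: "'a::field \<Rightarrow> 'b::field"
  assumes "ringhom h"
  shows "h a = h b \<longleftrightarrow> a = b"
  by (metis assms eq_iff_diff_eq_0 ringhom_diff ringhom_eq_0_iff)

lemma ringhom_comp: "ringhom g \<Longrightarrow> ringhom h \<Longrightarrow> ringhom (\<lambda>x. g (h x))"
  by (simp add: ringhom_def)

lemma ringhom_id: "ringhom (\<lambda>x. x)"
  by (simp add: ringhom_def)

lemma ringhom_const_poly: "ringhom (\<lambda>a. [:a:])"
  by (rule ringhomI) (simp_all add: one_pCons)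

section \<open>Evaluation of polynomials along a ring homomorphism\<close>

definition evp :: "('a::comm_ring_1 \<Rightarrow> 'b::comm_ring_1) \<Rightarrow> 'b \<Rightarrow> 'a poly \<Rightarrow> 'b" where
  "evp h x p = poly (map_poly h p) x"

lemma evp_0 [simp]: "evp h x 0 = 0"
  by (simp add: evp_def)

lemma evp_pCons: "ringhom h \<Longrightarrow> evp h x (pCons a p) = h a + x * evp h x p"
  by (simp add: evp_def map_poly_pCons ringhom_simps)

lemma evp_add: "ringhom h \<Longrightarrow> evp h x (p + q) = evp h x p + evp h x q"
proof (induction p arbitrary: q)
  case (pCons a p)
  then show ?case by (cases q) (simp add: evp_pCons ringhom_simps algebra_simps)
qed simp

lemma evp_smult: "ringhom h \<Longrightarrow> evp h x (smult a p) = h a * evp h x p"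
  by (induction p) (simp_all add: evp_pCons ringhom_simps algebra_simps)

lemma ringhom_evp: "ringhom h \<Longrightarrow> ringhom (evp h x)"
proof (rule ringhomI)
  assume h: "ringhom h"
  show "evp h x (p * q) = evp h x p * evp h x q" for p q
    by (induction p) (simp_all add: h evp_pCons evp_add evp_smult ringhom_simps algebra_simps)
qed (simp_all add: evp_add evp_pCons one_pCons ringhom_simps)

lemma evp_const: "ringhom h \<Longrightarrow> evp h x [:a:] = h a"
  by (simp add: evp_pCons)

lemma evp_X: "ringhom h \<Longrightarrow> evp h x [:0, 1:] = x"
  by (simp add: evp_pCons ringhom_simps)

lemma hom_evp:
  "ringhom g \<Longrightarrow> ringhom h \<Longrightarrow> g (evp h x p) = evp (\<lambda>a. g (h a)) (g x) p"
  by (induction p) (simp_all add: evp_pCons ringhom_comp ringhom_simps)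

lemma evp_ident: "evp (\<lambda>a. a) x p = poly p x"
  by (induction p) (simp_all add: evp_pCons ringhom_id)

lemma evp_pcompose: "ringhom h \<Longrightarrow> evp h x (pcompose p q) = evp h (evp h x q) p"
  by (induction p) (simp_all add: pcompose_pCons evp_pCons evp_add
      ringhom_simps(4)[OF ringhom_evp] evp_const)

lemma evp_at_hom: "ringhom h \<Longrightarrow> evp h (h a) p = h (poly p a)"
  by (induction p) (simp_all add: evp_pCons ringhom_simps)

definition evt :: "('a::comm_ring_1 \<Rightarrow> 'b::comm_ring_1) \<Rightarrow> 'b \<Rightarrow> 'b \<Rightarrow> 'b \<Rightarrow> 'a poly poly poly \<Rightarrow> 'b" where
  "evt h x y z = evp (evp (evp h x) y) z"

lemma ringhom_evt: "ringhom h \<Longrightarrow> ringhom (evt h x y z)"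
  by (simp add: evt_def ringhom_evp)

lemma evt_gens:
  assumes "ringhom h"
  shows "evt h x y z pU = x" "evt h x y z pV = y" "evt h x y z pW = z"
    "evt h x y z [:[:p:]:] = evp h x p" "evt h x y z [:[:[:a:]:]:] = h a"
  using assms by (simp_all add: evt_def pU_def pV_def pW_def evp_pCons ringhom_evp
      ringhom_simps(1,2)[OF ringhom_evp] ringhom_simps(1,2))

lemmas evt_simps = ringhom_simps[OF ringhom_evt] ringhom_diff[OF ringhom_evt]
  ringhom_power[OF ringhom_evt] ringhom_sum[OF ringhom_evt] ringhom_prod[OF ringhom_evt] evt_gens

lemma hom_evt:
  "ringhom g \<Longrightarrow> ringhom h \<Longrightarrow> g (evt h x y z P) = evt (\<lambda>a. g (h a)) (g x) (g y) (g z) P"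
  by (simp add: evt_def hom_evp ringhom_evp)

text \<open>\<open>eval3\<close> substitutes from the outermost variable \<open>W\<close> inwards by
  constant polynomials, \<open>evt\<close> from the innermost variable \<open>U\<close> outwards.
  Evaluations are ring homomorphisms, so \<open>hom_evp\<close> moves each of them past the
  substitution for the next variable.\<close>

lemma eval3_evt: "eval3 P (a, b, c) = evt (\<lambda>a. a) a b c P"
proof -
  have "poly P [:[:c:]:] = evp (\<lambda>a. a) [:[:c:]:] P"
    by (simp add: evp_ident)
  then have "poly (poly P [:[:c:]:]) [:b:] = evp (\<lambda>p. poly p [:b:]) [:c:] P"
    using hom_evp[OF ringhom_evp[OF ringhom_id] ringhom_id, of "[:b:]" "[:[:c:]:]" P]
    by (simp add: evp_ident)
  then have "eval3 P (a, b, c) = evp (\<lambda>p. poly (poly p [:b:]) a) c P"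
    using hom_evp[OF ringhom_evp[OF ringhom_id] ringhom_evp[OF ringhom_id], of a "[:b:]" "[:c:]" P]
    by (simp add: eval3_def evp_ident[abs_def])
  also have "(\<lambda>p. poly (poly p [:b:]) a) = evp (evp (\<lambda>a. a) a) b"
    using hom_evp[OF ringhom_evp[OF ringhom_id] ringhom_id, of a "[:b:]"]
    by (intro ext) (simp add: evp_ident evp_ident[abs_def])
  finally show ?thesis by (simp add: evt_def)
qed

text \<open>Coefficients are peeled off one variable at a time by
  \<open>pCons a p = a + X * p\<close>. The exponent of that variable is generalised in each
  induction, so that the factor X is absorbed into the monomial.\<close>

lemma poly3_induct [case_names add monom]:
  assumes add: "\<And>P Q. R P \<Longrightarrow> R Q \<Longrightarrow> R (P + Q)"
    and mon: "\<And>a i j k. R ([:[:[:a:]:]:] * pU ^ i * pV ^ j * pW ^ k)"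
  shows "R (P :: 'a::field poly poly poly)"
proof -
  have 0: "R 0" using mon[of 0 0 0 0] by simp
  have 1: "R ([:[:p:]:] * pU ^ i * pV ^ j * pW ^ k)" for p i j k
  proof (induction p arbitrary: i)
    case (pCons a p)
    have "[:[:pCons a p:]:] = [:[:[:a:]:]:] + pU * [:[:p:]:]"
      by (simp add: pU_def)
    then have "[:[:pCons a p:]:] * pU ^ i * pV ^ j * pW ^ k =
       [:[:[:a:]:]:] * pU ^ i * pV ^ j * pW ^ k + [:[:p:]:] * pU ^ Suc i * pV ^ j * pW ^ k"
      by (simp add: algebra_simps)
    then show ?case using add[OF mon pCons.IH] by metis
  qed (simp add: 0)
  have 2: "R ([:p:] * pV ^ j * pW ^ k)" for p j k
  proof (induction p arbitrary: j)
    case (pCons a p)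
    have "[:pCons a p:] = [:[:a:]:] + pV * [:p:]"
      by (simp add: pV_def)
    then have "[:pCons a p:] * pV ^ j * pW ^ k =
       [:[:a:]:] * pU ^ 0 * pV ^ j * pW ^ k + [:p:] * pV ^ Suc j * pW ^ k"
      by (simp add: algebra_simps)
    then show ?case using add[OF 1 pCons.IH] by metis
  qed (simp add: 0)
  have "R (P * pW ^ k)" for k
  proof (induction P arbitrary: k)
    case (pCons a p)
    have "pCons a p = [:a:] + pW * p"
      by (simp add: pW_def)
    then have "pCons a p * pW ^ k = [:a:] * pV ^ 0 * pW ^ k + p * pW ^ Suc k"
      by (simp add: algebra_simps)
    then show ?case using add[OF 2 pCons.IH] by metis
  qed (simp add: 0)
  from this[of 0] show ?thesis by simp
qed

subsection \<open>Subfields\<close>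

text \<open>Subfields as subsets of a field type. Because \<open>inverse 0 = 0\<close>, closure
  under \<open>inverse\<close> needs no exception, and \<open>0\<close> enters as
  \<open>1 + - 1\<close>.\<close>

definition subfld :: "'b::field set \<Rightarrow> bool" where
  "subfld S \<longleftrightarrow> 1 \<in> S \<and> (\<forall>a\<in>S. \<forall>b\<in>S. a + b \<in> S \<and> a * b \<in> S) \<and> (\<forall>a\<in>S. - a \<in> S \<and> inverse a \<in> S)"

lemma subfldD:
  assumes "subfld S"
  shows "1 \<in> S" "a \<in> S \<Longrightarrow> b \<in> S \<Longrightarrow> a + b \<in> S" "a \<in> S \<Longrightarrow> b \<in> S \<Longrightarrow> a * b \<in> S"
    "a \<in> S \<Longrightarrow> - a \<in> S" "a \<in> S \<Longrightarrow> inverse a \<in> S"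
  using assms by (auto simp: subfld_def)

lemma subfld_more:
  assumes "subfld S"
  shows "0 \<in> S" "a \<in> S \<Longrightarrow> b \<in> S \<Longrightarrow> a - b \<in> S" "a \<in> S \<Longrightarrow> b \<in> S \<Longrightarrow> a / b \<in> S"
    "a \<in> S \<Longrightarrow> a ^ n \<in> S" "a \<in> S \<Longrightarrow> a powi i \<in> S"
proof -
  note S = subfldD[OF assms]
  have "1 + - 1 \<in> S" using S by blast
  then show 0: "0 \<in> S" by simp
  show "a - b \<in> S" if "a \<in> S" "b \<in> S"
    using S(2)[OF that(1) S(4)[OF that(2)]] by simp
  show "a / b \<in> S" if "a \<in> S" "b \<in> S"
    using S(3)[OF that(1) S(5)[OF that(2)]] by (simp add: divide_inverse)
  have pow: "a ^ n \<in> S" if "a \<in> S" for a n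
    by (induction n) (use S that in auto)
  show "a ^ n \<in> S" if "a \<in> S" using pow that .
  show "a powi i \<in> S" if "a \<in> S"
    using pow[OF that] pow[OF S(5)[OF that]] by (simp add: power_int_def)
qed

lemma subfld_sum: "subfld S \<Longrightarrow> (\<And>i. i \<in> A \<Longrightarrow> f i \<in> S) \<Longrightarrow> sum f A \<in> S"
  by (induction A rule: infinite_finite_induct) (auto simp: subfldD subfld_more)

lemma subfld_evp: "subfld S \<Longrightarrow> ringhom h \<Longrightarrow> range h \<subseteq> S \<Longrightarrow> x \<in> S \<Longrightarrow> evp h x p \<in> S"
  by (induction p) (auto simp: evp_pCons subfld_more intro!: subfldD)

lemma subfld_evt:
  assumes "subfld S" "ringhom h" "range h \<subseteq> S" "x \<in> S" "y \<in> S" "z \<in> S"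
  shows "evt h x y z P \<in> S"
  unfolding evt_def using assms
  by (intro subfld_evp ringhom_evp image_subsetI) (auto intro!: subfld_evp ringhom_evp)

section \<open>Fields generated by three elements over the constants\<close>

definition gen3 :: "('a::field \<Rightarrow> 'b::field) \<Rightarrow> 'b \<Rightarrow> 'b \<Rightarrow> 'b \<Rightarrow> 'b set" where
  "gen3 h x y z = {evt h x y z P / evt h x y z Q | P Q. evt h x y z Q \<noteq> 0}"

lemma gen3I: "evt h x y z Q \<noteq> 0 \<Longrightarrow> evt h x y z P / evt h x y z Q \<in> gen3 h x y z"
  by (auto simp: gen3_def)

lemma evt_in_gen3: "ringhom h \<Longrightarrow> evt h x y z P \<in> gen3 h x y z"
  using gen3I[of h x y z 1 P] by (simp add: evt_simps)

lemma gen3_gens: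
  assumes "ringhom h"
  shows "h a \<in> gen3 h x y z" "x \<in> gen3 h x y z" "y \<in> gen3 h x y z" "z \<in> gen3 h x y z"
  using evt_in_gen3[OF assms, of x y z "[:[:[:a:]:]:]"] evt_in_gen3[OF assms, of x y z pU]
    evt_in_gen3[OF assms, of x y z pV] evt_in_gen3[OF assms, of x y z pW] assms
  by (simp_all add: evt_simps evp_const)

lemma subfld_gen3: "ringhom h \<Longrightarrow> subfld (gen3 h x y z)"
  unfolding subfld_def
proof (intro conjI ballI)
  assume h: "ringhom h"
  let ?e = "evt h x y z"
  note hs = evt_simps[OF h] ringhom_uminus[OF ringhom_evt[OF h]]
  show "1 \<in> gen3 h x y z"
    using evt_in_gen3[OF h, of x y z 1] by (simp add: hs)
  fix a assume "a \<in> gen3 h x y z"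
  then obtain P Q where a: "a = ?e P / ?e Q" "?e Q \<noteq> 0" by (auto simp: gen3_def)
  show "- a \<in> gen3 h x y z"
    using gen3I[of h x y z Q "- P"] a by (simp add: hs)
  show "inverse a \<in> gen3 h x y z"
    using gen3I[of h x y z P Q] a evt_in_gen3[OF h, of x y z 0] by (cases "?e P = 0") (simp_all add: hs)
  fix b assume "b \<in> gen3 h x y z"
  then obtain P' Q' where b: "b = ?e P' / ?e Q'" "?e Q' \<noteq> 0" by (auto simp: gen3_def)
  show "a + b \<in> gen3 h x y z"
    using gen3I[of h x y z "Q * Q'" "P * Q' + P' * Q"] a b by (simp add: hs add_frac_eq mult.commute)
  show "a * b \<in> gen3 h x y z"
    using gen3I[of h x y z "Q * Q'" "P * P'"] a b by (simp add: hs)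
qed

lemma gen3_least:
  assumes "subfld S" "ringhom h" "range h \<subseteq> S" "x \<in> S" "y \<in> S" "z \<in> S"
  shows "gen3 h x y z \<subseteq> S"
  using subfld_evt[OF assms] subfld_more(3)[OF assms(1)] by (auto simp: gen3_def)

section \<open>Polynomials over algebraically closed fields\<close>

text \<open>Linear factors are split off one at a time. This count of zeros balances the poles at
  infinity in \<open>principal_divisor\<close> and collects the degree of \<open>f\<close> in
  \<open>genus_formula\<close>.\<close>

lemma sum_order_eq_degree:
  fixes f :: "'a::alg_closed_field poly"
  assumes "f \<noteq> 0"
  shows "(\<Sum>a | poly f a = 0. Polynomial.order a f) = Polynomial.degree f"
  using assms
proof (induction "Polynomial.degree f" arbitrary: f rule: less_induct)
  case less
  show ?case
  proof (cases "Polynomial.degree f = 0")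
    case True
    then obtain c where "f = [:c:]" by (rule degree_eq_zeroE)
    with less.prems show ?thesis by simp
  next
    case False
    then obtain x where x: "poly f x = 0"
      using alg_closed_imp_poly_has_root by blast
    then obtain q where f: "f = [:- x, 1:] * q"
      by (metis dvdE poly_eq_0_iff_dvd)
    have q: "q \<noteq> 0" using less.prems f by auto
    have deg: "Polynomial.degree f = Suc (Polynomial.degree q)"
      unfolding f using q by (subst degree_mult_eq) auto
    have ordx: "Polynomial.order a [:- x, 1:] = (if a = x then 1 else 0)" for a
      using order_power_n_n[of x 1] by (auto intro: order_0I)
    have ord: "Polynomial.order a f = (if a = x then 1 else 0) + Polynomial.order a q" for a
      using less.prems order_mult[of "[:- x, 1:]" q a] f ordx by simp
    let ?R = "{a. poly f a = 0}"
    have fin: "finite ?R" using less.prems poly_roots_finite by blast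
    have "(\<Sum>a\<in>?R. Polynomial.order a f) = 1 + (\<Sum>a\<in>?R. Polynomial.order a q)"
      using fin x by (simp add: ord sum.distrib)
    also have "(\<Sum>a\<in>?R. Polynomial.order a q) = (\<Sum>a | poly q a = 0. Polynomial.order a q)"
      by (rule sum.mono_neutral_right[OF fin]) (use q in \<open>auto simp: f order_root\<close>)
    also have "\<dots> = Polynomial.degree q"
      using less.hyps[of q] q deg by simp
    finally show ?thesis by (simp add: deg)
  qed
qed

lemma order_simple_root:
  fixes f :: "'a::field poly"
  assumes "poly f a = 0" "poly (pderiv f) a \<noteq> 0"
  shows "Polynomial.order a f = 1"
proof -
  obtain q where f: "f = [:- a, 1:] * q"
    using assms(1) by (metis dvdE poly_eq_0_iff_dvd)
  have "poly (pderiv f) a = poly q a"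
    unfolding f pderiv_mult by (simp add: pderiv_pCons del: mult_pCons_left mult_pCons_right)
  then have "Polynomial.order a q = 0" "f \<noteq> 0"
    using assms(2) by (auto intro: order_0I)
  then show ?thesis
    using order_mult[of "[:- a, 1:]" q a] order_power_n_n[of a 1] f by simp
qed

lemma card_roots_separable:
  fixes f :: "'a::alg_closed_field poly"
  assumes "f \<noteq> 0" "\<And>a. poly f a = 0 \<Longrightarrow> poly (pderiv f) a \<noteq> 0"
  shows "card {a. poly f a = 0} = Polynomial.degree f"
proof -
  have "(\<Sum>a | poly f a = 0. Polynomial.order a f) = (\<Sum>a | poly f a = 0. 1)"
    by (rule sum.cong) (use assms(2) order_simple_root in auto)
  with sum_order_eq_degree[OF assms(1)] show ?thesis by simp
qed

section \<open>Roots of unity and character sums\<close>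

definition roots1 :: "nat \<Rightarrow> 'a::field set" where
  "roots1 N = {z. z ^ N = 1}"

lemma roots1_mult: "a \<in> roots1 N \<Longrightarrow> b \<in> roots1 N \<Longrightarrow> a * b \<in> roots1 N"
  by (simp add: roots1_def power_mult_distrib)

lemma roots1_inverse: "a \<in> roots1 N \<Longrightarrow> inverse a \<in> roots1 N"
  by (simp add: roots1_def power_inverse)

lemma roots1_one: "1 \<in> roots1 N"
  by (simp add: roots1_def)

lemma roots1_nz: "N > 0 \<Longrightarrow> a \<in> roots1 N \<Longrightarrow> a \<noteq> 0"
  by (auto simp: roots1_def zero_power)

lemma degree_X_power_minus_1: "N > 0 \<Longrightarrow> Polynomial.degree (Polynomial.monom 1 N - 1 :: 'a::field poly) = N"
proof -
  assume "N > 0"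
  then have "Polynomial.degree (Polynomial.monom 1 N + (- 1) :: 'a poly) = Polynomial.degree (Polynomial.monom 1 N :: 'a poly)"
    by (intro degree_add_eq_left) (simp add: degree_monom_eq)
  then show ?thesis by (simp add: degree_monom_eq)
qed

lemma roots1_poly: "roots1 N = {z. poly (Polynomial.monom 1 N - 1) z = 0}"
  by (simp add: roots1_def poly_monom)

lemma finite_roots1: "N > 0 \<Longrightarrow> finite (roots1 N :: 'a::field set)"
  unfolding roots1_poly
  by (rule poly_roots_finite) (metis degree_0 degree_X_power_minus_1 less_numeral_extra(3))

lemma card_roots1_le:
  assumes "N > 0"
  shows "card (roots1 N :: 'a::field set) \<le> N"
proof -
  have "Polynomial.monom 1 N - 1 \<noteq> (0 :: 'a poly)"
    using assms degree_X_power_minus_1[of N, where 'a = 'a] by (metis degree_0 less_numeral_extra(3))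
  from card_poly_roots_bound[OF this] show ?thesis
    by (simp add: roots1_poly degree_X_power_minus_1 assms)
qed

text \<open>\<open>X ^ N - 1\<close> is separable: its derivative \<open>N * X ^ (N - 1)\<close>
  vanishes at most at 0, which is not a root.\<close>

lemma card_roots1:
  assumes "N > 0" "of_nat N \<noteq> (0::'a::alg_closed_field)"
  shows "card (roots1 N :: 'a set) = N"
proof -
  let ?f = "Polynomial.monom 1 N - 1 :: 'a poly"
  have "card {a. poly ?f a = 0} = Polynomial.degree ?f"
  proof (rule card_roots_separable)
    show "?f \<noteq> 0" using assms degree_X_power_minus_1[of N, where 'a = 'a] by (metis degree_0 less_numeral_extra(3))
    fix a assume "poly ?f a = 0"
    then have "a \<noteq> 0" using assms by (auto simp: poly_monom zero_power)
    then show "poly (pderiv ?f) a \<noteq> 0"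
      using assms by (simp add: pderiv_diff pderiv_monom poly_monom pderiv_1)
  qed
  then show ?thesis by (simp add: roots1_poly degree_X_power_minus_1 assms)
qed

text \<open>Otherwise all \<open>N\<close> roots of unity would be roots of
  \<open>X ^ (j mod N) - 1\<close>, whose degree is positive and less than \<open>N\<close>.\<close>

lemma roots1_ex_nontrivial:
  assumes "N > 0" "of_nat N \<noteq> (0::'a::alg_closed_field)" "\<not> N dvd j"
  shows "\<exists>z::'a \<in> roots1 N. z ^ j \<noteq> 1"
proof (rule ccontr)
  assume H: "\<not> ?thesis"
  let ?k = "j mod N"
  have k: "0 < ?k" "?k < N" using assms by (auto simp: mod_greater_zero_iff_not_dvd)
  have "z ^ j = z ^ ?k" if "z \<in> roots1 N" for z :: 'a
  proof -
    have "z ^ j = (z ^ N) ^ (j div N) * z ^ (j mod N)"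
      by (simp flip: power_mult power_add)
    then show ?thesis using that by (simp add: roots1_def)
  qed
  with H have "roots1 N \<subseteq> (roots1 ?k :: 'a set)" by (auto simp: roots1_def)
  then have "card (roots1 N :: 'a set) \<le> ?k"
    using card_mono[OF finite_roots1[OF k(1)]] card_roots1_le[OF k(1), where 'a = 'a] le_trans by blast
  with k card_roots1[OF assms(1,2)] show False by simp
qed

text \<open>Orthogonality of characters: multiplication by a root \<open>y\<close> with
  \<open>y ^ j \<noteq> 1\<close> permutes the roots and multiplies the sum by \<open>y ^ j\<close>,
  so the sum vanishes.\<close>

lemma sum_roots1:
  assumes "N > 0" "of_nat N \<noteq> (0::'a::alg_closed_field)"
  shows "(\<Sum>z::'a \<in> roots1 N. z ^ j) = (if N dvd j then of_nat N else 0)"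
proof (cases "N dvd j")
  case True
  then have "z ^ j = 1" if "z \<in> roots1 N" for z :: 'a
    using that by (auto simp: roots1_def power_mult elim: dvdE)
  with True show ?thesis by (simp add: card_roots1[OF assms])
next
  case False
  then obtain y :: 'a where y: "y \<in> roots1 N" "y ^ j \<noteq> 1"
    using roots1_ex_nontrivial[OF assms] by blast
  have "(\<Sum>z::'a \<in> roots1 N. z ^ j) = (\<Sum>z \<in> roots1 N. (y * z) ^ j)"
    by (rule sum.reindex_bij_witness[of _ "\<lambda>z. y * z" "\<lambda>z. inverse y * z"])
      (use y roots1_nz[OF assms(1) y(1)] in \<open>auto intro!: roots1_mult roots1_inverse simp flip: mult.assoc\<close>)
  also have "\<dots> = y ^ j * (\<Sum>z \<in> roots1 N. z ^ j)"
    by (simp add: power_mult_distrib sum_distrib_left)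
  finally have "(1 - y ^ j) * (\<Sum>z::'a \<in> roots1 N. z ^ j) = 0" by (simp add: algebra_simps)
  with y False show ?thesis by simp
qed

section \<open>Linear independence of powers and the ideal of a tower\<close>

definition indep_over :: "'b::field set \<Rightarrow> 'b \<Rightarrow> nat \<Rightarrow> bool" where
  "indep_over S w N \<longleftrightarrow> (\<forall>a. (\<forall>j<N. a j \<in> S) \<longrightarrow> (\<Sum>j<N. a j * w ^ j) = 0 \<longrightarrow> (\<forall>j<N. a j = 0))"

lemma indep_overD:
  assumes "indep_over S w N" "\<And>j. j < N \<Longrightarrow> a j \<in> S" "(\<Sum>j<N. a j * w ^ j) = 0" "j < N"
  shows "a j = 0"
  using assms unfolding indep_over_def by blast

text \<open>A monomial change of basis: nonzero \<open>S\<close>-multiples of distinct powers of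
  \<open>w\<close> inherit independence. It serves the products \<open>\<theta> ^ i * t ^ j\<close>
  near a point and \<open>v ^ i * w ^ j\<close> on the curves.\<close>

lemma indep_over_reindex:
  assumes ind: "indep_over S w N" and S: "subfld S" and I: "finite I"
    and inj: "inj_on k I" and k: "k ` I \<subseteq> {..<N}"
    and c: "\<And>i. i \<in> I \<Longrightarrow> c i \<in> S \<and> c i \<noteq> 0 \<and> b i = c i * w ^ k i"
    and a: "\<And>i. i \<in> I \<Longrightarrow> a i \<in> S" and sum: "(\<Sum>i\<in>I. a i * b i) = 0"
  shows "\<forall>i\<in>I. a i = 0"
proof -
  define e where "e j = (if j \<in> k ` I then a (the_inv_into I k j) * c (the_inv_into I k j) else 0)" for j
  have e: "e (k i) = a i * c i" if "i \<in> I" for i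
    using that by (simp add: e_def the_inv_into_f_f[OF inj])
  have "(\<Sum>j<N. e j * w ^ j) = (\<Sum>j\<in>k ` I. e j * w ^ j)"
    by (rule sum.mono_neutral_right) (use k in \<open>auto simp: e_def\<close>)
  also have "\<dots> = (\<Sum>i\<in>I. a i * b i)"
    using e c by (simp add: sum.reindex[OF inj] mult.assoc)
  finally have "(\<Sum>j<N. e j * w ^ j) = 0" using sum by simp
  moreover have "e j \<in> S" for j
  proof (cases "j \<in> k ` I")
    case True
    then obtain i where "i \<in> I" "j = k i" by blast
    then show ?thesis using e a c subfldD(3)[OF S] by simp
  qed (use subfld_more(1)[OF S] in \<open>simp add: e_def\<close>)
  ultimately have "\<forall>j<N. e j = 0" using ind unfolding indep_over_def by blast
  then have "a i * c i = 0" if "i \<in> I" for i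
    using e[OF that] k that by (metis imageI lessThan_iff subsetD)
  then show ?thesis using c by auto
qed

text \<open>Computation modulo the ideal of \<open>e1\<close> and \<open>e2\<close>, with
  \<open>cg\<close> as congruence. Powers of \<open>W\<close> are reduced before powers of
  \<open>V\<close>, because the second equation turns \<open>W ^ b\<close> into a power of
  \<open>V\<close>, while the first leaves \<open>W\<close> untouched.\<close>

lemma tower_normal_form:
  fixes p q :: "'a::field poly" and P :: "'a poly poly poly" and e :: nat
  assumes a: "a > 0" and b: "b > 0"
  defines "e1 \<equiv> pV ^ a - [:[:p:]:]" and "e2 \<equiv> pW ^ b - pV ^ e * [:[:q:]:]"
  shows "\<exists>A B c. P = A * e1 + B * e2 + (\<Sum>i<a. \<Sum>j<b. [:[:c i j:]:] * pV ^ i * pW ^ j)"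
proof -
  define cg where "cg P Q \<longleftrightarrow> (\<exists>A B. P = A * e1 + B * e2 + Q)" for P Q
  have cg_refl: "cg P P" for P
    unfolding cg_def by (rule exI[of _ 0], rule exI[of _ 0]) simp
  have mult: "cg (P * P') (Q * Q')" if "cg P Q" "cg P' Q'" for P Q P' Q'
  proof -
    from that obtain A B A' B' where *: "P = A * e1 + B * e2 + Q" "P' = A' * e1 + B' * e2 + Q'"
      unfolding cg_def by blast
    have "P * P' = (A * P' + Q * A') * e1 + (B * P' + Q * B') * e2 + Q * Q'"
      by (simp add: * algebra_simps)
    then show ?thesis unfolding cg_def by blast
  qed
  have cg_add: "cg (P + P') (Q + Q')" if "cg P Q" "cg P' Q'" for P Q P' Q'
  proof -
    from that obtain A B A' B' where *: "P = A * e1 + B * e2 + Q" "P' = A' * e1 + B' * e2 + Q'"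
      unfolding cg_def by blast
    have "P + P' = (A + A') * e1 + (B + B') * e2 + (Q + Q')"
      by (simp add: * algebra_simps)
    then show ?thesis unfolding cg_def by blast
  qed
  have trans: "cg P R" if "cg P Q" "cg Q R" for P Q R
  proof -
    from that obtain A B A' B' where *: "P = A * e1 + B * e2 + Q" "Q = A' * e1 + B' * e2 + R"
      unfolding cg_def by blast
    have "P = (A + A') * e1 + (B + B') * e2 + R"
      by (simp add: * algebra_simps)
    then show ?thesis unfolding cg_def by blast
  qed
  have pow: "cg (P ^ n) (Q ^ n)" if "cg P Q" for P Q n
    by (induction n) (auto intro: cg_refl mult that)
  have V: "cg (pV ^ a) [:[:p:]:]"
    unfolding cg_def e1_def by (rule exI[of _ 1], rule exI[of _ 0]) simp
  have W: "cg (pW ^ b) (pV ^ e * [:[:q:]:])"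
    unfolding cg_def e2_def by (rule exI[of _ 0], rule exI[of _ 1]) simp
  have Vn: "cg (pV ^ n) ([:[:p ^ (n div a):]:] * pV ^ (n mod a))" for n
  proof -
    have 1: "pV ^ n = (pV ^ a) ^ (n div a) * pV ^ (n mod a)"
      by (simp flip: power_mult power_add)
    have 2: "[:[:p ^ (n div a):]:] = [:[:p:]:] ^ (n div a)"
      by (simp add: ringhom_power[OF ringhom_const_poly])
    show ?thesis unfolding 1 2 by (rule mult[OF pow[OF V] cg_refl])
  qed
  have Wn: "cg (pW ^ n) (pV ^ (e * (n div b)) * [:[:q ^ (n div b):]:] * pW ^ (n mod b))" for n
  proof -
    have 1: "pW ^ n = (pW ^ b) ^ (n div b) * pW ^ (n mod b)"
      by (simp flip: power_mult power_add)
    have 2: "pV ^ (e * (n div b)) * [:[:q ^ (n div b):]:] = (pV ^ e * [:[:q:]:]) ^ (n div b)"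
      by (simp add: ringhom_power[OF ringhom_const_poly] power_mult_distrib power_mult
          del: mult_pCons_left mult_pCons_right)
    show ?thesis unfolding 1 2 by (rule mult[OF pow[OF W] cg_refl])
  qed
  define NF where "NF c = (\<Sum>i<a. \<Sum>j<b. [:[:c i j:]:] * pV ^ i * pW ^ j)" for c :: "nat \<Rightarrow> nat \<Rightarrow> 'a poly"
  have "\<exists>c. cg P (NF c)"
  proof (induction P rule: poly3_induct)
    case (add P Q)
    then obtain c d where cd: "cg P (NF c)" "cg Q (NF d)" by blast
    have *: "[:[:x + y:]:] = [:[:x:]:] + [:[:y:]:]" for x y :: "'a poly" by simp
    have "NF (\<lambda>i j. c i j + d i j) = NF c + NF d"
      unfolding NF_def * by (simp only: sum.distrib ring_distribs)
    with cg_add[OF cd] have "cg (P + Q) (NF (\<lambda>i j. c i j + d i j))" by simp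
    then show ?case by blast
  next
    case (monom d i j k)
    \<comment> \<open>Reducing \<open>W ^ k\<close> contributes \<open>V ^ (e * (k div b))\<close>;
      \<open>m\<close> is the exponent of \<open>V\<close> still to be reduced, and \<open>s\<close>
      collects all factors in \<open>U\<close>.\<close>
    define m where "m = j + e * (k div b)"
    define s where "s = [:d:] * [:0, 1:] ^ i * q ^ (k div b) * p ^ (m div a)"
    have U: "[:[:[:d:]:]:] * pU ^ i = [:[:[:d:] * [:0, 1:] ^ i:]:]"
      unfolding pU_def by (simp only: ringhom_power[OF ringhom_const_poly] ringhom_simps(4)[OF ringhom_const_poly])
    have m1: "cg (pV ^ j * pW ^ k) ([:[:q ^ (k div b):]:] * pV ^ m * pW ^ (k mod b))"
      using mult[OF cg_refl[of "pV ^ j"] Wn[of k]] by (simp add: m_def power_add mult_ac)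
    have m2: "cg ([:[:q ^ (k div b):]:] * pV ^ m * pW ^ (k mod b))
        ([:[:q ^ (k div b):]:] * ([:[:p ^ (m div a):]:] * pV ^ (m mod a)) * pW ^ (k mod b))"
      by (intro mult cg_refl Vn)
    have "cg ([:[:[:d:]:]:] * pU ^ i * (pV ^ j * pW ^ k))
        ([:[:[:d:]:]:] * pU ^ i * ([:[:q ^ (k div b):]:] * ([:[:p ^ (m div a):]:] * pV ^ (m mod a)) * pW ^ (k mod b)))"
      by (rule mult[OF cg_refl trans[OF m1 m2]])
    also have "[:[:[:d:]:]:] * pU ^ i * ([:[:q ^ (k div b):]:] * ([:[:p ^ (m div a):]:] * pV ^ (m mod a)) * pW ^ (k mod b))
        = [:[:s:]:] * pV ^ (m mod a) * pW ^ (k mod b)"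
      unfolding s_def U by (simp only: ringhom_simps(4)[OF ringhom_const_poly] mult_ac)
    also have "\<dots> = NF (\<lambda>i j. if i = m mod a \<and> j = k mod b then s else 0)"
    proof -
      have "NF (\<lambda>i j. if i = m mod a \<and> j = k mod b then s else 0) =
         (\<Sum>i<a. if i = m mod a then (\<Sum>j<b. if j = k mod b then [:[:s:]:] * pV ^ i * pW ^ j else 0) else 0)"
        unfolding NF_def
      proof (intro sum.cong refl)
        fix i
        show "(\<Sum>j<b. [:[:if i = m mod a \<and> j = k mod b then s else 0:]:] * pV ^ i * pW ^ j) =
          (if i = m mod a then (\<Sum>j<b. if j = k mod b then [:[:s:]:] * pV ^ i * pW ^ j else 0) else 0)"
          by (auto intro!: sum.cong simp del: mult_pCons_left mult_pCons_right sum.delta sum.delta')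
      qed
      then show ?thesis using a b by (simp del: mult_pCons_left mult_pCons_right)
    qed
    finally show ?case by (auto simp: mult.assoc)
  qed
  then show ?thesis unfolding cg_def NF_def by blast
qed

text \<open>A relation is congruent to its normal form, whose value is then zero as well, and
  independence kills its coefficients. So the two equations generate all relations.\<close>

lemma tower_ideal:
  fixes h :: "'a::field \<Rightarrow> 'b::field"
  assumes h: "ringhom h" and ab: "a > 0" "b > 0"
    and y: "y ^ a = evp h x p" and z: "z ^ b = y ^ e * evp h x q"
    and ind: "\<And>c. (\<Sum>i<a. \<Sum>j<b. evp h x (c i j) * y ^ i * z ^ j) = 0 \<Longrightarrow> \<forall>i<a. \<forall>j<b. c i j = 0"
    and P: "evt h x y z P = 0"
  shows "\<exists>A B. P = A * (pV ^ a - [:[:p:]:]) + B * (pW ^ b - pV ^ e * [:[:q:]:])"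
proof -
  obtain A B c where P': "P = A * (pV ^ a - [:[:p:]:]) + B * (pW ^ b - pV ^ e * [:[:q:]:]) +
      (\<Sum>i<a. \<Sum>j<b. [:[:c i j:]:] * pV ^ i * pW ^ j)"
    using tower_normal_form[OF ab] by blast
  have "evt h x y z P = (\<Sum>i<a. \<Sum>j<b. evp h x (c i j) * y ^ i * z ^ j)"
    unfolding P' by (simp add: evt_simps[OF h] y z del: mult_pCons_left mult_pCons_right)
  then have "\<forall>i<a. \<forall>j<b. c i j = 0" using P ind by simp
  then have "(\<Sum>i<a. \<Sum>j<b. [:[:c i j:]:] * pV ^ i * pW ^ j) = 0" by simp
  with P' show ?thesis by auto
qed

section \<open>Kummer extensions of a rational function field\<close>

text \<open>\<open>'b\<close> is an ambient field that may be larger than k(u, w).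
  \<open>indep0\<close> expresses at once that u is transcendental and that w has degree
  \<open>N\<close> over k(u). The automorphisms in \<open>galois\<close> act on all of
  \<open>'b\<close>.\<close>

locale kummer =
  fixes h :: "'a::alg_closed_field \<Rightarrow> 'b::field" and u w :: 'b and N :: nat and f :: "'a poly"
  assumes hom: "ringhom h" and N0: "N > 0" and charN: "of_nat N \<noteq> (0::'a)"
    and f0: "f \<noteq> 0" and wN: "w ^ N = evp h u f"
    and indep0: "\<And>a. (\<Sum>j<N. evp h u (a j) * w ^ j) = 0 \<Longrightarrow> \<forall>j<N. a j = 0"
    and galois: "\<And>\<zeta>. \<zeta> ^ N = 1 \<Longrightarrow>
      \<exists>\<sigma>. ringhom \<sigma> \<and> (\<forall>a. \<sigma> (h a) = h a) \<and> \<sigma> u = u \<and> \<sigma> w = h \<zeta> * w"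
begin

abbreviation "ev \<equiv> evp h u"

lemmas h_simps = ringhom_simps[OF hom] ringhom_uminus[OF hom] ringhom_diff[OF hom]
  ringhom_power[OF hom] ringhom_inverse[OF hom] ringhom_eq_0_iff[OF hom]
lemmas hom_ev = ringhom_evp[OF hom, of u]
lemmas ev_simps = ringhom_simps[OF hom_ev] ringhom_uminus[OF hom_ev] ringhom_diff[OF hom_ev]
  ringhom_power[OF hom_ev] ringhom_sum[OF hom_ev] ringhom_prod[OF hom_ev]

lemma ev_eq_0_iff: "ev p = 0 \<longleftrightarrow> p = 0"
proof
  assume p: "ev p = 0"
  define a where "a j = (if j = 0 then p else 0)" for j :: nat
  have "ev (a j) = 0" for j
    using p by (simp add: a_def)
  then have "\<forall>j<N. a j = 0" by (intro indep0) simp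
  with N0 have "a 0 = 0" by blast
  then show "p = 0" by (simp add: a_def)
qed simp

lemma w_nz: "w \<noteq> 0"
  using wN N0 f0 ev_eq_0_iff[of f] by (metis zero_power)

section \<open>The rational function field k(u)\<close>

definition Ku :: "'b set" where "Ku = {ev p / ev q | p q. q \<noteq> 0}"

lemma KuI: "q \<noteq> 0 \<Longrightarrow> ev p / ev q \<in> Ku"
  by (auto simp: Ku_def)

lemma ev_Ku: "ev p \<in> Ku"
  using KuI[of 1 p] by (simp add: ev_simps)

lemma h_Ku: "h a \<in> Ku"
  using ev_Ku[of "[:a:]"] by (simp add: evp_const hom)

lemma u_Ku: "u \<in> Ku"
  using ev_Ku[of "[:0, 1:]"] by (simp add: evp_X hom)

lemma subfld_Ku: "subfld Ku"
  unfolding subfld_def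
proof (intro conjI ballI)
  show "1 \<in> Ku" using ev_Ku[of 1] by (simp add: ev_simps)
  fix a assume "a \<in> Ku"
  then obtain p q where a: "a = ev p / ev q" "q \<noteq> 0" by (auto simp: Ku_def)
  show "- a \<in> Ku" using KuI[of q "- p"] a by (simp add: ev_simps)
  show "inverse a \<in> Ku"
    using KuI[of p q] ev_Ku[of 0] a by (cases "p = 0") (simp_all add: ev_simps)
  fix b assume "b \<in> Ku"
  then obtain p' q' where b: "b = ev p' / ev q'" "q' \<noteq> 0" by (auto simp: Ku_def)
  show "a + b \<in> Ku" using KuI[of "q * q'" "p * q' + p' * q"] a b
    by (simp add: ev_simps ev_eq_0_iff add_frac_eq mult.commute)
  show "a * b \<in> Ku" using KuI[of "q * q'" "p * p'"] a b by (simp add: ev_simps)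
qed

lemmas Ku_closed = subfldD[OF subfld_Ku] subfld_more[OF subfld_Ku]

lemma indep_Ku: "indep_over Ku w N"
  unfolding indep_over_def
proof (intro allI impI)
  fix a j assume a: "\<forall>j<N. a j \<in> Ku" and s: "(\<Sum>j<N. a j * w ^ j) = 0" and j: "j < N"
  have "\<forall>j. \<exists>p q. j < N \<longrightarrow> a j = ev p / ev q \<and> q \<noteq> 0" using a by (fastforce simp: Ku_def)
  then obtain p q where pq: "\<And>j. j < N \<Longrightarrow> a j = ev (p j) / ev (q j) \<and> q j \<noteq> 0" by metis
  \<comment> \<open>\<open>r j\<close> is the numerator of \<open>a j\<close> over the common
    denominator \<open>?Q\<close>; this brings the relation into the polynomial form of
    \<open>indep0\<close>.\<close>
  define r where "r j = p j * (\<Prod>i\<in>{..<N} - {j}. q i)" for j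
  let ?Q = "\<Prod>i<N. q i"
  have r: "ev (r j) = a j * ev ?Q" if "j < N" for j
  proof -
    have "?Q = q j * (\<Prod>i\<in>{..<N} - {j}. q i)" using that by (intro prod.remove) auto
    then show ?thesis using pq[OF that] by (simp add: r_def ev_simps ev_eq_0_iff)
  qed
  have "(\<Sum>j<N. ev (r j) * w ^ j) = ev ?Q * (\<Sum>j<N. a j * w ^ j)"
    unfolding sum_distrib_left by (rule sum.cong) (auto simp: r)
  then have "\<forall>j<N. r j = 0" using indep0 s by simp
  then have "a j * ev ?Q = 0" using r[OF j] j by simp
  moreover have "ev ?Q \<noteq> 0" using pq by (simp add: ev_eq_0_iff)
  ultimately show "a j = 0" by simp
qed

section \<open>The extension k(u, w) and its Galois group\<close>

definition lin :: "(nat \<Rightarrow> 'b) \<Rightarrow> 'b" where "lin a = (\<Sum>j<N. a j * w ^ j)"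

definition L :: "'b set" where "L = {lin a | a. \<forall>j<N. a j \<in> Ku}"

text \<open>Coefficients beyond \<open>N\<close> do not enter \<open>lin\<close> and are set to 0;
  this frees later arguments from the bound on \<open>j\<close>.\<close>

lemma L_E:
  assumes "z \<in> L" obtains a where "z = lin a" "\<And>j. a j \<in> Ku"
proof -
  from assms obtain a where a: "z = lin a" "\<forall>j<N. a j \<in> Ku" by (auto simp: L_def)
  show ?thesis
    by (rule that[of "\<lambda>j. if j < N then a j else 0"]) (use a Ku_closed in \<open>auto simp: lin_def\<close>)
qed

lemma lin_L: "(\<And>j. j < N \<Longrightarrow> a j \<in> Ku) \<Longrightarrow> lin a \<in> L"
  by (auto simp: L_def)

lemma L_add: assumes "x \<in> L" "y \<in> L" shows "x + y \<in> L"
proof -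
  from assms obtain a b where *: "x = lin a" "\<And>j. a j \<in> Ku" "y = lin b" "\<And>j. b j \<in> Ku"
    by (elim L_E) blast
  have "x + y = lin (\<lambda>j. a j + b j)"
    unfolding * lin_def by (simp only: sum.distrib ring_distribs)
  then show ?thesis using lin_L[of "\<lambda>j. a j + b j"] * Ku_closed(2) by simp
qed

lemma L_smult: assumes "c \<in> Ku" "y \<in> L" shows "c * y \<in> L"
proof -
  from assms obtain b where *: "y = lin b" "\<And>j. b j \<in> Ku"
    by (elim L_E) blast
  have "c * y = lin (\<lambda>j. c * b j)"
    unfolding * lin_def by (simp only: sum_distrib_left mult.assoc)
  then show ?thesis using lin_L[of "\<lambda>j. c * b j"] * assms(1) Ku_closed(3) by simp
qed

lemma L_sum: "(\<And>i. i \<in> A \<Longrightarrow> g i \<in> L) \<Longrightarrow> sum g A \<in> L"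
proof (induction A rule: infinite_finite_induct)
  case empty
  have "lin (\<lambda>_. 0) \<in> L" by (rule lin_L) (simp add: Ku_closed)
  then show ?case by (simp add: lin_def)
next
  case (infinite A)
  have "lin (\<lambda>_. 0) \<in> L" by (rule lin_L) (simp add: Ku_closed)
  then show ?case using infinite by (simp add: lin_def)
qed (auto intro: L_add)

lemma w_power_L: "w ^ k \<in> L"
proof -
  have "w ^ k = (w ^ N) ^ (k div N) * w ^ (k mod N)"
    by (simp flip: power_mult power_add)
  moreover have "w ^ (k mod N) = lin (\<lambda>j. if j = k mod N then 1 else 0)"
    using N0 by (simp add: lin_def if_distrib[of "\<lambda>x. x * _"] cong: if_cong)
  moreover have "lin (\<lambda>j. if j = k mod N then 1 else 0) \<in> L"
    by (rule lin_L) (simp add: Ku_closed)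
  ultimately show ?thesis
    using L_smult[of "(w ^ N) ^ (k div N)" "w ^ (k mod N)"] by (simp add: wN ev_Ku Ku_closed)
qed

lemma Ku_L: "c \<in> Ku \<Longrightarrow> c \<in> L"
  using L_smult[OF _ w_power_L, of c 0] by simp

lemma L_mult: assumes "x \<in> L" "y \<in> L" shows "x * y \<in> L"
proof -
  from assms obtain a b where *: "x = lin a" "\<And>j. a j \<in> Ku" "y = lin b" "\<And>j. b j \<in> Ku"
    by (elim L_E) blast
  have "x * y = (\<Sum>i<N. \<Sum>j<N. (a i * b j) * w ^ (i + j))"
    by (simp add: * lin_def sum_product power_add mult_ac)
  also have "\<dots> \<in> L" by (intro L_sum L_smult w_power_L) (use * Ku_closed in auto)
  finally show ?thesis .
qed

lemma L_prod: "(\<And>i. i \<in> A \<Longrightarrow> g i \<in> L) \<Longrightarrow> prod g A \<in> L"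
  by (induction A rule: infinite_finite_induct) (auto intro: L_mult Ku_L simp: Ku_closed)

definition gal :: "'a \<Rightarrow> 'b \<Rightarrow> 'b" where
  "gal \<zeta> = (SOME \<sigma>. ringhom \<sigma> \<and> (\<forall>a. \<sigma> (h a) = h a) \<and> \<sigma> u = u \<and> \<sigma> w = h \<zeta> * w)"

lemma gal:
  assumes "\<zeta> \<in> roots1 N"
  shows "ringhom (gal \<zeta>)" "gal \<zeta> (h a) = h a" "gal \<zeta> u = u" "gal \<zeta> w = h \<zeta> * w"
proof -
  have "\<exists>\<sigma>. ringhom \<sigma> \<and> (\<forall>a. \<sigma> (h a) = h a) \<and> \<sigma> u = u \<and> \<sigma> w = h \<zeta> * w"
    using galois[of \<zeta>] assms by (simp add: roots1_def)
  from someI_ex[OF this] show "ringhom (gal \<zeta>)" "gal \<zeta> (h a) = h a" "gal \<zeta> u = u"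
      "gal \<zeta> w = h \<zeta> * w" unfolding gal_def by blast+
qed

lemma gal_Ku: "\<zeta> \<in> roots1 N \<Longrightarrow> c \<in> Ku \<Longrightarrow> gal \<zeta> c = c"
  by (auto simp: Ku_def ringhom_divide[OF gal(1)] hom_evp[OF gal(1) hom] gal)

lemma gal_lin:
  assumes "\<zeta> \<in> roots1 N" "\<And>j. a j \<in> Ku"
  shows "gal \<zeta> (lin a) = lin (\<lambda>j. h \<zeta> ^ j * a j)"
  unfolding lin_def using gal[OF assms(1)]
  by (simp add: ringhom_sum ringhom_simps ringhom_power gal_Ku assms power_mult_distrib mult_ac)

lemma gal_L: "\<zeta> \<in> roots1 N \<Longrightarrow> z \<in> L \<Longrightarrow> gal \<zeta> z \<in> L"
  by (elim L_E) (auto simp: gal_lin intro!: lin_L Ku_closed h_Ku)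

lemma gal_mult:
  assumes "\<zeta> \<in> roots1 N" "\<eta> \<in> roots1 N" "z \<in> L"
  shows "gal \<zeta> (gal \<eta> z) = gal (\<zeta> * \<eta>) z"
proof -
  from assms(3) obtain a where a: "z = lin a" "\<And>j. a j \<in> Ku" by (elim L_E) blast
  have "h \<eta> ^ j * a j \<in> Ku" for j by (intro Ku_closed h_Ku a)
  then show ?thesis
    using a assms by (simp add: gal_lin roots1_mult h_simps power_mult_distrib mult_ac)
qed

lemma gal_one: "z \<in> L \<Longrightarrow> gal 1 z = z"
  by (elim L_E) (simp add: gal_lin roots1_one h_simps)

text \<open>Projection to an eigenspace of the Galois group: \<open>gal \<zeta>\<close> multiplies
  \<open>w ^ i\<close> by \<open>\<zeta> ^ i\<close>, so the character sum keeps only the term with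
  \<open>i = j\<close>, counted \<open>N\<close> times.\<close>

lemma isotypic:
  assumes "\<And>j. a j \<in> Ku" "j < N"
  shows "(\<Sum>\<zeta>\<in>roots1 N. h (inverse \<zeta> ^ j) * gal \<zeta> (lin a)) = of_nat N * (a j * w ^ j)"
proof -
  have "(\<Sum>\<zeta>\<in>roots1 N. h (inverse \<zeta> ^ j) * gal \<zeta> (lin a)) =
     (\<Sum>\<zeta>\<in>roots1 N. \<Sum>i<N. h (\<zeta> ^ (i + (N - j))) * (a i * w ^ i))"
  proof (intro sum.cong refl)
    fix \<zeta> :: 'a assume z: "\<zeta> \<in> roots1 N"
    then have nz: "\<zeta> \<noteq> 0" using roots1_nz N0 by blast
    \<comment> \<open>The inverse power is rewritten as a nonnegative power of \<zeta>, the form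
      covered by \<open>sum_roots1\<close>.\<close>
    have "inverse \<zeta> ^ j * \<zeta> ^ j = 1" using nz by (simp flip: power_mult_distrib)
    moreover have "\<zeta> ^ (N - j) * \<zeta> ^ j = 1" using z assms(2) by (simp add: roots1_def flip: power_add)
    ultimately have *: "inverse \<zeta> ^ j = \<zeta> ^ (N - j)" using nz by (metis mult_right_cancel power_not_zero)
    show "h (inverse \<zeta> ^ j) * gal \<zeta> (lin a) = (\<Sum>i<N. h (\<zeta> ^ (i + (N - j))) * (a i * w ^ i))"
      unfolding gal_lin[OF z assms(1)] * unfolding lin_def by (simp add: sum_distrib_left h_simps power_add mult_ac)
  qed
  also have "\<dots> = (\<Sum>i<N. h (\<Sum>\<zeta>\<in>roots1 N. \<zeta> ^ (i + (N - j))) * (a i * w ^ i))"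
    by (subst sum.swap) (simp add: ringhom_sum[OF hom] sum_distrib_right)
  also have "\<dots> = (\<Sum>i<N. if i = j then of_nat N * (a i * w ^ i) else 0)"
  proof (intro sum.cong refl)
    fix i assume "i \<in> {..<N}"
    then have "N dvd (i + (N - j)) \<longleftrightarrow> i = j"
    proof (intro iffI)
      assume "N dvd (i + (N - j))"
      then obtain k where k: "i + (N - j) = N * k" by (elim dvdE)
      have "N * 0 < N * k" "N * k < N * 2" using \<open>i \<in> {..<N}\<close> assms(2) by (simp_all flip: k)
      then have "k = 1" by simp
      with k assms(2) show "i = j" by simp
    qed (use assms(2) in simp)
    then show "h (\<Sum>\<zeta>\<in>roots1 N. \<zeta> ^ (i + (N - j))) * (a i * w ^ i) =
        (if i = j then of_nat N * (a i * w ^ i) else 0)"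
      by (simp add: sum_roots1[OF N0 charN] h_simps ringhom_of_nat[OF hom])
  qed
  also have "\<dots> = of_nat N * (a j * w ^ j)" using assms(2) by simp
  finally show ?thesis .
qed

lemma of_nat_N_nz: "of_nat N \<noteq> (0::'b)"
  using charN by (metis ringhom_of_nat[OF hom] ringhom_eq_0_iff[OF hom])

text \<open>The norm is Galois invariant, hence equal to its own average, and averaging is the
  projection to the component of exponent 0.\<close>

lemma norm_Ku:
  assumes z: "z \<in> L"
  shows "(\<Prod>\<zeta>\<in>roots1 N. gal \<zeta> z) \<in> Ku"
proof -
  let ?n = "\<Prod>\<zeta>\<in>roots1 N. gal \<zeta> z"
  have "?n \<in> L" by (intro L_prod gal_L z)
  then obtain a where a: "?n = lin a" "\<And>j. a j \<in> Ku" by (elim L_E) blast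
  have inv: "gal \<eta> ?n = ?n" if e: "\<eta> \<in> roots1 N" for \<eta>
  proof -
    have nz: "\<eta> \<noteq> 0" using e roots1_nz N0 by blast
    have "gal \<eta> ?n = (\<Prod>\<zeta>\<in>roots1 N. gal (\<eta> * \<zeta>) z)"
      using e z by (simp add: ringhom_prod[OF gal(1)] gal_mult)
    also have "\<dots> = ?n"
      by (rule prod.reindex_bij_witness[of _ "\<lambda>\<zeta>. inverse \<eta> * \<zeta>" "\<lambda>\<zeta>. \<eta> * \<zeta>"])
        (use e nz in \<open>auto intro!: roots1_mult roots1_inverse simp flip: mult.assoc\<close>)
    finally show ?thesis .
  qed
  have "of_nat N * ?n = (\<Sum>\<zeta>\<in>roots1 N. gal \<zeta> ?n)"
    using inv by (simp add: card_roots1[OF N0 charN])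
  also have "\<dots> = of_nat N * a 0"
    using isotypic[OF a(2), of 0] N0 by (simp add: a(1) h_simps)
  finally have "?n = a 0" using of_nat_N_nz by simp
  then show ?thesis using a(2) by metis
qed

text \<open>The inverse of \<open>z\<close> is the product of its other conjugates divided by the
  norm, and the norm lies in k(u).\<close>

lemma subfld_L: "subfld L"
  unfolding subfld_def
proof (intro conjI ballI)
  show "1 \<in> L" using w_power_L[of 0] by simp
  fix z assume z: "z \<in> L"
  show "- z \<in> L" using L_smult[of "- 1" z] z Ku_closed by simp
  show "inverse z \<in> L"
  proof (cases "z = 0")
    case False
    let ?n = "\<Prod>\<zeta>\<in>roots1 N. gal \<zeta> z" and ?n' = "\<Prod>\<zeta>\<in>roots1 N - {1}. gal \<zeta> z"
    have fin: "finite (roots1 N :: 'a set)" using finite_roots1 N0 by blast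
    have "?n = gal 1 z * ?n'" by (rule prod.remove) (auto simp: fin roots1_one)
    then have n: "?n = z * ?n'" using gal_one z by simp
    have "?n \<noteq> 0" using fin False by (auto simp: ringhom_eq_0_iff[OF gal(1)])
    with n have "inverse z = inverse ?n * ?n'" by (simp add: field_simps)
    then show ?thesis
      by (simp only:) (intro L_smult L_prod gal_L z norm_Ku Ku_closed(5); simp)
  qed (use z in simp)
qed (auto intro: L_add L_mult)

lemmas L_closed = subfldD[OF subfld_L] subfld_more[OF subfld_L]

lemma w_L: "w \<in> L" using w_power_L[of 1] by simp

lemma h_L: "h a \<in> L" using Ku_L h_Ku by blast

lemma L_least:
  assumes "subfld S" "range h \<subseteq> S" "u \<in> S" "w \<in> S"
  shows "L \<subseteq> S"
proof
  fix z assume "z \<in> L"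
  then obtain a where a: "z = lin a" "\<And>j. a j \<in> Ku" by (elim L_E) blast
  have "ev p \<in> S" for p using assms hom by (intro subfld_evp) auto
  then have "Ku \<subseteq> S" by (auto simp: Ku_def subfld_more[OF assms(1)])
  then show "z \<in> S" unfolding a lin_def
    using a assms by (intro subfld_sum subfldD subfld_more) auto
qed

lemma gen3_eq_L: "v \<in> L \<Longrightarrow> gen3 h u v w = L"
  by (intro equalityI gen3_least subfld_L L_least subfld_gen3 hom image_subsetI gen3_gens w_L h_L Ku_L[OF u_Ku])

end

section \<open>Valuation rings\<close>

text \<open>The counterpart, for subsets of a field type, of membership in \<open>places\<close>;
  \<open>maxid\<close> and \<open>vunits\<close> are the non-units and the units of such a
  ring.\<close>

definition isplace :: "'b::field set \<Rightarrow> 'b set \<Rightarrow> 'b set \<Rightarrow> bool" where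
  "isplace k L P \<longleftrightarrow> 1 \<in> P \<and> (\<forall>a\<in>P. \<forall>b\<in>P. a + b \<in> P \<and> a * b \<in> P) \<and> (\<forall>a\<in>P. - a \<in> P) \<and>
     k \<subset> P \<and> P \<subset> L \<and> (\<forall>z\<in>L. z \<noteq> 0 \<longrightarrow> z \<in> P \<or> inverse z \<in> P)"

definition maxid :: "'b::field set \<Rightarrow> 'b set" where
  "maxid P = {z \<in> P. z = 0 \<or> inverse z \<notin> P}"

definition vunits :: "'b::field set \<Rightarrow> 'b set" where
  "vunits P = {z \<in> P. z \<noteq> 0 \<and> inverse z \<in> P}"

definition dvr :: "'b::field set \<Rightarrow> 'b set \<Rightarrow> 'b \<Rightarrow> bool" where
  "dvr L P t \<longleftrightarrow> t \<in> maxid P \<and> t \<noteq> 0 \<and>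
     (\<forall>z\<in>L. z \<noteq> 0 \<longrightarrow> (\<exists>i::int. \<exists>e\<in>vunits P. z = t powi i * e))"

locale valring =
  fixes k L P :: "'b::field set"
  assumes place: "isplace k L P" and Lf: "subfld L"
begin

lemma P_closed:
  shows "1 \<in> P" "a \<in> P \<Longrightarrow> b \<in> P \<Longrightarrow> a + b \<in> P" "a \<in> P \<Longrightarrow> b \<in> P \<Longrightarrow> a * b \<in> P"
    "a \<in> P \<Longrightarrow> - a \<in> P"
  using place unfolding isplace_def by blast+

lemma k_P: "a \<in> k \<Longrightarrow> a \<in> P" and P_L: "a \<in> P \<Longrightarrow> a \<in> L" and P_ne: "P \<noteq> L" "P \<noteq> k"
  using place unfolding isplace_def by blast+

lemma P_or: "z \<in> L \<Longrightarrow> z \<notin> P \<Longrightarrow> inverse z \<in> P"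
  using place P_closed(1) unfolding isplace_def
  by (metis P_closed(2,4) ab_group_add_class.ab_left_minus)

lemma P_more:
  shows "0 \<in> P" "a \<in> P \<Longrightarrow> b \<in> P \<Longrightarrow> a - b \<in> P" "a \<in> P \<Longrightarrow> a ^ n \<in> P"
proof -
  have "1 + - 1 \<in> P" using P_closed by blast
  then show "0 \<in> P" by simp
  show "a - b \<in> P" if "a \<in> P" "b \<in> P" using P_closed(2)[OF that(1) P_closed(4)[OF that(2)]] by simp
  show "a ^ n \<in> P" if "a \<in> P" by (induction n) (use P_closed that in auto)
qed

lemma P_sum: "(\<And>i. i \<in> A \<Longrightarrow> g i \<in> P) \<Longrightarrow> sum g A \<in> P"
  by (induction A rule: infinite_finite_induct) (auto simp: P_more(1) P_closed(2))

lemma P_evp: "ringhom h \<Longrightarrow> range h \<subseteq> P \<Longrightarrow> x \<in> P \<Longrightarrow> evp h x p \<in> P"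
  by (induction p) (auto simp: evp_pCons P_more intro!: P_closed)

lemma vunits_mult: "a \<in> vunits P \<Longrightarrow> b \<in> vunits P \<Longrightarrow> a * b \<in> vunits P"
  by (auto simp: vunits_def P_closed)

lemma vunits_inverse: "a \<in> vunits P \<Longrightarrow> inverse a \<in> vunits P"
  by (auto simp: vunits_def)

lemma vunits_one: "1 \<in> vunits P"
  by (auto simp: vunits_def P_closed)

lemma vunits_power: "a \<in> vunits P \<Longrightarrow> a ^ n \<in> vunits P"
  by (induction n) (auto simp: vunits_mult vunits_one)

lemma maxid_P: "a \<in> maxid P \<Longrightarrow> a \<in> P"
  by (auto simp: maxid_def)

lemma maxid_or_unit: "a \<in> P \<Longrightarrow> a \<in> maxid P \<or> a \<in> vunits P"
  by (auto simp: maxid_def vunits_def)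

lemma maxid_not_unit: "a \<in> maxid P \<Longrightarrow> a \<notin> vunits P"
  by (auto simp: maxid_def vunits_def)

lemma one_notin_maxid: "1 \<notin> maxid P"
  by (auto simp: maxid_def P_closed)

lemma maxid_absorb:
  assumes "a \<in> maxid P" "b \<in> P"
  shows "b * a \<in> maxid P"
proof (cases "a = 0 \<or> b = 0")
  case False
  have "inverse (b * a) \<notin> P"
  proof
    assume "inverse (b * a) \<in> P"
    then have "b * inverse (b * a) \<in> P" using assms(2) by (simp add: P_closed)
    moreover have "b * inverse (b * a) = inverse a" using False by simp
    ultimately have "inverse a \<in> P" by (simp only:)
    then show False using assms(1) False by (simp add: maxid_def)
  qed
  then show ?thesis using assms P_closed(3) by (auto simp: maxid_def)
qed (use P_more(1) in \<open>auto simp: maxid_def\<close>)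

text \<open>Of two nonzero elements one quotient lies in \<open>P\<close>, say \<open>a / b\<close>;
  then \<open>a + b = (a / b + 1) * b\<close> is a multiple of the non-unit
  \<open>b\<close>.\<close>

lemma maxid_add:
  assumes a: "a \<in> maxid P" and b: "b \<in> maxid P"
  shows "a + b \<in> maxid P"
proof -
  have aux: "a + b \<in> maxid P" if "b \<in> maxid P" "b \<noteq> 0" "a / b \<in> P" for a b
  proof -
    have "(a / b + 1) * b \<in> maxid P"
      by (intro maxid_absorb that P_closed)
    then show ?thesis using that by (simp add: distrib_right)
  qed
  show ?thesis
  proof (cases "a = 0 \<or> b = 0")
    case False
    have "a / b \<in> L" using a b P_L maxid_P subfld_more(3)[OF Lf] by blast
    then have "a / b \<in> P \<or> inverse (a / b) \<in> P" using P_or by blast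
    then show ?thesis using aux[of b a] aux[of a b] a b False by (auto simp: add.commute)
  qed (use a b in auto)
qed

lemma maxid_uminus: "a \<in> maxid P \<Longrightarrow> - a \<in> maxid P"
  using maxid_absorb[of a "- 1"] P_closed by simp

lemma maxid_diff: "a \<in> maxid P \<Longrightarrow> b \<in> maxid P \<Longrightarrow> a - b \<in> maxid P"
  using maxid_add[of a "- b"] maxid_uminus by simp

lemma maxid_power: "a \<in> maxid P \<Longrightarrow> n > 0 \<Longrightarrow> a ^ n \<in> maxid P"
  by (cases n) (auto intro!: maxid_absorb P_more simp: maxid_P mult.commute[of a])

lemma maxid_prime:
  assumes "a * b \<in> maxid P" "a \<in> P" "b \<in> P"
  shows "a \<in> maxid P \<or> b \<in> maxid P"
  using assms maxid_or_unit maxid_not_unit vunits_mult by metis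

lemma maxid_power_iff: "a \<in> P \<Longrightarrow> n > 0 \<Longrightarrow> a ^ n \<in> maxid P \<longleftrightarrow> a \<in> maxid P"
  using maxid_or_unit maxid_not_unit vunits_power maxid_power by metis

text \<open>If z were outside \<open>P\<close>, its inverse would lie inside, and then so would
  \<open>z = z ^ n * inverse z ^ (n - 1)\<close>.\<close>

lemma integrally_closed:
  assumes "z \<in> L" "z ^ n \<in> P" "n > 0"
  shows "z \<in> P"
proof (rule ccontr)
  assume z: "z \<notin> P"
  then have nz: "z \<noteq> 0" using P_more by auto
  have i: "inverse z \<in> P" using P_or assms z by blast
  have "z ^ n * inverse z ^ (n - 1) \<in> P" 
    by (rule P_closed(3)[OF assms(2) P_more(3)[OF i]])
  moreover have "z ^ n * inverse z ^ (n - 1) = z"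
    using assms(3) nz by (cases n) (simp_all add: field_simps)
  ultimately show False using z by simp
qed

text \<open>\<open>F\<close> splits into linear factors and \<open>maxid P\<close> is prime, so one
  factor lies in it. All points of the line and of the fibres are found this way: an element that
  satisfies an equation modulo the maximal ideal is congruent to a constant.\<close>

lemma maxid_poly_root:
  fixes h :: "'a::alg_closed_field \<Rightarrow> 'b"
  assumes h: "ringhom h" "range h \<subseteq> P" and x: "x \<in> P"
  shows "F \<noteq> 0 \<Longrightarrow> evp h x F \<in> maxid P \<Longrightarrow> \<exists>a. poly F a = 0 \<and> x - h a \<in> maxid P"
proof (induction "Polynomial.degree F" arbitrary: F rule: less_induct)
  case less
  show ?case
  proof (cases "Polynomial.degree F = 0")
    case True
    then obtain c where c: "F = [:c:]" by (rule degree_eq_zeroE)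
    have "h (inverse c) \<in> P" using h by blast
    then show ?thesis using less.prems c h
      by (auto simp: evp_const maxid_def ringhom_inverse ringhom_eq_0_iff)
  next
    case False
    then obtain a where a: "poly F a = 0"
      using alg_closed_imp_poly_has_root by blast
    then obtain q where F: "F = [:- a, 1:] * q"
      by (metis dvdE poly_eq_0_iff_dvd)
    have q: "q \<noteq> 0" using less.prems F by auto
    then have deg: "Polynomial.degree q < Polynomial.degree F"
      unfolding F by (subst degree_mult_eq) auto
    have "evp h x F = (x - h a) * evp h x q"
      unfolding F by (simp add: ringhom_simps(4)[OF ringhom_evp[OF h(1)]] evp_pCons h
          ringhom_uminus[OF h(1)] ringhom_simps[OF h(1)] del: mult_pCons_left)
    moreover have "x - h a \<in> P" "evp h x q \<in> P"
      using h x by (auto intro!: P_more P_evp)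
    ultimately have "x - h a \<in> maxid P \<or> evp h x q \<in> maxid P"
      using less.prems(2) maxid_prime by simp
    then show ?thesis
      using less.hyps[OF deg q] a by (auto simp: F)
  qed
qed

lemma notin_maxid_inverse: "z \<in> L \<Longrightarrow> z \<notin> P \<Longrightarrow> inverse z \<in> maxid P"
  using P_or by (auto simp: maxid_def)

end

section \<open>A criterion for discrete valuation rings\<close>

text \<open>
  The assumption \<open>bounded\<close> replaces the Noetherian hypothesis: it bounds the power of \<open>t\<close> that
  can be split off from an element of \<open>A\<close>.
\<close>

locale local_data =
  fixes h :: "'a::field \<Rightarrow> 'b::field" and L A :: "'b set" and \<epsilon> :: "'b \<Rightarrow> 'a" and t :: 'b
  assumes hom: "ringhom h" and Lf: "subfld L" and AL: "A \<subseteq> L"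
    and A_closed: "\<And>x y. x \<in> A \<Longrightarrow> y \<in> A \<Longrightarrow> x + y \<in> A" "\<And>x y. x \<in> A \<Longrightarrow> y \<in> A \<Longrightarrow> x * y \<in> A"
      "\<And>a. h a \<in> A"
    and eps: "\<And>x y. x \<in> A \<Longrightarrow> y \<in> A \<Longrightarrow> \<epsilon> (x + y) = \<epsilon> x + \<epsilon> y"
      "\<And>x y. x \<in> A \<Longrightarrow> y \<in> A \<Longrightarrow> \<epsilon> (x * y) = \<epsilon> x * \<epsilon> y" "\<And>a. \<epsilon> (h a) = a"
    and t: "t \<in> A" "t \<noteq> 0" "\<epsilon> t = 0"
    and frac: "\<And>z. z \<in> L \<Longrightarrow> \<exists>x\<in>A. \<exists>y\<in>A. y \<noteq> 0 \<and> z = x / y"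
    and principal: "\<exists>b\<in>A. \<epsilon> b \<noteq> 0 \<and> (\<forall>x\<in>A. \<epsilon> x = 0 \<longrightarrow> (\<exists>y\<in>A. x * b = t * y))"
    and bounded: "\<And>x. x \<in> A \<Longrightarrow> x \<noteq> 0 \<Longrightarrow> \<exists>x'\<in>A. \<exists>j e. e \<in> A \<and> \<epsilon> e \<noteq> 0 \<and> x * x' = t ^ j * e"
begin

lemma A_more:
  shows "0 \<in> A" "1 \<in> A" "x \<in> A \<Longrightarrow> - x \<in> A" "x \<in> A \<Longrightarrow> y \<in> A \<Longrightarrow> x - y \<in> A" "x \<in> A \<Longrightarrow> x ^ n \<in> A"
proof -
  show 0: "0 \<in> A" using A_closed(3)[of 0] by (simp add: ringhom_simps[OF hom])
  show 1: "1 \<in> A" using A_closed(3)[of 1] by (simp add: ringhom_simps[OF hom])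
  have "- 1 \<in> A" using A_closed(3)[of "- 1"] by (simp add: ringhom_simps[OF hom] ringhom_uminus[OF hom])
  then show m: "- x \<in> A" if "x \<in> A" for x using A_closed(2)[of "- 1" x] that by simp
  show "x - y \<in> A" if "x \<in> A" "y \<in> A" using A_closed(1)[OF that(1) m[OF that(2)]] by simp
  show "x ^ n \<in> A" if "x \<in> A" by (induction n) (use that 1 A_closed in auto)
qed

lemma eps_more:
  shows "\<epsilon> 0 = 0" "\<epsilon> 1 = 1" "x \<in> A \<Longrightarrow> \<epsilon> (- x) = - \<epsilon> x"
    "x \<in> A \<Longrightarrow> y \<in> A \<Longrightarrow> \<epsilon> (x - y) = \<epsilon> x - \<epsilon> y" "x \<in> A \<Longrightarrow> \<epsilon> (x ^ n) = \<epsilon> x ^ n"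
proof -
  show 0: "\<epsilon> 0 = 0" using eps(3)[of 0] by (simp add: ringhom_simps[OF hom])
  show 1: "\<epsilon> 1 = 1" using eps(3)[of 1] by (simp add: ringhom_simps[OF hom])
  show m: "\<epsilon> (- x) = - \<epsilon> x" if "x \<in> A" for x
  proof -
    have "\<epsilon> (x + - x) = \<epsilon> x + \<epsilon> (- x)" using that A_more by (intro eps) auto
    then have "\<epsilon> x + \<epsilon> (- x) = 0" by (simp add: 0)
    then show ?thesis by (simp add: eq_neg_iff_add_eq_0 add.commute)
  qed
  show "\<epsilon> (x - y) = \<epsilon> x - \<epsilon> y" if "x \<in> A" "y \<in> A"
    using eps(1)[OF that(1) A_more(3)[OF that(2)]] m[OF that(2)] by simp
  show "\<epsilon> (x ^ n) = \<epsilon> x ^ n" if "x \<in> A"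
    by (induction n) (use that 1 A_more(5) in \<open>auto simp: eps\<close>)
qed

text \<open>As long as \<open>\<epsilon>\<close> vanishes on the remaining factor,
  \<open>principal\<close> splits off another \<open>t\<close>. If this never stopped, more powers
  of \<open>t\<close> would come out of \<open>x\<close> than \<open>bounded\<close> allows.\<close>

lemma decompose_A:
  assumes x: "x \<in> A" "x \<noteq> 0"
  shows "\<exists>i. \<exists>c\<in>A. \<exists>e\<in>A. \<epsilon> c \<noteq> 0 \<and> \<epsilon> e \<noteq> 0 \<and> x * c = t ^ i * e"
proof (rule ccontr)
  assume H: "\<not> ?thesis"
  obtain b where b: "b \<in> A" "\<epsilon> b \<noteq> 0" "\<And>x. x \<in> A \<Longrightarrow> \<epsilon> x = 0 \<Longrightarrow> \<exists>y\<in>A. x * b = t * y"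
    using principal by blast
  have *: "\<exists>c\<in>A. \<exists>y\<in>A. \<epsilon> c \<noteq> 0 \<and> x * c = t ^ i * y" for i
  proof (induction i)
    case 0
    show ?case by (rule bexI[of _ 1], rule bexI[of _ x]) (use x A_more eps_more in auto)
  next
    case (Suc i)
    then obtain c y where cy: "c \<in> A" "y \<in> A" "\<epsilon> c \<noteq> 0" "x * c = t ^ i * y" by blast
    with H have "\<epsilon> y = 0" by blast
    then obtain y' where y': "y' \<in> A" "y * b = t * y'" using b(3) cy by blast
    have "x * (c * b) = t ^ Suc i * y'"
      using cy(4) y'(2) by (simp flip: mult.assoc)
    moreover have "c * b \<in> A" "\<epsilon> (c * b) \<noteq> 0" using cy b by (auto simp: eps A_closed)
    ultimately show ?case using y' by blast
  qed
  obtain x' j e where e: "x' \<in> A" "e \<in> A" "\<epsilon> e \<noteq> 0" "x * x' = t ^ j * e"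
    using bounded[OF x] by blast
  obtain c y where cy: "c \<in> A" "y \<in> A" "\<epsilon> c \<noteq> 0" "x * c = t ^ Suc j * y"
    using *[of "Suc j"] by blast
  \<comment> \<open>Comparing the two factorizations and cancelling \<open>t ^ j\<close> exhibits
    \<open>e * c\<close> as a multiple of \<open>t\<close>, although \<open>\<epsilon>\<close> does
    not vanish on it.\<close>
  have "t ^ j * (e * c) = (x * c) * x'" using e(4) by (simp add: mult_ac)
  also have "\<dots> = t ^ j * (t * (y * x'))" unfolding cy(4) by (simp add: mult_ac)
  finally have "e * c = t * (y * x')" using t(2) by simp
  then have "\<epsilon> (e * c) = \<epsilon> (t * (y * x'))" by simp
  then show False using e cy t by (simp add: eps A_closed)
qed

text \<open>The localization of \<open>A\<close> at the kernel of \<open>\<epsilon>\<close>.\<close>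

definition P :: "'b set" where "P = {x / y | x y. x \<in> A \<and> y \<in> A \<and> \<epsilon> y \<noteq> 0}"

lemma eps_nz: "\<epsilon> y \<noteq> 0 \<Longrightarrow> y \<noteq> 0" using eps_more by auto

lemma P_I: "x \<in> A \<Longrightarrow> y \<in> A \<Longrightarrow> \<epsilon> y \<noteq> 0 \<Longrightarrow> x / y \<in> P"
  by (auto simp: P_def)

lemma A_P: "x \<in> A \<Longrightarrow> x \<in> P"
  using P_I[of x 1] A_more eps_more by simp

lemma P_unit: "x \<in> A \<Longrightarrow> y \<in> A \<Longrightarrow> \<epsilon> x \<noteq> 0 \<Longrightarrow> \<epsilon> y \<noteq> 0 \<Longrightarrow> x / y \<in> vunits P"
  using P_I[of x y] P_I[of y x] eps_nz by (auto simp: vunits_def)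

lemma P_nonunit:
  assumes "x \<in> A" "y \<in> A" "\<epsilon> x = 0" "\<epsilon> y \<noteq> 0"
  shows "x / y \<in> maxid P"
proof -
  have "inverse (x / y) \<notin> P" if "x \<noteq> 0"
  proof
    assume "inverse (x / y) \<in> P"
    then obtain x1 y1 where *: "x1 \<in> A" "y1 \<in> A" "\<epsilon> y1 \<noteq> 0" "y / x = x1 / y1"
      by (auto simp: P_def)
    then have "y * y1 = x1 * x" using that eps_nz by (simp add: frac_eq_eq)
    then have "\<epsilon> (y * y1) = \<epsilon> (x1 * x)" by simp
    then show False using assms * by (simp add: eps)
  qed
  then show ?thesis using P_I assms by (auto simp: maxid_def)
qed

lemma decompose_L:
  assumes "z \<in> L" "z \<noteq> 0"
  shows "\<exists>i::int. \<exists>c\<in>A. \<exists>e\<in>A. \<epsilon> c \<noteq> 0 \<and> \<epsilon> e \<noteq> 0 \<and> z = t powi i * (e / c)"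
proof -
  obtain x y where xy: "x \<in> A" "y \<in> A" "y \<noteq> 0" "z = x / y" using frac assms by blast
  with assms have "x \<noteq> 0" by auto
  obtain i c e where 1: "c \<in> A" "e \<in> A" "\<epsilon> c \<noteq> 0" "\<epsilon> e \<noteq> 0" "x * c = t ^ i * e"
    using decompose_A xy \<open>x \<noteq> 0\<close> by blast
  obtain j c' e' where 2: "c' \<in> A" "e' \<in> A" "\<epsilon> c' \<noteq> 0" "\<epsilon> e' \<noteq> 0" "y * c' = t ^ j * e'"
    using decompose_A xy by blast
  have nz: "c \<noteq> 0" "e \<noteq> 0" "c' \<noteq> 0" "e' \<noteq> 0" using 1 2 eps_nz by blast+
  have "x = t ^ i * e / c" "y = t ^ j * e' / c'" using 1(5) 2(5) nz by (simp_all add: field_simps)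
  then have "z = t powi (int i - int j) * ((e * c') / (c * e'))"
    using xy nz t by (simp add: power_int_diff mult_ac)
  moreover have "e * c' \<in> A" "c * e' \<in> A" "\<epsilon> (e * c') \<noteq> 0" "\<epsilon> (c * e') \<noteq> 0"
    using 1 2 by (auto simp: eps A_closed)
  ultimately show ?thesis by blast
qed

lemma isplace_P: "isplace (range h) L P"
  unfolding isplace_def
proof (intro conjI ballI impI)
  show "1 \<in> P" using A_P A_more by blast
  have tm: "t / 1 \<in> maxid P" using t A_more eps_more by (intro P_nonunit) auto
  show "range h \<subset> P"
  proof
    show "range h \<subseteq> P" using A_closed(3) A_P by blast
    have "t \<notin> range h" using t eps(3) by (auto simp: ringhom_simps[OF hom])
    then show "range h \<noteq> P" using A_P t by blast
  qed
  show "P \<subset> L"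
  proof
    show "P \<subseteq> L" using AL subfld_more(3)[OF Lf] by (auto simp: P_def)
    have "inverse t \<notin> P" "inverse t \<in> L"
      using tm t AL subfldD(5)[OF Lf] by (auto simp: maxid_def)
    then show "P \<noteq> L" by blast
  qed
  fix a assume "a \<in> P"
  then obtain x y where a: "a = x / y" "x \<in> A" "y \<in> A" "\<epsilon> y \<noteq> 0" by (auto simp: P_def)
  show "- a \<in> P" using P_I[of "- x" y] a A_more by simp
  fix b assume "b \<in> P"
  then obtain x' y' where b: "b = x' / y'" "x' \<in> A" "y' \<in> A" "\<epsilon> y' \<noteq> 0" by (auto simp: P_def)
  have yy: "y * y' \<in> A" "\<epsilon> (y * y') \<noteq> 0" using a b by (auto simp: A_closed eps)
  have nz: "y \<noteq> 0" "y' \<noteq> 0" using a b eps_nz by auto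
  show "a + b \<in> P" using P_I[of "x * y' + x' * y" "y * y'"] a b yy nz
    by (simp add: A_closed add_frac_eq)
  show "a * b \<in> P" using P_I[of "x * x'" "y * y'"] a b yy by (simp add: A_closed)
next
  fix z assume "z \<in> L" "z \<noteq> 0"
  then obtain i :: int and c e where *: "c \<in> A" "e \<in> A" "\<epsilon> c \<noteq> 0" "\<epsilon> e \<noteq> 0" "z = t powi i * (e / c)"
    using decompose_L by blast
  show "z \<in> P \<or> inverse z \<in> P"
  proof (cases "i \<ge> 0")
    case True
    then have "z = (t ^ nat i * e) / c" by (simp add: * power_int_def)
    moreover have "t ^ nat i * e \<in> A" using * t by (auto intro: A_closed A_more)
    ultimately show ?thesis using P_I * by blast
  next
    case False
    then have "inverse z = (t ^ nat (- i) * c) / e"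
      by (simp add: * power_int_def field_simps)
    moreover have "t ^ nat (- i) * c \<in> A" using * t by (auto intro: A_closed A_more)
    ultimately show ?thesis using P_I * by metis
  qed
qed

sublocale valring "range h" L P
  using isplace_P Lf by unfold_locales

lemma t_maxid: "t \<in> maxid P"
  using P_nonunit[of t 1] t A_more eps_more by simp

lemma dvr_P: "dvr L P t"
  unfolding dvr_def using t_maxid t decompose_L P_unit by (meson)

text \<open>The residue of \<open>x / y\<close> is the constant
  \<open>\<epsilon> x / \<epsilon> y\<close>, so the place has degree one.\<close>

lemma residue_P: "z \<in> P \<Longrightarrow> \<exists>a. z - h a \<in> maxid P"
proof -
  assume "z \<in> P"
  then obtain x y where z: "z = x / y" "x \<in> A" "y \<in> A" "\<epsilon> y \<noteq> 0" by (auto simp: P_def)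
  define a where "a = \<epsilon> x / \<epsilon> y"
  have "\<epsilon> (x - h a * y) = 0" using z by (simp add: eps eps_more A_closed a_def)
  then have "(x - h a * y) / y \<in> maxid P" using z by (intro P_nonunit A_more A_closed)
  moreover have "(x - h a * y) / y = z - h a" using z eps_nz by (simp add: field_simps)
  ultimately show ?thesis by metis
qed

text \<open>Elements of \<open>A\<close> off the kernel become units of \<open>Q\<close>, so
  \<open>Q\<close> contains \<open>P\<close>. An element of \<open>Q\<close> outside
  \<open>P\<close> would have an inverse \<open>x / y\<close> with \<open>x\<close> in the kernel,
  hence in the maximal ideal of \<open>Q\<close>, which is impossible.\<close>

lemma P_unique:
  assumes Q: "isplace (range h) L Q" and AQ: "\<And>x. x \<in> A \<Longrightarrow> x \<in> Q"
    and ker: "\<And>x. x \<in> A \<Longrightarrow> \<epsilon> x = 0 \<Longrightarrow> x \<in> maxid Q"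
  shows "Q = P"
proof -
  interpret Q: valring "range h" L Q using Q Lf by unfold_locales
  have PQ: "P \<subseteq> Q"
  proof
    fix z assume "z \<in> P"
    then obtain x y where z: "z = x / y" "x \<in> A" "y \<in> A" "\<epsilon> y \<noteq> 0" by (auto simp: P_def)
    have "y \<notin> maxid Q"
    proof
      assume "y \<in> maxid Q"
      moreover have "y - h (\<epsilon> y) \<in> maxid Q"
        using z by (intro ker) (auto intro: A_more A_closed simp: eps eps_more A_closed)
      ultimately have "y - (y - h (\<epsilon> y)) \<in> maxid Q" by (rule Q.maxid_diff)
      moreover have "h (\<epsilon> y) \<in> vunits Q"
      proof -
        have "inverse (h (\<epsilon> y)) = h (inverse (\<epsilon> y))" by (simp add: ringhom_inverse[OF hom])
        then show ?thesis using Q.k_P z by (auto simp: vunits_def ringhom_eq_0_iff[OF hom])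
      qed
      ultimately show False using Q.maxid_not_unit by simp
    qed
    then have "inverse y \<in> Q" using AQ z Q.maxid_or_unit by (auto simp: vunits_def)
    then show "z \<in> Q" using z AQ Q.P_closed(3) by (simp add: divide_inverse)
  qed
  moreover have "z \<in> P" if z: "z \<in> Q" for z
  proof (rule ccontr)
    assume n: "z \<notin> P"
    then have i: "inverse z \<in> P" using P_or Q.P_L z by blast
    then obtain x y where xy: "inverse z = x / y" "x \<in> A" "y \<in> A" "\<epsilon> y \<noteq> 0" by (auto simp: P_def)
    have "\<epsilon> x = 0"
    proof (rule ccontr)
      assume "\<epsilon> x \<noteq> 0"
      then have "y / x \<in> P" using xy P_I by blast
      moreover have "z = y / x" using xy(1) by (metis inverse_divide inverse_inverse_eq)
      ultimately show False using n by simp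
    qed
    then have "x \<in> maxid Q" using ker xy by blast
    moreover have "inverse y \<in> Q" using P_I[of 1 y] A_more xy PQ by (auto simp: divide_inverse)
    ultimately have "inverse z \<in> maxid Q" using Q.maxid_absorb xy(1) by (simp add: divide_inverse mult.commute)
    moreover have "z \<noteq> 0" using n P_more by auto
    ultimately show False using z by (auto simp: maxid_def)
  qed
  ultimately show ?thesis by blast
qed

end

section \<open>The places of a Kummer extension above a point of the projective line\<close>

lemma poly3_alg_induct [case_names add mult const U V W]:
  assumes "\<And>P Q. R P \<Longrightarrow> R Q \<Longrightarrow> R (P + Q)" "\<And>P Q. R P \<Longrightarrow> R Q \<Longrightarrow> R (P * Q)"
    "\<And>a. R [:[:[:a:]:]:]" "R pU" "R pV" "R pW"
  shows "R (P :: 'a::field poly poly poly)"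
proof -
  have one: "R 1" using assms(3)[of 1] by (simp add: one_pCons)
  have pow: "R (P ^ n)" if "R P" for P n by (induction n) (auto simp: one intro: assms(2) that)
  show ?thesis
  proof (induction P rule: poly3_induct)
    case (monom a i j k)
    show ?case by (intro assms(2-6) pow)
  qed (rule assms(1))
qed

text \<open>The extension near the point s = 0 of the projective line, where \<open>Ku\<close> is
  k(s). A positive \<open>m\<close> can always be arranged, since multiplying \<open>w\<close> by
  \<open>s\<close> adds \<open>N\<close> to \<open>m\<close>.\<close>

locale local_kummer =
  fixes h :: "'a::alg_closed_field \<Rightarrow> 'b::field" and Ku L :: "'b set" and s w :: 'b
    and N m :: nat and hp :: "'a poly"
  assumes hom: "ringhom h" and N0: "N > 0" and m0: "m > 0" and charN: "of_nat N \<noteq> (0::'a)"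
    and Kuf: "subfld Ku" and Lf: "subfld L" and KuL: "Ku \<subseteq> L" and hKu: "h a \<in> Ku"
    and s_Ku: "s \<in> Ku" and w_L: "w \<in> L"
    and Ku_frac: "\<And>z. z \<in> Ku \<Longrightarrow> \<exists>p q. q \<noteq> 0 \<and> z = evp h s p / evp h s q"
    and trans: "\<And>p. evp h s p = 0 \<Longrightarrow> p = 0"
    and wN: "w ^ N = s ^ m * evp h s hp" and hp0: "poly hp 0 \<noteq> 0"
    and ind: "indep_over Ku w N"
    and span: "\<And>z. z \<in> L \<Longrightarrow> \<exists>a. (\<forall>j. a j \<in> Ku) \<and> z = (\<Sum>j<N. a j * w ^ j)"
begin

abbreviation "ev \<equiv> evp h s"

definition r where "r = gcd N m"
definition N' where "N' = N div r"
definition m' where "m' = m div r"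

lemma rNm: "r > 0" "N = N' * r" "m = m' * r" "N' > 0" "m' > 0" "coprime N' m'"
  using N0 m0 div_gcd_coprime[of N m]
  by (auto simp: r_def N'_def m'_def div_greater_zero_iff gcd_le1_nat gcd_le2_nat)

lemma ex_bezout: "\<exists>bk. fst bk * m' = N' * snd bk + (1::nat)"
  using bezout_nat[of m' N'] rNm by (auto simp: coprime_iff_gcd_eq_1 gcd.commute mult.commute)

definition "\<beta> = fst (SOME bk. fst bk * m' = N' * snd bk + (1::nat))"
definition "\<kappa> = snd (SOME bk. fst bk * m' = N' * snd bk + (1::nat))"

text \<open>The exponents are made for the parameter: where \<open>s\<close> has order
  \<open>N'\<close> and \<open>w\<close> has order \<open>m'\<close>, the quotient
  \<open>w ^ \<beta> / s ^ \<kappa>\<close> has order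
  \<open>\<beta> * m' - \<kappa> * N' = 1\<close>.\<close>

lemma bezout: "\<beta> * m' = N' * \<kappa> + 1"
  unfolding \<beta>_def \<kappa>_def by (rule someI_ex[OF ex_bezout])

text \<open>
  With \<open>\<theta> ^ r = hp(s)\<close> and \<open>t ^ N' = \<theta> ^ \<beta> * s\<close>, the ring \<open>A\<close> of polynomials in \<open>s, \<theta>, t\<close> is regular
  at the points \<open>(0, \<eta>, 0)\<close> with \<open>\<eta> ^ r = hp(0)\<close>, and \<open>t\<close> is a parameter there.
\<close>

definition "\<theta> = w ^ N' / s ^ m'"
definition "t = w ^ \<beta> / s ^ \<kappa>"

lemma s_nz: "s \<noteq> 0"
  using trans[of "[:0, 1:]"] by (auto simp: evp_X hom)

lemma evhp_nz: "ev hp \<noteq> 0"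
  using trans[of hp] hp0 by auto

lemma w_nz: "w \<noteq> 0"
proof
  assume "w = 0"
  then have "w ^ N = 0" using N0 by (simp add: zero_power)
  then show False using wN s_nz evhp_nz by simp
qed

lemma theta_r: "\<theta> ^ r = ev hp"
proof -
  have "\<theta> ^ r = w ^ N / s ^ m" using rNm by (simp add: \<theta>_def power_divide flip: power_mult)
  then show ?thesis using s_nz by (simp add: wN)
qed

lemma theta_nz: "\<theta> \<noteq> 0" and t_nz: "t \<noteq> 0"
  using w_nz s_nz by (auto simp: \<theta>_def t_def)

text \<open>\<open>\<theta> ^ \<beta>\<close> and \<open>t ^ N'\<close> have the same numerator; by
  the Bezout relation the denominator of the former contains exactly one more factor
  \<open>s\<close>.\<close>

lemma t_N: "t ^ N' = \<theta> ^ \<beta> * s"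
proof -
  have "t ^ N' = w ^ (\<beta> * N') / s ^ (N' * \<kappa>)"
    by (simp add: t_def power_divide mult.commute flip: power_mult)
  moreover have "\<theta> ^ \<beta> = w ^ (\<beta> * N') / s ^ (\<beta> * m')"
    by (simp add: \<theta>_def power_divide mult.commute flip: power_mult)
  moreover have "s ^ (\<beta> * m') = s ^ (N' * \<kappa>) * s" by (simp add: bezout)
  ultimately show ?thesis using s_nz by simp
qed

text \<open>This recovers \<open>w\<close> from \<open>t\<close> up to a power of
  \<open>\<theta>\<close>, which is a unit at the places in question.\<close>

lemma t_m: "t ^ m' = w * \<theta> ^ \<kappa>"
proof -
  have "t ^ m' = w ^ (\<beta> * m') / s ^ (m' * \<kappa>)"
    by (simp add: t_def power_divide mult.commute flip: power_mult)
  moreover have "\<theta> ^ \<kappa> = w ^ (N' * \<kappa>) / s ^ (m' * \<kappa>)"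
    by (simp add: \<theta>_def power_divide flip: power_mult)
  ultimately show ?thesis by (simp add: bezout)
qed

definition "A = range (evt h s \<theta> t)"

lemma theta_L: "\<theta> \<in> L" and t_L: "t \<in> L"
  using w_L s_Ku KuL by (auto simp: \<theta>_def t_def intro!: subfld_more[OF Lf])

lemma A_closed: "x \<in> A \<Longrightarrow> y \<in> A \<Longrightarrow> x + y \<in> A" "x \<in> A \<Longrightarrow> y \<in> A \<Longrightarrow> x * y \<in> A"
  unfolding A_def by (auto simp flip: evt_simps(3,4)[OF hom])

lemma A_gens: "h a \<in> A" "s \<in> A" "\<theta> \<in> A" "t \<in> A" "ev p \<in> A" "1 \<in> A" "0 \<in> A"
  unfolding A_def
  using evt_gens[OF hom, of s \<theta> t] evt_simps(1,2)[OF hom, of s \<theta> t] by (metis rangeI)+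

lemma A_power: "x \<in> A \<Longrightarrow> x ^ n \<in> A"
  by (induction n) (auto intro: A_closed A_gens)

lemma A_sum: "(\<And>i. i \<in> I \<Longrightarrow> g i \<in> A) \<Longrightarrow> sum g I \<in> A"
  by (induction I rule: infinite_finite_induct) (auto intro: A_closed A_gens)

lemma A_L: "A \<subseteq> L"
  unfolding A_def using hKu KuL s_Ku theta_L t_L
  by (auto intro!: subfld_evt[OF Lf hom])

text \<open>Up to a factor in k(s), \<open>\<theta> ^ i * t ^ j\<close> is the power of
  \<open>w\<close> with exponent \<open>N' * i + \<beta> * j\<close>. These exponents are distinct
  modulo \<open>N\<close>: modulo \<open>N'\<close> they determine \<open>j\<close>, because
  \<open>\<beta>\<close> is coprime to \<open>N'\<close>, and then they determine \<open>i\<close>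
  modulo \<open>r\<close>.\<close>

lemma tower_indep:
  assumes "(\<Sum>i<r. \<Sum>j<N'. ev (c i j) * \<theta> ^ i * t ^ j) = 0"
  shows "\<forall>i<r. \<forall>j<N'. c i j = 0"
proof -
  let ?I = "{..<r} \<times> {..<N'}"
  let ?e = "\<lambda>(i, j). N' * i + \<beta> * j"
  let ?d = "\<lambda>(i, j). m' * i + \<kappa> * j"
  have evKu: "ev p \<in> Ku" for p using hKu s_Ku by (intro subfld_evp Kuf hom) auto
  have "\<forall>ij\<in>?I. (case ij of (i, j) \<Rightarrow> ev (c i j)) = 0"
  proof (rule indep_over_reindex[OF ind Kuf, where k = "\<lambda>ij. ?e ij mod N"
        and c = "\<lambda>ij. (s ^ m * ev hp) ^ (?e ij div N) / s ^ ?d ij"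
        and b = "\<lambda>(i, j). \<theta> ^ i * t ^ j"])
    show "finite ?I" by simp
    show "(\<lambda>ij. ?e ij mod N) ` ?I \<subseteq> {..<N}" using N0 by auto
    show "inj_on (\<lambda>ij. ?e ij mod N) ?I"
    proof (rule inj_onI)
      fix x y assume xy: "x \<in> ?I" "y \<in> ?I" "?e x mod N = ?e y mod N"
      obtain i j i2 j2 where e: "x = (i, j)" "y = (i2, j2)" by fastforce
      have c: "[N' * i + \<beta> * j = N' * i2 + \<beta> * j2] (mod N)" using xy e by (simp add: cong_def)
      then have "[N' * i + \<beta> * j = N' * i2 + \<beta> * j2] (mod N')"
        using rNm(2) cong_dvd_modulus_nat by (metis dvd_triv_left)
      then have "[\<beta> * j = \<beta> * j2] (mod N')" by (simp add: cong_def)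
      moreover have "coprime \<beta> N'"
      proof (rule coprimeI)
        fix c assume "c dvd \<beta>" "c dvd N'"
        then have "c dvd \<beta> * m'" "c dvd N' * \<kappa>" by simp_all
        then show "is_unit c" unfolding bezout using dvd_add_right_iff by blast
      qed
      ultimately have "[j = j2] (mod N')" by (simp add: cong_mult_lcancel_nat)
      then have jj: "j = j2" using xy e by (simp add: cong_less_modulus_unique_nat)
      with c have "[N' * i = N' * i2] (mod N)" by (simp add: cong_add_rcancel_nat)
      then have "[N' * i = N' * i2] (mod N' * r)" by (simp only: flip: rNm(2))
      then have "[i = i2] (mod r)" using rNm(4) by (simp add: cong_def mult_mod_right[symmetric])
      then have "i = i2" using xy e by (simp add: cong_less_modulus_unique_nat)
      with jj e show "x = y" by simp
    qed
    fix ij assume "ij \<in> ?I"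
    obtain i j where ij: "ij = (i, j)" by fastforce
    have "\<theta> ^ i * t ^ j = w ^ ?e ij / s ^ ?d ij"
      by (simp add: \<theta>_def t_def ij power_divide power_add flip: power_mult)
    also have "w ^ ?e ij = (w ^ N) ^ (?e ij div N) * w ^ (?e ij mod N)"
      by (simp flip: power_mult power_add)
    finally show "(s ^ m * ev hp) ^ (?e ij div N) / s ^ ?d ij \<in> Ku \<and>
        (s ^ m * ev hp) ^ (?e ij div N) / s ^ ?d ij \<noteq> 0 \<and>
        (case ij of (i, j) \<Rightarrow> \<theta> ^ i * t ^ j) =
        (s ^ m * ev hp) ^ (?e ij div N) / s ^ ?d ij * w ^ (?e ij mod N)"
      using s_nz evhp_nz
      by (auto simp: ij wN intro!: subfld_more[OF Kuf] subfldD[OF Kuf] evKu s_Ku)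
    show "(case ij of (i, j) \<Rightarrow> ev (c i j)) \<in> Ku" by (simp add: ij evKu)
  next
    show "(\<Sum>ij\<in>?I. (case ij of (i, j) \<Rightarrow> ev (c i j)) * (case ij of (i, j) \<Rightarrow> \<theta> ^ i * t ^ j)) = 0"
      using assms by (simp add: sum.cartesian_product case_prod_beta mult.assoc)
  qed
  then show ?thesis using trans by auto
qed

text \<open>Denominators can be taken in k[s] alone. The fractions in \<open>T\<close> are closed
  under sums and products, and they contain
  \<open>inverse \<theta> = \<theta> ^ (r - 1) / ev hp\<close> and therefore
  \<open>w = t ^ m' * inverse \<theta> ^ \<kappa>\<close>.\<close>

lemma L_form:
  assumes "z \<in> L"
  shows "\<exists>y\<in>A. \<exists>q. q \<noteq> 0 \<and> z = y / ev q"
proof -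
  define T where "T = {y / ev q | y q. y \<in> A \<and> q \<noteq> 0}"
  have TI: "y / ev q \<in> T" if "y \<in> A" "q \<noteq> 0" for y q using that by (auto simp: T_def)
  have T1: "x + y \<in> T" if "x \<in> T" "y \<in> T" for x y
  proof -
    from that obtain a p b q where *: "x = a / ev p" "a \<in> A" "p \<noteq> 0" "y = b / ev q" "b \<in> A" "q \<noteq> 0"
      by (auto simp: T_def)
    have "x + y = (a * ev q + b * ev p) / ev (p * q)"
      using * trans by (simp add: add_frac_eq ringhom_simps[OF ringhom_evp[OF hom]]) (metis add_frac_eq mult.commute)
    moreover have "(a * ev q + b * ev p) / ev (p * q) \<in> T"
      by (rule TI) (use * A_closed A_gens in auto)
    ultimately show ?thesis by (simp only:)
  qed
  have T2: "x * y \<in> T" if "x \<in> T" "y \<in> T" for x y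
  proof -
    from that obtain a p b q where *: "x = a / ev p" "a \<in> A" "p \<noteq> 0" "y = b / ev q" "b \<in> A" "q \<noteq> 0"
      by (auto simp: T_def)
    have "x * y = (a * b) / ev (p * q)"
      using * by (simp add: ringhom_simps[OF ringhom_evp[OF hom]])
    moreover have "(a * b) / ev (p * q) \<in> T" by (rule TI) (use * A_closed in auto)
    ultimately show ?thesis by (simp only:)
  qed
  have T0: "x \<in> T" if "x \<in> A" for x
    using TI[OF that, of 1] by (simp add: ringhom_simps[OF ringhom_evp[OF hom]])
  have Tpow: "x ^ n \<in> T" if "x \<in> T" for x n
    by (induction n) (use T0[of 1] A_gens T2 that in auto)
  have TKu: "x \<in> T" if "x \<in> Ku" for x
    using Ku_frac[OF that] TI A_gens by metis
  have "inverse \<theta> = \<theta> ^ (r - 1) / ev hp"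
  proof -
    have "\<theta> * \<theta> ^ (r - 1) = ev hp" using theta_r rNm(1) by (metis power_eq_if not_gr0)
    then show ?thesis using theta_nz evhp_nz by (simp add: field_simps)
  qed
  moreover have "\<theta> ^ (r - 1) / ev hp \<in> T"
    by (intro TI A_power A_gens) (use hp0 in auto)
  ultimately have "inverse \<theta> \<in> T" by (simp only:)
  then have "t ^ m' * inverse \<theta> ^ \<kappa> \<in> T" by (intro T2 Tpow T0[OF A_gens(4)])
  moreover have "t ^ m' * inverse \<theta> ^ \<kappa> = w"
    using theta_nz by (simp add: t_m field_simps)
  ultimately have wT: "w \<in> T" by simp
  obtain a where a: "\<And>j. a j \<in> Ku" "z = (\<Sum>j<N. a j * w ^ j)" using span[OF assms] by blast
  have Tsum: "sum g I \<in> T" if "\<And>i. i \<in> I \<Longrightarrow> g i \<in> T" for g :: "nat \<Rightarrow> 'b" and I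
    using that by (induction I rule: infinite_finite_induct) (auto intro: T1 T0 A_gens)
  have "z \<in> T" unfolding a(2) by (rule Tsum) (intro T2 TKu Tpow a(1) wT)
  then show ?thesis by (auto simp: T_def)
qed

end

section \<open>The local ring at a point (0, \<eta>, 0)\<close>

locale local_point = local_kummer +
  fixes \<eta> :: 'a
  assumes eta: "\<eta> ^ r = poly hp 0"
begin

abbreviation "ev0 \<equiv> evt (\<lambda>a. a) 0 \<eta> 0"

lemmas ev0_simps = evt_simps[OF ringhom_id, of 0 \<eta> 0]

text \<open>Every relation among \<open>s\<close>, \<open>\<theta>\<close>, \<open>t\<close> is a
  combination of \<open>V ^ r - hp(U)\<close> and \<open>W ^ N' - V ^ \<beta> * U\<close>, and both
  vanish at (0, \<eta>, 0). Hence evaluation at that point is well defined on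
  \<open>A\<close>.\<close>

lemma specialize: "evt h s \<theta> t P = 0 \<Longrightarrow> ev0 P = 0"
proof -
  assume "evt h s \<theta> t P = 0"
  then obtain A B where
    P: "P = A * (pV ^ r - [:[:hp:]:]) + B * (pW ^ N' - pV ^ \<beta> * [:[:[:0, 1:]:]:])"
    using tower_ideal[OF hom rNm(1,4) theta_r, of t \<beta> "[:0, 1:]" P] t_N tower_indep
    by (auto simp: evp_X hom)
  show ?thesis unfolding P using rNm
    by (simp add: ev0_simps evp_ident eta zero_power del: mult_pCons_left mult_pCons_right)
qed

definition "\<epsilon> x = ev0 (SOME P. x = evt h s \<theta> t P)"

lemma eps_evt: "\<epsilon> (evt h s \<theta> t P) = ev0 P"
proof -
  let ?P = "SOME Q. evt h s \<theta> t P = evt h s \<theta> t Q"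
  have "evt h s \<theta> t P = evt h s \<theta> t ?P" by (rule someI[of _ P]) simp
  then have "evt h s \<theta> t (P - ?P) = 0" by (simp add: evt_simps[OF hom])
  then have "ev0 (P - ?P) = 0" by (rule specialize)
  then show ?thesis by (simp add: \<epsilon>_def ev0_simps)
qed

lemma eps_hom: "x \<in> A \<Longrightarrow> y \<in> A \<Longrightarrow> \<epsilon> (x + y) = \<epsilon> x + \<epsilon> y" "x \<in> A \<Longrightarrow> y \<in> A \<Longrightarrow> \<epsilon> (x * y) = \<epsilon> x * \<epsilon> y"
proof -
  assume "x \<in> A" "y \<in> A"
  then obtain P Q where *: "x = evt h s \<theta> t P" "y = evt h s \<theta> t Q" by (auto simp: A_def)
  show "\<epsilon> (x + y) = \<epsilon> x + \<epsilon> y"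
    unfolding * eps_evt evt_simps(3)[OF hom, symmetric] by (simp add: ev0_simps)
  show "\<epsilon> (x * y) = \<epsilon> x * \<epsilon> y"
    unfolding * eps_evt evt_simps(4)[OF hom, symmetric] by (simp add: ev0_simps)
qed

lemma eps_power: "x \<in> A \<Longrightarrow> \<epsilon> (x ^ n) = \<epsilon> x ^ n"
  using eps_evt[of 1] by (induction n) (auto simp: eps_hom A_power evt_simps[OF hom] ev0_simps)

lemma eps_gens: "\<epsilon> (h a) = a" "\<epsilon> s = 0" "\<epsilon> \<theta> = \<eta>" "\<epsilon> t = 0" "\<epsilon> (ev p) = poly p 0"
  using eps_evt[of "[:[:[:a:]:]:]"] eps_evt[of pU] eps_evt[of pV] eps_evt[of pW] eps_evt[of "[:[:p:]:]"]
  by (simp_all add: evt_gens[OF hom] evt_gens[OF ringhom_id] evp_ident evp_const hom)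

lemma eta_nz: "\<eta> \<noteq> 0"
  using eta hp0 rNm(1) by (auto simp: zero_power)

text \<open>With \<open>I\<close> the ideal generated by the three local coordinates, the claim
  passes to products by \<open>P * Q - p * q = (P - p) * Q + (Q - q) * p\<close>, where p and q are
  the values at the point; so only constants and coordinates remain to be checked.\<close>

lemma taylor:
  assumes "x \<in> A"
  shows "\<exists>y1\<in>A. \<exists>y2\<in>A. \<exists>y3\<in>A. x = h (\<epsilon> x) + s * y1 + (\<theta> - h \<eta>) * y2 + t * y3"
proof -
  obtain P where P: "x = evt h s \<theta> t P" using assms by (auto simp: A_def)
  define I where "I = {s * y1 + (\<theta> - h \<eta>) * y2 + t * y3 | y1 y2 y3. y1 \<in> A \<and> y2 \<in> A \<and> y3 \<in> A}"
  have I: "s * y1 + (\<theta> - h \<eta>) * y2 + t * y3 \<in> I" if "y1 \<in> A" "y2 \<in> A" "y3 \<in> A" for y1 y2 y3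
    using that by (auto simp: I_def)
  have I_add: "x + y \<in> I" if "x \<in> I" "y \<in> I" for x y
  proof -
    from that(1) obtain y1 y2 y3 where x: "y1 \<in> A" "y2 \<in> A" "y3 \<in> A"
      "x = s * y1 + (\<theta> - h \<eta>) * y2 + t * y3" by (auto simp: I_def)
    from that(2) obtain z1 z2 z3 where y: "z1 \<in> A" "z2 \<in> A" "z3 \<in> A"
      "y = s * z1 + (\<theta> - h \<eta>) * z2 + t * z3" by (auto simp: I_def)
    have "x + y = s * (y1 + z1) + (\<theta> - h \<eta>) * (y2 + z2) + t * (y3 + z3)"
      unfolding x(4) y(4) by (simp add: algebra_simps)
    then show ?thesis using I x y A_closed(1) by simp
  qed
  have I_mult: "x * q \<in> I" if "x \<in> I" "q \<in> A" for x q
  proof -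
    from that(1) obtain y1 y2 y3 where x: "y1 \<in> A" "y2 \<in> A" "y3 \<in> A"
      "x = s * y1 + (\<theta> - h \<eta>) * y2 + t * y3" by (auto simp: I_def)
    have "x * q = s * (y1 * q) + (\<theta> - h \<eta>) * (y2 * q) + t * (y3 * q)"
      unfolding x(4) by (simp add: algebra_simps)
    then show ?thesis using I x that(2) A_closed(2) by simp
  qed
  have I0: "0 \<in> I" "s \<in> I" "\<theta> - h \<eta> \<in> I" "t \<in> I"
    using I[of 0 0 0] I[of 1 0 0] I[of 0 1 0] I[of 0 0 1] A_gens by simp_all
  have "evt h s \<theta> t P - h (ev0 P) \<in> I"
  proof (induction P rule: poly3_alg_induct)
    case (add P Q)
    have "evt h s \<theta> t (P + Q) - h (ev0 (P + Q)) =
      (evt h s \<theta> t P - h (ev0 P)) + (evt h s \<theta> t Q - h (ev0 Q))"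
      by (simp add: evt_simps[OF hom] ev0_simps ringhom_simps[OF hom])
    with I_add[OF add] show ?case by simp
  next
    case (mult P Q)
    have "evt h s \<theta> t (P * Q) - h (ev0 (P * Q)) =
      (evt h s \<theta> t P - h (ev0 P)) * evt h s \<theta> t Q + (evt h s \<theta> t Q - h (ev0 Q)) * h (ev0 P)"
      by (simp add: evt_simps[OF hom] ev0_simps ringhom_simps[OF hom] algebra_simps)
    moreover have "evt h s \<theta> t Q \<in> A" by (simp add: A_def)
    ultimately show ?case using I_add[OF I_mult[OF mult(1)] I_mult[OF mult(2)]] A_gens by simp
  qed (simp_all add: evt_gens[OF hom] evt_gens[OF ringhom_id] evp_const hom ringhom_id
      ringhom_simps[OF hom] I0)
  then obtain y1 y2 y3 where y: "y1 \<in> A" "y2 \<in> A" "y3 \<in> A"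
    "x - h (\<epsilon> x) = s * y1 + (\<theta> - h \<eta>) * y2 + t * y3" unfolding P eps_evt by (auto simp: I_def)
  have "x = h (\<epsilon> x) + s * y1 + (\<theta> - h \<eta>) * y2 + t * y3"
    using y(4)[symmetric] by (simp add: add.assoc)
  with y(1-3) show ?thesis by blast
qed

lemma of_nat_r_nz: "of_nat r \<noteq> (0::'a)"
  using charN rNm(2) by (metis mult_zero_right of_nat_mult)

text \<open>\<open>\<theta> - h \<eta>\<close> divides the difference of the \<open>r\<close>-th
  powers, which is the value of \<open>hp(s) - hp(0)\<close> and so a multiple of \<open>s\<close>.
  The cofactor has value \<open>r * \<eta> ^ (r - 1)\<close> at the point, nonzero because
  \<open>r\<close> divides \<open>N\<close>, which is invertible in k.\<close>

lemma theta_eta: "\<exists>c\<in>A. \<epsilon> c \<noteq> 0 \<and> (\<exists>y\<in>A. (\<theta> - h \<eta>) * c = s * y)"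
proof -
  define c where "c = (\<Sum>i<r. h \<eta> ^ (r - Suc i) * \<theta> ^ i)"
  have cA: "c \<in> A" unfolding c_def by (intro A_sum A_closed A_power A_gens)
  define C :: "'a poly poly poly" where "C = (\<Sum>i<r. [:[:[:\<eta>:]:]:] ^ (r - Suc i) * pV ^ i)"
  have "c = evt h s \<theta> t C" unfolding c_def C_def
    by (simp add: evt_simps[OF hom] evp_const hom del: mult_pCons_right mult_pCons_left)
  then have "\<epsilon> c = ev0 C" by (simp add: eps_evt)
  also have "\<dots> = (\<Sum>i<r. \<eta> ^ (r - 1))"
    unfolding C_def ev0_simps(7) by (intro sum.cong refl)
      (auto simp: ev0_simps evp_const ringhom_id simp flip: power_add simp del: mult_pCons_right mult_pCons_left)
  finally have ec: "\<epsilon> c \<noteq> 0" using of_nat_r_nz eta_nz by simp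
  obtain a q where hpq: "hp = pCons a q" by (cases hp)
  have "(\<theta> - h \<eta>) * c = \<theta> ^ r - h \<eta> ^ r"
    by (simp add: c_def power_diff_sumr2)
  also have "h \<eta> ^ r = h a" using eta by (simp add: hpq flip: ringhom_power[OF hom])
  finally have "(\<theta> - h \<eta>) * c = s * ev q"
    by (simp add: theta_r hpq evp_pCons hom)
  then show ?thesis using cA ec A_gens by blast
qed

sublocale local_data h L A \<epsilon> t
proof
  show "\<exists>x\<in>A. \<exists>y\<in>A. y \<noteq> 0 \<and> z = x / y" if "z \<in> L" for z
    using L_form[OF that] trans A_gens by metis
  \<comment> \<open>Locally \<open>t\<close> generates the ideal of the point:
    \<open>s * \<theta> ^ \<beta>\<close> is the power \<open>t ^ N'\<close>, and
    \<open>\<theta> - h \<eta>\<close> is a multiple of \<open>s\<close> up to the cofactor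
    \<open>c\<close>.\<close>
  show "\<exists>b\<in>A. \<epsilon> b \<noteq> 0 \<and> (\<forall>x\<in>A. \<epsilon> x = 0 \<longrightarrow> (\<exists>y\<in>A. x * b = t * y))"
  proof -
    obtain c y where c: "c \<in> A" "\<epsilon> c \<noteq> 0" "y \<in> A" "(\<theta> - h \<eta>) * c = s * y" using theta_eta by blast
    let ?b = "c * \<theta> ^ \<beta>"
    have sb: "s * \<theta> ^ \<beta> = t * t ^ (N' - 1)"
      using t_N rNm(4) by (metis mult.commute power_eq_if not_gr0)
    have b: "?b \<in> A" "\<epsilon> ?b \<noteq> 0"
      using c A_gens eta_nz by (auto simp: A_closed A_power eps_hom eps_power eps_gens)
    have "\<exists>z\<in>A. x * ?b = t * z" if xA: "x \<in> A" and x0: "\<epsilon> x = 0" for x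
    proof -
      obtain y1 y2 y3 where y': "y1 \<in> A" "y2 \<in> A" "y3 \<in> A" "x = s * y1 + (\<theta> - h \<eta>) * y2 + t * y3"
        using taylor[OF xA] by (auto simp: x0 ringhom_simps[OF hom])
      have "x * ?b = (s * \<theta> ^ \<beta>) * (y1 * c) + ((\<theta> - h \<eta>) * c) * (y2 * \<theta> ^ \<beta>) + t * (y3 * ?b)"
        unfolding y'(4) by (simp add: algebra_simps)
      also have "\<dots> = (s * \<theta> ^ \<beta>) * (y1 * c + y * y2) + t * (y3 * ?b)"
        unfolding c(4) by (simp add: algebra_simps)
      also have "\<dots> = t * (t ^ (N' - 1) * (y1 * c + y * y2) + y3 * ?b)"
        unfolding sb by (simp add: algebra_simps)
      finally have "x * ?b = t * (t ^ (N' - 1) * (y1 * c + y * y2) + y3 * ?b)" .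
      moreover have "t ^ (N' - 1) * (y1 * c + y * y2) + y3 * ?b \<in> A"
        by (intro A_closed A_power A_gens y' c)
      ultimately show ?thesis by blast
    qed
    with b show ?thesis by blast
  qed
  \<comment> \<open>\<open>inverse x\<close> has a denominator in k[s], so \<open>x\<close> divides
    a polynomial in \<open>s\<close>. Its factor \<open>s ^ j\<close> becomes
    \<open>t ^ (N' * j)\<close> after multiplication by \<open>\<theta> ^ (\<beta> * j)\<close>, and
    the remaining factor does not vanish at the point.\<close>
  show "\<exists>x'\<in>A. \<exists>j e. e \<in> A \<and> \<epsilon> e \<noteq> 0 \<and> x * x' = t ^ j * e" if x: "x \<in> A" "x \<noteq> 0" for x
  proof -
    have "inverse x \<in> L" using x A_L subfldD(5)[OF Lf] by blast
    then obtain y q where y: "y \<in> A" "q \<noteq> 0" "inverse x = y / ev q" using L_form by blast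
    have evq: "ev q \<noteq> 0" using trans y by blast
    have xy: "x * y = ev q" using y(3) x evq by (simp add: field_simps)
    obtain q1 where q1: "q = [:- 0, 1:] ^ Polynomial.order 0 q * q1" "\<not> [:- 0, 1:] dvd q1"
      using order_decomp[OF y(2)] by blast
    define j where "j = Polynomial.order 0 q"
    have evq1: "ev q = s ^ j * ev q1"
      by (subst q1(1)) (simp add: ringhom_simps(4)[OF ringhom_evp[OF hom]] ringhom_power[OF ringhom_evp[OF hom]]
          evp_X hom j_def del: mult_pCons_left)
    have "x * (y * \<theta> ^ (\<beta> * j)) = (x * y) * \<theta> ^ (\<beta> * j)" by simp
    also have "\<dots> = (\<theta> ^ \<beta> * s) ^ j * ev q1"
      unfolding xy evq1 by (simp add: power_mult_distrib power_mult)
    also have "\<dots> = t ^ (N' * j) * ev q1" by (simp add: t_N power_mult)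
    finally have "x * (y * \<theta> ^ (\<beta> * j)) = t ^ (N' * j) * ev q1" .
    moreover have "\<epsilon> (ev q1) \<noteq> 0" using q1(2) by (simp add: eps_gens poly_eq_0_iff_dvd)
    moreover have "y * \<theta> ^ (\<beta> * j) \<in> A" by (intro A_closed A_power A_gens y)
    ultimately show ?thesis using A_gens(5)[of q1] by blast
  qed
qed (use hom Lf A_L A_closed A_gens eps_hom eps_gens t_nz in auto)

lemma theta_unit: "\<theta> \<in> vunits P"
  using P_unit[of \<theta> 1] A_gens eps_gens eta_nz eps_more by simp

lemma s_eq: "s = t ^ N' * inverse (\<theta> ^ \<beta>)"
  using t_N theta_nz by (simp add: field_simps)

lemma w_eq: "w = t ^ m' * inverse (\<theta> ^ \<kappa>)"
  using t_m theta_nz by (simp add: field_simps)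

lemma s_maxid: "s \<in> maxid P"
  using P_nonunit[of s 1] A_gens eps_gens eps_more by simp

lemma theta_eta_maxid: "\<theta> - h \<eta> \<in> maxid P"
  using P_nonunit[of "\<theta> - h \<eta>" 1] A_gens eps_gens eps_more A_more by simp

end

section \<open>Counting the places above s = 0\<close>

context local_kummer
begin

definition above :: "'b set set" where
  "above = {Q. isplace (range h) L Q \<and> s \<in> maxid Q}"

lemma local_point: "\<eta> ^ r = poly hp 0 \<Longrightarrow> local_point h Ku L s w N m hp \<eta>"
  by unfold_locales (auto simp: r_def)

text \<open>\<open>\<theta>\<close> is integral because its \<open>r\<close>-th power is
  \<open>ev hp\<close>, and modulo the maximal ideal it is a root of \<open>X ^ r - hp(0)\<close>,
  hence congruent to a constant.\<close>

lemma above_point: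
  assumes "Q \<in> above"
  shows "\<exists>\<eta>. \<eta> ^ r = poly hp 0 \<and> \<theta> - h \<eta> \<in> maxid Q"
proof -
  interpret Q: valring "range h" L Q
    using assms Lf by unfold_locales (auto simp: above_def)
  have s: "s \<in> maxid Q" using assms by (simp add: above_def)
  have evQ: "ev p \<in> Q" for p using Q.k_P Q.maxid_P[OF s] by (intro Q.P_evp hom) auto
  have "\<theta> \<in> Q" using Q.integrally_closed[OF theta_L _ rNm(1)] theta_r evQ by simp
  obtain a q where q: "hp = pCons a q" by (cases hp)
  define F where "F = [:0, 1:] ^ r - [:poly hp 0:]"
  have F: "poly F \<eta> = \<eta> ^ r - poly hp 0" for \<eta> by (simp add: F_def)
  have "evp h \<theta> F = s * ev q"
    by (simp add: F_def ringhom_diff[OF ringhom_evp[OF hom]] ringhom_power[OF ringhom_evp[OF hom]]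
        evp_const evp_X hom theta_r) (simp add: q evp_pCons hom)
  then have F1: "evp h \<theta> F \<in> maxid Q" using Q.maxid_absorb[OF s evQ[of q]] by (simp add: mult.commute)
  have F2: "F \<noteq> 0"
  proof
    assume "F = 0"
    then have "poly ([:0, 1:] ^ r) x = poly [:poly hp 0:] x" for x by (simp add: F_def)
    from this[of 0] show False using hp0 rNm(1) by (simp add: zero_power)
  qed
  have "range h \<subseteq> Q" using Q.k_P by blast
  from Q.maxid_poly_root[OF hom this \<open>\<theta> \<in> Q\<close> F2 F1] show ?thesis
    by (metis F eq_iff_diff_eq_0)
qed

lemma point_unique:
  assumes "Q \<in> above" "\<theta> - h \<eta> \<in> maxid Q" "\<theta> - h \<eta>' \<in> maxid Q"
  shows "\<eta> = \<eta>'"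
proof (rule ccontr)
  interpret Q: valring "range h" L Q
    using assms(1) Lf by unfold_locales (auto simp: above_def)
  assume ne: "\<eta> \<noteq> \<eta>'"
  have "h (\<eta> - \<eta>') \<in> maxid Q"
    using Q.maxid_diff[OF assms(3,2)] by (simp add: ringhom_diff[OF hom])
  moreover have "h (inverse (\<eta> - \<eta>')) \<in> Q" by (rule Q.k_P) simp
  ultimately show False
    using ne by (auto simp: maxid_def ringhom_inverse[OF hom] ringhom_eq_0_iff[OF hom])
qed

text \<open>Ramification index \<open>N / gcd N m\<close>, the matching order of \<open>w\<close>,
  and residue field k.\<close>

definition good :: "'b set \<Rightarrow> bool" where
  "good Q \<longleftrightarrow> (\<exists>t e e'. dvr L Q t \<and> e \<in> vunits Q \<and> e' \<in> vunits Q \<and>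
     s = t ^ (N div gcd N m) * e \<and> w = t ^ (m div gcd N m) * e') \<and>
     (\<forall>z\<in>Q. \<exists>a. z - h a \<in> maxid Q)"

text \<open>The local ring at \<open>\<eta>\<close> is such a place. Any other one contains
  \<open>A\<close>, since \<open>t\<close> is integral by
  \<open>t ^ N' = \<theta> ^ \<beta> * s\<close>, and has the kernel of \<open>\<epsilon>\<close> in
  its maximal ideal by \<open>taylor\<close>; so \<open>P_unique\<close> applies.\<close>

lemma point_place:
  assumes "\<eta> ^ r = poly hp 0"
  shows "\<exists>P\<in>above. good P \<and> \<theta> - h \<eta> \<in> maxid P \<and> (\<forall>Q\<in>above. \<theta> - h \<eta> \<in> maxid Q \<longrightarrow> Q = P)"
proof -
  interpret lp: local_point h Ku L s w N m hp \<eta> by (rule local_point[OF assms])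
  have u: "inverse (\<theta> ^ k) \<in> vunits lp.P" for k
    by (intro lp.vunits_inverse lp.vunits_power lp.theta_unit)
  have "good lp.P"
    unfolding good_def
    using lp.dvr_P lp.residue_P u lp.s_eq lp.w_eq unfolding N'_def m'_def r_def by blast
  moreover have "lp.P \<in> above" using lp.isplace_P lp.s_maxid by (simp add: above_def)
  moreover have "Q = lp.P" if Q: "Q \<in> above" "\<theta> - h \<eta> \<in> maxid Q" for Q
  proof (rule lp.P_unique)
    show pl: "isplace (range h) L Q" using Q by (simp add: above_def)
    interpret Q: valring "range h" L Q using pl Lf by unfold_locales
    have s: "s \<in> maxid Q" using Q by (simp add: above_def)
    have th: "\<theta> \<in> Q" using Q.P_closed(2)[OF Q.maxid_P[OF Q(2)] Q.k_P[of "h \<eta>"]] by simp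
    have tN: "t ^ N' \<in> maxid Q" unfolding t_N by (intro Q.maxid_absorb s Q.P_more th)
    then have "t \<in> Q" using Q.integrally_closed[OF t_L _ rNm(4)] Q.maxid_P by blast
    with tN have t: "t \<in> maxid Q" using Q.maxid_power_iff rNm(4) by blast
    have "evt h s \<theta> t P \<in> Q" for P
      by (induction P rule: poly3_alg_induct)
        (auto simp: evt_simps[OF hom] evp_const hom Q.P_closed Q.k_P th Q.maxid_P s t)
    then show AQ: "x \<in> Q" if "x \<in> A" for x using that by (auto simp: A_def)
    show "x \<in> maxid Q" if xA: "x \<in> A" and x0: "lp.\<epsilon> x = 0" for x
    proof -
      obtain y1 y2 y3 where y: "y1 \<in> A" "y2 \<in> A" "y3 \<in> A" "x = y1 * s + y2 * (\<theta> - h \<eta>) + y3 * t"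
        using lp.taylor[OF xA] by (auto simp: x0 ringhom_simps[OF hom] mult.commute)
      show ?thesis unfolding y(4) using y AQ
        by (intro Q.maxid_add Q.maxid_absorb s t Q(2)) auto
    qed
  qed
  ultimately show ?thesis using lp.theta_eta_maxid by blast
qed

text \<open>The places correspond to the solutions of \<open>\<eta> ^ r = hp(0)\<close>. These form
  a coset of the \<open>r\<close>-th roots of unity, so there are exactly \<open>r\<close> of
  them.\<close>

theorem above_places: "finite above" "card above = gcd N m" "Q \<in> above \<Longrightarrow> good Q"
proof -
  define pt where "pt Q = (THE \<eta>. \<theta> - h \<eta> \<in> maxid Q)" for Q
  have pt: "pt Q = \<eta>" if "Q \<in> above" "\<theta> - h \<eta> \<in> maxid Q" for Q \<eta>
    unfolding pt_def by (rule the_equality) (use that point_unique in auto)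
  have "inj_on pt above"
  proof (rule inj_onI)
    fix Q Q' assume Q: "Q \<in> above" "Q' \<in> above" "pt Q = pt Q'"
    obtain \<eta> \<eta>' where e: "\<eta> ^ r = poly hp 0" "\<theta> - h \<eta> \<in> maxid Q" "\<theta> - h \<eta>' \<in> maxid Q'"
      using above_point Q by meson
    then have "\<eta> = \<eta>'" using pt Q by metis
    then show "Q = Q'" using point_place[OF e(1)] e Q by metis
  qed
  moreover have "pt ` above = {\<eta>. \<eta> ^ r = poly hp 0}"
  proof (intro equalityI subsetI)
    fix \<eta> assume "\<eta> \<in> pt ` above"
    then obtain Q where Q: "Q \<in> above" "\<eta> = pt Q" by blast
    then obtain \<eta>' where e: "\<eta>' ^ r = poly hp 0" "\<theta> - h \<eta>' \<in> maxid Q" using above_point by blast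
    show "\<eta> \<in> {\<eta>. \<eta> ^ r = poly hp 0}" using pt[OF Q(1) e(2)] Q(2) e(1) by simp
  next
    fix \<eta> assume "\<eta> \<in> {\<eta>. \<eta> ^ r = poly hp 0}"
    then obtain Q where Q: "Q \<in> above" "\<theta> - h \<eta> \<in> maxid Q" using point_place by blast
    show "\<eta> \<in> pt ` above" using pt[OF Q] Q(1) by blast
  qed
  ultimately have "bij_betw pt above {\<eta>. \<eta> ^ r = poly hp 0}" by (simp add: bij_betw_def)
  moreover have "finite {\<eta>. \<eta> ^ r = poly hp 0} \<and> card {\<eta>. \<eta> ^ r = poly hp 0} = r"
  proof -
    obtain \<eta>0 where e0: "\<eta>0 ^ r = poly hp 0" using nth_root_exists[OF rNm(1)] by blast
    have n0: "\<eta>0 \<noteq> 0" using e0 hp0 rNm(1) by (auto simp: zero_power)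
    have "{\<eta>. \<eta> ^ r = poly hp 0} = (\<lambda>z. \<eta>0 * z) ` roots1 r"
    proof (intro equalityI subsetI)
      fix \<eta> assume "\<eta> \<in> {\<eta>. \<eta> ^ r = poly hp 0}"
      then have "\<eta> / \<eta>0 \<in> roots1 r" "\<eta> = \<eta>0 * (\<eta> / \<eta>0)"
        using n0 e0 hp0 by (auto simp: roots1_def power_divide)
      then show "\<eta> \<in> (\<lambda>z. \<eta>0 * z) ` roots1 r" by blast
    qed (auto simp: roots1_def power_mult_distrib e0)
    moreover have "of_nat r \<noteq> (0::'a)"
      using charN rNm(2) by (metis mult_zero_right of_nat_mult)
    moreover have "inj_on (\<lambda>z. \<eta>0 * z) (roots1 r)" using n0 by (auto intro: inj_onI)
    ultimately show ?thesis
      using card_roots1[OF rNm(1), where 'a = 'a] finite_roots1[OF rNm(1), where 'a = 'a]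
      by (simp add: card_image)
  qed
  ultimately show "finite above" "card above = gcd N m"
    using bij_betw_finite[of pt above] bij_betw_same_card[of pt above] by (auto simp: r_def)
  show "good Q" if "Q \<in> above" using above_point[OF that] point_place that by blast
qed

end

section \<open>Discrete valuations\<close>

definition unif :: "'b::field set \<Rightarrow> 'b \<Rightarrow> bool" where
  "unif P t \<longleftrightarrow> t \<in> P \<and> maxid P = {t * a | a. a \<in> P}"

text \<open>The counterpart of \<open>valuation\<close>. Its value at 0 carries no meaning, which is
  why 0 is listed separately in the inequalities below.\<close>

definition val :: "'b::field set \<Rightarrow> 'b \<Rightarrow> int" where
  "val P z = (THE i. \<exists>t e. unif P t \<and> e \<in> vunits P \<and> z = t powi i * e)"

locale dval = valring +
  fixes t
  assumes dvr: "dvr L P t"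
begin

lemma t: "t \<in> maxid P" "t \<noteq> 0" "t \<in> P" "t \<in> L"
  using dvr maxid_P P_L by (auto simp: dvr_def)

lemma decomp: "z \<in> L \<Longrightarrow> z \<noteq> 0 \<Longrightarrow> \<exists>i::int. \<exists>e\<in>vunits P. z = t powi i * e"
  using dvr by (simp add: dvr_def)

lemma vunits_powi: "e \<in> vunits P \<Longrightarrow> e powi i \<in> vunits P"
  by (simp add: power_int_def vunits_power vunits_inverse)

lemma t_powi_in_P:
  assumes "e \<in> vunits P"
  shows "t powi i * e \<in> P \<longleftrightarrow> i \<ge> 0" "t powi i * e \<in> maxid P \<longleftrightarrow> i > 0"
proof -
  have e: "e \<in> P" "e \<noteq> 0" using assms by (auto simp: vunits_def)
  have pos: "t powi i * e \<in> maxid P" if "i > 0" for i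
  proof -
    have "e * t ^ nat i \<in> maxid P" using that by (intro maxid_absorb maxid_power t e) auto
    then show ?thesis using that by (simp add: power_int_def mult.commute)
  qed
  have zero: "t powi i * e \<in> vunits P" if "i = 0" using that assms by simp
  have neg: "t powi i * e \<notin> P" if "i < 0"
  proof
    assume *: "t powi i * e \<in> P"
    have "inverse e * t ^ nat (- i) \<in> maxid P"
      using that vunits_inverse[OF assms] by (intro maxid_absorb maxid_power t) (auto simp: vunits_def)
    then have "(t powi i * e) * (inverse e * t ^ nat (- i)) \<in> maxid P"
      by (rule maxid_absorb) (rule *)
    moreover have "(t powi i * e) * (inverse e * t ^ nat (- i)) = 1"
      using that e t by (simp add: power_int_def field_simps)
    ultimately show False using one_notin_maxid by simp
  qed
  have "(t powi i * e \<in> P \<longleftrightarrow> i \<ge> 0) \<and> (t powi i * e \<in> maxid P \<longleftrightarrow> i > 0)"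
  proof (cases i "0 :: int" rule: linorder_cases)
    case less
    then show ?thesis using neg maxid_P by auto
  next
    case equal
    then show ?thesis using zero maxid_not_unit by (auto simp: vunits_def maxid_def)
  next
    case greater
    then show ?thesis using pos maxid_P by auto
  qed
  then show "t powi i * e \<in> P \<longleftrightarrow> i \<ge> 0" "t powi i * e \<in> maxid P \<longleftrightarrow> i > 0" by auto
qed

lemma unif_t: "unif P t"
  unfolding unif_def
proof (intro conjI equalityI subsetI)
  fix z assume z: "z \<in> maxid P"
  show "z \<in> {t * a | a. a \<in> P}"
  proof (cases "z = 0")
    case True
    then show ?thesis using P_more(1) by force
  next
    case False
    have "z \<in> L" using z maxid_P P_L by blast
    then obtain i e where ie: "e \<in> vunits P" "z = t powi i * e" using decomp False by blast
    then have "i > 0" using t_powi_in_P z by simp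
    then have "t powi (i - 1) * e \<in> P" using t_powi_in_P ie by simp
    moreover have "z = t * (t powi (i - 1) * e)"
      using t by (simp add: ie power_int_diff)
    ultimately show ?thesis by blast
  qed
next
  fix z assume "z \<in> {t * a | a. a \<in> P}"
  then show "z \<in> maxid P" using maxid_absorb[OF t(1)] by (auto simp: mult.commute)
qed (rule t)

text \<open>Two uniformizers divide each other, so they differ by a unit and the exponent does not
  depend on the choice; this justifies the \<open>THE\<close>.\<close>

lemma val_eq:
  assumes e: "e \<in> vunits P"
  shows "val P (t powi i * e) = i"
  unfolding val_def
proof (rule the_equality)
  show "\<exists>t' e'. unif P t' \<and> e' \<in> vunits P \<and> t powi i * e = t' powi i * e'" using unif_t e by blast
  fix j assume "\<exists>t' e'. unif P t' \<and> e' \<in> vunits P \<and> t powi i * e = t' powi j * e'"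
  then obtain t' e' where *: "unif P t'" "e' \<in> vunits P" "t powi i * e = t' powi j * e'" by blast
  have "t' \<in> maxid P" using *(1) P_closed(1) unfolding unif_def by (metis (mono_tags, lifting) CollectI mult.right_neutral)
  then obtain a where a: "a \<in> P" "t' = t * a" using unif_t unfolding unif_def by blast
  obtain b where b: "b \<in> P" "t = t' * b" using t(1) *(1) unfolding unif_def by blast
  have "a * b = 1" using a b t by (metis mult.assoc mult_cancel_left1)
  then have u: "a \<in> vunits P" using a b by (auto simp: vunits_def dest: inverse_unique)
  have "t powi i * e = t powi j * (a powi j * e')"
    using *(3) a by (simp add: power_int_mult_distrib)
  moreover have "t powi (j - i) * (a powi j * e' * inverse e) = (t powi j * (a powi j * e')) / (t powi i * e)"
    using t(2) by (simp add: power_int_diff divide_inverse mult_ac)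
  moreover have "t powi i * e \<noteq> 0" using t(2) e by (simp add: vunits_def)
  ultimately have "t powi (j - i) * (a powi j * e' * inverse e) = 1" by simp
  moreover have "a powi j * e' * inverse e \<in> vunits P"
    by (intro vunits_mult vunits_powi u * vunits_inverse e)
  ultimately have "j - i \<ge> 0" "\<not> j - i > 0"
    using t_powi_in_P[of "a powi j * e' * inverse e" "j - i"] P_closed(1) one_notin_maxid by auto
  then show "j = i" by simp
qed

lemma val_decomp:
  assumes "z \<in> L" "z \<noteq> 0"
  shows "\<exists>e\<in>vunits P. z = t powi val P z * e"
  using decomp[OF assms] val_eq by metis

lemma val_unit: "e \<in> vunits P \<Longrightarrow> val P e = 0"
  using val_eq[of e 0] by simp

lemma val_mult:
  assumes "x \<in> L" "x \<noteq> 0" "y \<in> L" "y \<noteq> 0"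
  shows "val P (x * y) = val P x + val P y"
proof -
  obtain e e' where *: "e \<in> vunits P" "x = t powi val P x * e" "e' \<in> vunits P" "y = t powi val P y * e'"
    using val_decomp assms by meson
  have "x * y = t powi (val P x + val P y) * (e * e')"
    using t by (subst *(2), subst *(4)) (simp add: power_int_add)
  then show ?thesis using val_eq vunits_mult * by metis
qed

lemma val_inverse:
  assumes "x \<in> L" "x \<noteq> 0"
  shows "val P (inverse x) = - val P x"
proof -
  have "inverse x \<in> L" using assms subfldD(5)[OF Lf] by blast
  then have "val P (x * inverse x) = val P x + val P (inverse x)" using assms by (intro val_mult) auto
  moreover have "val P (x * inverse x) = 0" using assms val_unit[OF vunits_one] by simp
  ultimately show ?thesis by simp
qed

lemma val_divide:
  assumes "x \<in> L" "x \<noteq> 0" "y \<in> L" "y \<noteq> 0"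
  shows "val P (x / y) = val P x - val P y"
  using val_mult[of x "inverse y"] val_inverse[of y] assms subfldD(5)[OF Lf] by (simp add: divide_inverse)

lemma val_power: "x \<in> L \<Longrightarrow> x \<noteq> 0 \<Longrightarrow> val P (x ^ n) = int n * val P x"
  using val_unit[OF vunits_one]
  by (induction n) (auto simp: val_mult subfld_more[OF Lf] algebra_simps)

lemma val_nonneg_iff: "z \<in> L \<Longrightarrow> z \<noteq> 0 \<Longrightarrow> val P z \<ge> 0 \<longleftrightarrow> z \<in> P"
  using val_decomp[of z] t_powi_in_P(1) by metis

lemma val_pos_iff: "z \<in> L \<Longrightarrow> z \<noteq> 0 \<Longrightarrow> val P z > 0 \<longleftrightarrow> z \<in> maxid P"
  using val_decomp[of z] t_powi_in_P(2) by metis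

text \<open>The inequality, together with the exception for 0, becomes membership in the ring; the
  ultrametric inequality is then closure under addition.\<close>

lemma val_ge_iff:
  assumes "z \<in> L"
  shows "z = 0 \<or> val P z \<ge> i \<longleftrightarrow> z * t powi (- i) \<in> P"
proof (cases "z = 0")
  case False
  have tp: "t powi (- i) \<in> L" "t powi (- i) \<noteq> 0" using t subfld_more(5)[OF Lf] by auto
  have "val P (t powi (- i)) = - i" using val_eq[OF vunits_one, of "- i"] by simp
  then have "val P (z * t powi (- i)) = val P z - i" using val_mult[OF assms False tp] by simp
  then show ?thesis using val_nonneg_iff[of "z * t powi (- i)"] False tp assms
    by (auto simp: subfldD(3)[OF Lf])
qed (use P_more(1) in simp)

lemma val_ge_add:
  assumes "x \<in> L" "y \<in> L" "x = 0 \<or> val P x \<ge> i" "y = 0 \<or> val P y \<ge> i"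
  shows "x + y = 0 \<or> val P (x + y) \<ge> i"
  using assms val_ge_iff[of x i] val_ge_iff[of y i] val_ge_iff[of "x + y" i]
    P_closed(2)[of "x * t powi (- i)" "y * t powi (- i)"]
  by (simp add: subfldD(2)[OF Lf] distrib_right)

end

section \<open>Places of the Kummer extension\<close>

lemma evp_reflect:
  fixes h :: "'a::field \<Rightarrow> 'b::field"
  assumes "ringhom h" "x \<noteq> 0"
  shows "evp h (inverse x) (reflect_poly p) = inverse x ^ Polynomial.degree p * evp h x p"
proof -
  have c: "Polynomial.coeff (map_poly h p) i = h (Polynomial.coeff p i)" for i and p :: "'a poly"
    using assms by (simp add: coeff_map_poly ringhom_simps)
  have d: "Polynomial.degree (map_poly h p) = Polynomial.degree p" for p :: "'a poly"
    by (rule degree_map_poly) (simp add: ringhom_eq_0_iff assms)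
  have "map_poly h (reflect_poly p) = reflect_poly (map_poly h p)"
    by (rule poly_eqI) (simp add: c coeff_reflect_poly d ringhom_simps[OF assms(1)])
  then show ?thesis
    using poly_reflect_poly_nz[of "inverse x" "map_poly h p"] assms(2) by (simp add: evp_def d)
qed

context kummer
begin

lemma indep_scale:
  assumes c: "c \<in> Ku" "c \<noteq> 0"
  shows "indep_over Ku (w * c) N"
  unfolding indep_over_def
proof (intro allI impI)
  fix a j assume a: "\<forall>j<N. a j \<in> Ku" "(\<Sum>j<N. a j * (w * c) ^ j) = 0" and j: "j < N"
  have "a j * c ^ j = 0"
    by (rule indep_overD[OF indep_Ku, of "\<lambda>j. a j * c ^ j"])
      (use a c j Ku_closed(3,9) in \<open>auto simp: power_mult_distrib mult_ac\<close>)
  with c show "a j = 0" by simp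
qed

lemma span_scale:
  assumes c: "c \<in> Ku" "c \<noteq> 0" and z: "z \<in> L"
  shows "\<exists>a. (\<forall>j. a j \<in> Ku) \<and> z = (\<Sum>j<N. a j * (w * c) ^ j)"
proof -
  obtain a where a: "z = lin a" "\<And>j. a j \<in> Ku" using z by (elim L_E) blast
  have "z = (\<Sum>j<N. (a j / c ^ j) * (w * c) ^ j)"
    unfolding a lin_def using c by (intro sum.cong) (auto simp: power_mult_distrib)
  moreover have "\<forall>j. a j / c ^ j \<in> Ku" using a c Ku_closed by simp
  ultimately show ?thesis by (intro exI[of _ "\<lambda>j. a j / c ^ j"]) blast
qed

text \<open>\<open>frac\<close> covers both uses: for \<open>s = u - h a\<close> no denominator
  occurs, and for \<open>s = inverse u\<close> a polynomial in u is its reversal in \<open>s\<close>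
  divided by a power of \<open>s\<close>.\<close>

lemma local_kummerI:
  assumes s: "s \<in> Ku" and c: "c \<in> Ku" "c \<noteq> 0" and m: "m > 0"
    and frac: "\<And>p. \<exists>p' k. ev p = evp h s p' / s ^ k"
    and trans: "\<And>p. evp h s p = 0 \<Longrightarrow> p = 0"
    and eq: "(w * c) ^ N = s ^ m * evp h s hp" and hp: "poly hp 0 \<noteq> 0"
  shows "local_kummer h Ku L s (w * c) N m hp"
proof
  have snz: "s \<noteq> 0" using trans[of "[:0, 1:]"] by (auto simp: evp_X hom)
  show "\<exists>p q. q \<noteq> 0 \<and> z = evp h s p / evp h s q" if "z \<in> Ku" for z
  proof -
    from that obtain p q where z: "z = ev p / ev q" "q \<noteq> 0" by (auto simp: Ku_def)
    obtain p' k q' l where *: "ev p = evp h s p' / s ^ k" "ev q = evp h s q' / s ^ l"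
      using frac by meson
    have sX: "s ^ k = evp h s ([:0, 1:] ^ k)" for k
      by (simp add: ringhom_power[OF ringhom_evp[OF hom]] evp_X hom)
    have "ev q \<noteq> 0" using z ev_eq_0_iff by simp
    then have "q' \<noteq> 0" using * by auto
    then have "q' * [:0, 1:] ^ k \<noteq> 0" by simp
    moreover have "z = evp h s (p' * [:0, 1:] ^ l) / evp h s (q' * [:0, 1:] ^ k)"
      unfolding z(1) * ringhom_simps(4)[OF ringhom_evp[OF hom]] sX[symmetric]
      using snz by (simp add: field_simps)
    ultimately show ?thesis by blast
  qed
  show "w * c \<in> L" using L_mult[OF w_L Ku_L[OF c(1)]] .
  show "\<exists>a. (\<forall>j. a j \<in> Ku) \<and> z = (\<Sum>j<N. a j * (w * c) ^ j)" if "z \<in> L" for z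
    using span_scale c that by blast
qed (use hom N0 m charN subfld_Ku subfld_L Ku_L h_Ku s trans eq hp indep_scale c in auto)

section \<open>Places over the finite points and over infinity\<close>

definition places :: "'b set set" where "places = {P. isplace (range h) L P}"

definition pfin :: "'a \<Rightarrow> 'b set set" where "pfin a = {P \<in> places. u - h a \<in> maxid P}"

definition pinf :: "'b set set" where "pinf = {P \<in> places. inverse u \<in> maxid P}"

lemma valring_places: "P \<in> places \<Longrightarrow> valring (range h) L P"
  by (simp add: places_def valring_def subfld_L)

lemma u_nz: "u \<noteq> 0"
  using ev_eq_0_iff[of "[:0, 1:]"] by (auto simp: evp_X hom)

lemma ua_nz: "u - h a \<noteq> 0"
  using ev_eq_0_iff[of "[:- a, 1:]"] by (auto simp: evp_pCons hom h_simps)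

lemma ua: "u - h a \<in> Ku" "u - h a \<in> L"
  using Ku_closed(7)[OF u_Ku h_Ku] Ku_L by auto

text \<open>\<open>w\<close> is multiplied by \<open>u - h a\<close> so that the exponent is
  positive also where \<open>f\<close> does not vanish. Branch points and ordinary points are then
  treated alike, and the gcd of the exponent with \<open>N\<close> is unchanged.\<close>

lemma local_fin:
  defines "q a \<equiv> f div [:- a, 1:] ^ Polynomial.order a f"
  shows "local_kummer h Ku L (u - h a) (w * (u - h a)) N (Polynomial.order a f + N) (pcompose (q a) [:a, 1:])"
proof (rule local_kummerI)
  let ?s = "u - h a"
  have sev: "?s = ev [:- a, 1:]" by (simp add: evp_pCons hom h_simps)
  have uev: "evp h ?s [:a, 1:] = u" by (simp add: evp_pCons hom h_simps)
  show "?s \<in> Ku" "?s \<in> Ku" "?s \<noteq> 0" using ua ua_nz by auto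
  show "Polynomial.order a f + N > 0" using N0 by simp
  show "\<exists>p' k. ev p = evp h ?s p' / ?s ^ k" for p
    by (rule exI[of _ "pcompose p [:a, 1:]"], rule exI[of _ 0]) (simp add: evp_pcompose hom uev)
  show "p = 0" if "evp h ?s p = 0" for p
  proof -
    have "ev (pcompose p [:- a, 1:]) = 0" using that by (simp add: evp_pcompose hom flip: sev)
    then have "pcompose p [:- a, 1:] = 0" by (simp add: ev_eq_0_iff)
    then show ?thesis by (rule pcompose_eq_0) simp
  qed
  have fq: "f = [:- a, 1:] ^ Polynomial.order a f * q a"
    unfolding q_def by (simp add: order_1)
  have "ev f = ?s ^ Polynomial.order a f * ev (q a)"
    by (subst fq) (simp add: ev_simps sev del: mult_pCons_left)
  then show "(w * ?s) ^ N = ?s ^ (Polynomial.order a f + N) * evp h ?s (pcompose (q a) [:a, 1:])"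
    by (simp add: evp_pcompose hom uev power_mult_distrib wN power_add)
  have "\<not> [:- a, 1:] dvd q a"
  proof
    assume "[:- a, 1:] dvd q a"
    then have "[:- a, 1:] ^ Polynomial.order a f * [:- a, 1:] dvd f"
      by (subst (2) fq) (rule mult_dvd_mono[OF dvd_refl])
    then show False using order[OF f0, of a] by (simp add: mult.commute)
  qed
  then show "poly (pcompose (q a) [:a, 1:]) 0 \<noteq> 0"
    by (simp add: poly_pcompose poly_eq_0_iff_dvd)
qed

abbreviation "M \<equiv> Polynomial.degree f"

text \<open>On the line, \<open>f(u)\<close> has a pole of order \<open>M\<close> at infinity. The
  factor \<open>inverse u ^ (M + 1)\<close> turns it into a zero of order
  \<open>(M + 1) * N - M\<close>; the exponent \<open>M\<close> alone would not suffice for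
  \<open>N = 1\<close>.\<close>

lemma local_inf:
  "local_kummer h Ku L (inverse u) (w * inverse u ^ (M + 1)) N ((M + 1) * N - M) (reflect_poly f)"
proof (rule local_kummerI)
  let ?s = "inverse u"
  show "?s \<in> Ku" "?s ^ (M + 1) \<in> Ku" "?s ^ (M + 1) \<noteq> 0"
    using u_Ku Ku_closed u_nz by auto
  have MN: "M < (M + 1) * N" using N0 by (cases N) auto
  then show "(M + 1) * N - M > 0" by simp
  show "\<exists>p' k. ev p = evp h ?s p' / ?s ^ k" for p
    by (rule exI[of _ "reflect_poly p"], rule exI[of _ "Polynomial.degree p"])
      (use u_nz in \<open>simp add: evp_reflect hom\<close>)
  show "p = 0" if "evp h ?s p = 0" for p
  proof -
    have "ev (reflect_poly p) = 0" using evp_reflect[OF hom, of "inverse u" p] that u_nz by simp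
    then show ?thesis by (simp add: ev_eq_0_iff)
  qed
  have "?s ^ ((M + 1) * N) = ?s ^ ((M + 1) * N - M) * ?s ^ M"
    using MN by (simp flip: power_add)
  moreover have "(w * ?s ^ (M + 1)) ^ N = w ^ N * ?s ^ ((M + 1) * N)"
    by (simp only: power_mult_distrib power_mult)
  ultimately show "(w * ?s ^ (M + 1)) ^ N = ?s ^ ((M + 1) * N - M) * evp h ?s (reflect_poly f)"
    by (simp only: evp_reflect[OF hom u_nz] wN mult_ac)
  show "poly (reflect_poly f) 0 \<noteq> 0" using f0 by simp
qed

lemma gcd_inf: "gcd N ((M + 1) * N - M) = gcd N M"
proof -
  have "M \<le> (M + 1) * N" using N0 by (cases N) auto
  then have "[M + ((M + 1) * N - M) = 0] (mod N)" by (simp add: cong_def)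
  then have "k dvd N \<Longrightarrow> k dvd (M + 1) * N - M \<longleftrightarrow> k dvd M" for k
    by (metis \<open>M \<le> (M + 1) * N\<close> dvd_diff_nat dvd_mult diff_diff_cancel)
  then show ?thesis by (intro dvd_antisym) (auto intro!: gcd_greatest)
qed

lemma pfin_above: "pfin a = local_kummer.above h L (u - h a)"
  using local_kummer.above_def[OF local_fin] by (auto simp: pfin_def places_def)

lemma pinf_above: "pinf = local_kummer.above h L (inverse u)"
  using local_kummer.above_def[OF local_inf] by (auto simp: pinf_def places_def)

lemma pfin_card: "finite (pfin a)" "card (pfin a) = gcd N (Polynomial.order a f)"
  using local_kummer.above_places(1,2)[OF local_fin, of a]
  by (simp_all add: pfin_above add.commute[of _ N])

lemma pinf_card: "finite pinf" "card pinf = gcd N M"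
  using local_kummer.above_places(1,2)[OF local_inf] gcd_inf by (simp_all add: pinf_above)

text \<open>If \<open>u\<close> lies in \<open>P\<close> but is congruent to no constant, every
  nonzero polynomial in \<open>u\<close> is a unit by \<open>maxid_poly_root\<close>. Then
  \<open>P\<close> contains k(u), and also \<open>w\<close>, which is integral over it, so
  \<open>P\<close> would be all of \<open>L\<close>.\<close>

lemma places_cases:
  assumes "P \<in> places"
  shows "P \<in> pinf \<or> (\<exists>a. P \<in> pfin a)"
proof -
  interpret valring "range h" L P by (rule valring_places[OF assms])
  have hP: "range h \<subseteq> P" using k_P by blast
  show ?thesis
  proof (cases "u \<in> P")
    case False
    then show ?thesis using notin_maxid_inverse[OF Ku_L[OF u_Ku]] assms by (simp add: pinf_def)
  next
    case True
    show ?thesis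
    proof (rule ccontr)
      assume n: "\<not> ?thesis"
      have evP: "ev p \<in> P" for p by (rule P_evp[OF hom hP True])
      have "inverse (ev q) \<in> P" if "q \<noteq> 0" for q
      proof (rule ccontr)
        assume "inverse (ev q) \<notin> P"
        then have "ev q \<in> maxid P" using evP by (simp add: maxid_def)
        then show False using maxid_poly_root[OF hom hP True that] n assms by (auto simp: pfin_def)
      qed
      then have KuP: "Ku \<subseteq> P" using evP P_closed(3) by (auto simp: Ku_def divide_inverse)
      have "w \<in> P" using integrally_closed[OF w_L _ N0] evP wN by simp
      have "L \<subseteq> P"
      proof
        fix z assume "z \<in> L"
        then obtain a where a: "z = lin a" "\<And>j. a j \<in> Ku" by (elim L_E) blast
        show "z \<in> P" unfolding a(1) lin_def
          by (rule P_sum) (use a(2) KuP \<open>w \<in> P\<close> in \<open>auto intro!: P_closed P_more\<close>)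
      qed
      then show False using P_L P_ne by blast
    qed
  qed
qed

lemma place_dval:
  assumes "P \<in> places"
  shows "\<exists>t. dval (range h) L P t"
    and "z \<in> P \<Longrightarrow> \<exists>a. z - h a \<in> maxid P"
proof -
  have "(\<exists>t. dvr L P t) \<and> (\<forall>z\<in>P. \<exists>a. z - h a \<in> maxid P)"
    using places_cases[OF assms]
  proof
    assume "P \<in> pinf"
    then have "local_kummer.good h L (inverse u) (w * inverse u ^ (M + 1)) N ((M + 1) * N - M) P"
      unfolding pinf_above by (rule local_kummer.above_places(3)[OF local_inf])
    then show ?thesis unfolding local_kummer.good_def[OF local_inf] by blast
  next
    assume "\<exists>a. P \<in> pfin a"
    then obtain a where "P \<in> pfin a" by blast
    then have "local_kummer.good h L (u - h a) (w * (u - h a)) N (Polynomial.order a f + N) P"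
      unfolding pfin_above by (rule local_kummer.above_places(3)[OF local_fin])
    then show ?thesis unfolding local_kummer.good_def[OF local_fin] by blast
  qed
  then show "\<exists>t. dval (range h) L P t" "z \<in> P \<Longrightarrow> \<exists>a. z - h a \<in> maxid P"
    using valring_places[OF assms] by (auto simp: dval_def dval_axioms_def)
qed

text \<open>Let m be the order of \<open>f\<close> at \<open>a\<close> and g its gcd with
  \<open>N\<close>. The local analysis yields the order \<open>(m + N) / g\<close> of
  \<open>w * (u - h a)\<close>; subtracting the order \<open>N / g\<close> of \<open>u - h a\<close>
  leaves \<open>m / g\<close>.\<close>

lemma w_fin:
  assumes "P \<in> pfin a"
  shows "val P (u - h a) = int (N div gcd N (Polynomial.order a f))"
    and "val P w = int (Polynomial.order a f div gcd N (Polynomial.order a f))"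
proof -
  let ?s = "u - h a" and ?m = "Polynomial.order a f"
  define g where "g = gcd N ?m"
  have gm: "gcd N (?m + N) = g" by (simp add: g_def add.commute[of _ N])
  have "local_kummer.good h L ?s (w * ?s) N (?m + N) P"
    using assms unfolding pfin_above by (rule local_kummer.above_places(3)[OF local_fin])
  then obtain t e e' where tt: "dvr L P t" "e \<in> vunits P" "e' \<in> vunits P"
     "?s = t ^ (N div g) * e" "w * ?s = t ^ ((?m + N) div g) * e'"
    unfolding local_kummer.good_def[OF local_fin] gm by blast
  have P: "P \<in> places" using assms by (simp add: pfin_def)
  interpret dval "range h" L P t
    using valring_places[OF P] tt(1) by (simp add: dval_def dval_axioms_def)
  show 1: "val P ?s = int (N div gcd N ?m)"
    using val_eq[OF tt(2), of "int (N div g)"] tt(4) by (simp add: g_def)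
  have "val P (w * ?s) = int ((?m + N) div g)"
    using val_eq[OF tt(3), of "int ((?m + N) div g)"] tt(5) by simp
  moreover have "val P (w * ?s) = val P w + val P ?s"
    using val_mult w_L w_nz ua ua_nz by blast
  moreover have "(?m + N) div g = ?m div g + N div g" by (simp add: g_def)
  ultimately show "val P w = int (?m div gcd N ?m)" using 1 by (simp add: g_def)
qed

lemma w_inf:
  assumes "P \<in> pinf"
  shows "val P u = - int (N div gcd N M)" and "val P w = - int (M div gcd N M)"
proof -
  let ?s = "inverse u"
  define g where "g = gcd N M"
  have "local_kummer.good h L ?s (w * ?s ^ (M + 1)) N ((M + 1) * N - M) P"
    using assms unfolding pinf_above by (rule local_kummer.above_places(3)[OF local_inf])
  then obtain t e e' where tt: "dvr L P t" "e \<in> vunits P" "e' \<in> vunits P"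
     "?s = t ^ (N div g) * e" "w * ?s ^ (M + 1) = t ^ (((M + 1) * N - M) div g) * e'"
    unfolding local_kummer.good_def[OF local_inf] g_def gcd_inf by blast
  have P: "P \<in> places" using assms by (simp add: pinf_def)
  interpret dval "range h" L P t
    using valring_places[OF P] tt(1) by (simp add: dval_def dval_axioms_def)
  have uL: "u \<in> L" "?s \<in> L" "?s \<noteq> 0" using Ku_L u_Ku Ku_closed(5) u_nz by auto
  have 1: "val P ?s = int (N div g)"
    using val_eq[OF tt(2), of "int (N div g)"] tt(4) by simp
  then show 2: "val P u = - int (N div gcd N M)"
    using val_inverse[OF uL(1) u_nz] by (simp add: g_def)
  have "val P (w * ?s ^ (M + 1)) = int (((M + 1) * N - M) div g)"
    using val_eq[OF tt(3), of "int (((M + 1) * N - M) div g)"] tt(5) by simp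
  moreover have "val P (w * ?s ^ (M + 1)) = val P w + int (M + 1) * val P ?s"
    using val_mult[OF w_L w_nz, of "?s ^ (M + 1)"] val_power[OF uL(2,3), of "M + 1"] uL L_closed(9)
    by (simp del: power_Suc)
  moreover have "int (((M + 1) * N - M) div g) = int (M + 1) * int (N div g) - int (M div g)"
  proof -
    obtain n m where nm: "N = g * n" "M = g * m" unfolding g_def by (metis dvdE gcd_dvd1 gcd_dvd2)
    have g0: "g > 0" using N0 by (simp add: g_def)
    have "M \<le> (M + 1) * N" using N0 by (cases N) auto
    then have "g * m \<le> g * ((M + 1) * n)" using nm by (metis mult.assoc mult.commute)
    then have le: "m \<le> (M + 1) * n" using g0 by simp
    have "(M + 1) * N - M = g * ((M + 1) * n - m)"
      by (metis nm diff_mult_distrib2 mult.assoc mult.commute)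
    then have "((M + 1) * N - M) div g = (M + 1) * n - m" using g0 by simp
    moreover have "N div g = n" "M div g = m" using nm g0 by (metis nonzero_mult_div_cancel_left less_irrefl)+
    ultimately show ?thesis using le by (simp add: of_nat_diff algebra_simps)
  qed
  ultimately show "val P w = - int (M div gcd N M)" using 1 by (simp add: g_def)
qed

text \<open>What remains of \<open>q\<close> after removing its zeros at \<open>a\<close> is a unit:
  otherwise \<open>u\<close> would be congruent to some root \<open>b\<close> of it, and
  \<open>b = a\<close> since \<open>u\<close> has only one residue.\<close>

lemma ev_fin:
  assumes "P \<in> pfin a" "q \<noteq> 0"
  shows "val P (ev q) = int (Polynomial.order a q) * val P (u - h a)"
proof -
  have P: "P \<in> places" and sm: "u - h a \<in> maxid P" using assms by (auto simp: pfin_def)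
  obtain t where "dval (range h) L P t" using place_dval[OF P] by blast
  then interpret dval "range h" L P t .
  have hP: "range h \<subseteq> P" using k_P by blast
  have uP: "u \<in> P" using P_closed(2)[OF maxid_P[OF sm] k_P[of "h a"]] by simp
  obtain r where r: "q = [:- a, 1:] ^ Polynomial.order a q * r" "\<not> [:- a, 1:] dvd r"
    using order_decomp[OF assms(2)] by blast
  have "r \<noteq> 0" using r by auto
  have "ev r \<notin> maxid P"
  proof
    assume "ev r \<in> maxid P"
    then obtain b where b: "poly r b = 0" "u - h b \<in> maxid P"
      using maxid_poly_root[OF hom hP uP \<open>r \<noteq> 0\<close>] by blast
    have "h (b - a) \<in> maxid P" using maxid_diff[OF sm b(2)] by (simp add: h_simps)
    moreover have "h (inverse (b - a)) \<in> P" using hP by blast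
    ultimately have "b = a" by (auto simp: maxid_def h_simps ringhom_eq_iff[OF hom])
    with b r show False by (simp add: poly_eq_0_iff_dvd)
  qed
  then have "ev r \<in> vunits P" using maxid_or_unit P_evp[OF hom hP uP] by blast
  then have v: "val P (ev r) = 0" by (rule val_unit)
  have "ev q = (u - h a) ^ Polynomial.order a q * ev r"
    by (subst r(1)) (simp add: ev_simps evp_pCons hom h_simps del: mult_pCons_left)
  then show ?thesis
    using val_mult[of "(u - h a) ^ Polynomial.order a q" "ev r"] val_power[of "u - h a"] ua ua_nz
      L_closed(9) \<open>r \<noteq> 0\<close> Ku_L[OF ev_Ku] v by (simp add: ev_eq_0_iff)
qed

text \<open>The reversed polynomial, taken at \<open>inverse u\<close>, has a nonzero constant term
  and is therefore a unit at infinity.\<close>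

lemma ev_inf:
  assumes "P \<in> pinf" "q \<noteq> 0"
  shows "val P (ev q) = int (Polynomial.degree q) * val P u"
proof -
  have P: "P \<in> places" and sm: "inverse u \<in> maxid P" using assms by (auto simp: pinf_def)
  obtain t where "dval (range h) L P t" using place_dval[OF P] by blast
  then interpret dval "range h" L P t .
  have hP: "range h \<subseteq> P" using k_P by blast
  let ?r = "reflect_poly q"
  have "evp h (inverse u) ?r \<notin> maxid P"
  proof
    assume "evp h (inverse u) ?r \<in> maxid P"
    then obtain b where b: "poly ?r b = 0" "inverse u - h b \<in> maxid P"
      using maxid_poly_root[OF hom hP maxid_P[OF sm], of ?r] assms(2) by auto
    have "h b \<in> maxid P" using maxid_diff[OF sm b(2)] by simp
    moreover have "h (inverse b) \<in> P" using hP by blast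
    ultimately have "b = 0" by (auto simp: maxid_def h_simps)
    with b assms(2) show False by simp
  qed
  then have U: "evp h (inverse u) ?r \<in> vunits P" using maxid_or_unit P_evp[OF hom hP maxid_P[OF sm]] by blast
  then have v: "val P (evp h (inverse u) ?r) = 0" by (rule val_unit)
  have "ev q = u ^ Polynomial.degree q * evp h (inverse u) ?r"
    using u_nz by (simp add: evp_reflect[OF hom] flip: mult.assoc power_mult_distrib)
  moreover have "evp h (inverse u) ?r \<in> L" "evp h (inverse u) ?r \<noteq> 0"
    using U P_L by (auto simp: vunits_def)
  ultimately show ?thesis
    using val_mult[of "u ^ Polynomial.degree q" "evp h (inverse u) ?r"] val_power[of u] Ku_L[OF u_Ku] u_nz
      L_closed(9) v by simp
qed

end

section \<open>Dimensions over the constants\<close>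

locale hspace =
  fixes h :: "'a::field \<Rightarrow> 'b::field"
  assumes hhom: "ringhom h"
begin

sublocale vs: vector_space "\<lambda>a x. h a * x"
  by unfold_locales (simp_all add: ringhom_simps[OF hhom] algebra_simps)

text \<open>The finite basis is part of the claim, so that a dimension is never a default value of
  the cardinality of an infinite set.\<close>

definition hasdim :: "'b set \<Rightarrow> nat \<Rightarrow> bool" where
  "hasdim V n \<longleftrightarrow> (\<exists>B. finite B \<and> vs.independent B \<and> vs.span B = V \<and> card B = n)"

lemma hasdim_subspace:
  assumes V: "vs.subspace V" "V \<subseteq> W" and W: "hasdim W n"
  shows "\<exists>m. hasdim V m"
proof -
  obtain B where B: "finite B" "vs.independent B" "vs.span B = W" "card B = n"
    using W by (auto simp: hasdim_def)
  obtain C where C: "C \<subseteq> V" "vs.independent C" "V \<subseteq> vs.span C"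
    using vs.maximal_independent_subset by blast
  have "C \<subseteq> vs.span B" using C V B by blast
  then have "finite C" using vs.independent_span_bound[OF B(1) C(2)] by blast
  moreover have "vs.span C = V" using C V(1) vs.span_minimal by blast
  ultimately show ?thesis using C by (auto simp: hasdim_def)
qed

lemma hasdim_step:
  assumes W: "hasdim W n" and V: "hasdim V m" and x: "\<And>z. z \<in> W \<Longrightarrow> \<exists>a. z - h a * x \<in> V"
  shows "n \<le> m + 1"
proof -
  obtain B where B: "finite B" "vs.independent B" "vs.span B = W" "card B = n"
    using W by (auto simp: hasdim_def)
  obtain C where C: "finite C" "vs.independent C" "vs.span C = V" "card C = m"
    using V by (auto simp: hasdim_def)
  have "B \<subseteq> vs.span (insert x C)"
  proof
    fix z assume "z \<in> B"
    then have "z \<in> W" using B vs.span_base by blast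
    then obtain a where "z - h a * x \<in> vs.span C" using x C by blast
    then show "z \<in> vs.span (insert x C)" using vs.span_insert by blast
  qed
  then have "card B \<le> card (insert x C)"
    using vs.independent_span_bound[of "insert x C" B] B C by blast
  also have "\<dots> \<le> m + 1" using C by (simp add: card_insert_if)
  finally show ?thesis using B by simp
qed

lemma hasdim_family:
  assumes I: "finite I"
    and ind: "\<And>c. (\<Sum>i\<in>I. h (c i) * b i) = 0 \<Longrightarrow> \<forall>i\<in>I. c i = 0"
    and V: "V = {\<Sum>i\<in>I. h (c i) * b i | c. True}"
  shows "hasdim V (card I)"
proof -
  have inj: "inj_on b I"
  proof (rule inj_onI, rule ccontr)
    fix i j assume ij: "i \<in> I" "j \<in> I" "b i = b j" "i \<noteq> j"
    define c where "c k = (if k = i then 1 else if k = j then - 1 else (0::'a))" for k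
    have "(\<Sum>k\<in>I. h (c k) * b k) = (\<Sum>k\<in>{i, j}. h (c k) * b k)"
      by (rule sum.mono_neutral_right) (use ij I in \<open>auto simp: c_def ringhom_simps[OF hhom]\<close>)
    also have "\<dots> = 0" using ij by (simp add: c_def ringhom_simps[OF hhom] ringhom_uminus[OF hhom])
    finally have "c i = 0" using ind ij by blast
    then show False by (simp add: c_def)
  qed
  have sum: "(\<Sum>v\<in>b ` I. h (c v) * v) = (\<Sum>i\<in>I. h (c (b i)) * b i)" for c
    by (simp add: sum.reindex[OF inj])
  have "vs.independent (b ` I)"
    using ind sum vs.dependent_finite[of "b ` I"] I by fastforce
  moreover have "vs.span (b ` I) = V"
  proof -
    have "vs.span (b ` I) = range (\<lambda>u. \<Sum>v\<in>b ` I. h (u v) * v)"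
      using I by (simp add: vs.span_finite)
    also have "\<dots> = V"
    proof (intro equalityI subsetI)
      fix z assume "z \<in> V"
      then obtain c where c: "z = (\<Sum>i\<in>I. h (c i) * b i)" using V by blast
      have "z = (\<Sum>v\<in>b ` I. h ((\<lambda>v. c (the_inv_into I b v)) v) * v)"
        unfolding sum c by (rule sum.cong) (auto simp: the_inv_into_f_f[OF inj])
      then show "z \<in> range (\<lambda>u. \<Sum>v\<in>b ` I. h (u v) * v)"
        by (rule range_eqI[where x = "\<lambda>v. c (the_inv_into I b v)"])
    qed (auto simp: V sum)
    finally show ?thesis .
  qed
  ultimately show ?thesis unfolding hasdim_def using I inj by (auto intro!: exI[of _ "b ` I"] card_image)
qed

lemma hasdim_scale:
  assumes V: "hasdim V n" and c: "c \<noteq> 0"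
  shows "hasdim ((\<lambda>x. c * x) ` V) n"
proof -
  obtain B where B: "finite B" "vs.independent B" "vs.span B = V" "card B = n"
    using V by (auto simp: hasdim_def)
  have "hasdim ((\<lambda>x. c * x) ` V) (card B)"
  proof (rule hasdim_family[where b = "\<lambda>x. c * x", OF B(1)])
    fix a assume "(\<Sum>i\<in>B. h (a i) * (c * i)) = 0"
    then have "c * (\<Sum>i\<in>B. h (a i) * i) = 0" by (simp add: sum_distrib_left mult_ac)
    then have "(\<Sum>i\<in>B. h (a i) * i) = 0" using c by simp
    then show "\<forall>i\<in>B. a i = 0" using B(1,2) vs.dependent_finite[of B] by auto
  next
    have "(\<lambda>x. c * x) ` V = {c * (\<Sum>i\<in>B. h (a i) * i) | a. True}"
      using B(1,3) vs.span_finite[of B] by auto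
    also have "\<dots> = {\<Sum>i\<in>B. h (a i) * (c * i) | a. True}"
      by (simp add: sum_distrib_left mult_ac)
    finally show "(\<lambda>x. c * x) ` V = {\<Sum>i\<in>B. h (a i) * (c * i) | a. True}" .
  qed
  with B show ?thesis by simp
qed

end

text \<open>Common linear factors are removed one at a time. In \<open>aw_RR_D\<close> this turns
  bounds on orders into a bound on denominators.\<close>

lemma dvd_if_order_le:
  fixes q r :: "'a::alg_closed_field poly"
  assumes "q \<noteq> 0" "r \<noteq> 0" "\<And>b. Polynomial.order b q \<le> Polynomial.order b r"
  shows "q dvd r"
  using assms
proof (induction "Polynomial.degree q" arbitrary: q r rule: less_induct)
  case less
  show ?case
  proof (cases "Polynomial.degree q = 0")
    case True
    then show ?thesis using less.prems(1) by (metis degree_eq_zeroE dvd_refl is_unit_triv pCons_0_0 unit_imp_dvd)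
  next
    case False
    then obtain a where a: "poly q a = 0"
      using alg_closed_imp_poly_has_root by blast
    then have "Polynomial.order a q > 0" using less.prems by (simp add: order_gt_0_iff)
    then have "poly r a = 0" using less.prems by (metis order_gt_0_iff order_less_le_trans)
    then obtain q' r' where f: "q = [:- a, 1:] * q'" "r = [:- a, 1:] * r'"
      using a by (metis dvdE poly_eq_0_iff_dvd)
    have nz: "q' \<noteq> 0" "r' \<noteq> 0" using less.prems f by auto
    have deg: "Polynomial.degree q' < Polynomial.degree q"
      unfolding f using nz by (subst degree_mult_eq) auto
    have "Polynomial.order b q = Polynomial.order b [:- a, 1:] + Polynomial.order b q'"
      "Polynomial.order b r = Polynomial.order b [:- a, 1:] + Polynomial.order b r'" for b
      using less.prems(1,2) order_mult unfolding f by blast+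
    then have "Polynomial.order b q' \<le> Polynomial.order b r'" for b
      using less.prems(3)[of b] by simp
    then have "q' dvd r'" using less.hyps[OF deg nz] by blast
    then show ?thesis unfolding f by (rule mult_dvd_mono[OF dvd_refl])
  qed
qed

section \<open>Riemann-Roch spaces of the Kummer extension\<close>

context kummer
begin

sublocale hspace h by unfold_locales (rule hom)

definition divs :: "('b set \<Rightarrow> int) set" where "divs = {A. finite {P \<in> places. A P \<noteq> 0}}"

definition deg :: "('b set \<Rightarrow> int) \<Rightarrow> int" where "deg A = (\<Sum>P | P \<in> places \<and> A P \<noteq> 0. A P)"

definition RR :: "('b set \<Rightarrow> int) \<Rightarrow> 'b set" where
  "RR A = {z \<in> L. z = 0 \<or> (\<forall>P\<in>places. val P z \<ge> - A P)}"

lemma place_obtain: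
  assumes "P \<in> places" obtains t where "dval (range h) L P t"
  using place_dval(1)[OF assms] by blast

lemma deg_eq:
  assumes "finite S" "S \<subseteq> places" "\<And>P. P \<in> places \<Longrightarrow> A P \<noteq> 0 \<Longrightarrow> P \<in> S"
  shows "deg A = sum A S"
  unfolding deg_def by (rule sum.mono_neutral_left) (use assms in auto)

lemma deg_add:
  assumes "A \<in> divs" "B \<in> divs"
  shows "deg (\<lambda>P. A P + B P) = deg A + deg B" "(\<lambda>P. A P + B P) \<in> divs"
proof -
  let ?S = "{P \<in> places. A P \<noteq> 0} \<union> {P \<in> places. B P \<noteq> 0}"
  have f: "finite ?S" "?S \<subseteq> places" using assms by (auto simp: divs_def)
  have "deg A = sum A ?S" "deg B = sum B ?S" "deg (\<lambda>P. A P + B P) = (\<Sum>P\<in>?S. A P + B P)"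
    by (rule deg_eq[OF f]; auto)+
  then show "deg (\<lambda>P. A P + B P) = deg A + deg B" by (simp add: sum.distrib)
  show "(\<lambda>P. A P + B P) \<in> divs"
    unfolding divs_def mem_Collect_eq by (rule finite_subset[OF _ f(1)]) auto
qed

lemma RR_iff: "z \<in> RR A \<longleftrightarrow> z \<in> L \<and> (\<forall>P\<in>places. z = 0 \<or> val P z \<ge> - A P)"
  by (auto simp: RR_def)

lemma val_const: "P \<in> places \<Longrightarrow> a \<noteq> 0 \<Longrightarrow> val P (h a) = 0"
proof -
  assume P: "P \<in> places" and a: "a \<noteq> 0"
  obtain t where "dval (range h) L P t" using place_obtain[OF P] .
  then interpret dval "range h" L P t .
  have "h a \<in> vunits P" using a k_P by (auto simp: vunits_def h_simps simp flip: ringhom_inverse[OF hom])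
  then show ?thesis by (rule val_unit)
qed

lemma RR_add: assumes "x \<in> RR A" "y \<in> RR A" shows "x + y \<in> RR A"
  unfolding RR_iff
proof (intro conjI ballI)
  show "x + y \<in> L" using assms L_add by (simp add: RR_iff)
  fix P assume P: "P \<in> places"
  obtain t where "dval (range h) L P t" using place_obtain[OF P] .
  then interpret dval "range h" L P t .
  show "x + y = 0 \<or> - A P \<le> val P (x + y)"
    by (rule val_ge_add) (use assms P in \<open>auto simp: RR_iff\<close>)
qed

lemma RR_smult: assumes "x \<in> RR A" shows "h a * x \<in> RR A"
proof (cases "a = 0 \<or> x = 0")
  case False
  show ?thesis unfolding RR_iff
  proof (intro conjI ballI)
    show "h a * x \<in> L" using assms L_mult h_L by (simp add: RR_iff)
    fix P assume P: "P \<in> places"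
    obtain t where "dval (range h) L P t" using place_obtain[OF P] .
    then interpret dval "range h" L P t .
    have "val P (h a * x) = val P x"
      using val_mult[of "h a" x] val_const[OF P] False assms by (simp add: h_L h_simps RR_iff)
    then show "h a * x = 0 \<or> - A P \<le> val P (h a * x)" using assms P by (auto simp: RR_iff)
  qed
qed (auto simp: h_simps RR_iff L_closed)

lemma RR_zero: "0 \<in> RR A"
  by (simp add: RR_iff L_closed)

lemma RR_subspace: "vs.subspace (RR A)"
  by (rule vs.subspaceI) (auto intro: RR_zero RR_add RR_smult)

lemma RR_sum: "(\<And>i. i \<in> I \<Longrightarrow> g i \<in> RR A) \<Longrightarrow> sum g I \<in> RR A"
  by (induction I rule: infinite_finite_induct) (auto intro: RR_zero RR_add)

lemma RR_mono: "(\<And>P. P \<in> places \<Longrightarrow> A P \<le> B P) \<Longrightarrow> RR A \<subseteq> RR B"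
  by (force simp: RR_iff)

text \<open>If some \<open>x\<close> has order exactly \<open>- (A P0 + 1)\<close> at
  \<open>P0\<close>, then for every \<open>z\<close> in the larger space \<open>z / x\<close> has a
  residue \<open>a\<close> in k, and \<open>z - h a * x\<close> falls into the smaller space.
  Otherwise the two spaces agree.\<close>

lemma RR_step:
  assumes P0: "P0 \<in> places" and n: "hasdim (RR (A(P0 := A P0 + 1))) n"
  shows "\<exists>m. hasdim (RR A) m \<and> n \<le> m + 1"
proof -
  let ?A' = "A(P0 := A P0 + 1)"
  obtain t where "dval (range h) L P0 t" using place_obtain[OF P0] .
  then interpret dval "range h" L P0 t .
  have sub: "RR A \<subseteq> RR ?A'" by (rule RR_mono) auto
  obtain m where m: "hasdim (RR A) m" using hasdim_subspace[OF RR_subspace sub n] by blast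
  have "\<exists>x. \<forall>z\<in>RR ?A'. \<exists>a. z - h a * x \<in> RR A"
  proof (cases "\<exists>x\<in>RR ?A'. x \<noteq> 0 \<and> val P0 x = - (A P0 + 1)")
    case True
    then obtain x where x: "x \<in> RR ?A'" "x \<noteq> 0" "val P0 x = - (A P0 + 1)" by blast
    have xL: "x \<in> L" using x by (simp add: RR_iff)
    show ?thesis
    proof (rule exI[of _ x], rule ballI)
      fix z assume z: "z \<in> RR ?A'"
      then have zL: "z \<in> L" by (simp add: RR_iff)
      have "z / x \<in> P0"
      proof (cases "z = 0")
        case False
        then have "val P0 (z / x) \<ge> 0"
          using val_divide[OF zL False xL x(2)] x(3) z P0 by (auto simp: RR_iff dest!: bspec[of _ _ P0])
        then show ?thesis using val_nonneg_iff[of "z / x"] False x zL xL L_closed(8) by simp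
      qed (simp add: P_more)
      then obtain a where a: "z / x - h a \<in> maxid P0" using place_dval(2)[OF P0] by blast
      let ?y = "z - h a * x"
      have y: "?y \<in> RR ?A'"
        using RR_add[OF z RR_smult[OF x(1), of "- a"]] by (simp add: h_simps)
      have "?y \<in> RR A" unfolding RR_iff
      proof (intro conjI ballI)
        show "?y \<in> L" using y by (simp add: RR_iff)
        fix P assume P: "P \<in> places"
        show "?y = 0 \<or> - A P \<le> val P ?y"
        proof (cases "P = P0 \<and> ?y \<noteq> 0")
          case True
          have yy: "?y = (z / x - h a) * x" using x by (simp add: field_simps)
          then have nz: "z / x - h a \<noteq> 0" using True by auto
          have l: "z / x - h a \<in> L" using maxid_P[OF a] P_L by blast
          have "val P0 (z / x - h a) > 0" using val_pos_iff[OF l nz] a by simp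
          moreover have "val P0 ?y = val P0 (z / x - h a) + val P0 x"
            unfolding yy by (rule val_mult) (use nz l xL x in auto)
          ultimately show ?thesis using x(3) True by simp
        next
          case False
          then show ?thesis using y P by (auto simp: RR_iff dest!: bspec[of _ _ P] split: if_splits)
        qed
      qed
      then show "\<exists>a. z - h a * x \<in> RR A" by blast
    qed
  next
    case False
    have "z \<in> RR A" if z: "z \<in> RR ?A'" for z
    proof (cases "z = 0")
      case nz: False
      show ?thesis unfolding RR_iff
      proof (intro conjI ballI)
        show "z \<in> L" using z by (simp add: RR_iff)
        fix P assume P: "P \<in> places"
        have "val P z \<ge> - ?A' P" using z nz P by (auto simp: RR_iff)
        moreover have "val P0 z \<noteq> - (A P0 + 1)" using False z nz by blast
        ultimately show "z = 0 \<or> - A P \<le> val P z" by (cases "P = P0") auto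
      qed
    qed (simp add: RR_zero)
    then have "\<forall>z\<in>RR ?A'. z - h 0 * 0 \<in> RR A" by (simp add: h_simps)
    then show ?thesis by blast
  qed
  then show ?thesis using hasdim_step[OF n m] m by blast
qed

text \<open>The smaller divisor is raised towards \<open>B\<close> by one place at a time, and each
  step costs at most one dimension. Finiteness is inherited from \<open>RR B\<close>.\<close>

lemma RR_descend:
  assumes "A \<in> divs" "B \<in> divs" "\<And>P. P \<in> places \<Longrightarrow> A P \<le> B P" "hasdim (RR B) n"
  shows "\<exists>m. hasdim (RR A) m \<and> int n - int m \<le> deg B - deg A"
  using assms
proof (induction "nat (deg B - deg A)" arbitrary: A rule: less_induct)
  case less
  show ?case
  proof (cases "\<exists>P0\<in>places. A P0 < B P0")
    case False
    then have "\<And>P. P \<in> places \<Longrightarrow> A P = B P" using less.prems(3) by force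
    then have "RR A = RR B" "deg A = deg B" by (auto simp: RR_def deg_def intro!: sum.cong)
    with less.prems show ?thesis by auto
  next
    case True
    then obtain P0 where P0: "P0 \<in> places" "A P0 < B P0" by blast
    define D where "D P = (if P = P0 then 1 else 0 :: int)" for P
    have D: "D \<in> divs" "deg D = 1"
    proof -
      show "D \<in> divs" by (auto simp: divs_def D_def)
      have "deg D = sum D {P0}" by (rule deg_eq) (use P0 in \<open>auto simp: D_def\<close>)
      then show "deg D = 1" by (simp add: D_def)
    qed
    have A': "A(P0 := A P0 + 1) = (\<lambda>P. A P + D P)" by (auto simp: D_def)
    have dA': "(\<lambda>P. A P + D P) \<in> divs" "deg (\<lambda>P. A P + D P) = deg A + 1"
      using deg_add[OF less.prems(1) D(1)] D by auto
    have le: "A P + D P \<le> B P" if "P \<in> places" for P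
      using less.prems(3)[OF that] P0 by (auto simp: D_def)
    have "deg (\<lambda>P. A P + D P) \<le> deg B"
    proof -
      let ?S = "{P \<in> places. A P + D P \<noteq> 0} \<union> {P \<in> places. B P \<noteq> 0}"
      have f: "finite ?S" "?S \<subseteq> places" using dA' less.prems by (auto simp: divs_def)
      have d: "deg (\<lambda>P. A P + D P) = (\<Sum>P\<in>?S. A P + D P)" "deg B = sum B ?S"
        by (rule deg_eq[OF f]; auto)+
      show ?thesis unfolding d by (rule sum_mono) (use le in auto)
    qed
    then have "\<exists>m. hasdim (RR (\<lambda>P. A P + D P)) m \<and> int n - int m \<le> deg B - deg (\<lambda>P. A P + D P)"
      by (intro less.hyps dA' less.prems le) (use dA' in auto)
    then obtain m where m: "hasdim (RR (A(P0 := A P0 + 1))) m" "int n - int m \<le> deg B - deg A - 1"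
      unfolding A' using dA' by auto
    from RR_step[OF P0(1) m(1)] m(2) show ?thesis by force
  qed
qed

text \<open>Multiplication by \<open>c\<close> identifies the spaces of two divisors that differ by
  the divisor of \<open>c\<close>.\<close>

lemma RR_shift:
  assumes c: "c \<in> L" "c \<noteq> 0" and n: "hasdim (RR (\<lambda>P. A P - val P c)) n"
  shows "hasdim (RR A) n"
proof -
  have v: "val P (z * c) = val P z + val P c" "val P (inverse c) = - val P c"
    if P: "P \<in> places" and "z \<in> L" "z \<noteq> 0" for P z
  proof -
    obtain t where "dval (range h) L P t" using place_obtain[OF P] .
    then interpret dval "range h" L P t .
    show "val P (z * c) = val P z + val P c" "val P (inverse c) = - val P c"
      using val_mult val_inverse that c by auto
  qed
  have "RR A = (\<lambda>x. inverse c * x) ` RR (\<lambda>P. A P - val P c)"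
  proof (intro equalityI subsetI)
    fix z assume z: "z \<in> RR A"
    then have "c * z \<in> RR (\<lambda>P. A P - val P c)"
      using c v[of _ z] by (auto simp: RR_iff L_mult mult.commute)
    moreover have "z = inverse c * (c * z)" using c by simp
    ultimately show "z \<in> (\<lambda>x. inverse c * x) ` RR (\<lambda>P. A P - val P c)" by blast
  next
    fix z assume "z \<in> (\<lambda>x. inverse c * x) ` RR (\<lambda>P. A P - val P c)"
    then obtain x where x: "x \<in> RR (\<lambda>P. A P - val P c)" "z = inverse c * x" by blast
    have zL: "z \<in> L" using x c L_mult L_closed(5) by (simp add: RR_iff)
    have xz: "x = z * c" using x c by simp
    show "z \<in> RR A" unfolding RR_iff
    proof (intro conjI ballI zL)
      fix P assume P: "P \<in> places"
      show "z = 0 \<or> - A P \<le> val P z"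
        using x(1) P v(1)[OF P zL] c by (cases "z = 0") (auto simp: RR_iff xz dest!: bspec[of _ _ P])
    qed
  qed
  then show ?thesis using hasdim_scale[OF n, of "inverse c"] c by simp
qed

end

section \<open>Multiples of the pole divisor of u\<close>

context kummer
begin

lemma pfin_pinf_disjoint: "P \<in> pfin b \<Longrightarrow> P \<notin> pinf"
proof
  assume P: "P \<in> pfin b" "P \<in> pinf"
  then have pl: "P \<in> places" by (simp add: pfin_def)
  interpret valring "range h" L P by (rule valring_places[OF pl])
  have "u \<in> P" using P_closed(2)[OF maxid_P k_P[of "h b"], of "u - h b"] P(1) by (simp add: pfin_def)
  then have "u * inverse u \<in> maxid P" using P(2) maxid_absorb by (simp add: pinf_def)
  then show False using u_nz one_notin_maxid by simp
qed

lemma pfin_disjoint: "P \<in> pfin a \<Longrightarrow> P \<in> pfin b \<Longrightarrow> a = b"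
proof -
  assume P: "P \<in> pfin a" "P \<in> pfin b"
  then have pl: "P \<in> places" by (simp add: pfin_def)
  interpret valring "range h" L P by (rule valring_places[OF pl])
  have "h (b - a) \<in> maxid P"
    using maxid_diff[of "u - h a" "u - h b"] P by (simp add: pfin_def h_simps)
  moreover have "h (inverse (b - a)) \<in> P" by (rule k_P) simp
  ultimately show "a = b" by (auto simp: maxid_def h_simps ringhom_eq_iff[OF hom])
qed

lemma pfin_nonempty: "pfin b \<noteq> {}" and pinf_nonempty: "pinf \<noteq> {}"
  using pfin_card[of b] pinf_card N0 by (auto simp: card_gt_0_iff)

text \<open>\<open>Bm m\<close> is \<open>m\<close> times the pole divisor of \<open>u\<close>.\<close>

definition Bm :: "nat \<Rightarrow> 'b set \<Rightarrow> int" where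
  "Bm m P = (if P \<in> pinf then int m * int (N div gcd N M) else 0)"

lemma Bm_divs: "Bm m \<in> divs"
  unfolding divs_def mem_Collect_eq
  by (rule finite_subset[OF _ pinf_card(1)]) (auto simp: Bm_def split: if_splits)

lemma deg_Bm: "deg (Bm m) = int m * int N"
proof -
  have "deg (Bm m) = sum (Bm m) pinf"
    by (rule deg_eq[OF pinf_card(1)]) (auto simp: pinf_def Bm_def split: if_splits)
  also have "\<dots> = int (card pinf) * (int m * int (N div gcd N M))" by (simp add: Bm_def)
  also have "int (card pinf) * (int m * int (N div gcd N M)) = int m * int (gcd N M * (N div gcd N M))"
    unfolding pinf_card(2) by (simp only: of_nat_mult mult_ac)
  finally show ?thesis by simp
qed

text \<open>Membership is phrased by valuation rings instead of orders: Galois automorphisms permute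
  the rings and fix \<open>u\<close>, so the invariance of the space can be read off.\<close>

lemma RR_Bm_iff:
  "z \<in> RR (Bm m) \<longleftrightarrow> z \<in> L \<and> (\<forall>P\<in>places. if P \<in> pinf then z * inverse u ^ m \<in> P else z \<in> P)"
proof -
  have *: "(z = 0 \<or> val P z \<ge> - Bm m P) \<longleftrightarrow> (if P \<in> pinf then z * inverse u ^ m \<in> P else z \<in> P)"
    if P: "P \<in> places" and z: "z \<in> L" for P
  proof (cases "z = 0")
    case nz: False
    obtain t where "dval (range h) L P t" using place_obtain[OF P] .
    then interpret dval "range h" L P t .
    show ?thesis
    proof (cases "P \<in> pinf")
      case True
      have iu: "inverse u \<in> L" "inverse u \<noteq> 0" using u_nz u_Ku Ku_L L_closed(5) by auto
      have ium: "inverse u ^ m \<in> L" "inverse u ^ m \<noteq> 0" using iu L_closed(9) by auto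
      have "val P (inverse u) = int (N div gcd N M)"
        using w_inf(1)[OF True] val_inverse[OF Ku_L[OF u_Ku] u_nz] by simp
      then have "val P (z * inverse u ^ m) = val P z + int m * int (N div gcd N M)"
        using val_mult[OF z nz ium] val_power[OF iu, of m] by simp
      then show ?thesis
        using True nz val_nonneg_iff[of "z * inverse u ^ m"] L_mult[OF z ium(1)] ium(2)
        by (auto simp: Bm_def)
    next
      case False
      then show ?thesis using val_nonneg_iff[OF z nz] nz by (simp add: Bm_def)
    qed
  next
    case True
    interpret valring "range h" L P by (rule valring_places[OF P])
    show ?thesis using True P_more by simp
  qed
  then show ?thesis unfolding RR_iff by (intro conj_cong ball_cong refl)
qed

text \<open>\<open>gal \<zeta>\<close> maps \<open>L\<close> bijectively to itself, so the preimage
  of a place is a place; it is cut down to \<open>L\<close> because the automorphism acts on all of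
  \<open>'b\<close>. As \<open>u\<close> is fixed, infinity is preserved.\<close>

lemma gal_place:
  assumes z: "\<zeta> \<in> roots1 N" and P: "P \<in> places"
  defines "Q \<equiv> {x \<in> L. gal \<zeta> x \<in> P}"
  shows "Q \<in> places" "Q \<in> pinf \<longleftrightarrow> P \<in> pinf"
proof -
  interpret valring "range h" L P by (rule valring_places[OF P])
  note g = ringhom_simps[OF gal(1)[OF z]] ringhom_uminus[OF gal(1)[OF z]] ringhom_inverse[OF gal(1)[OF z]]
  have z': "inverse \<zeta> \<in> roots1 N" using roots1_inverse z .
  have nz: "\<zeta> \<noteq> 0" using z roots1_nz N0 by blast
  have inv: "\<exists>x\<in>L. gal \<zeta> x = y" if "y \<in> L" for y
    using gal_mult[OF z z' that] gal_one[OF that] gal_L[OF z' that] nz by auto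
  have "isplace (range h) L Q"
    unfolding isplace_def
  proof (intro conjI ballI impI)
    show "1 \<in> Q" by (simp add: Q_def g L_closed P_closed)
    show "a + b \<in> Q" "a * b \<in> Q" if "a \<in> Q" "b \<in> Q" for a b
      using that by (auto simp: Q_def g L_closed P_closed)
    show "- a \<in> Q" if "a \<in> Q" for a using that by (auto simp: Q_def g L_closed P_closed)
    show "range h \<subset> Q"
    proof
      show "range h \<subseteq> Q" using h_L gal(2)[OF z] k_P by (auto simp: Q_def)
      obtain y where y: "y \<in> P" "y \<notin> range h" using P_ne k_P by blast
      then obtain x where x: "x \<in> L" "gal \<zeta> x = y" using inv P_L by blast
      have "x \<in> Q" using x y by (simp add: Q_def)
      moreover have "x \<notin> range h"
      proof
        assume "x \<in> range h"
        then show False using x(2) y(2) gal(2)[OF z] by auto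
      qed
      ultimately show "range h \<noteq> Q" by blast
    qed
    show "Q \<subset> L"
    proof
      obtain y where "y \<in> L" "y \<notin> P" using P_ne P_L by blast
      moreover from this obtain x where "x \<in> L" "gal \<zeta> x = y" using inv by blast
      ultimately show "Q \<noteq> L" by (auto simp: Q_def)
    qed (auto simp: Q_def)
    show "x \<in> Q \<or> inverse x \<in> Q" if "x \<in> L" for x
      using that P_or[OF gal_L[OF z that]] by (auto simp: Q_def g L_closed)
  qed
  then show Q: "Q \<in> places" by (simp add: places_def)
  have "gal \<zeta> (inverse u) = inverse u" "inverse u \<in> L"
    using gal(3)[OF z] Ku_L[OF u_Ku] L_closed(5) by (auto simp: g)
  moreover have "gal \<zeta> u = u" "u \<in> L" using gal(3)[OF z] Ku_L[OF u_Ku] by auto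
  ultimately have "inverse u \<in> maxid Q \<longleftrightarrow> inverse u \<in> maxid P"
    by (auto simp: maxid_def Q_def)
  then show "Q \<in> pinf \<longleftrightarrow> P \<in> pinf" using Q P by (simp add: pinf_def)
qed

lemma gal_RR:
  assumes z: "\<zeta> \<in> roots1 N" and x: "x \<in> RR (Bm m)"
  shows "gal \<zeta> x \<in> RR (Bm m)"
  unfolding RR_Bm_iff
proof (intro conjI ballI)
  have xL: "x \<in> L" using x by (simp add: RR_iff)
  then show "gal \<zeta> x \<in> L" by (rule gal_L[OF z])
  fix P assume P: "P \<in> places"
  let ?Q = "{x \<in> L. gal \<zeta> x \<in> P}"
  have "gal \<zeta> (x * inverse u ^ m) = gal \<zeta> x * inverse u ^ m"
    by (simp add: ringhom_simps[OF gal(1)[OF z]] ringhom_power[OF gal(1)[OF z]]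
        ringhom_inverse[OF gal(1)[OF z]] gal(3)[OF z])
  moreover have "if ?Q \<in> pinf then x * inverse u ^ m \<in> ?Q else x \<in> ?Q"
    using x gal_place(1)[OF z P] unfolding RR_Bm_iff by blast
  ultimately show "if P \<in> pinf then gal \<zeta> x * inverse u ^ m \<in> P else gal \<zeta> x \<in> P"
    using gal_place(2)[OF z P] by (auto split: if_splits)
qed

text \<open>Up to the factor \<open>N\<close>, invertible in k, the \<open>j\<close>-th component is
  a combination of conjugates, and these all lie in the space.\<close>

lemma RR_isotypic:
  assumes "lin a \<in> RR (Bm m)" "\<And>j. a j \<in> Ku" "j < N"
  shows "a j * w ^ j \<in> RR (Bm m)"
proof -
  have "(\<Sum>\<zeta>\<in>roots1 N. h (inverse \<zeta> ^ j) * gal \<zeta> (lin a)) \<in> RR (Bm m)"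
    by (intro RR_sum RR_smult gal_RR assms(1))
  then have "h (of_nat N) * (a j * w ^ j) \<in> RR (Bm m)"
    by (simp add: isotypic assms ringhom_of_nat[OF hom])
  then have "h (inverse (of_nat N)) * (h (of_nat N) * (a j * w ^ j)) \<in> RR (Bm m)"
    by (rule RR_smult)
  moreover have "h (inverse (of_nat N)) * h (of_nat N) = 1"
    using charN by (simp add: h_simps flip: h_simps(4))
  ultimately show ?thesis by (simp flip: mult.assoc)
qed

text \<open>For \<open>a\<close> in \<open>k(u)\<close>, the product \<open>a * w ^ j\<close> has no finite poles iff \<open>a * gg j\<close> is a polynomial.\<close>

definition gg :: "nat \<Rightarrow> 'a poly" where
  "gg j = (\<Prod>b | poly f b = 0. [:- b, 1:] ^ (j * Polynomial.order b f div N))"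

lemma roots_f_finite: "finite {b. poly f b = 0}" using poly_roots_finite f0 by blast

lemma gg_nz: "gg j \<noteq> 0"
  using roots_f_finite by (auto simp: gg_def)

lemma order_gg: "Polynomial.order b (gg j) = j * Polynomial.order b f div N"
proof -
  have lin: "Polynomial.order b ([:- a, 1:] ^ k) = (if a = b then k else 0)" for a b :: 'a and k
    by (auto simp: order_power_n_n intro!: order_0I)
  have "finite R \<Longrightarrow> Polynomial.order b (\<Prod>b\<in>R. [:- b, 1:] ^ e b) = (if b \<in> R then e b else 0)"
    for R and e :: "'a \<Rightarrow> nat"
  proof (induction R rule: finite_induct)
    case (insert x F)
    have "(\<Prod>b\<in>F. [:- b, 1:] ^ e b) \<noteq> 0" using insert by auto
    then have "[:- x, 1:] ^ e x * (\<Prod>b\<in>F. [:- b, 1:] ^ e b) \<noteq> 0" by simp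
    then show ?case using insert by (auto simp: order_mult lin simp del: mult_pCons_left)
  qed simp
  from this[OF roots_f_finite, of "\<lambda>b. j * Polynomial.order b f div N"] show ?thesis
    by (cases "poly f b = 0") (simp_all add: gg_def order_0I)
qed

lemma degree_gg: "Polynomial.degree (gg j) = (\<Sum>b | poly f b = 0. j * Polynomial.order b f div N)"
  unfolding gg_def by (subst degree_prod_eq_sum_degree) (auto simp: degree_power_eq)

text \<open>The valuations involve \<open>N / g\<close> with a gcd \<open>g\<close> that varies with
  the place. Multiplying the inequality by \<open>g\<close> leaves a condition in \<open>N\<close>,
  orders and degrees only.\<close>

lemma val_aw:
  assumes "p \<noteq> 0" "q \<noteq> 0"
  shows "P \<in> pfin b \<Longrightarrow> val P (ev p / ev q * w ^ j) \<ge> 0 \<longleftrightarrow>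
      int (Polynomial.order b q) * int N \<le> int (Polynomial.order b p) * int N + int j * int (Polynomial.order b f)"
    and "P \<in> pinf \<Longrightarrow> val P (ev p / ev q * w ^ j) \<ge> - Bm m P \<longleftrightarrow>
      int (Polynomial.degree p) * int N + int j * int M \<le> int m * int N + int (Polynomial.degree q) * int N"
proof -
  have evL: "ev p \<in> L" "ev p \<noteq> 0" if "p \<noteq> 0" for p using that Ku_L[OF ev_Ku] ev_eq_0_iff by auto
  have v: "val P (ev p / ev q * w ^ j) = val P (ev p) - val P (ev q) + int j * val P w" if P: "P \<in> places" for P
  proof -
    obtain t where "dval (range h) L P t" using place_obtain[OF P] .
    then interpret dval "range h" L P t .
    have "ev p / ev q \<in> L" "ev p / ev q \<noteq> 0" "w ^ j \<in> L" "w ^ j \<noteq> 0"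
      using evL assms L_closed(8,9) w_L w_nz by auto
    then have "val P (ev p / ev q * w ^ j) = val P (ev p / ev q) + val P (w ^ j)" by (rule val_mult)
    then show ?thesis
      by (simp only: val_divide[OF evL[OF assms(1)] evL[OF assms(2)]] val_power[OF w_L w_nz])
  qed
  show "val P (ev p / ev q * w ^ j) \<ge> 0 \<longleftrightarrow>
      int (Polynomial.order b q) * int N \<le> int (Polynomial.order b p) * int N + int j * int (Polynomial.order b f)"
    if P: "P \<in> pfin b" for P
  proof -
    have pl: "P \<in> places" using P by (simp add: pfin_def)
    define g where "g = gcd N (Polynomial.order b f)"
    obtain n k where nk: "N = g * n" "Polynomial.order b f = g * k"
      unfolding g_def by (metis dvdE gcd_dvd1 gcd_dvd2)
    have g0: "g > 0" using N0 by (simp add: g_def)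
    then have d: "N div g = n" "Polynomial.order b f div g = k" using nk by simp_all
    have "val P (ev p / ev q * w ^ j) =
      int (Polynomial.order b p) * int n - int (Polynomial.order b q) * int n + int j * int k"
      using v[OF pl] ev_fin[OF P] assms w_fin[OF P, folded g_def] d by simp
    moreover have "int (Polynomial.order b p) * int N + int j * int (Polynomial.order b f) - int (Polynomial.order b q) * int N =
      int g * (int (Polynomial.order b p) * int n - int (Polynomial.order b q) * int n + int j * int k)"
      by (simp add: nk algebra_simps)
    ultimately have "int (Polynomial.order b p) * int N + int j * int (Polynomial.order b f) - int (Polynomial.order b q) * int N =
      int g * val P (ev p / ev q * w ^ j)" by simp
    moreover have "int g * val P (ev p / ev q * w ^ j) \<ge> 0 \<longleftrightarrow> val P (ev p / ev q * w ^ j) \<ge> 0"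
      using g0 by (simp add: zero_le_mult_iff)
    ultimately show ?thesis by linarith
  qed
  show "val P (ev p / ev q * w ^ j) \<ge> - Bm m P \<longleftrightarrow>
      int (Polynomial.degree p) * int N + int j * int M \<le> int m * int N + int (Polynomial.degree q) * int N"
    if P: "P \<in> pinf" for P
  proof -
    have pl: "P \<in> places" using P by (simp add: pinf_def)
    define g where "g = gcd N M"
    obtain n k where nk: "N = g * n" "M = g * k"
      unfolding g_def by (metis dvdE gcd_dvd1 gcd_dvd2)
    have g0: "g > 0" using N0 by (simp add: g_def)
    then have d: "N div g = n" "M div g = k" using nk by (metis nonzero_mult_div_cancel_left less_irrefl)+
    have "val P (ev p / ev q * w ^ j) + Bm m P =
      int m * int n + int (Polynomial.degree q) * int n - int (Polynomial.degree p) * int n - int j * int k"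
      using v[OF pl] ev_inf[OF P] assms w_inf[OF P, folded g_def] P by (simp add: Bm_def d flip: g_def)
    moreover have "int m * int (g * n) + int (Polynomial.degree q) * int (g * n) - int (Polynomial.degree p) * int (g * n) - int j * int (g * k) =
      int g * (int m * int n + int (Polynomial.degree q) * int n - int (Polynomial.degree p) * int n - int j * int k)"
      by (simp add: algebra_simps)
    ultimately have "int m * int N + int (Polynomial.degree q) * int N - int (Polynomial.degree p) * int N - int j * int M =
      int g * (val P (ev p / ev q * w ^ j) + Bm m P)" by (simp only: nk[symmetric])
    moreover have "int g * (val P (ev p / ev q * w ^ j) + Bm m P) \<ge> 0 \<longleftrightarrow> val P (ev p / ev q * w ^ j) + Bm m P \<ge> 0"
      using g0 by (simp add: zero_le_mult_iff)
    ultimately show ?thesis by linarith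
  qed
qed

lemma aw_RR_iff:
  assumes "p \<noteq> 0" "q \<noteq> 0"
  shows "ev p / ev q * w ^ j \<in> RR (Bm m) \<longleftrightarrow>
    (\<forall>b. int (Polynomial.order b q) * int N \<le> int (Polynomial.order b p) * int N + int j * int (Polynomial.order b f)) \<and>
    int (Polynomial.degree p) * int N + int j * int M \<le> int m * int N + int (Polynomial.degree q) * int N"
    (is "?z \<in> _ \<longleftrightarrow> ?A \<and> ?B")
proof -
  have "ev p / ev q \<in> Ku" using KuI assms by blast
  then have zL: "?z \<in> L" using L_mult Ku_L w_power_L by blast
  have znz: "?z \<noteq> 0" using assms ev_eq_0_iff w_nz by simp
  show ?thesis
  proof
    assume z: "?z \<in> RR (Bm m)"
    have ?A
    proof
      fix b
      obtain P where P: "P \<in> pfin b" using pfin_nonempty by blast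
      then have "P \<in> places" "P \<notin> pinf" using pfin_pinf_disjoint by (auto simp: pfin_def)
      then have "val P ?z \<ge> 0" using z znz by (auto simp: RR_iff Bm_def)
      then show "int (Polynomial.order b q) * int N \<le> int (Polynomial.order b p) * int N + int j * int (Polynomial.order b f)"
        using val_aw(1)[OF assms P] by blast
    qed
    moreover obtain P where P: "P \<in> pinf" using pinf_nonempty by blast
    then have "val P ?z \<ge> - Bm m P" using z znz by (auto simp: RR_iff pinf_def)
    then have ?B using val_aw(2)[OF assms P] by blast
    ultimately show "?A \<and> ?B" ..
  next
    assume AB: "?A \<and> ?B"
    have "val P ?z \<ge> - Bm m P" if "P \<in> places" for P
      using places_cases[OF that]
    proof
      assume "P \<in> pinf" then show ?thesis using val_aw(2)[OF assms] AB by blast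
    next
      assume "\<exists>b. P \<in> pfin b"
      then obtain b where b: "P \<in> pfin b" by blast
      then show ?thesis using val_aw(1)[OF assms b] AB pfin_pinf_disjoint[OF b] by (simp add: Bm_def)
    qed
    then show "?z \<in> RR (Bm m)" using zL by (simp add: RR_iff)
  qed
qed

text \<open>The ceiling of \<open>j * M / N\<close>: the growth of \<open>w ^ j\<close> at infinity
  measured in powers of \<open>u\<close>, rounded up.\<close>

definition cl :: "nat \<Rightarrow> nat" where "cl j = (j * M + (N - 1)) div N"

lemma cl_le_iff: "cl j \<le> y \<longleftrightarrow> j * M \<le> y * N"
proof -
  have "cl j \<le> y \<longleftrightarrow> j * M + (N - 1) < (y + 1) * N"
    unfolding cl_def using N0 by (metis Suc_eq_plus1 div_less_iff_less_mult less_Suc_eq_le)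
  also have "\<dots> \<longleftrightarrow> j * M \<le> y * N" using N0 by (simp add: algebra_simps) linarith
  finally show ?thesis .
qed

text \<open>The largest degree allowed for a numerator over \<open>gg j\<close>. For
  \<open>M \<le> m\<close> and \<open>j < N\<close> the subtraction is not truncated, by
  \<open>cl_le_M\<close>.\<close>

definition Dm :: "nat \<Rightarrow> nat \<Rightarrow> nat" where "Dm m j = m + Polynomial.degree (gg j) - cl j"

lemma cl_le_M: "j < N \<Longrightarrow> cl j \<le> M"
  by (simp add: cl_le_iff mult.commute)

text \<open>At each finite point the order of \<open>q\<close> is at most that of \<open>p\<close>
  plus the floor of \<open>j * order f / N\<close>, which is the order of \<open>p * gg j\<close>;
  hence \<open>q\<close> divides \<open>p * gg j\<close>. The condition at infinity then bounds the
  degree of the quotient.\<close>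

lemma aw_RR_D:
  assumes a: "a \<in> Ku" "a \<noteq> 0" and j: "j < N" and m: "M \<le> m" and z: "a * w ^ j \<in> RR (Bm m)"
  shows "\<exists>p. Polynomial.degree p \<le> Dm m j \<and> a = ev p / ev (gg j)"
proof -
  obtain p q where pq: "a = ev p / ev q" "q \<noteq> 0" using a by (auto simp: Ku_def)
  then have pnz: "p \<noteq> 0" using a by auto
  have *: "int (Polynomial.order b q) * int N \<le> int (Polynomial.order b p) * int N + int j * int (Polynomial.order b f)"
    "int (Polynomial.degree p) * int N + int j * int M \<le> int m * int N + int (Polynomial.degree q) * int N" for b
    using z aw_RR_iff[OF pnz pq(2)] unfolding pq(1) by blast+
  have "q dvd p * gg j"
  proof (rule dvd_if_order_le)
    show "q \<noteq> 0" "p * gg j \<noteq> 0" using pq pnz gg_nz by auto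
    fix b
    have "Polynomial.order b q * N \<le> Polynomial.order b p * N + j * Polynomial.order b f"
      using *(1)[of b] by (simp flip: of_nat_mult of_nat_add)
    then have "Polynomial.order b q \<le> (Polynomial.order b p * N + j * Polynomial.order b f) div N"
      using N0 by (simp only: less_eq_div_iff_mult_less_eq)
    also have "\<dots> = Polynomial.order b (p * gg j)"
      using N0 pnz gg_nz by (simp add: order_mult order_gg)
    finally show "Polynomial.order b q \<le> Polynomial.order b (p * gg j)" .
  qed
  then obtain r where r: "p * gg j = q * r" by (elim dvdE)
  have rnz: "r \<noteq> 0" using r pnz gg_nz by auto
  have "ev p * ev (gg j) = ev q * ev r" using r by (metis ev_simps(4))
  then have "a = ev r / ev (gg j)"
    using pq gg_nz[of j] ev_eq_0_iff by (simp add: frac_eq_eq mult.commute)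
  moreover have "Polynomial.degree r \<le> Dm m j"
  proof -
    have d: "Polynomial.degree p + Polynomial.degree (gg j) = Polynomial.degree q + Polynomial.degree r"
      using r pnz rnz pq(2) gg_nz by (metis degree_mult_eq)
    have le: "Polynomial.degree p * N + j * M \<le> (m + Polynomial.degree q) * N"
      using *(2) by (simp add: algebra_simps flip: of_nat_mult of_nat_add)
    then have pm: "Polynomial.degree p \<le> m + Polynomial.degree q"
      using N0 by (metis add_leD1 mult_le_cancel2)
    have "j * M \<le> (m + Polynomial.degree q - Polynomial.degree p) * N"
      using le by (simp add: diff_mult_distrib)
    then have "cl j \<le> m + Polynomial.degree q - Polynomial.degree p" by (simp add: cl_le_iff)
    then show ?thesis using d pm unfolding Dm_def by linarith
  qed
  ultimately show ?thesis by blast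
qed

lemma aw_RR_I:
  assumes j: "j < N" and m: "M \<le> m" and i: "i \<le> Dm m j"
  shows "u ^ i * w ^ j / ev (gg j) \<in> RR (Bm m)"
proof -
  let ?p = "[:0, 1:] ^ i :: 'a poly"
  have "ev ?p = u ^ i" by (simp add: ev_simps evp_X hom)
  then have e: "u ^ i * w ^ j / ev (gg j) = ev ?p / ev (gg j) * w ^ j" by simp
  have p: "?p \<noteq> 0" "Polynomial.degree ?p = i" by (simp_all add: degree_power_eq)
  have "cl j \<le> m" using cl_le_M[OF j] m by simp
  then have "j * M \<le> m * N" by (simp add: cl_le_iff)
  have "i + cl j \<le> m + Polynomial.degree (gg j)" using i \<open>cl j \<le> m\<close> by (simp add: Dm_def)
  then have "(i + cl j) * N \<le> (m + Polynomial.degree (gg j)) * N" by (rule mult_le_mono1)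
  moreover have "j * M \<le> cl j * N" using cl_le_iff[of j "cl j"] by simp
  ultimately have "i * N + j * M \<le> m * N + Polynomial.degree (gg j) * N"
    by (simp add: add_mult_distrib)
  then have "int i * int N + int j * int M \<le> int m * int N + int (Polynomial.degree (gg j)) * int N"
    by (simp flip: of_nat_mult of_nat_add)
  moreover have "int (Polynomial.order b (gg j)) * int N \<le> int (Polynomial.order b ?p) * int N + int j * int (Polynomial.order b f)" for b
  proof -
    have "j * Polynomial.order b f div N * N \<le> j * Polynomial.order b f" by simp
    then have "Polynomial.order b (gg j) * N \<le> Polynomial.order b ?p * N + j * Polynomial.order b f"
      by (simp add: order_gg trans_le_add2)
    then show ?thesis by (simp flip: of_nat_mult of_nat_add)
  qed
  ultimately show ?thesis unfolding e using aw_RR_iff[OF p(1) gg_nz] p(2) by simp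
qed

text \<open>The elements \<open>u ^ i * w ^ j / gg j\<close> with \<open>i \<le> Dm m j\<close> form
  a basis: \<open>RR_isotypic\<close> separates the exponents \<open>j\<close>, and
  \<open>aw_RR_D\<close> describes the coefficient of each.\<close>

lemma hasdim_Bm:
  assumes m: "M \<le> m"
  shows "hasdim (RR (Bm m)) (\<Sum>j<N. Dm m j + 1)"
proof -
  let ?I = "SIGMA j:{..<N}. {..Dm m j}"
  let ?b = "\<lambda>(j, i). u ^ i * w ^ j / ev (gg j)"
  have ev_sum: "(\<Sum>i\<le>d. h (c i) * u ^ i) = ev (\<Sum>i\<le>d. Polynomial.monom (c i) i)" for c :: "nat \<Rightarrow> 'a" and d
  proof -
    have "ev (Polynomial.monom a i) = h a * u ^ i" for a i
      by (simp add: monom_altdef evp_smult hom ev_simps evp_X)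
    then show ?thesis by (simp add: ev_simps)
  qed
  have sum: "(\<Sum>x\<in>?I. h (c x) * ?b x) =
     lin (\<lambda>j. ev (\<Sum>i\<le>Dm m j. Polynomial.monom (c (j, i)) i) / ev (gg j))" for c
  proof -
    have "(\<Sum>x\<in>?I. h (c x) * ?b x) = (\<Sum>j<N. \<Sum>i\<le>Dm m j. h (c (j, i)) * (u ^ i * w ^ j / ev (gg j)))"
      by (subst sum.Sigma) (auto simp: case_prod_beta)
    also have "\<dots> = (\<Sum>j<N. (\<Sum>i\<le>Dm m j. h (c (j, i)) * u ^ i) / ev (gg j) * w ^ j)"
      by (simp add: sum_distrib_right sum_distrib_left sum_divide_distrib mult_ac)
    finally show ?thesis by (simp add: ev_sum lin_def)
  qed
  have "hasdim (RR (Bm m)) (card ?I)"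
  proof (rule hasdim_family[where b = ?b])
    fix c assume "(\<Sum>x\<in>?I. h (c x) * ?b x) = 0"
    then have z: "lin (\<lambda>j. ev (\<Sum>i\<le>Dm m j. Polynomial.monom (c (j, i)) i) / ev (gg j)) = 0"
      by (simp add: sum)
    show "\<forall>x\<in>?I. c x = 0"
    proof
      fix x assume "x \<in> ?I"
      then obtain j i where x: "x = (j, i)" "j < N" "i \<le> Dm m j" by auto
      have "ev (\<Sum>i\<le>Dm m j. Polynomial.monom (c (j, i)) i) / ev (gg j) = 0"
        by (rule indep_overD[OF indep_Ku _ z[unfolded lin_def] x(2)]) (rule KuI[OF gg_nz])
      then have "(\<Sum>i\<le>Dm m j. Polynomial.monom (c (j, i)) i) = 0"
        using ev_eq_0_iff gg_nz by simp
      then have "Polynomial.coeff (\<Sum>i\<le>Dm m j. Polynomial.monom (c (j, i)) i) i = 0" by simp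
      then show "c x = 0" using x by (simp add: coeff_sum)
    qed
  next
    show "RR (Bm m) = {\<Sum>x\<in>?I. h (c x) * ?b x | c. True}"
    proof (intro equalityI subsetI)
      fix z assume z: "z \<in> RR (Bm m)"
      then have "z \<in> L" by (simp add: RR_iff)
      then obtain a where a: "z = lin a" "\<And>j. a j \<in> Ku" by (elim L_E) blast
      have "\<forall>j. \<exists>p. j < N \<longrightarrow> Polynomial.degree p \<le> Dm m j \<and> a j = ev p / ev (gg j)"
      proof (intro allI)
        fix j
        show "\<exists>p. j < N \<longrightarrow> Polynomial.degree p \<le> Dm m j \<and> a j = ev p / ev (gg j)"
        proof (cases "a j = 0")
          case True
          then show ?thesis by (intro exI[of _ 0]) simp
        next
          case False
          then show ?thesis using aw_RR_D[OF a(2) False _ m] RR_isotypic[OF z[unfolded a(1)] a(2)] by blast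
        qed
      qed
      then obtain p where p: "\<And>j. j < N \<Longrightarrow> Polynomial.degree (p j) \<le> Dm m j \<and> a j = ev (p j) / ev (gg j)"
        by metis
      have "z = (\<Sum>x\<in>?I. h (Polynomial.coeff (p (fst x)) (snd x)) * ?b x)"
        unfolding sum a(1) lin_def
        by (intro sum.cong refl) (use p in \<open>simp add: poly_as_sum_of_monoms'\<close>)
      then show "z \<in> {\<Sum>x\<in>?I. h (c x) * ?b x | c. True}"
        by (intro CollectI exI[of _ "\<lambda>x. Polynomial.coeff (p (fst x)) (snd x)"] conjI TrueI)
    next
      fix z assume "z \<in> {\<Sum>x\<in>?I. h (c x) * ?b x | c. True}"
      then obtain c where c: "z = (\<Sum>x\<in>?I. h (c x) * ?b x)" by blast
      show "z \<in> RR (Bm m)" unfolding c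
        by (intro RR_sum RR_smult) (use aw_RR_I[OF _ m] in auto)
    qed
  qed auto
  then show ?thesis by simp
qed

text \<open>Chosen so that \<open>RR (Bm m)\<close> has dimension \<open>deg + 1 - G\<close> for all
  \<open>m \<ge> M\<close>. The ceilings come from infinity; the degrees of \<open>gg j\<close> are
  sums of floors over the zeros of \<open>f\<close>.\<close>

definition G :: int where
  "G = 1 - int N + (\<Sum>j<N. int (cl j)) - (\<Sum>j<N. int (Polynomial.degree (gg j)))"

lemma dim_Bm: "M \<le> m \<Longrightarrow> int (\<Sum>j<N. Dm m j + 1) = int m * int N + 1 - G"
proof -
  assume m: "M \<le> m"
  have "int (Dm m j + 1) = int m + 1 + int (Polynomial.degree (gg j)) - int (cl j)" if "j < N" for j
    using cl_le_M[OF that] m by (simp add: Dm_def)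
  then have "int (\<Sum>j<N. Dm m j + 1) = (\<Sum>j<N. int m + 1 + int (Polynomial.degree (gg j)) - int (cl j))"
    unfolding of_nat_sum by (intro sum.cong) auto
  then show ?thesis by (simp add: G_def sum.distrib sum_subtractf algebra_simps)
qed

text \<open>Above each root there are as many places as the gcd says, and the ramification index is
  \<open>N\<close> divided by that gcd, so the root contributes its order times \<open>N\<close>. In
  the same way infinity contributes \<open>- degree * N\<close>.\<close>

lemma principal_divisor:
  assumes "q \<noteq> 0"
  shows "(\<lambda>P. val P (ev q)) \<in> divs" "deg (\<lambda>P. val P (ev q)) = 0"
proof -
  let ?R = "{b. poly q b = 0}"
  have fR: "finite ?R" using poly_roots_finite assms by blast
  let ?S = "(\<Union>b\<in>?R. pfin b) \<union> pinf"
  have fS: "finite ?S" "?S \<subseteq> places" using fR pfin_card pinf_card by (auto simp: pfin_def pinf_def)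
  have supp: "P \<in> ?S" if P: "P \<in> places" "val P (ev q) \<noteq> 0" for P
    using places_cases[OF P(1)]
  proof
    assume "\<exists>a. P \<in> pfin a"
    then obtain b where b: "P \<in> pfin b" by blast
    then have "Polynomial.order b q \<noteq> 0" using ev_fin[OF b assms] P(2) by auto
    then show ?thesis using b assms by (auto simp: order_root)
  qed simp
  then show "(\<lambda>P. val P (ev q)) \<in> divs"
    unfolding divs_def mem_Collect_eq by (intro finite_subset[OF _ fS(1)]) auto
  have "deg (\<lambda>P. val P (ev q)) = (\<Sum>P\<in>?S. val P (ev q))"
    by (rule deg_eq[OF fS]) (use supp in auto)
  also have "\<dots> = (\<Sum>P\<in>(\<Union>b\<in>?R. pfin b). val P (ev q)) + (\<Sum>P\<in>pinf. val P (ev q))"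
    by (rule sum.union_disjoint) (use fS pfin_pinf_disjoint in auto)
  also have "(\<Sum>P\<in>(\<Union>b\<in>?R. pfin b). val P (ev q)) = (\<Sum>b\<in>?R. \<Sum>P\<in>pfin b. val P (ev q))"
    by (rule sum.UNION_disjoint) (use fR pfin_card pfin_disjoint in auto)
  also have "\<dots> = (\<Sum>b\<in>?R. int (Polynomial.order b q) * int N)"
  proof (rule sum.cong[OF refl])
    fix b
    let ?g = "gcd N (Polynomial.order b f)"
    have "(\<Sum>P\<in>pfin b. val P (ev q)) = (\<Sum>P\<in>pfin b. int (Polynomial.order b q) * int (N div ?g))"
      by (rule sum.cong) (simp_all add: ev_fin assms w_fin)
    also have "\<dots> = int (Polynomial.order b q) * int (?g * (N div ?g))"
      unfolding sum_constant pfin_card(2) by (simp only: of_nat_mult mult_ac)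
    finally show "(\<Sum>P\<in>pfin b. val P (ev q)) = int (Polynomial.order b q) * int N" by simp
  qed
  also have "\<dots> = int (Polynomial.degree q) * int N"
    using sum_order_eq_degree[OF assms] by (simp flip: sum_distrib_right of_nat_sum)
  also have "(\<Sum>P\<in>pinf. val P (ev q)) = (\<Sum>P\<in>pinf. - (int (Polynomial.degree q) * int (N div gcd N M)))"
    by (rule sum.cong) (simp_all add: ev_inf assms w_inf)
  also have "\<dots> = - (int (Polynomial.degree q) * int (gcd N M * (N div gcd N M)))"
    unfolding sum_constant pinf_card(2) by (simp only: of_nat_mult mult_ac mult_minus_left mult_minus_right)
  finally show "deg (\<lambda>P. val P (ev q)) = 0" by simp
qed

text \<open>\<open>e\<close> bounds all coefficients of \<open>A\<close>, and \<open>q\<close> gets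
  a zero of order at least \<open>e\<close> below every finite place in the support. Ramification
  indices being at least 1, this cancels \<open>A\<close> at finite places; at infinity
  \<open>m\<close> absorbs both \<open>e\<close> and the pole of \<open>q\<close>.\<close>

lemma divisor_dominated:
  assumes A: "A \<in> divs"
  shows "\<exists>q m. q \<noteq> 0 \<and> M \<le> m \<and> (\<forall>P\<in>places. A P - val P (ev q) \<le> Bm m P)"
proof -
  let ?S = "{P \<in> places. A P \<noteq> 0}"
  have fS: "finite ?S" using A by (simp add: divs_def)
  define e where "e = nat (\<Sum>P\<in>?S. \<bar>A P\<bar>)"
  have e: "A P \<le> int e" if "P \<in> places" for P
  proof (cases "A P = 0")
    case False
    then have "\<bar>A P\<bar> \<le> (\<Sum>P\<in>?S. \<bar>A P\<bar>)" using that fS by (intro member_le_sum) auto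
    then show ?thesis by (simp add: e_def)
  qed simp
  \<comment> \<open>For a place at infinity \<open>pt\<close> is an arbitrary element, which at most
    adds a harmless zero to \<open>q\<close>.\<close>
  define pt where "pt P = (THE b. P \<in> pfin b)" for P
  have pt: "pt P = b" if "P \<in> pfin b" for P b
    unfolding pt_def by (rule the_equality) (use that pfin_disjoint in auto)
  define T where "T = pt ` ?S"
  have fT: "finite T" using fS by (simp add: T_def)
  define q where "q = (\<Prod>b\<in>T. [:- b, 1:] ^ e)"
  have qnz: "q \<noteq> 0" using fT by (auto simp: q_def)
  have ordq: "Polynomial.order b q \<ge> e" if "b \<in> T" for b
  proof -
    have "[:- b, 1:] ^ e dvd q" unfolding q_def using fT that by (intro dvd_prodI) auto
    then show ?thesis using qnz by (simp add: order_divides)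
  qed
  define m where "m = M + e + Polynomial.degree q"
  have "A P - val P (ev q) \<le> Bm m P" if P: "P \<in> places" for P
    using places_cases[OF P]
  proof
    assume i: "P \<in> pinf"
    let ?n = "int (N div gcd N M)"
    have n: "?n \<ge> 1" using N0 by (simp add: div_greater_zero_iff gcd_le1_nat Suc_le_eq)
    have "int e * 1 \<le> int e * ?n" using n by (intro mult_left_mono) auto
    then have "A P \<le> int e * ?n" using e[OF P] by simp
    also have "\<dots> \<le> (int e + int M) * ?n" using n by (intro mult_right_mono) auto
    finally show ?thesis using ev_inf[OF i qnz] w_inf(1)[OF i] i by (simp add: Bm_def m_def algebra_simps)
  next
    assume "\<exists>b. P \<in> pfin b"
    then obtain b where b: "P \<in> pfin b" by blast
    let ?n = "int (N div gcd N (Polynomial.order b f))"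
    have n: "?n \<ge> 1" using N0 by (simp add: div_greater_zero_iff gcd_le1_nat Suc_le_eq)
    have v: "val P (ev q) = int (Polynomial.order b q) * ?n" using ev_fin[OF b qnz] w_fin(1)[OF b] by simp
    have "A P \<le> val P (ev q)"
    proof (cases "A P = 0")
      case True
      then show ?thesis by (simp add: v)
    next
      case False
      then have "b \<in> T" using P pt[OF b] by (auto simp: T_def)
      then have "int e \<le> int (Polynomial.order b q)" using ordq by simp
      also have "int (Polynomial.order b q) * 1 \<le> int (Polynomial.order b q) * ?n"
        using n by (intro mult_left_mono) auto
      then have "int (Polynomial.order b q) \<le> val P (ev q)" unfolding v by simp
      finally show ?thesis using e[OF P] by simp
    qed
    then show ?thesis using pfin_pinf_disjoint[OF b] by (simp add: Bm_def)
  qed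
  then show ?thesis using qnz by (intro exI[of _ q] exI[of _ m]) (simp add: m_def)
qed

text \<open>Descent from \<open>Bm m\<close> to \<open>A\<close> shifted by a principal divisor: the
  dimension drops at most by the difference of the degrees, and the dimension for
  \<open>Bm m\<close> is known exactly.\<close>

theorem riemann:
  assumes A: "A \<in> divs"
  shows "\<exists>d. hasdim (RR A) d \<and> deg A - int d + 1 \<le> G"
proof -
  obtain q m where q: "q \<noteq> 0" "M \<le> m" "\<And>P. P \<in> places \<Longrightarrow> A P - val P (ev q) \<le> Bm m P"
    using divisor_dominated[OF A] by blast
  let ?v = "\<lambda>P. - val P (ev q)"
  have v: "?v \<in> divs" "deg ?v = 0"
    using principal_divisor[OF q(1)] by (simp_all add: divs_def deg_def sum_negf)
  let ?A = "\<lambda>P. A P - val P (ev q)"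
  have A': "?A \<in> divs" "deg ?A = deg A" using deg_add[OF A v(1)] v(2) by simp_all
  obtain d where d: "hasdim (RR ?A) d" "int (\<Sum>j<N. Dm m j + 1) - int d \<le> deg (Bm m) - deg ?A"
    using RR_descend[OF A'(1) Bm_divs q(3) hasdim_Bm[OF q(2)]] by blast
  have "ev q \<in> L" "ev q \<noteq> 0" using Ku_L[OF ev_Ku] ev_eq_0_iff q by auto
  then have "hasdim (RR A) d" using RR_shift d(1) by blast
  then show ?thesis using d(2) unfolding dim_Bm[OF q(2)] deg_Bm A'(2) by (intro exI[of _ d]) simp
qed

lemma riemann_sharp: "hasdim (RR (Bm M)) (\<Sum>j<N. Dm M j + 1)" "deg (Bm M) - int (\<Sum>j<N. Dm M j + 1) + 1 = G"
  using hasdim_Bm[of M] dim_Bm[of M] by (simp_all add: deg_Bm)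

end

subsection \<open>Evaluation of the genus\<close>

lemma card_multiples_gcd:
  fixes N m :: nat
  assumes N: "N > 0"
  shows "card {j \<in> {..<N}. N dvd j * m} = gcd N m"
proof -
  define g where "g = gcd N m"
  obtain n k where nk: "N = g * n" "m = g * k" "coprime n k"
    unfolding g_def using gcd_coprime_exists[of N m] N by (metis gcd_nat.eq_neutr_iff mult.commute not_gr0)
  have g0: "g > 0" "n > 0" using N nk by auto
  have "N dvd j * m \<longleftrightarrow> n dvd j" for j
  proof -
    have "N dvd j * m \<longleftrightarrow> g * n dvd g * (j * k)" by (simp add: nk(1,2) mult_ac)
    also have "\<dots> \<longleftrightarrow> n dvd j" using g0 nk(3) by (simp add: coprime_dvd_mult_left_iff)
    finally show ?thesis .
  qed
  then have "{j \<in> {..<N}. N dvd j * m} = (\<lambda>i. n * i) ` {..<g}"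
    using g0 by (auto simp: nk(1) elim!: dvdE)
  moreover have "inj_on (\<lambda>i. n * i) {..<g}" using g0 by (auto intro: inj_onI)
  ultimately show ?thesis by (simp add: card_image g_def)
qed

text \<open>Since \<open>(N - j) * m / N = m - j * m / N\<close>, the ceiling on one side
  complements the floor on the other; adding \<open>N - 1\<close> before \<open>div\<close> rounds
  up.\<close>

lemma floor_reflect:
  fixes N m j :: nat
  assumes "j \<le> N" "N > 0"
  shows "j * m div N + ((N - j) * m + (N - 1)) div N = m"
proof -
  define q r where "q = j * m div N" and "r = j * m mod N"
  have jm: "j * m = N * q + r" by (simp add: q_def r_def)
  have r: "r < N" using assms by (simp add: r_def)
  have le: "N * q + r \<le> N * m" using jm assms mult_le_mono1[OF assms(1), of m] by simp
  then have "N * q \<le> N * m" by (rule add_leD1)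
  then have "q \<le> m" using assms(2) by (simp only: mult_le_cancel1)
  have "(N - j) * m + (N - 1) = N * (m - q) + (N - 1 - r)"
    using jm le r \<open>q \<le> m\<close> by (simp add: diff_mult_distrib diff_mult_distrib2)
  also have "\<dots> div N = m - q"
    using r assms by (subst div_mult_self4) auto
  finally show ?thesis using \<open>q \<le> m\<close> by (simp add: q_def)
qed

lemma ceil_floor:
  fixes N a :: nat
  assumes "N > 0"
  shows "(a + (N - 1)) div N = a div N + (if N dvd a then 0 else 1)"
proof -
  define q r where "q = a div N" and "r = a mod N"
  have a: "a = N * q + r" "r < N" using assms by (simp_all add: q_def r_def)
  have "a + (N - 1) = N * q + (r + (N - 1))" using a(1) by (simp only: add.assoc)
  then have "(a + (N - 1)) div N = q + (r + (N - 1)) div N"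
    using assms by (simp only: div_mult_self4)
  also have "(r + (N - 1)) div N = (if r = 0 then 0 else 1)"
    using a(2) assms by (auto intro!: div_nat_eqI)
  finally show ?thesis by (auto simp: q_def r_def dvd_eq_mod_eq_0)
qed

text \<open>Two linear equations for the sum \<open>?F\<close> of floors and the sum
  \<open>?C\<close> of ceilings: they differ by 1 for each \<open>j\<close> with
  \<open>j * m\<close> not divisible by \<open>N\<close>, and pairing \<open>j\<close> with
  \<open>N - j\<close> gives \<open>?F + ?C = m * (N - 1)\<close>.\<close>

lemma sum_floor_gcd:
  fixes N m :: nat
  assumes N: "N > 0"
  shows "2 * (\<Sum>j<N. int (j * m div N)) = (int m - 1) * (int N - 1) + int (gcd N m) - 1"
    and "2 * (\<Sum>j<N. int ((j * m + (N - 1)) div N)) = (int m + 1) * (int N - 1) - int (gcd N m) + 1"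
proof -
  let ?F = "\<Sum>j<N. int (j * m div N)" and ?C = "\<Sum>j<N. int ((j * m + (N - 1)) div N)"
  have "?C = ?F + (\<Sum>j<N. if N dvd j * m then 0 else 1)"
    unfolding sum.distrib[symmetric] ceil_floor[OF N] by (rule sum.cong) auto
  also have "(\<Sum>j<N. if N dvd j * m then 0 else 1) = (\<Sum>j<N. 1 - (if N dvd j * m then 1 else 0 :: int))"
    by (rule sum.cong) auto
  also have "\<dots> = int N - int (card {j \<in> {..<N}. N dvd j * m})"
    by (simp add: sum_subtractf sum.If_cases Int_def)
  also have "\<dots> = int N - int (gcd N m)" by (simp only: card_multiples_gcd[OF N])
  finally have 1: "?C = ?F + int N - int (gcd N m)" by simp
  have "(\<Sum>j\<in>{1..<N}. int (j * m div N) + int (((N - j) * m + (N - 1)) div N)) = (\<Sum>j\<in>{1..<N}. int m)"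
    by (rule sum.cong) (use floor_reflect[of _ N m] N in \<open>auto simp flip: of_nat_add\<close>)
  then have "(\<Sum>j\<in>{1..<N}. int (j * m div N)) + (\<Sum>j\<in>{1..<N}. int (((N - j) * m + (N - 1)) div N)) = int m * (int N - 1)"
    using N by (simp add: sum.distrib of_nat_diff)
  moreover have "(\<Sum>j\<in>{1..<N}. int (((N - j) * m + (N - 1)) div N)) = (\<Sum>j\<in>{1..<N}. int ((j * m + (N - 1)) div N))"
    by (rule sum.reindex_bij_witness[of _ "\<lambda>j. N - j" "\<lambda>j. N - j"]) auto
  moreover have "{..<N} = insert 0 {1..<N}" using N by auto
  then have "?F = (\<Sum>j\<in>{1..<N}. int (j * m div N))" "?C = (\<Sum>j\<in>{1..<N}. int ((j * m + (N - 1)) div N))"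
    using N by simp_all
  ultimately have 2: "?F + ?C = int m * (int N - 1)" by simp
  show "2 * ?F = (int m - 1) * (int N - 1) + int (gcd N m) - 1"
    "2 * ?C = (int m + 1) * (int N - 1) - int (gcd N m) + 1"
    using 1 2 by (simp_all add: algebra_simps)
qed

text \<open>The Riemann-Hurwitz formula for the cover given by u, read off from the floor and
  ceiling sums. The terms \<open>M * (N - 1)\<close> cancel because the orders of the roots of
  \<open>f\<close> add up to its degree.\<close>

lemma (in kummer) genus_formula:
  "2 * G - 2 = - 2 * int N + (\<Sum>b | poly f b = 0. int N - int (gcd N (Polynomial.order b f)))
     + (int N - int (gcd N M))"
proof -
  have "(\<Sum>j<N. int (Polynomial.degree (gg j))) = (\<Sum>b | poly f b = 0. \<Sum>j<N. int (j * Polynomial.order b f div N))"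
    by (subst sum.swap) (simp add: degree_gg)
  then have "2 * (\<Sum>j<N. int (Polynomial.degree (gg j))) =
      (\<Sum>b | poly f b = 0. 2 * (\<Sum>j<N. int (j * Polynomial.order b f div N)))"
    by (simp add: sum_distrib_left)
  also have "\<dots> = (\<Sum>b | poly f b = 0. (int (Polynomial.order b f) - 1) * (int N - 1) + int (gcd N (Polynomial.order b f)) - 1)"
    by (simp add: sum_floor_gcd(1)[OF N0])
  also have "\<dots> = (\<Sum>b | poly f b = 0. int (Polynomial.order b f) * (int N - 1) - (int N - int (gcd N (Polynomial.order b f))))"
    by (rule sum.cong) (auto simp: algebra_simps)
  also have "\<dots> = int M * (int N - 1) - (\<Sum>b | poly f b = 0. int N - int (gcd N (Polynomial.order b f)))"
    by (simp add: sum_subtractf flip: sum_distrib_right sum_order_eq_degree[OF f0])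
  finally have g: "2 * (\<Sum>j<N. int (Polynomial.degree (gg j))) =
    int M * (int N - 1) - (\<Sum>b | poly f b = 0. int N - int (gcd N (Polynomial.order b f)))" .
  have c: "2 * (\<Sum>j<N. int (cl j)) = (int M + 1) * (int N - 1) - int (gcd N M) + 1"
    unfolding cl_def by (rule sum_floor_gcd(2)[OF N0])
  have "2 * G - 2 = - 2 * int N + 2 * (\<Sum>j<N. int (cl j)) - 2 * (\<Sum>j<N. int (Polynomial.degree (gg j)))"
    by (simp add: G_def)
  then show ?thesis unfolding g c by (simp add: algebra_simps)
qed

section \<open>Transfer between abstract fields and subfields of a field type\<close>

text \<open>The interface between ring records and field types: an abstract field with an embedding
  into \<open>'b\<close>. Subsets are moved by image one way and by \<open>pre\<close> the other
  way.\<close>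

locale field_embed =
  fixes F :: "'f ring" and \<phi> :: "'f \<Rightarrow> 'b::field"
  assumes F: "Ring.field F"
    and phi_mult: "\<And>x y. x \<in> carrier F \<Longrightarrow> y \<in> carrier F \<Longrightarrow> \<phi> (x \<otimes>\<^bsub>F\<^esub> y) = \<phi> x * \<phi> y"
    and phi_add: "\<And>x y. x \<in> carrier F \<Longrightarrow> y \<in> carrier F \<Longrightarrow> \<phi> (x \<oplus>\<^bsub>F\<^esub> y) = \<phi> x + \<phi> y"
    and phi_one: "\<phi> \<one>\<^bsub>F\<^esub> = 1"
    and inj: "inj_on \<phi> (carrier F)"
begin

sublocale F: Ring.field F by (rule F)

lemma phi_zero: "\<phi> \<zero>\<^bsub>F\<^esub> = 0"
proof -
  have "\<phi> \<zero>\<^bsub>F\<^esub> + \<phi> \<zero>\<^bsub>F\<^esub> = \<phi> \<zero>\<^bsub>F\<^esub> + 0"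
    using phi_add[of "\<zero>\<^bsub>F\<^esub>" "\<zero>\<^bsub>F\<^esub>"] by (simp only: F.zero_closed F.l_zero add_0_right)
  then show ?thesis by (rule add_left_imp_eq)
qed

lemma phi_eq_iff: "x \<in> carrier F \<Longrightarrow> y \<in> carrier F \<Longrightarrow> \<phi> x = \<phi> y \<longleftrightarrow> x = y"
  using inj by (auto dest: inj_onD)

lemma phi_eq_0_iff: "x \<in> carrier F \<Longrightarrow> \<phi> x = 0 \<longleftrightarrow> x = \<zero>\<^bsub>F\<^esub>"
  using phi_eq_iff[of x "\<zero>\<^bsub>F\<^esub>"] phi_zero by simp

lemma phi_a_inv: "x \<in> carrier F \<Longrightarrow> \<phi> (\<ominus>\<^bsub>F\<^esub> x) = - \<phi> x"
  using phi_add[of "\<ominus>\<^bsub>F\<^esub> x" x] by (simp add: F.l_neg phi_zero eq_neg_iff_add_eq_0)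

lemma inv_closed: "x \<in> carrier F \<Longrightarrow> x \<noteq> \<zero>\<^bsub>F\<^esub> \<Longrightarrow> inv\<^bsub>F\<^esub> x \<in> carrier F"
  using F.field_Units by blast

lemma phi_inv:
  assumes "x \<in> carrier F" "x \<noteq> \<zero>\<^bsub>F\<^esub>"
  shows "\<phi> (inv\<^bsub>F\<^esub> x) = inverse (\<phi> x)"
proof -
  have "x \<in> Units F" using assms F.field_Units by blast
  then have "\<phi> (x \<otimes>\<^bsub>F\<^esub> inv\<^bsub>F\<^esub> x) = 1" by (simp add: phi_one F.Units_r_inv)
  then have "\<phi> x * \<phi> (inv\<^bsub>F\<^esub> x) = 1" using phi_mult assms inv_closed by simp
  then show ?thesis by (metis inverse_unique)
qed

lemma phi_nat_pow: "x \<in> carrier F \<Longrightarrow> \<phi> (x [^]\<^bsub>F\<^esub> (n::nat)) = \<phi> x ^ n"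
  by (induction n) (simp_all add: phi_one phi_mult F.nat_pow_Suc mult.commute)

lemma phi_int_pow:
  assumes "x \<in> carrier F" "x \<noteq> \<zero>\<^bsub>F\<^esub>"
  shows "x [^]\<^bsub>F\<^esub> (i::int) \<in> carrier F" "\<phi> (x [^]\<^bsub>F\<^esub> i) = \<phi> x powi i"
proof -
  have "\<phi> (x [^]\<^bsub>F\<^esub> n) \<noteq> 0" for n :: nat
    using assms by (simp add: phi_nat_pow phi_eq_0_iff)
  then have nz: "x [^]\<^bsub>F\<^esub> n \<noteq> \<zero>\<^bsub>F\<^esub>" for n :: nat using phi_zero by metis
  have c: "x [^]\<^bsub>F\<^esub> n \<in> carrier F" for n :: nat
    using assms by simp
  have "x [^]\<^bsub>F\<^esub> i \<in> carrier F \<and> \<phi> (x [^]\<^bsub>F\<^esub> i) = \<phi> x powi i"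
  proof (cases "i < 0")
    case True
    then have e: "x [^]\<^bsub>F\<^esub> i = inv\<^bsub>F\<^esub> (x [^]\<^bsub>F\<^esub> nat (- i))" by (simp only: int_pow_def2 if_True)
    have "\<phi> (x [^]\<^bsub>F\<^esub> i) = inverse (\<phi> x ^ nat (- i))"
      unfolding e phi_inv[OF c nz] by (simp only: phi_nat_pow[OF assms(1)])
    also have "\<dots> = \<phi> x powi i" using True by (simp add: power_int_def power_inverse)
    finally have 1: "\<phi> (x [^]\<^bsub>F\<^esub> i) = \<phi> x powi i" .
    have "x [^]\<^bsub>F\<^esub> i \<in> carrier F" unfolding e by (rule inv_closed[OF c nz])
    with 1 show ?thesis by blast
  next
    case False
    then have e: "x [^]\<^bsub>F\<^esub> i = x [^]\<^bsub>F\<^esub> nat i" by (simp only: int_pow_def2 if_False)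
    have "x [^]\<^bsub>F\<^esub> i \<in> carrier F" unfolding e by (rule c)
    moreover have "\<phi> (x [^]\<^bsub>F\<^esub> i) = \<phi> x ^ nat i" unfolding e by (rule phi_nat_pow[OF assms(1)])
    ultimately show ?thesis using False by (simp add: power_int_def)
  qed
  then show "x [^]\<^bsub>F\<^esub> i \<in> carrier F" "\<phi> (x [^]\<^bsub>F\<^esub> i) = \<phi> x powi i" by blast+
qed

definition "img = \<phi> ` carrier F"

definition "pre S = {x \<in> carrier F. \<phi> x \<in> S}"

lemma pre_sub: "pre S \<subseteq> carrier F" by (auto simp: pre_def)

lemma image_pre: "S \<subseteq> img \<Longrightarrow> \<phi> ` pre S = S"
  by (auto simp: pre_def img_def)

lemma pre_image: "P \<subseteq> carrier F \<Longrightarrow> pre (\<phi> ` P) = P"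
  using phi_eq_iff by (auto simp: pre_def)

lemma mem_image: "P \<subseteq> carrier F \<Longrightarrow> x \<in> carrier F \<Longrightarrow> \<phi> x \<in> \<phi> ` P \<longleftrightarrow> x \<in> P"
  using phi_eq_iff by auto

lemma subfld_img: "subfld img"
  unfolding subfld_def
proof (intro conjI ballI)
  show "1 \<in> img" unfolding img_def by (metis F.one_closed image_eqI phi_one)
  fix a assume "a \<in> img"
  then obtain x where x: "x \<in> carrier F" "a = \<phi> x" by (auto simp: img_def)
  show "- a \<in> img" using x phi_a_inv[of x] by (auto simp: img_def intro!: image_eqI[of _ _ "\<ominus>\<^bsub>F\<^esub> x"])
  show "inverse a \<in> img"
  proof (cases "x = \<zero>\<^bsub>F\<^esub>")
    case False
    then show ?thesis using x phi_inv[of x] inv_closed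
      by (auto simp: img_def intro!: image_eqI[of _ _ "inv\<^bsub>F\<^esub> x"])
  qed (use x phi_zero in \<open>auto simp: img_def\<close>)
  fix b assume "b \<in> img"
  then obtain y where y: "y \<in> carrier F" "b = \<phi> y" by (auto simp: img_def)
  show "a + b \<in> img" using x y phi_add[of x y] by (auto simp: img_def intro!: image_eqI[of _ _ "x \<oplus>\<^bsub>F\<^esub> y"])
  show "a * b \<in> img" using x y phi_mult[of x y] by (auto simp: img_def intro!: image_eqI[of _ _ "x \<otimes>\<^bsub>F\<^esub> y"])
qed

lemma places_image:
  assumes k: "k \<subseteq> carrier F" and P: "P \<subseteq> carrier F"
  shows "P \<in> places k F \<longleftrightarrow> isplace (\<phi> ` k) img (\<phi> ` P)"
proof
  assume "P \<in> places k F"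
  then have *: "subring P F" "k \<subset> P" "P \<subset> carrier F"
    "\<And>z. z \<in> carrier F \<Longrightarrow> z \<noteq> \<zero>\<^bsub>F\<^esub> \<Longrightarrow> z \<in> P \<or> inv\<^bsub>F\<^esub> z \<in> P"
    by (auto simp: places_def)
  note S = subringE[OF *(1)]
  show "isplace (\<phi> ` k) img (\<phi> ` P)"
    unfolding isplace_def
  proof (intro conjI ballI impI)
    show "1 \<in> \<phi> ` P" using S(3) phi_one by (metis imageI)
    show "a + b \<in> \<phi> ` P" "a * b \<in> \<phi> ` P" if ab: "a \<in> \<phi> ` P" "b \<in> \<phi> ` P" for a b
    proof -
      obtain x y where xy: "x \<in> P" "y \<in> P" "a = \<phi> x" "b = \<phi> y" using ab by blast
      then show "a + b \<in> \<phi> ` P" "a * b \<in> \<phi> ` P"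
        using S(6)[of x y] S(7)[of x y] phi_add[of x y] phi_mult[of x y] P by (metis imageI subsetD)+
    qed
    show "- a \<in> \<phi> ` P" if "a \<in> \<phi> ` P" for a
      using that S(5) phi_a_inv P by (metis (no_types, lifting) image_iff subsetD)
    show "\<phi> ` k \<subset> \<phi> ` P" using *(2) P inj by (metis inj_on_image_eq_iff k psubset_eq subset_image_iff)
    show "\<phi> ` P \<subset> img" using *(3) inj unfolding img_def by (metis inj_on_image_eq_iff psubset_eq subset_refl image_mono)
    show "z \<in> \<phi> ` P \<or> inverse z \<in> \<phi> ` P" if z: "z \<in> img" "z \<noteq> 0" for z
    proof -
      obtain x where x: "x \<in> carrier F" "z = \<phi> x" using z by (auto simp: img_def)
      then have "x \<noteq> \<zero>\<^bsub>F\<^esub>" using z phi_zero by auto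
      then show ?thesis using *(4)[OF x(1)] x phi_inv by (metis imageI)
    qed
  qed
next
  assume Q: "isplace (\<phi> ` k) img (\<phi> ` P)"
  interpret valring "\<phi> ` k" img "\<phi> ` P" by unfold_locales (rule Q, rule subfld_img)
  have mem: "x \<in> P \<longleftrightarrow> \<phi> x \<in> \<phi> ` P" if "x \<in> carrier F" for x using mem_image[OF P that] by simp
  have "subring P F"
  proof (rule F.subringI[OF P])
    show "\<one>\<^bsub>F\<^esub> \<in> P" by (simp add: mem phi_one P_closed)
    show "\<ominus>\<^bsub>F\<^esub> x \<in> P" if "x \<in> P" for x
      using that P mem[of "\<ominus>\<^bsub>F\<^esub> x"] phi_a_inv[of x] P_closed(4)[of "\<phi> x"] by auto
    show "x \<otimes>\<^bsub>F\<^esub> y \<in> P" "x \<oplus>\<^bsub>F\<^esub> y \<in> P" if xy: "x \<in> P" "y \<in> P" for x y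
    proof -
      have c: "x \<in> carrier F" "y \<in> carrier F" using xy P by auto
      show "x \<otimes>\<^bsub>F\<^esub> y \<in> P" "x \<oplus>\<^bsub>F\<^esub> y \<in> P"
        using c xy P_closed(2,3)[of "\<phi> x" "\<phi> y"] by (simp_all add: mem phi_add phi_mult)
    qed
  qed
  moreover have "k \<subset> P"
  proof
    show "k \<subseteq> P"
    proof
      fix x assume "x \<in> k"
      then show "x \<in> P" using k_P[of "\<phi> x"] k mem by blast
    qed
    show "k \<noteq> P" using P_ne(2) by blast
  qed
  moreover have "P \<subset> carrier F" using place P unfolding isplace_def img_def by blast
  moreover have "z \<in> P \<or> inv\<^bsub>F\<^esub> z \<in> P" if z: "z \<in> carrier F" "z \<noteq> \<zero>\<^bsub>F\<^esub>" for z
    using P_or[of "\<phi> z"] z mem[OF z(1)] mem[OF inv_closed[OF z]] phi_inv[OF z] by (auto simp: img_def)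
  ultimately show "P \<in> places k F" by (simp add: places_def)
qed

context
  fixes k P
  assumes k: "k \<subseteq> carrier F" and P: "P \<in> places k F"
begin

lemma P_carrier: "P \<subseteq> carrier F"
  using P by (auto simp: places_def)

lemma place_img: "isplace (\<phi> ` k) img (\<phi> ` P)"
  using places_image[OF k P_carrier] P by simp

interpretation valring "\<phi> ` k" img "\<phi> ` P"
  by unfold_locales (rule place_img, rule subfld_img)

lemma Units_image:
  assumes "x \<in> carrier F"
  shows "x \<in> Units (F\<lparr>carrier := P\<rparr>) \<longleftrightarrow> \<phi> x \<in> vunits (\<phi> ` P)"
proof
  assume "x \<in> Units (F\<lparr>carrier := P\<rparr>)"
  then obtain y where y: "x \<in> P" "y \<in> P" "x \<otimes>\<^bsub>F\<^esub> y = \<one>\<^bsub>F\<^esub>" by (auto simp: Units_def)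
  then have "\<phi> x * \<phi> y = 1" using P_carrier phi_mult phi_one by (metis subsetD)
  then show "\<phi> x \<in> vunits (\<phi> ` P)" using y by (auto simp: vunits_def dest: inverse_unique)
next
  assume x: "\<phi> x \<in> vunits (\<phi> ` P)"
  then have nz: "x \<noteq> \<zero>\<^bsub>F\<^esub>" using phi_zero by (auto simp: vunits_def)
  have "\<phi> (inv\<^bsub>F\<^esub> x) \<in> \<phi> ` P" using x phi_inv[OF assms nz] by (simp add: vunits_def)
  then have i: "inv\<^bsub>F\<^esub> x \<in> P" using mem_image[OF P_carrier inv_closed[OF assms nz]] by simp
  have "x \<in> P" using x mem_image[OF P_carrier assms] by (simp add: vunits_def)
  moreover have "x \<in> Units F" using assms nz F.field_Units by blast
  then have "inv\<^bsub>F\<^esub> x \<otimes>\<^bsub>F\<^esub> x = \<one>\<^bsub>F\<^esub>" "x \<otimes>\<^bsub>F\<^esub> inv\<^bsub>F\<^esub> x = \<one>\<^bsub>F\<^esub>"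
    by (simp_all add: F.Units_l_inv F.Units_r_inv)
  ultimately show "x \<in> Units (F\<lparr>carrier := P\<rparr>)" using i by (auto simp: Units_def)
qed

lemma uniformizer_image:
  assumes t: "t \<in> carrier F"
  shows "uniformizer F P t \<longleftrightarrow> unif (\<phi> ` P) (\<phi> t)"
proof -
  have max: "maxid (\<phi> ` P) = \<phi> ` (P - Units (F\<lparr>carrier := P\<rparr>))"
  proof (intro equalityI subsetI)
    fix z assume z: "z \<in> maxid (\<phi> ` P)"
    then obtain x where x: "x \<in> P" "z = \<phi> x" using maxid_P by blast
    then have "x \<notin> Units (F\<lparr>carrier := P\<rparr>)" using Units_image[of x] P_carrier z maxid_not_unit by blast
    with x show "z \<in> \<phi> ` (P - Units (F\<lparr>carrier := P\<rparr>))" by blast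
  next
    fix z assume "z \<in> \<phi> ` (P - Units (F\<lparr>carrier := P\<rparr>))"
    then obtain x where x: "x \<in> P" "x \<notin> Units (F\<lparr>carrier := P\<rparr>)" "z = \<phi> x" by blast
    then show "z \<in> maxid (\<phi> ` P)" using maxid_or_unit[of z] Units_image[of x] P_carrier by blast
  qed
  have mul: "\<phi> ` {t \<otimes>\<^bsub>F\<^esub> a | a. a \<in> P} = {\<phi> t * a | a. a \<in> \<phi> ` P}"
  proof -
    have "\<phi> (t \<otimes>\<^bsub>F\<^esub> a) = \<phi> t * \<phi> a" if "a \<in> P" for a using phi_mult t that P_carrier by blast
    then have "(\<lambda>a. \<phi> (t \<otimes>\<^bsub>F\<^esub> a)) ` P = (\<lambda>a. \<phi> t * \<phi> a) ` P" by (rule image_cong[OF refl])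
    then show ?thesis by (simp add: Setcompr_eq_image image_image)
  qed
  have "P - Units (F\<lparr>carrier := P\<rparr>) \<subseteq> carrier F" "{t \<otimes>\<^bsub>F\<^esub> a | a. a \<in> P} \<subseteq> carrier F"
    using P_carrier t by auto
  from inj_on_image_eq_iff[OF inj this]
  have "P - Units (F\<lparr>carrier := P\<rparr>) = {t \<otimes>\<^bsub>F\<^esub> a | a. a \<in> P} \<longleftrightarrow>
     maxid (\<phi> ` P) = {\<phi> t * a | a. a \<in> \<phi> ` P}"
    unfolding max mul[symmetric] by (rule sym)
  then show ?thesis using mem_image[OF P_carrier t] by (simp add: uniformizer_def unif_def)
qed

text \<open>A zero uniformizer would make the maximal ideal zero; then nothing could lie outside
  \<open>P\<close>, because the inverse of such an element is a nonzero non-unit.\<close>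

lemma unif_nz: "unif (\<phi> ` P) 0 \<Longrightarrow> False"
proof -
  assume "unif (\<phi> ` P) 0"
  then have m: "maxid (\<phi> ` P) \<subseteq> {0}" by (auto simp: unif_def)
  have "z \<in> \<phi> ` P" if z: "z \<in> img" for z
  proof (rule ccontr)
    assume n: "z \<notin> \<phi> ` P"
    then have "inverse z \<in> maxid (\<phi> ` P)" using notin_maxid_inverse z by blast
    then have "z = 0" using m by auto
    then show False using n P_more by simp
  qed
  then show False using P_L P_ne by blast
qed

lemma valuation_image:
  assumes z: "z \<in> carrier F"
  shows "valuation F P z = val (\<phi> ` P) (\<phi> z)"
proof -
  have "(\<exists>t e. uniformizer F P t \<and> e \<in> Units (F\<lparr>carrier := P\<rparr>) \<and> z = (t [^]\<^bsub>F\<^esub> i) \<otimes>\<^bsub>F\<^esub> e) \<longleftrightarrow>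
    (\<exists>t e. unif (\<phi> ` P) t \<and> e \<in> vunits (\<phi> ` P) \<and> \<phi> z = t powi i * e)" for i :: int
  proof
    assume "\<exists>t e. uniformizer F P t \<and> e \<in> Units (F\<lparr>carrier := P\<rparr>) \<and> z = (t [^]\<^bsub>F\<^esub> i) \<otimes>\<^bsub>F\<^esub> e"
    then obtain t e where te: "uniformizer F P t" "e \<in> Units (F\<lparr>carrier := P\<rparr>)" "z = (t [^]\<^bsub>F\<^esub> i) \<otimes>\<^bsub>F\<^esub> e" by blast
    have tc: "t \<in> carrier F" using te(1) P_carrier by (auto simp: uniformizer_def)
    have ec: "e \<in> carrier F" using te(2) P_carrier by (auto simp: Units_def)
    have u: "unif (\<phi> ` P) (\<phi> t)" using te(1) uniformizer_image[OF tc] by simp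
    then have "t \<noteq> \<zero>\<^bsub>F\<^esub>" using unif_nz phi_zero by auto
    then have "\<phi> z = \<phi> t powi i * \<phi> e" using te(3) phi_int_pow[OF tc, of i] phi_mult ec by simp
    then show "\<exists>t e. unif (\<phi> ` P) t \<and> e \<in> vunits (\<phi> ` P) \<and> \<phi> z = t powi i * e"
      using u te(2) Units_image[OF ec] by blast
  next
    assume "\<exists>t e. unif (\<phi> ` P) t \<and> e \<in> vunits (\<phi> ` P) \<and> \<phi> z = t powi i * e"
    then obtain t' e' where te: "unif (\<phi> ` P) t'" "e' \<in> vunits (\<phi> ` P)" "\<phi> z = t' powi i * e'" by blast
    obtain t where t: "t \<in> P" "t' = \<phi> t" using te(1) by (auto simp: unif_def)
    obtain e where e: "e \<in> P" "e' = \<phi> e" using te(2) by (auto simp: vunits_def)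
    have c: "t \<in> carrier F" "e \<in> carrier F" using t e P_carrier by auto
    have nz: "t \<noteq> \<zero>\<^bsub>F\<^esub>" using te(1) t unif_nz phi_zero by auto
    have "\<phi> z = \<phi> ((t [^]\<^bsub>F\<^esub> i) \<otimes>\<^bsub>F\<^esub> e)"
      using te(3) phi_int_pow[OF c(1) nz, of i] phi_mult c t e by simp
    then have "z = (t [^]\<^bsub>F\<^esub> i) \<otimes>\<^bsub>F\<^esub> e"
      using phi_eq_iff[OF z] phi_int_pow(1)[OF c(1) nz] c by simp
    then show "\<exists>t e. uniformizer F P t \<and> e \<in> Units (F\<lparr>carrier := P\<rparr>) \<and> z = (t [^]\<^bsub>F\<^esub> i) \<otimes>\<^bsub>F\<^esub> e"
      using uniformizer_image[OF c(1)] Units_image[OF c(2)] te t e by blast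
  qed
  then show ?thesis unfolding valuation_def val_def by simp
qed

end

end

section \<open>The genus of an abstract copy of a Kummer extension\<close>

locale kummer_embed = kummer h u w N f + field_embed F \<phi>
  for h :: "'a::alg_closed_field \<Rightarrow> 'b::field" and u w N f and F :: "'f ring" and \<phi> :: "'f \<Rightarrow> 'b" +
  fixes k :: "'f set"
  assumes k: "k \<subseteq> carrier F" "\<phi> ` k = range h" and img: "img = L"
begin

lemma places_iff: "P \<subseteq> carrier F \<Longrightarrow> P \<in> Defs.places k F \<longleftrightarrow> \<phi> ` P \<in> places"
  using places_image[OF k(1)] k(2) img by (simp add: places_def)

lemma places_sub: "P \<in> Defs.places k F \<Longrightarrow> P \<subseteq> carrier F" "Q \<in> places \<Longrightarrow> Q \<subseteq> img"
  by (auto simp: Defs.places_def places_def isplace_def img)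

lemma pre_places: "Q \<in> places \<Longrightarrow> pre Q \<in> Defs.places k F"
  using places_iff[OF pre_sub] image_pre places_sub(2) by simp

lemma image_places: "P \<in> Defs.places k F \<Longrightarrow> \<phi> ` P \<in> places"
  using places_iff places_sub by blast

lemma bij_places: "bij_betw (\<lambda>P. \<phi> ` P) (Defs.places k F) places"
  by (rule bij_betw_byWitness[where f' = pre])
    (use pre_image image_pre places_sub pre_places image_places in auto)

lemma subfield_k: "subfield k F"
proof -
  have mem: "x \<in> k \<longleftrightarrow> \<phi> x \<in> range h" if "x \<in> carrier F" for x
    using mem_image[OF k(1) that] k(2) by simp
  have hr: "h a + h b \<in> range h" "h a * h b \<in> range h" "- h a \<in> range h" "inverse (h a) \<in> range h" "1 \<in> range h" for a b
    using rangeI[of h "a + b"] rangeI[of h "a * b"] rangeI[of h "- a"] rangeI[of h "inverse a"] rangeI[of h 1]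
    by (simp_all only: h_simps)
  have "subring k F"
  proof (rule F.subringI[OF k(1)])
    show "\<one>\<^bsub>F\<^esub> \<in> k" using hr(5) by (simp add: mem phi_one)
    show "\<ominus>\<^bsub>F\<^esub> x \<in> k" if xk: "x \<in> k" for x
    proof -
      have c: "x \<in> carrier F" using xk k by auto
      then obtain a where "\<phi> x = h a" using xk mem by auto
      then show ?thesis using hr(3) c by (simp add: mem phi_a_inv)
    qed
    show "x \<otimes>\<^bsub>F\<^esub> y \<in> k" "x \<oplus>\<^bsub>F\<^esub> y \<in> k" if xy: "x \<in> k" "y \<in> k" for x y
    proof -
      have c: "x \<in> carrier F" "y \<in> carrier F" using xy k by auto
      then obtain a b where "\<phi> x = h a" "\<phi> y = h b" using xy mem by auto
      then show "x \<otimes>\<^bsub>F\<^esub> y \<in> k" "x \<oplus>\<^bsub>F\<^esub> y \<in> k" using hr(1,2) c by (simp_all add: mem phi_add phi_mult)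
    qed
  qed
  then show ?thesis
  proof (rule F.subfieldI')
    fix x assume "x \<in> k - {\<zero>\<^bsub>F\<^esub>}"
    then have c: "x \<in> carrier F" "x \<noteq> \<zero>\<^bsub>F\<^esub>" "x \<in> k" using k by auto
    then obtain a where "\<phi> x = h a" using mem by auto
    then show "inv\<^bsub>F\<^esub> x \<in> k" using hr(4) c by (simp add: mem inv_closed phi_inv)
  qed
qed

text \<open>\<open>F.dimension\<close> is built by adjoining one vector at a time, so the induction
  adjoins basis vectors one by one, with \<open>line_extension\<close> matching
  \<open>vs.span_insert\<close>.\<close>

lemma dimension_pre:
  assumes "hasdim V n" "V \<subseteq> L"
  shows "F.dimension n k (pre V)"
proof -
  obtain B where B: "finite B" "vs.independent B" "vs.span B = V" "card B = n"
    using assms(1) by (auto simp: hasdim_def)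
  have BL: "B \<subseteq> L" using B assms(2) vs.span_superset by blast
  have "finite B \<Longrightarrow> vs.independent B \<Longrightarrow> B \<subseteq> L \<Longrightarrow> vs.span B \<subseteq> L \<and> F.dimension (card B) k (pre (vs.span B))"
  proof (induction B rule: finite_induct)
    case empty
    have "pre {0} = {\<zero>\<^bsub>F\<^esub>}" using phi_eq_0_iff phi_zero by (auto simp: pre_def)
    then show ?case using F.zero_dim L_closed by simp
  next
    case (insert b B)
    have ind: "vs.independent B" "b \<notin> vs.span B"
      using insert.prems(1) insert.hyps(2) vs.independent_insert[of b B] by simp_all
    have IH: "vs.span B \<subseteq> L" "F.dimension (card B) k (pre (vs.span B))"
      using insert.IH ind insert.prems by auto
    have bL: "b \<in> L" using insert.prems by blast
    then have "b \<in> \<phi> ` carrier F" by (simp add: img[symmetric] img_def)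
    then obtain x where x: "x \<in> carrier F" "\<phi> x = b" by blast
    have sp: "z \<in> vs.span (insert b B) \<longleftrightarrow> (\<exists>a. \<exists>v\<in>vs.span B. z = h a * b + v)" for z
    proof -
      have "z \<in> vs.span (insert b B) \<longleftrightarrow> (\<exists>a. z - h a * b \<in> vs.span B)"
        unfolding vs.span_insert by (rule mem_Collect_eq)
      also have "\<dots> \<longleftrightarrow> (\<exists>a. \<exists>v\<in>vs.span B. z = h a * b + v)"
      proof
        assume "\<exists>a. z - h a * b \<in> vs.span B"
        then obtain a where "z - h a * b \<in> vs.span B" by blast
        moreover have "z = h a * b + (z - h a * b)" by simp
        ultimately show "\<exists>a. \<exists>v\<in>vs.span B. z = h a * b + v" by blast
      next
        assume "\<exists>a. \<exists>v\<in>vs.span B. z = h a * b + v"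
        then obtain a v where "v \<in> vs.span B" "z = h a * b + v" by blast
        then have "z - h a * b \<in> vs.span B" by simp
        then show "\<exists>a. z - h a * b \<in> vs.span B" ..
      qed
      finally show ?thesis .
    qed
    have 1: "vs.span (insert b B) \<subseteq> L"
    proof
      fix z assume "z \<in> vs.span (insert b B)"
      then obtain a v where "v \<in> vs.span B" "z = h a * b + v" using sp by blast
      then show "z \<in> L" using IH(1) L_add[OF L_mult[OF h_L bL]] by auto
    qed
    have "F.line_extension k x (pre (vs.span B)) = pre (vs.span (insert b B))"
    proof (intro equalityI subsetI)
      fix z assume "z \<in> F.line_extension k x (pre (vs.span B))"
      then obtain c v where cv: "c \<in> k" "v \<in> pre (vs.span B)" "z = c \<otimes>\<^bsub>F\<^esub> x \<oplus>\<^bsub>F\<^esub> v"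
        unfolding F.line_extension_mem_iff by blast
      have cc: "c \<in> carrier F" "v \<in> carrier F" using cv k pre_sub by auto
      obtain a where a: "\<phi> c = h a" using cv(1) k(2) by blast
      have "\<phi> z = h a * b + \<phi> v" using cv cc x a by (simp add: phi_add phi_mult)
      then show "z \<in> pre (vs.span (insert b B))" using sp cv cc x by (auto simp: pre_def)
    next
      fix z assume "z \<in> pre (vs.span (insert b B))"
      then have z: "z \<in> carrier F" "\<phi> z \<in> vs.span (insert b B)" by (auto simp: pre_def)
      then obtain a v where av: "v \<in> vs.span B" "\<phi> z = h a * b + v" using sp by blast
      obtain c where c: "c \<in> k" "\<phi> c = h a" using k(2) by (metis imageE rangeI)
      have "v \<in> L" using av(1) IH(1) by blast
      then have "v \<in> \<phi> ` carrier F" by (simp add: img[symmetric] img_def)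
      then obtain y where y: "y \<in> carrier F" "\<phi> y = v" by blast
      have cc: "c \<in> carrier F" using c k by auto
      have "\<phi> z = \<phi> (c \<otimes>\<^bsub>F\<^esub> x \<oplus>\<^bsub>F\<^esub> y)" using av c y x cc by (simp add: phi_add phi_mult)
      then have "z = c \<otimes>\<^bsub>F\<^esub> x \<oplus>\<^bsub>F\<^esub> y" using phi_eq_iff z x y cc by simp
      then show "z \<in> F.line_extension k x (pre (vs.span B))"
        unfolding F.line_extension_mem_iff using c y av by (auto simp: pre_def)
    qed
    moreover have "x \<notin> pre (vs.span B)" using ind(2) x by (simp add: pre_def)
    ultimately have "F.dimension (Suc (card B)) k (pre (vs.span (insert b B)))"
      using F.Suc_dim[OF x(1) _ IH(2)] by simp
    then show ?case using 1 insert.hyps by simp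
  qed
  then show ?thesis using B BL by blast
qed

lemma dim_pre: "hasdim V n \<Longrightarrow> V \<subseteq> L \<Longrightarrow> ring.dim F k (pre V) = n"
  using F.dimI[OF subfield_k dimension_pre] by (simp add: over_def)

lemma RR_pre:
  assumes A: "\<And>P. P \<in> Defs.places k F \<Longrightarrow> A P = B (\<phi> ` P)"
  shows "riemann_roch_space k F A = pre (RR B)"
proof -
  have "(\<forall>P\<in>Defs.places k F. valuation F P z \<ge> - A P) \<longleftrightarrow> (\<forall>Q\<in>places. val Q (\<phi> z) \<ge> - B Q)"
    if z: "z \<in> carrier F" for z
  proof -
    have "(\<forall>P\<in>Defs.places k F. valuation F P z \<ge> - A P) \<longleftrightarrow>
        (\<forall>P\<in>Defs.places k F. val (\<phi> ` P) (\<phi> z) \<ge> - B (\<phi> ` P))"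
      by (rule ball_cong) (simp_all add: valuation_image[OF k(1) _ z] A)
    also have "\<dots> \<longleftrightarrow> (\<forall>Q\<in>(\<lambda>P. \<phi> ` P) ` Defs.places k F. val Q (\<phi> z) \<ge> - B Q)" by simp
    also have "(\<lambda>P. \<phi> ` P) ` Defs.places k F = places" using bij_places by (rule bij_betw_imp_surj_on)
    finally show ?thesis .
  qed
  moreover have "\<phi> z \<in> L" if "z \<in> carrier F" for z using that img by (auto simp: img_def)
  ultimately show ?thesis
    by (auto simp: riemann_roch_space_def RR_def pre_def phi_eq_0_iff)
qed

lemma divisor_transfer:
  assumes A: "\<And>P. P \<in> Defs.places k F \<Longrightarrow> A P = B (\<phi> ` P)"
  shows "A \<in> divisors k F \<longleftrightarrow> B \<in> divs" "divisor_degree k F A = deg B"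
proof -
  have b: "bij_betw (\<lambda>P. \<phi> ` P) {P \<in> Defs.places k F. A P \<noteq> 0} {Q \<in> places. B Q \<noteq> 0}"
    unfolding bij_betw_def
  proof
    show "inj_on (\<lambda>P. \<phi> ` P) {P \<in> Defs.places k F. A P \<noteq> 0}"
      using bij_places by (auto simp: bij_betw_def intro: inj_on_subset)
    have "(\<lambda>P. \<phi> ` P) ` Defs.places k F = places" using bij_places by (rule bij_betw_imp_surj_on)
    then have im: "Q \<in> places \<Longrightarrow> \<exists>P\<in>Defs.places k F. Q = \<phi> ` P" for Q by blast
    show "(\<lambda>P. \<phi> ` P) ` {P \<in> Defs.places k F. A P \<noteq> 0} = {Q \<in> places. B Q \<noteq> 0}"
    proof (intro equalityI subsetI)
      fix Q assume Q: "Q \<in> {Q \<in> places. B Q \<noteq> 0}"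
      then obtain P where "P \<in> Defs.places k F" "Q = \<phi> ` P" using im by blast
      then show "Q \<in> (\<lambda>P. \<phi> ` P) ` {P \<in> Defs.places k F. A P \<noteq> 0}" using A Q by auto
    qed (use A image_places in auto)
  qed
  show "A \<in> divisors k F \<longleftrightarrow> B \<in> divs" using bij_betw_finite[OF b] by (simp add: divisors_def divs_def)
  have "deg B = (\<Sum>P | P \<in> Defs.places k F \<and> A P \<noteq> 0. B (\<phi> ` P))"
    unfolding deg_def using sum.reindex_bij_betw[OF b, of B] by simp
  also have "\<dots> = divisor_degree k F A" unfolding divisor_degree_def by (rule sum.cong) (auto simp: A)
  finally show "divisor_degree k F A = deg B" by simp
qed

text \<open>\<open>Bm M\<close> attains \<open>G\<close> by \<open>riemann_sharp\<close>, and
  \<open>riemann\<close> bounds every other divisor; both statements are carried over by the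
  bijection between places.\<close>

theorem genus_eq: "genus k F = G"
  unfolding genus_def
proof (rule Greatest_equality)
  let ?A = "\<lambda>P. Bm M (\<phi> ` P)"
  have "?A \<in> divisors k F" "divisor_degree k F ?A = deg (Bm M)"
    using divisor_transfer[of ?A "Bm M"] Bm_divs by auto
  moreover have "ring.dim F k (riemann_roch_space k F ?A) = (\<Sum>j<N. Dm M j + 1)"
    using RR_pre[of ?A "Bm M"] dim_pre[OF riemann_sharp(1)] by (auto simp: RR_def)
  ultimately show "\<exists>A\<in>divisors k F. G = divisor_degree k F A - int (ring.dim F k (riemann_roch_space k F A)) + 1"
    using riemann_sharp(2) by (intro bexI[of _ ?A]) simp_all
next
  fix g assume "\<exists>A\<in>divisors k F. g = divisor_degree k F A - int (ring.dim F k (riemann_roch_space k F A)) + 1"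
  then obtain A where A: "A \<in> divisors k F" "g = divisor_degree k F A - int (ring.dim F k (riemann_roch_space k F A)) + 1" by blast
  let ?B = "\<lambda>Q. A (pre Q)"
  have e: "A P = ?B (\<phi> ` P)" if "P \<in> Defs.places k F" for P
    using pre_image[OF places_sub(1)[OF that]] by simp
  have "?B \<in> divs" "divisor_degree k F A = deg ?B" using divisor_transfer[of A ?B, OF e] A by auto
  moreover obtain d where d: "hasdim (RR ?B) d" "deg ?B - int d + 1 \<le> G"
    using riemann[OF \<open>?B \<in> divs\<close>] by blast
  moreover have "ring.dim F k (riemann_roch_space k F A) = d"
    using RR_pre[of A ?B, OF e] dim_pre[OF d(1)] by (auto simp: RR_def)
  ultimately show "g \<le> G" using A by simp
qed

end

abbreviation fldrec :: "'b::field set \<Rightarrow> 'b ring" where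
  "fldrec L \<equiv> ring_of_type_algebra\<lparr>carrier := L\<rparr>"

lemma type_algebra_sel:
  "carrier ring_of_type_algebra = UNIV" "x \<otimes>\<^bsub>ring_of_type_algebra\<^esub> y = x * y"
  "x \<oplus>\<^bsub>ring_of_type_algebra\<^esub> y = x + y" "\<one>\<^bsub>ring_of_type_algebra\<^esub> = 1" "\<zero>\<^bsub>ring_of_type_algebra\<^esub> = 0"
  by (simp_all add: ring_of_type_algebra_def)

lemma field_fldrec:
  assumes "subfld (L :: 'b::field set)"
  shows "Ring.field (fldrec L)"
proof -
  interpret field_embed "ring_of_type_algebra :: 'b ring" "\<lambda>x. x"
    by (intro field_embed.intro field_from_type_algebra) (auto simp: type_algebra_sel)
  have "subring L ring_of_type_algebra"
    by (rule F.subringI) (use subfldD[OF assms] phi_a_inv in \<open>auto simp: type_algebra_sel\<close>)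
  then have "subfield L ring_of_type_algebra"
    by (rule F.subfieldI') (use phi_inv subfldD(5)[OF assms] in \<open>auto simp: type_algebra_sel\<close>)
  then show ?thesis by (rule F.subfield_iff(2))
qed

section \<open>Rings of fractions as subfields\<close>

text \<open>Shared by forms and by polynomial functions. \<open>R m F\<close> says that
  \<open>F\<close> is admissible of degree \<open>m\<close>, with the same functions for every
  \<open>m\<close> in the affine case. \<open>e F\<close> is the value at a generic point, which
  decides whether \<open>F\<close> vanishes on \<open>S\<close>.\<close>

locale frac_data =
  fixes S :: "'p set" and D :: "(('p \<Rightarrow> 'a::field) \<times> ('p \<Rightarrow> 'a)) set"
    and R :: "nat \<Rightarrow> ('p \<Rightarrow> 'a) \<Rightarrow> bool" and e :: "('p \<Rightarrow> 'a) \<Rightarrow> 'b::field"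
  assumes D_def': "D = {(F, G). \<exists>m. R m F \<and> R m G \<and> (\<exists>s\<in>S. G s \<noteq> 0)}"
    and e_0_iff: "R m F \<Longrightarrow> (\<forall>s\<in>S. F s = 0) \<longleftrightarrow> e F = 0"
    and R_mult: "R m F \<Longrightarrow> R m' G \<Longrightarrow> R (m + m') (\<lambda>s. F s * G s) \<and> e (\<lambda>s. F s * G s) = e F * e G"
    and R_add: "R m F \<Longrightarrow> R m G \<Longrightarrow> R m (\<lambda>s. F s + G s) \<and> e (\<lambda>s. F s + G s) = e F + e G"
    and R_diff: "R m F \<Longrightarrow> R m G \<Longrightarrow> R m (\<lambda>s. F s - G s) \<and> e (\<lambda>s. F s - G s) = e F - e G"
    and R_one: "R 0 (\<lambda>s. 1) \<and> e (\<lambda>s. 1) = 1"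
    and R_zero: "R 0 (\<lambda>s. 0)"
begin

lemma D_iff: "(F, G) \<in> D \<longleftrightarrow> (\<exists>m. R m F \<and> R m G) \<and> e G \<noteq> 0"
  using e_0_iff unfolding D_def' by blast

lemma e_zero: "e (\<lambda>s. 0) = 0"
  using e_0_iff[OF R_zero] by simp

lemma frac_eq:
  assumes "(F, G) \<in> D" "(F', G') \<in> D"
  shows "(\<forall>s\<in>S. F s * G' s = F' s * G s) \<longleftrightarrow> e F / e G = e F' / e G'"
proof -
  obtain m m' where m: "R m F" "R m G" "e G \<noteq> 0" "R m' F'" "R m' G'" "e G' \<noteq> 0"
    using assms by (auto simp: D_iff)
  have 1: "R (m + m') (\<lambda>s. F s * G' s)" "e (\<lambda>s. F s * G' s) = e F * e G'"
    using R_mult m by auto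
  have 2: "R (m + m') (\<lambda>s. F' s * G s)" "e (\<lambda>s. F' s * G s) = e F' * e G"
    using R_mult[OF m(4,2)] by (auto simp: add.commute)
  have "R (m + m') (\<lambda>s. F s * G' s - F' s * G s)" "e (\<lambda>s. F s * G' s - F' s * G s) = e F * e G' - e F' * e G"
    using R_diff[OF 1(1) 2(1)] 1 2 by auto
  from e_0_iff[OF this(1)] this(2) show ?thesis using m by (simp add: frac_eq_eq)
qed

lemma frac_rel_iff: "((F, G), (F', G')) \<in> frac_rel S D \<longleftrightarrow>
    (F, G) \<in> D \<and> (F', G') \<in> D \<and> e F / e G = e F' / e G'"
  using frac_eq[of F G F' G'] by (auto simp: frac_rel_def)

lemma frac_mem_iff: "(F, G) \<in> D \<Longrightarrow> (F', G') \<in> frac S D F G \<longleftrightarrow> (F', G') \<in> D \<and> e F' / e G' = e F / e G"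
  by (auto simp: frac_def frac_rel_iff)

lemma frac_self: "(F, G) \<in> D \<Longrightarrow> (F, G) \<in> frac S D F G"
  by (simp add: frac_mem_iff)

lemma frac_eq_iff: "(F, G) \<in> D \<Longrightarrow> (F', G') \<in> D \<Longrightarrow> frac S D F G = frac S D F' G' \<longleftrightarrow> e F / e G = e F' / e G'"
proof
  assume *: "(F, G) \<in> D" "(F', G') \<in> D" "e F / e G = e F' / e G'"
  then have "\<And>q. q \<in> frac S D F G \<longleftrightarrow> q \<in> frac S D F' G'"
    using frac_mem_iff by (metis surj_pair)
  then show "frac S D F G = frac S D F' G'" by blast
qed (metis frac_mem_iff frac_self)

lemma carrier_frac: "carrier (frac_ring S D) = {frac S D F G | F G. (F, G) \<in> D}"
  by (auto simp: frac_ring_def quotient_def frac_def)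

lemma carrierE:
  assumes "f \<in> carrier (frac_ring S D)"
  obtains F G where "(F, G) \<in> D" "f = frac S D F G"
  using assms by (auto simp: carrier_frac)

text \<open>The value of a class at the generic point. By \<open>frac_eq\<close> it does not depend
  on the representative and it determines the class.\<close>

definition nu :: "('p, 'a) ratfun \<Rightarrow> 'b" where
  "nu f = (let p = (SOME p. p \<in> f) in e (fst p) / e (snd p))"

lemma nu_frac:
  assumes "(F, G) \<in> D" shows "nu (frac S D F G) = e F / e G"
proof -
  let ?p = "SOME p. p \<in> frac S D F G"
  have "?p \<in> frac S D F G" using frac_self[OF assms] by (rule someI)
  then show ?thesis using frac_mem_iff[OF assms, of "fst ?p" "snd ?p"] by (simp add: nu_def)
qed

lemma D_mult: "(F, G) \<in> D \<Longrightarrow> (F', G') \<in> D \<Longrightarrow> (\<lambda>s. F s * F' s, \<lambda>s. G s * G' s) \<in> D \<and>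
    e (\<lambda>s. F s * F' s) / e (\<lambda>s. G s * G' s) = (e F / e G) * (e F' / e G')"
proof -
  assume "(F, G) \<in> D" "(F', G') \<in> D"
  then obtain m m' where m: "R m F" "R m G" "e G \<noteq> 0" "R m' F'" "R m' G'" "e G' \<noteq> 0"
    by (auto simp: D_iff)
  then show ?thesis using R_mult[OF m(1,4)] R_mult[OF m(2,5)] by (auto simp: D_iff)
qed

lemma D_add: "(F, G) \<in> D \<Longrightarrow> (F', G') \<in> D \<Longrightarrow> (\<lambda>s. F s * G' s + F' s * G s, \<lambda>s. G s * G' s) \<in> D \<and>
    e (\<lambda>s. F s * G' s + F' s * G s) / e (\<lambda>s. G s * G' s) = e F / e G + e F' / e G'"
proof -
  assume "(F, G) \<in> D" "(F', G') \<in> D"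
  then obtain m m' where m: "R m F" "R m G" "e G \<noteq> 0" "R m' F'" "R m' G'" "e G' \<noteq> 0"
    by (auto simp: D_iff)
  have 1: "R (m + m') (\<lambda>s. F s * G' s)" "e (\<lambda>s. F s * G' s) = e F * e G'"
    using R_mult[OF m(1,5)] by auto
  have 2: "R (m + m') (\<lambda>s. F' s * G s)" "e (\<lambda>s. F' s * G s) = e F' * e G"
    using R_mult[OF m(4,2)] by (auto simp: add.commute)
  show ?thesis using R_add[OF 1(1) 2(1)] 1 2 R_mult[OF m(2,5)] m(3,6) by (auto simp: D_iff add_frac_eq)
qed

lemma mult_frac:
  assumes "(F, G) \<in> D" "(F', G') \<in> D"
  shows "frac S D F G \<otimes>\<^bsub>frac_ring S D\<^esub> frac S D F' G' = frac S D (\<lambda>s. F s * F' s) (\<lambda>s. G s * G' s)"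
proof -
  have c: "frac S D (\<lambda>s. H s * H' s) (\<lambda>s. J s * J' s) = frac S D (\<lambda>s. F s * F' s) (\<lambda>s. G s * G' s)"
    if "(H, J) \<in> frac S D F G" "(H', J') \<in> frac S D F' G'" for H J H' J'
  proof -
    have *: "(H, J) \<in> D" "(H', J') \<in> D" "e H / e J = e F / e G" "e H' / e J' = e F' / e G'"
      using that assms frac_mem_iff by auto
    show ?thesis using D_mult[OF *(1,2)] D_mult[OF assms] frac_eq_iff *(3,4) by simp
  qed
  have "frac S D F G \<otimes>\<^bsub>frac_ring S D\<^esub> frac S D F' G' =
      (\<Union>(H, J)\<in>frac S D F G. \<Union>(H', J')\<in>frac S D F' G'. frac S D (\<lambda>s. H s * H' s) (\<lambda>s. J s * J' s))"
    by (simp add: frac_ring_def)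
  also have "\<dots> = frac S D (\<lambda>s. F s * F' s) (\<lambda>s. G s * G' s)"
    using c frac_self[OF assms(1)] frac_self[OF assms(2)] by fast
  finally show ?thesis .
qed

lemma add_frac:
  assumes "(F, G) \<in> D" "(F', G') \<in> D"
  shows "frac S D F G \<oplus>\<^bsub>frac_ring S D\<^esub> frac S D F' G' = frac S D (\<lambda>s. F s * G' s + F' s * G s) (\<lambda>s. G s * G' s)"
proof -
  have c: "frac S D (\<lambda>s. H s * J' s + H' s * J s) (\<lambda>s. J s * J' s) = frac S D (\<lambda>s. F s * G' s + F' s * G s) (\<lambda>s. G s * G' s)"
    if "(H, J) \<in> frac S D F G" "(H', J') \<in> frac S D F' G'" for H J H' J'
  proof -
    have *: "(H, J) \<in> D" "(H', J') \<in> D" "e H / e J = e F / e G" "e H' / e J' = e F' / e G'"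
      using that assms frac_mem_iff by auto
    show ?thesis using D_add[OF *(1,2)] D_add[OF assms] frac_eq_iff *(3,4) by simp
  qed
  have "frac S D F G \<oplus>\<^bsub>frac_ring S D\<^esub> frac S D F' G' =
      (\<Union>(H, J)\<in>frac S D F G. \<Union>(H', J')\<in>frac S D F' G'. frac S D (\<lambda>s. H s * J' s + H' s * J s) (\<lambda>s. J s * J' s))"
    by (simp add: frac_ring_def)
  also have "\<dots> = frac S D (\<lambda>s. F s * G' s + F' s * G s) (\<lambda>s. G s * G' s)"
    using c frac_self[OF assms(1)] frac_self[OF assms(2)] by fast
  finally show ?thesis .
qed

lemma one_D: "(\<lambda>s. 1, \<lambda>s. 1) \<in> D" and zero_D: "(\<lambda>s. 0, \<lambda>s. 1) \<in> D"
  using R_one R_zero by (auto simp: D_iff)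

definition vals :: "'b set" where "vals = {e F / e G | F G. (F, G) \<in> D}"

lemma valsI: "(F, G) \<in> D \<Longrightarrow> e F / e G \<in> vals"
  by (auto simp: vals_def)

lemma subfld_vals: "subfld vals"
  unfolding subfld_def
proof (intro conjI ballI)
  show "1 \<in> vals" using valsI[OF one_D] R_one by simp
  fix a assume "a \<in> vals"
  then obtain F G where a: "(F, G) \<in> D" "a = e F / e G" by (auto simp: vals_def)
  obtain m where m: "R m F" "R m G" "e G \<noteq> 0" using a by (auto simp: D_iff)
  have z: "R m (\<lambda>s. 0)" "e (\<lambda>s. 0) = 0"
    using R_diff[OF m(1,1)] by auto
  have "(\<lambda>s. 0 - F s, G) \<in> D" "e (\<lambda>s. 0 - F s) / e G = - a"
    using R_diff[OF z(1) m(1)] m a z by (auto simp: D_iff)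
  then show "- a \<in> vals" using valsI[of "\<lambda>s. 0 - F s" G] by (simp only:)
  show "inverse a \<in> vals"
  proof (cases "e F = 0")
    case True
    then have "inverse a = e (\<lambda>s. 0) / e (\<lambda>s. 1)" by (simp add: a e_zero)
    then show ?thesis using zero_D by (auto simp: vals_def)
  next
    case False
    then have "(G, F) \<in> D" using m by (auto simp: D_iff)
    then show ?thesis by (auto simp: vals_def a)
  qed
  fix b assume "b \<in> vals"
  then obtain F' G' where b: "(F', G') \<in> D" "b = e F' / e G'" by (auto simp: vals_def)
  show "a + b \<in> vals" 
    using valsI[OF conjunct1[OF D_add[OF a(1) b(1)]]] conjunct2[OF D_add[OF a(1) b(1)]] by (simp only: a b)
  show "a * b \<in> vals" 
    using valsI[OF conjunct1[OF D_mult[OF a(1) b(1)]]] conjunct2[OF D_mult[OF a(1) b(1)]] by (simp only: a b)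
qed

lemma nu_image: "nu ` carrier (frac_ring S D) = vals"
proof (intro equalityI subsetI)
  fix z assume "z \<in> nu ` carrier (frac_ring S D)"
  then obtain F G where "(F, G) \<in> D" "z = nu (frac S D F G)" by (auto simp: carrier_frac)
  then show "z \<in> vals" by (auto simp: nu_frac vals_def)
next
  fix z assume "z \<in> vals"
  then obtain F G where "(F, G) \<in> D" "z = nu (frac S D F G)" by (auto simp: nu_frac vals_def)
  then show "z \<in> nu ` carrier (frac_ring S D)" by (auto simp: carrier_frac)
qed

lemma nu_mult:
  assumes "f \<in> carrier (frac_ring S D)" "g \<in> carrier (frac_ring S D)"
  shows "nu (f \<otimes>\<^bsub>frac_ring S D\<^esub> g) = nu f * nu g" "f \<otimes>\<^bsub>frac_ring S D\<^esub> g \<in> carrier (frac_ring S D)"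
proof -
  obtain F G where f: "(F, G) \<in> D" "f = frac S D F G" using assms(1) by (rule carrierE)
  obtain F' G' where g: "(F', G') \<in> D" "g = frac S D F' G'" using assms(2) by (rule carrierE)
  note m = D_mult[OF f(1) g(1)]
  show "nu (f \<otimes>\<^bsub>frac_ring S D\<^esub> g) = nu f * nu g"
    unfolding f(2) g(2) mult_frac[OF f(1) g(1)] using m by (simp add: nu_frac f(1) g(1))
  show "f \<otimes>\<^bsub>frac_ring S D\<^esub> g \<in> carrier (frac_ring S D)"
    unfolding f(2) g(2) mult_frac[OF f(1) g(1)] using m by (auto simp: carrier_frac)
qed

lemma nu_add:
  assumes "f \<in> carrier (frac_ring S D)" "g \<in> carrier (frac_ring S D)"
  shows "nu (f \<oplus>\<^bsub>frac_ring S D\<^esub> g) = nu f + nu g" "f \<oplus>\<^bsub>frac_ring S D\<^esub> g \<in> carrier (frac_ring S D)"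
proof -
  obtain F G where f: "(F, G) \<in> D" "f = frac S D F G" using assms(1) by (rule carrierE)
  obtain F' G' where g: "(F', G') \<in> D" "g = frac S D F' G'" using assms(2) by (rule carrierE)
  note m = D_add[OF f(1) g(1)]
  show "nu (f \<oplus>\<^bsub>frac_ring S D\<^esub> g) = nu f + nu g"
    unfolding f(2) g(2) add_frac[OF f(1) g(1)] using m by (simp add: nu_frac f(1) g(1))
  show "f \<oplus>\<^bsub>frac_ring S D\<^esub> g \<in> carrier (frac_ring S D)"
    unfolding f(2) g(2) add_frac[OF f(1) g(1)] using m by (auto simp: carrier_frac)
qed

lemma one_frac: "\<one>\<^bsub>frac_ring S D\<^esub> = frac S D (\<lambda>s. 1) (\<lambda>s. 1)"
  and zero_frac: "\<zero>\<^bsub>frac_ring S D\<^esub> = frac S D (\<lambda>s. 0) (\<lambda>s. 1)"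
  by (simp_all add: frac_ring_def)

lemma nu_one: "nu \<one>\<^bsub>frac_ring S D\<^esub> = 1" and nu_zero: "nu \<zero>\<^bsub>frac_ring S D\<^esub> = 0"
  using one_D zero_D R_one by (simp_all add: one_frac zero_frac nu_frac e_zero)

lemma nu_inj: "inj_on nu (carrier (frac_ring S D))"
proof (rule inj_onI)
  fix f g assume fg: "f \<in> carrier (frac_ring S D)" "g \<in> carrier (frac_ring S D)" "nu f = nu g"
  obtain F G where f: "(F, G) \<in> D" "f = frac S D F G" using fg(1) by (rule carrierE)
  obtain F' G' where g: "(F', G') \<in> D" "g = frac S D F' G'" using fg(2) by (rule carrierE)
  show "f = g" using fg(3) unfolding f(2) g(2) by (simp add: nu_frac f(1) g(1) frac_eq_iff)
qed

lemma one_carrier: "\<one>\<^bsub>frac_ring S D\<^esub> \<in> carrier (frac_ring S D)"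
  and zero_carrier: "\<zero>\<^bsub>frac_ring S D\<^esub> \<in> carrier (frac_ring S D)"
  using one_D zero_D by (auto simp: carrier_frac one_frac zero_frac)

lemma nu_iso: "nu \<in> ring_iso (frac_ring S D) (fldrec vals)"
  using nu_mult nu_add nu_one nu_inj nu_image
  by (auto simp: ring_iso_def ring_hom_def bij_betw_def type_algebra_sel)

text \<open>The field structure is transported from the subfield \<open>vals\<close> of
  \<open>'b\<close> along the inverse of \<open>nu\<close>.\<close>

theorem field_frac_ring: "Ring.field (frac_ring S D)"
proof -
  let ?psi = "the_inv_into (carrier (frac_ring S D)) nu"
  have nup: "nu (?psi z) = z" "?psi z \<in> carrier (frac_ring S D)" if "z \<in> vals" for z
    using f_the_inv_into_f[OF nu_inj] the_inv_into_into[OF nu_inj] that nu_image by auto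
  have uniq: "f = g" if "nu f = nu g" "f \<in> carrier (frac_ring S D)" "g \<in> carrier (frac_ring S D)" for f g
    using inj_onD[OF nu_inj that] .
  note s = subfldD[OF subfld_vals] subfld_more[OF subfld_vals]
  have one: "?psi 1 = \<one>\<^bsub>frac_ring S D\<^esub>" by (rule uniq) (use nup s nu_one one_carrier in auto)
  have zero: "?psi 0 = \<zero>\<^bsub>frac_ring S D\<^esub>" by (rule uniq) (use nup s nu_zero zero_carrier in auto)
  have "?psi \<in> ring_hom (fldrec vals) (frac_ring S D)"
    unfolding ring_hom_def
  proof (intro CollectI conjI allI impI)
    show "?psi \<in> carrier (fldrec vals) \<rightarrow> carrier (frac_ring S D)" using nup by auto
    fix a b assume "a \<in> carrier (fldrec vals) \<and> b \<in> carrier (fldrec vals)"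
    then have ab: "a \<in> vals" "b \<in> vals" by auto
    show "?psi (a \<otimes>\<^bsub>fldrec vals\<^esub> b) = ?psi a \<otimes>\<^bsub>frac_ring S D\<^esub> ?psi b"
      by (rule uniq) (use ab nup s nu_mult in \<open>auto simp: type_algebra_sel\<close>)
    show "?psi (a \<oplus>\<^bsub>fldrec vals\<^esub> b) = ?psi a \<oplus>\<^bsub>frac_ring S D\<^esub> ?psi b"
      by (rule uniq) (use ab nup s nu_add in \<open>auto simp: type_algebra_sel\<close>)
  qed (use one in \<open>simp add: type_algebra_sel\<close>)
  moreover have "bij_betw ?psi vals (carrier (frac_ring S D))"
    using nu_inj nu_image by (intro bij_betw_the_inv_into) (simp add: bij_betw_def)
  ultimately have "?psi \<in> ring_iso (fldrec vals) (frac_ring S D)" by (simp add: ring_iso_def)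
  from field.ring_iso_imp_img_field[OF field_fldrec[OF subfld_vals] this]
  show ?thesis using one zero by (simp add: type_algebra_sel)
qed

lemma field_embed_nu: "field_embed (frac_ring S D) nu"
  by (intro field_embed.intro field_frac_ring nu_mult nu_add nu_one nu_inj)

end

context field_embed
begin

text \<open>One inclusion is induction over the generation; for the other, the image of
  \<open>generate_field\<close> is a subfield containing the generators, so
  \<open>gen3_least\<close> applies.\<close>

lemma generate_field_pre:
  fixes h :: "'a::field \<Rightarrow> 'b"
  assumes h: "ringhom h" and k: "k \<subseteq> carrier F" "\<phi> ` k = range h"
    and xyz: "x \<in> carrier F" "y \<in> carrier F" "z \<in> carrier F"
  shows "generate_field F (k \<union> {x, y, z}) = pre (gen3 h (\<phi> x) (\<phi> y) (\<phi> z))"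
proof (intro equalityI subsetI)
  have H: "k \<union> {x, y, z} \<subseteq> carrier F" using k xyz by auto
  let ?E = "gen3 h (\<phi> x) (\<phi> y) (\<phi> z)" and ?Gf = "generate_field F (k \<union> {x, y, z})"
  note E = subfldD[OF subfld_gen3[OF h]] gen3_gens[OF h]
  note sub = F.generate_field_in_carrier[OF H]
  {
    fix g assume "g \<in> ?Gf"
    then have "g \<in> carrier F \<and> \<phi> g \<in> ?E"
    proof (induction rule: generate_field.induct)
      case one
      then show ?case using E by (simp add: phi_one)
    next
      case (incl g)
      have "\<phi> g \<in> ?E"
      proof (cases "g \<in> k")
        case True
        then obtain a where "\<phi> g = h a" using k(2) by blast
        then show ?thesis using E by simp
      qed (use incl E in auto)
      then show ?case using incl H by blast
    next
      case (m_inv g)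
      then show ?case using E phi_inv inv_closed by simp
    qed (use E phi_a_inv phi_add phi_mult in auto)
    then show "g \<in> pre ?E" by (simp add: pre_def)
  }
  fix g assume g: "g \<in> pre ?E"
  have "subfld (\<phi> ` ?Gf)"
    unfolding subfld_def
  proof (intro conjI ballI)
    show "1 \<in> \<phi> ` ?Gf" using generate_field.one[of F] phi_one by (metis imageI)
    fix a assume "a \<in> \<phi> ` ?Gf"
    then obtain s where s: "s \<in> ?Gf" "a = \<phi> s" by blast
    show "- a \<in> \<phi> ` ?Gf" using generate_field.a_inv[OF s(1)] phi_a_inv[OF sub[OF s(1)]] s(2) by (metis imageI)
    show "inverse a \<in> \<phi> ` ?Gf"
    proof (cases "s = \<zero>\<^bsub>F\<^esub>")
      case True
      then show ?thesis using imageI[OF s(1), of \<phi>] s(2) phi_zero by simp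
    next
      case False
      then show ?thesis using generate_field.m_inv[OF s(1) False] phi_inv[OF sub[OF s(1)] False] s(2) by (metis imageI)
    qed
    fix b assume "b \<in> \<phi> ` ?Gf"
    then obtain r where r: "r \<in> ?Gf" "b = \<phi> r" by blast
    show "a + b \<in> \<phi> ` ?Gf" using generate_field.eng_add[OF s(1) r(1)] phi_add[OF sub[OF s(1)] sub[OF r(1)]] s r by (metis imageI)
    show "a * b \<in> \<phi> ` ?Gf" using generate_field.eng_mult[OF s(1) r(1)] phi_mult[OF sub[OF s(1)] sub[OF r(1)]] s r by (metis imageI)
  qed
  moreover have "range h \<subseteq> \<phi> ` ?Gf" unfolding k(2)[symmetric] by (intro image_mono subsetI generate_field.incl) simp
  moreover have "\<phi> x \<in> \<phi> ` ?Gf" "\<phi> y \<in> \<phi> ` ?Gf" "\<phi> z \<in> \<phi> ` ?Gf"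
    by (intro imageI generate_field.incl; simp)+
  ultimately have "?E \<subseteq> \<phi> ` ?Gf" by (intro gen3_least h)
  then have "\<phi> g \<in> \<phi> ` ?Gf" using g by (auto simp: pre_def)
  then obtain s where "s \<in> ?Gf" "\<phi> g = \<phi> s" by blast
  then show "g \<in> ?Gf" using phi_eq_iff[of g s] g sub by (auto simp: pre_def)
qed

end

section \<open>Generic points\<close>

text \<open>The kernel of evaluation at \<open>(x, y, z)\<close> is the ideal of \<open>A\<close>;
  as the values lie in a field, this ideal is prime.\<close>

definition generic :: "('a::field \<times> 'a \<times> 'a) set \<Rightarrow> ('a \<Rightarrow> 'b::field) \<Rightarrow> 'b \<Rightarrow> 'b \<Rightarrow> 'b \<Rightarrow> bool" where
  "generic A h x y z \<longleftrightarrow> ringhom h \<and> (\<forall>P. (\<forall>s\<in>A. eval3 P s = 0) \<longleftrightarrow> evt h x y z P = 0)"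

lemma eval3_simps:
  "eval3 (P + Q) s = eval3 P s + eval3 Q s" "eval3 (P * Q) s = eval3 P s * eval3 Q s"
  "eval3 (P - Q) s = eval3 P s - eval3 Q s" "eval3 1 s = 1" "eval3 0 s = 0"
  by (cases s; simp add: eval3_evt evt_simps[OF ringhom_id])+

text \<open>A polynomial representing the function is chosen; at a generic point the value does not
  depend on the choice.\<close>

definition eaff :: "('a::field \<Rightarrow> 'b::field) \<Rightarrow> 'b \<Rightarrow> 'b \<Rightarrow> 'b \<Rightarrow> ('a \<times> 'a \<times> 'a \<Rightarrow> 'a) \<Rightarrow> 'b" where
  "eaff h x y z F = evt h x y z (SOME P. F = eval3 P)"

lemma eaff:
  assumes "generic A h x y z"
  shows "eaff h x y z (eval3 P) = evt h x y z P"
proof -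
  have h: "ringhom h" using assms by (simp add: generic_def)
  let ?P = "SOME Q. eval3 P = eval3 Q"
  have "eval3 P = eval3 ?P" by (rule someI[of _ P]) simp
  then have "\<forall>s\<in>A. eval3 (P - ?P) s = 0" by (simp add: eval3_simps)
  then have "evt h x y z (P - ?P) = 0" using assms by (simp add: generic_def)
  then show ?thesis by (simp add: eaff_def evt_simps[OF h])
qed

lemma aff_frac_data:
  assumes g: "generic A h x y z"
  shows "frac_data A (aff_fractions A) (\<lambda>_ F. \<exists>P. F = eval3 P) (eaff h x y z)"
proof -
  have h: "ringhom h" using g by (simp add: generic_def)
  have op: "(\<lambda>s. eval3 P s * eval3 Q s) = eval3 (P * Q)" "(\<lambda>s. eval3 P s + eval3 Q s) = eval3 (P + Q)"
    "(\<lambda>s. eval3 P s - eval3 Q s) = eval3 (P - Q)" "(\<lambda>s. 1) = eval3 1" "(\<lambda>s. 0) = eval3 0" for P Q :: "'a poly poly poly"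
    by (auto simp: eval3_simps)
  show ?thesis
  proof
    show "aff_fractions A = {(F, G). \<exists>m::nat. (\<exists>P. F = eval3 P) \<and> (\<exists>P. G = eval3 P) \<and> (\<exists>s\<in>A. G s \<noteq> 0)}"
      by (auto simp: aff_fractions_def)
    show "(\<forall>s\<in>A. F s = 0) \<longleftrightarrow> eaff h x y z F = 0" if "\<exists>P. F = eval3 P" for F
      using that g by (auto simp: eaff[OF g] generic_def)
  qed (auto simp: op eaff[OF g] evt_simps[OF h])
qed

lemma aff_vals:
  assumes g: "generic A h x y z"
  shows "frac_data.vals (aff_fractions A) (eaff h x y z) = gen3 h x y z"
proof -
  interpret frac_data A "aff_fractions A" "\<lambda>_ F. \<exists>P. F = eval3 P" "eaff h x y z"
    by (rule aff_frac_data[OF g])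
  have "(eval3 P, eval3 Q) \<in> aff_fractions A \<longleftrightarrow> evt h x y z Q \<noteq> 0" for P Q
    by (auto simp: D_iff eaff[OF g])
  then show ?thesis
    unfolding vals_def gen3_def by (auto simp: aff_fractions_def eaff[OF g]) (metis eaff[OF g])+
qed

section \<open>Forms and their dehomogenizations\<close>

definition mon :: "'a::field \<Rightarrow> nat \<Rightarrow> nat \<Rightarrow> nat \<Rightarrow> nat \<Rightarrow> 'a vec4 \<Rightarrow> 'a" where
  "mon c i j k l = (\<lambda>(X, Y, Z, T). c * X ^ i * Y ^ j * Z ^ k * T ^ l)"

definition pmon :: "'a::field \<Rightarrow> nat \<Rightarrow> nat \<Rightarrow> nat \<Rightarrow> 'a poly poly poly" where
  "pmon c i j k = [:[:[:c:]:]:] * pU ^ i * pV ^ j * pW ^ k"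

text \<open>\<open>hform m F P\<close>: \<open>F\<close> is a form of degree \<open>m\<close> and \<open>P\<close> is obtained from it by \<open>T = 1\<close>.\<close>

inductive hform :: "nat \<Rightarrow> ('a::field vec4 \<Rightarrow> 'a) \<Rightarrow> 'a poly poly poly \<Rightarrow> bool" where
  zero: "hform m (\<lambda>_. 0) 0"
| step: "hform m F P \<Longrightarrow> i + j + k + l = m \<Longrightarrow> hform m (\<lambda>v. F v + mon c i j k l v) (P + pmon c i j k)"

lemma hform_mon: "i + j + k + l = m \<Longrightarrow> hform m (mon c i j k l) (pmon c i j k)"
  using hform.step[OF hform.zero, of i j k l m c] by simp

lemma hform_add: "hform m G Q \<Longrightarrow> hform m F P \<Longrightarrow> hform m (\<lambda>v. F v + G v) (P + Q)"
proof (induction rule: hform.induct)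
  case (step m G Q i j k l c)
  from hform.step[OF step.IH[OF step.prems] step.hyps(2), of c] show ?case by (simp add: add.assoc)
qed simp

lemma hform_sum:
  "finite I \<Longrightarrow> (\<And>i. i \<in> I \<Longrightarrow> hform m (F i) (P i)) \<Longrightarrow> hform m (\<lambda>v. \<Sum>i\<in>I. F i v) (\<Sum>i\<in>I. P i)"
proof (induction I rule: finite_induct)
  case (insert i I)
  then show ?case using hform_add[of m "\<lambda>v. \<Sum>i\<in>I. F i v" "\<Sum>i\<in>I. P i" "F i" "P i"] by simp
qed (simp add: hform.zero)

lemma mon_mult: "mon c i j k l v * mon c' i' j' k' l' v = mon (c * c') (i + i') (j + j') (k + k') (l + l') v"
  by (cases v) (simp add: mon_def power_add)

lemma pmon_mult: "pmon c i j k * pmon c' i' j' k' = pmon (c * c') (i + i') (j + j') (k + k')"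
proof -
  have "[:[:[:c * c':]:]:] = [:[:[:c:]:]:] * [:[:[:c':]:]:]" by simp
  then show ?thesis unfolding pmon_def by (simp only: power_add mult_ac)
qed

lemma hform_mult: "hform m F P \<Longrightarrow> hform m' G Q \<Longrightarrow> hform (m + m') (\<lambda>v. F v * G v) (P * Q)"
proof (induction rule: hform.induct)
  case (zero m)
  then show ?case by (simp add: hform.zero)
next
  case (step m F P i j k l c)
  have "hform m' G Q \<Longrightarrow> hform (m + m') (\<lambda>v. mon c i j k l v * G v) (pmon c i j k * Q)"
  proof (induction rule: hform.induct)
    case (zero m')
    then show ?case by (simp add: hform.zero)
  next
    case (step m' G Q i' j' k' l' c')
    have "(i + i') + (j + j') + (k + k') + (l + l') = m + m'"
      using step.hyps(2) \<open>i + j + k + l = m\<close> by simp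
    from hform.step[OF step.IH this, of "c * c'"] show ?case
      by (simp add: mon_mult pmon_mult distrib_left)
  qed
  from hform_add[OF this[OF step.prems] step.IH[OF step.prems]] show ?case
    by (simp add: distrib_right)
qed

lemma hform_const: "hform 0 (\<lambda>_. c) [:[:[:c:]:]:]"
proof -
  have "mon c 0 0 0 0 = (\<lambda>_. c)" by (auto simp: mon_def)
  then show ?thesis using hform_mon[of 0 0 0 0 0 c] by (simp add: pmon_def)
qed

lemma hform_diff: "hform m F P \<Longrightarrow> hform m G Q \<Longrightarrow> hform m (\<lambda>v. F v - G v) (P - Q)"
proof -
  assume *: "hform m F P" "hform m G Q"
  have "hform m (\<lambda>v. - 1 * G v) ([:[:[:- 1:]:]:] * Q)"
    using hform_mult[OF hform_const *(2), of "- 1"] by simp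
  moreover have "[:[:[:- 1:]:]:] = (- 1 :: 'a poly poly poly)" by (simp add: one_pCons)
  ultimately have "hform m (\<lambda>v. - G v) (- Q)" by simp
  from hform_add[OF this *(1)] show ?thesis by simp
qed

lemma form_hform:
  assumes "form m F" shows "\<exists>P. hform m F P"
proof -
  obtain a where F: "F = (\<lambda>(X, Y, Z, T).
     \<Sum>i\<le>m. \<Sum>j\<le>m - i. \<Sum>k\<le>m - i - j. a i j k * X ^ i * Y ^ j * Z ^ k * T ^ (m - i - j - k))"
    using assms by (auto simp: form_def)
  have "F = (\<lambda>v. \<Sum>i\<le>m. \<Sum>j\<le>m - i. \<Sum>k\<le>m - i - j. mon (a i j k) i j k (m - i - j - k) v)"
    unfolding F mon_def by (rule ext) (simp split: prod.split)
  moreover have "hform m \<dots> (\<Sum>i\<le>m. \<Sum>j\<le>m - i. \<Sum>k\<le>m - i - j. pmon (a i j k) i j k)"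
    by (intro hform_sum hform_mon) auto
  ultimately show ?thesis by auto
qed

lemma hform_form: "hform m F P \<Longrightarrow> form m F"
proof (induction rule: hform.induct)
  case (zero m)
  show ?case unfolding form_def by (rule exI[of _ "\<lambda>_ _ _. 0"]) auto
next
  case (step m F P i j k l c)
  then obtain a where F: "F = (\<lambda>(X, Y, Z, T).
     \<Sum>i\<le>m. \<Sum>j\<le>m - i. \<Sum>k\<le>m - i - j. a i j k * X ^ i * Y ^ j * Z ^ k * T ^ (m - i - j - k))"
    by (auto simp: form_def)
  \<comment> \<open>\<open>c\<close> is added to the single coefficient at \<open>(i, j, k)\<close>;
    the exponent of T is then forced to be \<open>l\<close>.\<close>
  define a' where "a' i' j' k' = a i' j' k' + (if i' = i then if j' = j then if k' = k then c else 0 else 0 else 0)"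
    for i' j' k'
  have d: "(\<Sum>i'\<le>m. \<Sum>j'\<le>m - i'. \<Sum>k'\<le>m - i' - j'.
      (if i' = i then if j' = j then if k' = k then c else 0 else 0 else 0) * g i' j' k') = c * g i j k"
    for g :: "nat \<Rightarrow> nat \<Rightarrow> nat \<Rightarrow> 'a"
  proof -
    have 1: "(\<Sum>k'\<le>m - i' - j'. (if i' = i then if j' = j then if k' = k then c else 0 else 0 else 0) * g i' j' k') =
        (if i' = i then if j' = j then c * g i j k else 0 else 0)" for i' j'
    proof (cases "i' = i \<and> j' = j")
      case True
      have "(\<Sum>k'\<le>m - i - j. (if k' = k then c else 0) * g i j k') = (\<Sum>k'\<le>m - i - j. if k' = k then c * g i j k else 0)"
        by (rule sum.cong) auto
      also have "\<dots> = c * g i j k" using step.hyps by simp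
      finally show ?thesis using True by simp
    qed auto
    have 2: "(\<Sum>j'\<le>m - i'. if i' = i then if j' = j then c * g i j k else 0 else 0) = (if i' = i then c * g i j k else 0)" for i'
      using step.hyps by (cases "i' = i") auto
    show ?thesis unfolding 1 2 using step.hyps by simp
  qed
  have l: "m - i - j - k = l" using step.hyps by simp
  have "(\<lambda>v. F v + mon c i j k l v) = (\<lambda>(X, Y, Z, T).
     \<Sum>i\<le>m. \<Sum>j\<le>m - i. \<Sum>k\<le>m - i - j. a' i j k * X ^ i * Y ^ j * Z ^ k * T ^ (m - i - j - k))"
  proof (rule ext, safe)
    fix X Y Z T
    have "(\<Sum>i\<le>m. \<Sum>j\<le>m - i. \<Sum>k\<le>m - i - j. a' i j k * X ^ i * Y ^ j * Z ^ k * T ^ (m - i - j - k)) =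
      F (X, Y, Z, T) + (\<Sum>i'\<le>m. \<Sum>j'\<le>m - i'. \<Sum>k'\<le>m - i' - j'.
      (if i' = i then if j' = j then if k' = k then c else 0 else 0 else 0) *
      (X ^ i' * Y ^ j' * Z ^ k' * T ^ (m - i' - j' - k')))"
      by (simp add: F a'_def sum.distrib distrib_right mult.assoc)
    then show "F (X, Y, Z, T) + mon c i j k l (X, Y, Z, T) =
      (\<Sum>i\<le>m. \<Sum>j\<le>m - i. \<Sum>k\<le>m - i - j. a' i j k * X ^ i * Y ^ j * Z ^ k * T ^ (m - i - j - k))"
      unfolding d by (simp only: mon_def prod.case l mult.assoc)
  qed
  then show ?case unfolding form_def by (intro exI[of _ a']) simp
qed

lemma hform_eval: "hform m F P \<Longrightarrow> F (X, Y, Z, 1) = eval3 P (X, Y, Z)"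
proof (induction rule: hform.induct)
  case (step m F P i j k l c)
  have "eval3 (pmon c i j k) (X, Y, Z) = c * X ^ i * Y ^ j * Z ^ k"
    unfolding pmon_def eval3_evt by (simp add: evt_simps[OF ringhom_id] evp_const ringhom_id del: mult_pCons_left)
  then show ?case using step by (simp add: mon_def eval3_simps)
qed (simp add: eval3_simps)

definition dg :: "'a::field \<Rightarrow> 'a \<Rightarrow> 'a \<Rightarrow> 'a \<Rightarrow> 'a vec4 \<Rightarrow> 'a vec4" where
  "dg a b c d = (\<lambda>(X, Y, Z, T). (a * X, b * Y, c * Z, d * T))"

definition sbst :: "'a::field \<Rightarrow> 'a \<Rightarrow> 'a \<Rightarrow> 'a poly poly poly \<Rightarrow> 'a poly poly poly" where
  "sbst a b c = evt (\<lambda>a. [:[:[:a:]:]:]) ([:[:[:a:]:]:] * pU) ([:[:[:b:]:]:] * pV) ([:[:[:c:]:]:] * pW)"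

lemma ringhom_const3: "ringhom (\<lambda>a. [:[:[:a :: 'a :: comm_ring_1:]:]:])"
  by (rule ringhomI) (simp_all add: one_pCons)

lemma evt_sbst:
  assumes "ringhom h"
  shows "evt h x y z (sbst a b c P) = evt h (h a * x) (h b * y) (h c * z) P"
proof -
  have "evt h x y z (sbst a b c P) = evt (\<lambda>a. evt h x y z [:[:[:a:]:]:]) (evt h x y z ([:[:[:a:]:]:] * pU))
     (evt h x y z ([:[:[:b:]:]:] * pV)) (evt h x y z ([:[:[:c:]:]:] * pW)) P"
    unfolding sbst_def by (rule hom_evt[OF ringhom_evt[OF assms] ringhom_const3])
  then show ?thesis
    by (simp add: evt_simps[OF assms] evp_const assms del: mult_pCons_left)
qed

lemma eval3_sbst: "eval3 (sbst a b c P) (X, Y, Z) = eval3 P (a * X, b * Y, c * Z)"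
  by (simp add: eval3_evt evt_sbst ringhom_id)

lemma hform_sbst: "hform m F P \<Longrightarrow> hform m (\<lambda>v. F (dg a b c 1 v)) (sbst a b c P)"
proof (induction rule: hform.induct)
  case (zero m)
  show ?case by (simp add: hform.zero sbst_def evt_simps[OF ringhom_const3])
next
  case (step m F P i j k l d)
  let ?d = "d * a ^ i * b ^ j * c ^ k"
  have 1: "mon d i j k l (dg a b c 1 v) = mon ?d i j k l v" for v
    by (cases v) (simp add: mon_def dg_def power_mult_distrib mult_ac)
  have C: "[:[:[:d:]:]:] * [:[:[:a:]:]:] ^ i * [:[:[:b:]:]:] ^ j * [:[:[:c:]:]:] ^ k = [:[:[:?d:]:]:]"
    by (simp only: ringhom_simps(4)[OF ringhom_const3] ringhom_power[OF ringhom_const3])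
  have "sbst a b c (pmon d i j k) = [:[:[:d:]:]:] * ([:[:[:a:]:]:] * pU) ^ i * ([:[:[:b:]:]:] * pV) ^ j * ([:[:[:c:]:]:] * pW) ^ k"
    unfolding sbst_def pmon_def
    by (simp add: evt_simps[OF ringhom_const3] evp_const ringhom_const3 del: mult_pCons_left)
  also have "\<dots> = ([:[:[:d:]:]:] * [:[:[:a:]:]:] ^ i * [:[:[:b:]:]:] ^ j * [:[:[:c:]:]:] ^ k) * pU ^ i * pV ^ j * pW ^ k"
    by (simp only: power_mult_distrib mult_ac)
  also have "\<dots> = pmon ?d i j k" unfolding C pmon_def ..
  finally have 2: "sbst a b c (pmon d i j k) = pmon ?d i j k" .
  have 3: "sbst a b c (P + pmon d i j k) = sbst a b c P + sbst a b c (pmon d i j k)"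
    by (simp add: sbst_def evt_simps[OF ringhom_const3])
  show ?case unfolding 1 3 2 by (rule hform.step[OF step.IH step.hyps(2)])
qed

lemma form_scale: "form m F \<Longrightarrow> F (dg r r r r v) = r ^ m * F v"
proof -
  assume "form m F"
  then obtain P where "hform m F P" using form_hform by blast
  then show ?thesis
  proof (induction rule: hform.induct)
    case (step m F P i j k l c)
    have "mon c i j k l (dg r r r r v) = r ^ (i + j + k + l) * mon c i j k l v"
      by (cases v) (simp add: mon_def dg_def power_mult_distrib power_add mult_ac)
    then show ?case using step by (simp add: distrib_left)
  qed simp
qed

text \<open>All large degrees are offered, so that a numerator and a denominator can be given the
  same degree.\<close>

lemma homogenize: "\<exists>m0. \<forall>m\<ge>m0. \<exists>F. hform m F P"
proof (induction P rule: poly3_induct)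
  case (add P Q)
  then obtain m0 m1 where "\<forall>m\<ge>m0. \<exists>F. hform m F P" "\<forall>m\<ge>m1. \<exists>F. hform m F Q" by blast
  then have "\<exists>F. hform m F (P + Q)" if "m \<ge> max m0 m1" for m
    using that hform_add[of m _ Q _ P] by (meson max.bounded_iff)
  then show ?case by blast
next
  case (monom a i j k)
  have "\<exists>F. hform m F (pmon a i j k)" if "m \<ge> i + j + k" for m
    using hform_mon[of i j k "m - i - j - k" m a] that by (intro exI) auto
  then show ?case unfolding pmon_def by blast
qed

section \<open>The function field of a projective curve with a generic point\<close>

locale proj_curve =
  fixes A :: "('a::field \<times> 'a \<times> 'a) set" and h :: "'a \<Rightarrow> 'b::field" and x y z :: 'b
  assumes gen: "generic A h x y z"
begin

abbreviation "ev \<equiv> evt h x y z"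
abbreviation "C \<equiv> projective_closure A"

lemma hom: "ringhom h" using gen by (simp add: generic_def)

lemma gen_iff: "(\<forall>s\<in>A. eval3 P s = 0) \<longleftrightarrow> ev P = 0" using gen by (simp add: generic_def)

text \<open>Scaling multiplies a form by a power of the factor, so the closure can be tested on any
  coordinate vector of a point.\<close>

lemma mem_C: "v \<in> \<Union>C \<longleftrightarrow> v \<noteq> (0, 0, 0, 0) \<and>
    (\<forall>m F. form m F \<longrightarrow> (\<forall>(X, Y, Z)\<in>A. F (X, Y, Z, 1) = 0) \<longrightarrow> F v = 0)"
proof
  assume "v \<in> \<Union>C"
  then obtain v0 where v0: "v \<in> ppoint v0" "v0 \<noteq> (0, 0, 0, 0)"
    "\<And>m F. form m F \<Longrightarrow> (\<forall>(X, Y, Z)\<in>A. F (X, Y, Z, 1) = 0) \<Longrightarrow> F v0 = 0"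
    by (auto simp: projective_closure_def)
  obtain r where r: "r \<noteq> 0" "v = dg r r r r v0" using v0(1) by (cases v0) (auto simp: ppoint_def dg_def)
  then have "v \<noteq> (0, 0, 0, 0)" using v0(2) by (cases v0) (auto simp: dg_def)
  then show "v \<noteq> (0, 0, 0, 0) \<and>
    (\<forall>m F. form m F \<longrightarrow> (\<forall>(X, Y, Z)\<in>A. F (X, Y, Z, 1) = 0) \<longrightarrow> F v = 0)"
  proof (intro conjI allI impI)
    fix m F assume F: "form m F" "\<forall>(X, Y, Z)\<in>A. F (X, Y, Z, 1) = 0"
    show "F v = 0" unfolding r(2) form_scale[OF F(1)] using v0(3)[OF F] by simp
  qed
next
  assume v: "v \<noteq> (0, 0, 0, 0) \<and>
    (\<forall>m F. form m F \<longrightarrow> (\<forall>(X, Y, Z)\<in>A. F (X, Y, Z, 1) = 0) \<longrightarrow> F v = 0)"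
  then have "ppoint v \<in> C" unfolding projective_closure_def by blast
  moreover have "v \<in> ppoint v" by (cases v) (auto simp: ppoint_def intro!: exI[of _ 1])
  ultimately show "v \<in> \<Union>C" by blast
qed

lemma C_point:
  assumes "P \<in> C" "v \<in> P"
  shows "P = ppoint v" "v \<in> \<Union>C"
proof -
  obtain v0 where v0: "P = ppoint v0" using assms by (auto simp: projective_closure_def)
  obtain r where r: "r \<noteq> 0" "v = dg r r r r v0" using assms v0 by (cases v0) (auto simp: ppoint_def dg_def)
  obtain X Y Z T where xyzt: "v0 = (X, Y, Z, T)" by (cases v0)
  show "P = ppoint v"
    unfolding v0 r(2) xyzt ppoint_def dg_def prod.case
  proof (intro equalityI subsetI; clarify)
    fix s :: 'a assume "s \<noteq> 0"
    then show "\<exists>r'. (s * X, s * Y, s * Z, s * T) = (r' * (r * X), r' * (r * Y), r' * (r * Z), r' * (r * T)) \<and> r' \<noteq> 0"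
      using r(1) by (intro exI[of _ "s / r"]) simp
  next
    fix s :: 'a assume "s \<noteq> 0"
    then show "\<exists>r'. (s * (r * X), s * (r * Y), s * (r * Z), s * (r * T)) = (r' * X, r' * Y, r' * Z, r' * T) \<and> r' \<noteq> 0"
      using r(1) by (intro exI[of _ "s * r"]) simp
  qed
  show "v \<in> \<Union>C" using assms by blast
qed

text \<open>A form that vanishes on the affine part vanishes on the whole closure by definition, so
  setting T = 1 and testing at the generic point loses nothing.\<close>

lemma form_vanish:
  assumes "hform m F P"
  shows "(\<forall>v\<in>\<Union>C. F v = 0) \<longleftrightarrow> ev P = 0"
proof -
  have "(\<forall>v\<in>\<Union>C. F v = 0) \<longleftrightarrow> (\<forall>(X, Y, Z)\<in>A. F (X, Y, Z, 1) = 0)"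
  proof
    assume *: "\<forall>v\<in>\<Union>C. F v = 0"
    have "(X, Y, Z, 1) \<in> \<Union>C" if "(X, Y, Z) \<in> A" for X Y Z
      unfolding mem_C using that by auto
    then show "\<forall>(X, Y, Z)\<in>A. F (X, Y, Z, 1) = 0" using * by blast
  next
    assume F: "\<forall>(X, Y, Z)\<in>A. F (X, Y, Z, 1) = 0"
    show "\<forall>v\<in>\<Union>C. F v = 0"
    proof
      fix v assume v: "v \<in> \<Union>C"
      from conjunct2[OF iffD1[OF mem_C v]] show "F v = 0" using hform_form[OF assms] F by blast
    qed
  qed
  also have "\<dots> \<longleftrightarrow> (\<forall>s\<in>A. eval3 P s = 0)" using hform_eval[OF assms] by auto
  finally show ?thesis by (simp add: gen_iff)
qed

definition eproj :: "('a vec4 \<Rightarrow> 'a) \<Rightarrow> 'b" where "eproj F = ev (SOME P. \<exists>m. hform m F P)"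

lemma eproj: assumes "hform m F P" shows "eproj F = ev P"
proof -
  have "\<exists>P m. hform m F P" using assms by blast
  from someI_ex[OF this] obtain m' where "hform m' F (SOME P. \<exists>m. hform m F P)" by blast
  then have "eval3 (SOME P. \<exists>m. hform m F P) (X, Y, Z) = eval3 P (X, Y, Z)" for X Y Z
    using hform_eval[OF assms] hform_eval by metis
  then have "\<forall>s\<in>A. eval3 ((SOME P. \<exists>m. hform m F P) - P) s = 0" by (auto simp: eval3_simps)
  then show ?thesis by (simp add: gen_iff eproj_def evt_simps[OF hom])
qed

sublocale frac_data "\<Union>C" "proj_fractions C" form eproj
proof
  show "proj_fractions C = {(F, G). \<exists>m. form m F \<and> form m G \<and> (\<exists>s\<in>\<Union>C. G s \<noteq> 0)}"
    by (simp add: proj_fractions_def)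
  show "(\<forall>s\<in>\<Union>C. F s = 0) \<longleftrightarrow> eproj F = 0" if "form m F" for m F
  proof -
    obtain P where P: "hform m F P" using form_hform \<open>form m F\<close> by blast
    show ?thesis using form_vanish[OF P] eproj[OF P] by simp
  qed
  fix m m' and F G :: "'a vec4 \<Rightarrow> 'a"
  {
    assume "form m F" "form m' G"
    then obtain P Q where P: "hform m F P" "hform m' G Q" using form_hform[of m F] form_hform[of m' G] by auto
    from hform_mult[OF P] show "form (m + m') (\<lambda>s. F s * G s) \<and> eproj (\<lambda>s. F s * G s) = eproj F * eproj G"
      using eproj[OF P(1)] eproj[OF P(2)] by (auto simp: eproj evt_simps[OF hom] intro: hform_form)
  }
  {
    assume "form m F" "form m G"
    then obtain P Q where P: "hform m F P" "hform m G Q" using form_hform[of m F] form_hform[of m G] by auto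
    from hform_add[OF P(2,1)] show "form m (\<lambda>s. F s + G s) \<and> eproj (\<lambda>s. F s + G s) = eproj F + eproj G"
      using eproj[OF P(1)] eproj[OF P(2)] by (auto simp: eproj evt_simps[OF hom] intro: hform_form)
    from hform_diff[OF P] show "form m (\<lambda>s. F s - G s) \<and> eproj (\<lambda>s. F s - G s) = eproj F - eproj G"
      using eproj[OF P(1)] eproj[OF P(2)] by (auto simp: eproj evt_simps[OF hom] intro: hform_form)
  }
  show "form 0 (\<lambda>s. 1) \<and> eproj (\<lambda>s. 1) = 1" "form 0 (\<lambda>s. 0)"
    using hform_form[OF hform_const] eproj[OF hform_const, of 1]
    by (simp_all add: evt_simps[OF hom] evp_const hom ringhom_simps[OF hom])
qed

lemma vals_gen3: "vals = gen3 h x y z"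
proof (intro equalityI subsetI)
  fix c assume "c \<in> vals"
  then obtain F G where FG: "(F, G) \<in> proj_fractions C" "c = eproj F / eproj G" by (auto simp: vals_def)
  then obtain m where m: "form m F" "form m G" "eproj G \<noteq> 0" by (auto simp: D_iff)
  obtain P Q where "hform m F P" "hform m G Q" using form_hform[OF m(1)] form_hform[OF m(2)] by auto
  then show "c \<in> gen3 h x y z" using FG(2) m(3) eproj gen3I by metis
next
  fix c assume "c \<in> gen3 h x y z"
  then obtain P Q where PQ: "c = ev P / ev Q" "ev Q \<noteq> 0" by (auto simp: gen3_def)
  obtain m0 m1 where "\<forall>m\<ge>m0. \<exists>F. hform m F P" "\<forall>m\<ge>m1. \<exists>F. hform m F Q" using homogenize by meson
  then obtain F G where FG: "hform (max m0 m1) F P" "hform (max m0 m1) G Q" by (metis max.cobounded1 max.cobounded2)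
  then have "(F, G) \<in> proj_fractions C" using PQ(2) eproj by (auto simp: D_iff intro: hform_form)
  from valsI[OF this] show "c \<in> vals" using eproj FG PQ by simp
qed

lemma proj_frac_nu:
  assumes "hform m F P" "hform m G Q" "ev Q \<noteq> 0"
  shows "proj_frac C F G \<in> carrier (proj_function_field C)" "nu (proj_frac C F G) = ev P / ev Q"
proof -
  have "(F, G) \<in> proj_fractions C" using assms by (auto simp: D_iff eproj[OF assms(2)] intro: hform_form)
  then show "proj_frac C F G \<in> carrier (proj_function_field C)" "nu (proj_frac C F G) = ev P / ev Q"
    using eproj assms by (auto simp: proj_frac_def proj_function_field_def carrier_frac nu_frac)
qed

lemma coordinate_functions:
  "proj_const C a \<in> carrier (proj_function_field C)" "nu (proj_const C a) = h a"
  "proj_frac C (\<lambda>(X, Y, Z, T). X) (\<lambda>(X, Y, Z, T). T) \<in> carrier (proj_function_field C)"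
  "nu (proj_frac C (\<lambda>(X, Y, Z, T). X) (\<lambda>(X, Y, Z, T). T)) = x"
  "proj_frac C (\<lambda>(X, Y, Z, T). Y) (\<lambda>(X, Y, Z, T). T) \<in> carrier (proj_function_field C)"
  "nu (proj_frac C (\<lambda>(X, Y, Z, T). Y) (\<lambda>(X, Y, Z, T). T)) = y"
  "proj_frac C (\<lambda>(X, Y, Z, T). Z) (\<lambda>(X, Y, Z, T). T) \<in> carrier (proj_function_field C)"
  "nu (proj_frac C (\<lambda>(X, Y, Z, T). Z) (\<lambda>(X, Y, Z, T). T)) = z"
proof -
  have p: "pmon 1 1 0 0 = pU" "pmon 1 0 1 0 = pV" "pmon 1 0 0 1 = pW" "pmon 1 0 0 0 = (1 :: 'a poly poly poly)"
    by (simp_all add: pmon_def flip: one_pCons)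
  have m: "mon 1 1 0 0 0 = (\<lambda>(X, Y, Z, T). X)" "mon 1 0 1 0 0 = (\<lambda>(X, Y, Z, T). Y)"
    "mon 1 0 0 1 0 = (\<lambda>(X, Y, Z, T). Z)" "mon 1 0 0 0 1 = (\<lambda>(X, Y, Z, T). T :: 'a)"
    by (auto simp: mon_def)
  have X: "hform 1 (\<lambda>(X, Y, Z, T). X :: 'a) pU" and Y: "hform 1 (\<lambda>(X, Y, Z, T). Y :: 'a) pV"
    and Z: "hform 1 (\<lambda>(X, Y, Z, T). Z :: 'a) pW" and T: "hform 1 (\<lambda>(X, Y, Z, T). T :: 'a) 1"
    using hform_mon[of 1 0 0 0 1 "1::'a"] hform_mon[of 0 1 0 0 1 "1::'a"] hform_mon[of 0 0 1 0 1 "1::'a"]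
      hform_mon[of 0 0 0 1 1 "1::'a"] unfolding p m by simp_all
  note e = evt_simps[OF hom] evp_const hom ringhom_simps[OF hom]
  have e1: "ev 1 \<noteq> 0" by (simp add: e)
  show "proj_const C a \<in> carrier (proj_function_field C)" "nu (proj_const C a) = h a"
    using proj_frac_nu[OF hform_const hform_const, of 1 a] by (simp_all add: proj_const_def e)
  show "proj_frac C (\<lambda>(X, Y, Z, T). X) (\<lambda>(X, Y, Z, T). T) \<in> carrier (proj_function_field C)"
    "nu (proj_frac C (\<lambda>(X, Y, Z, T). X) (\<lambda>(X, Y, Z, T). T)) = x"
    using proj_frac_nu[OF X T e1] by (simp_all add: e)
  show "proj_frac C (\<lambda>(X, Y, Z, T). Y) (\<lambda>(X, Y, Z, T). T) \<in> carrier (proj_function_field C)"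
    "nu (proj_frac C (\<lambda>(X, Y, Z, T). Y) (\<lambda>(X, Y, Z, T). T)) = y"
    using proj_frac_nu[OF Y T e1] by (simp_all add: e)
  show "proj_frac C (\<lambda>(X, Y, Z, T). Z) (\<lambda>(X, Y, Z, T). T) \<in> carrier (proj_function_field C)"
    "nu (proj_frac C (\<lambda>(X, Y, Z, T). Z) (\<lambda>(X, Y, Z, T). T)) = z"
    using proj_frac_nu[OF Z T e1] by (simp_all add: e)
qed

end

section \<open>Fixed fields of diagonal groups\<close>

text \<open>\<open>A_inv\<close> makes the diagonal maps act on the curve; the point in
  \<open>A_point\<close> shows that the action is faithful.\<close>

locale diag_group = proj_curve A h x y z
  for A :: "('a::alg_closed_field \<times> 'a \<times> 'a) set" and h :: "'a \<Rightarrow> 'b::field" and x y z +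
  fixes e1 e2 :: nat
  assumes e0: "e1 > 0" "e2 > 0" and e_char: "of_nat e1 \<noteq> (0::'a)" "of_nat e2 \<noteq> (0::'a)"
    and x_nz: "x \<noteq> 0"
    and A_inv: "\<And>X Y Z b l. (X, Y, Z) \<in> A \<Longrightarrow> b \<in> roots1 e1 \<Longrightarrow> l \<in> roots1 e2 \<Longrightarrow>
      (inverse b * X, b * Y, l * Z) \<in> A"
    and A_point: "\<exists>X Y Z. (X, Y, Z) \<in> A \<and> X \<noteq> 0 \<and> Z \<noteq> 0"
begin

definition I :: "('a \<times> 'a) set" where "I = roots1 e1 \<times> roots1 e2"

definition tau :: "'a \<times> 'a \<Rightarrow> 'a vec4 \<Rightarrow> 'a vec4" where
  "tau i = dg (inverse (fst i)) (fst i) (snd i) 1"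

text \<open>The action of a group element on functions, realised by moving the generic point. It is
  defined on polynomials and descends to their values by \<open>evi_0_iff\<close>.\<close>

definition evi :: "'a \<times> 'a \<Rightarrow> 'a poly poly poly \<Rightarrow> 'b" where
  "evi i = evt h (h (inverse (fst i)) * x) (h (fst i) * y) (h (snd i) * z)"

definition sb :: "'a \<times> 'a \<Rightarrow> 'a poly poly poly \<Rightarrow> 'a poly poly poly" where
  "sb i = sbst (inverse (fst i)) (fst i) (snd i)"

definition mul :: "'a \<times> 'a \<Rightarrow> 'a \<times> 'a \<Rightarrow> 'a \<times> 'a" where
  "mul i j = (fst i * fst j, snd i * snd j)"

definition iv :: "'a \<times> 'a \<Rightarrow> 'a \<times> 'a" where
  "iv i = (inverse (fst i), inverse (snd i))"

lemma I_nz: "i \<in> I \<Longrightarrow> fst i \<noteq> 0 \<and> snd i \<noteq> 0"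
  using roots1_nz[OF e0(1), of "fst i"] roots1_nz[OF e0(2), of "snd i"] by (auto simp: I_def)

lemma I_closed: "i \<in> I \<Longrightarrow> j \<in> I \<Longrightarrow> mul i j \<in> I" "i \<in> I \<Longrightarrow> iv i \<in> I" "(1, 1) \<in> I"
  by (auto simp: I_def mul_def iv_def intro: roots1_mult roots1_inverse roots1_one)

lemma mul_iv: "i \<in> I \<Longrightarrow> mul i (iv i) = (1, 1)" "i \<in> I \<Longrightarrow> mul (iv i) (mul i j) = j"
    "i \<in> I \<Longrightarrow> mul i (mul (iv i) j) = j"
  using I_nz[of i] by (auto simp: mul_def iv_def prod_eq_iff)

lemma I_finite: "finite I" and I_card: "card I = e1 * e2"
  using finite_roots1[OF e0(1), where 'a = 'a] finite_roots1[OF e0(2), where 'a = 'a]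
    card_roots1[OF e0(1) e_char(1)] card_roots1[OF e0(2) e_char(2)]
  by (simp_all add: I_def card_cartesian_product)

lemma tau_mul: "tau i (tau j v) = tau (mul i j) v"
  by (cases v) (simp add: tau_def dg_def mul_def)

lemma tau_one: "tau (1, 1) v = v"
  by (cases v) (simp add: tau_def dg_def)

lemma tau_iv: "i \<in> I \<Longrightarrow> tau i (tau (iv i) v) = v" "i \<in> I \<Longrightarrow> tau (iv i) (tau i v) = v"
  using I_nz[of i] by (auto simp: tau_def dg_def iv_def split: prod.split)

lemma sb_hform: "hform m F P \<Longrightarrow> hform m (\<lambda>v. F (tau i v)) (sb i P)"
  unfolding tau_def sb_def by (rule hform_sbst)

lemma ev_sb: "ev (sb i P) = evi i P"
  by (simp add: sb_def evi_def evt_sbst hom)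

lemma evi_sb: "i \<in> I \<Longrightarrow> j \<in> I \<Longrightarrow> evi j (sb i P) = evi (mul j i) P"
  unfolding evi_def sb_def mul_def
  by (simp add: evt_sbst hom ringhom_simps[OF hom] mult_ac)

lemma ringhom_evi: "ringhom (evi i)"
  unfolding evi_def by (rule ringhom_evt[OF hom])

lemma evi_one: "evi (1, 1) P = ev P"
  by (simp add: evi_def ringhom_simps[OF hom])

text \<open>The ideal of \<open>A\<close> is stable because \<open>A\<close> is; the converse
  applies this to the inverse group element.\<close>

lemma evi_0_iff:
  assumes i: "i \<in> I" shows "evi i P = 0 \<longleftrightarrow> ev P = 0"
proof -
  have e: "eval3 (sb j P) (X, Y, Z) = eval3 P (inverse (fst j) * X, fst j * Y, snd j * Z)" for j P X Y Z
    by (simp add: sb_def eval3_sbst)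
  have imp: "evi j P = 0" if "ev P = 0" "j \<in> I" for j P
  proof -
    have "\<forall>s\<in>A. eval3 P s = 0" using that gen_iff by blast
    then have "eval3 (sb j P) (X, Y, Z) = 0" if "(X, Y, Z) \<in> A" for X Y Z
      using A_inv[OF that, of "fst j" "snd j"] \<open>j \<in> I\<close> by (auto simp: e I_def)
    then have "\<forall>s\<in>A. eval3 (sb j P) s = 0" by auto
    then show ?thesis using gen_iff ev_sb by metis
  qed
  show ?thesis
  proof
    assume "evi i P = 0"
    then have "ev (sb i P) = 0" by (simp add: ev_sb)
    then have "evi (iv i) (sb i P) = 0" using imp I_closed i by blast
    then have "evi (mul (iv i) i) P = 0" using evi_sb I_closed i by simp
    moreover have "mul (iv i) i = (1, 1)" using I_nz[OF i] by (simp add: mul_def iv_def)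
    ultimately show "ev P = 0" by (simp add: evi_one)
  qed (use imp i in blast)
qed

lemma tau_C: assumes i: "i \<in> I" and v: "v \<in> \<Union>C" shows "tau i v \<in> \<Union>C"
proof (rule iffD2[OF mem_C], intro conjI allI impI)
  note v' = iffD1[OF mem_C v]
  show "tau i v \<noteq> (0, 0, 0, 0)" using conjunct1[OF v'] I_nz[OF i] by (cases v) (auto simp: tau_def dg_def)
  fix m F assume F: "form m F" "\<forall>(X, Y, Z)\<in>A. F (X, Y, Z, 1) = 0"
  obtain P where "hform m F P" using form_hform[OF F(1)] by blast
  then have 1: "form m (\<lambda>v. F (tau i v))" using sb_hform hform_form by blast
  have "F (tau i (X, Y, Z, 1)) = 0" if "(X, Y, Z) \<in> A" for X Y Z
    using A_inv[OF that, of "fst i" "snd i"] F(2) i by (auto simp: tau_def dg_def I_def)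
  then have "\<forall>(X, Y, Z)\<in>A. F (tau i (X, Y, Z, 1)) = 0" by auto
  from mp[OF mp[OF spec[OF spec[OF conjunct2[OF v'], of m], of "\<lambda>v. F (tau i v)"] 1] this]
  show "F (tau i v) = 0" .
qed

lemma tau_D:
  assumes i: "i \<in> I" and FG: "(F, G) \<in> proj_fractions C"
  shows "(\<lambda>v. F (tau i v), \<lambda>v. G (tau i v)) \<in> proj_fractions C"
proof -
  obtain m s where m: "form m F" "form m G" "s \<in> \<Union>C" "G s \<noteq> 0" using FG unfolding proj_fractions_def by blast
  obtain P Q where "hform m F P" "hform m G Q" using form_hform[OF m(1)] form_hform[OF m(2)] by auto
  then have "form m (\<lambda>v. F (tau i v))" "form m (\<lambda>v. G (tau i v))" using sb_hform hform_form by blast+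
  moreover have "tau (iv i) s \<in> \<Union>C" using tau_C I_closed i m by blast
  moreover have "G (tau i (tau (iv i) s)) \<noteq> 0" using m tau_iv[OF i] by simp
  ultimately show ?thesis unfolding proj_fractions_def by blast
qed

definition act :: "'a \<times> 'a \<Rightarrow> 'a ppoint \<Rightarrow> 'a ppoint" where
  "act i = restrict (image (tau i)) C"

lemma ppoint_C: "v \<in> \<Union>C \<Longrightarrow> ppoint v \<in> C"
  using C_point(1) by fastforce

lemma ppoint_alt: "ppoint v = {dg r r r r v | r. r \<noteq> 0}"
  by (cases v) (simp add: ppoint_def dg_def)

lemma tau_ppoint: "tau i ` ppoint v = ppoint (tau i v)"
proof -
  have "tau i (dg r r r r v) = dg r r r r (tau i v)" for r
    by (cases v) (simp add: tau_def dg_def)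
  then have e: "(\<lambda>r. tau i (dg r r r r v)) = (\<lambda>r. dg r r r r (tau i v))" by (rule ext)
  have pp: "ppoint v = (\<lambda>r. dg r r r r v) ` {r. r \<noteq> 0}" for v :: "'a vec4"
    unfolding ppoint_alt by blast
  show ?thesis unfolding pp image_image e ..
qed

lemma ppoint_self: "v \<in> ppoint v"
  by (cases v) (auto simp: ppoint_def intro!: exI[of _ 1])

lemma C_E: assumes "P \<in> C" obtains v where "P = ppoint v" "v \<in> \<Union>C"
proof -
  obtain v where "P = ppoint v" using assms by (auto simp: projective_closure_def)
  moreover from this have "v \<in> \<Union>C" using assms ppoint_self by blast
  ultimately show ?thesis by (rule that)
qed

lemma act_C: assumes "i \<in> I" "P \<in> C" shows "act i P \<in> C"
proof -
  obtain v where "P = ppoint v" "v \<in> \<Union>C" using assms(2) by (rule C_E)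
  then show ?thesis using assms tau_C ppoint_C by (simp add: act_def tau_ppoint)
qed

lemma act_act: "j \<in> I \<Longrightarrow> P \<in> C \<Longrightarrow> act i (act j P) = act (mul i j) P"
  using act_C[of j P] by (simp add: act_def image_image tau_mul)

lemma act_one: "P \<in> C \<Longrightarrow> act (1, 1) P = P"
  by (simp add: act_def tau_one)

lemma act_Bij: assumes i: "i \<in> I" shows "act i \<in> Bij C"
proof -
  have "bij_betw (act i) C C"
  proof (rule bij_betw_byWitness[where f' = "act (iv i)"])
    show "\<forall>P\<in>C. act (iv i) (act i P) = P"
      using act_act[OF i, of _ "iv i"] act_one I_nz[OF i] by (simp add: mul_def iv_def)
    show "\<forall>P\<in>C. act i (act (iv i) P) = P"
      using act_act[OF I_closed(2)[OF i], of _ i] act_one mul_iv(1)[OF i] by simp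
  qed (auto intro: act_C I_closed i)
  then show ?thesis by (simp add: Bij_def act_def)
qed

lemma compose_act: "i \<in> I \<Longrightarrow> j \<in> I \<Longrightarrow> compose C (act i) (act j) = act (mul i j)"
proof (rule extensionalityI[of _ C])
  assume "i \<in> I" "j \<in> I"
  then show "compose C (act i) (act j) P = act (mul i j) P" if "P \<in> C" for P
    using act_act that by (simp add: compose_eq)
qed (auto simp: act_def)

theorem subgroup_act: "subgroup (act ` I) (BijGroup C)"
proof (rule group.subgroupI[OF group_BijGroup])
  show "act ` I \<subseteq> carrier (BijGroup C)" using act_Bij by (auto simp: BijGroup_def)
  show "act ` I \<noteq> {}" using I_closed(3) by blast
  fix a assume "a \<in> act ` I"
  then obtain i where i: "i \<in> I" "a = act i" by blast
  have "act (iv i) \<otimes>\<^bsub>BijGroup C\<^esub> act i = \<one>\<^bsub>BijGroup C\<^esub>"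
  proof -
    have "mul (iv i) i = (1, 1)" using I_nz[OF i(1)] by (simp add: mul_def iv_def)
    then have "compose C (act (iv i)) (act i) = act (1, 1)" using compose_act I_closed i by simp
    moreover have "tau (1, 1) = (\<lambda>v. v)" by (rule ext) (rule tau_one)
    then have "act (1, 1) = (\<lambda>x\<in>C. x)" unfolding act_def by (intro ext) (simp add: restrict_def)
    ultimately show ?thesis using act_Bij I_closed i by (simp add: BijGroup_def)
  qed
  then have "inv\<^bsub>BijGroup C\<^esub> a = act (iv i)"
    using group.inv_equality[OF group_BijGroup] act_Bij I_closed i by (metis BijGroup_def partial_object.select_convs(1))
  then show "inv\<^bsub>BijGroup C\<^esub> a \<in> act ` I" using I_closed i by simp
  fix b assume "b \<in> act ` I"
  then obtain j where j: "j \<in> I" "b = act j" by blast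
  have "a \<otimes>\<^bsub>BijGroup C\<^esub> b = act (mul i j)"
    using i j act_Bij compose_act by (simp add: BijGroup_def)
  then show "a \<otimes>\<^bsub>BijGroup C\<^esub> b \<in> act ` I" using I_closed i j by simp
qed

text \<open>At a point with \<open>X\<close> and \<open>Z\<close> nonzero and T = 1, equality of the
  images forces the scaling factor to be 1 by the last coordinate, so \<open>b\<close> and
  \<open>l\<close> can be read off.\<close>

theorem card_act: "card (act ` I) = e1 * e2"
proof -
  have "inj_on act I"
  proof (rule inj_onI)
    fix i j assume ij: "i \<in> I" "j \<in> I" "act i = act j"
    obtain X Y Z where p: "(X, Y, Z) \<in> A" "X \<noteq> 0" "Z \<noteq> 0" using A_point by blast
    let ?v = "(X, Y, Z, 1)"
    have v: "?v \<in> \<Union>C" unfolding mem_C using p(1) by auto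
    have "act i (ppoint ?v) = act j (ppoint ?v)" using ij by simp
    then have "ppoint (tau i ?v) = ppoint (tau j ?v)" using ppoint_C[OF v] by (simp add: act_def tau_ppoint)
    then have "tau i ?v \<in> ppoint (tau j ?v)" using ppoint_self by blast
    then have "inverse (fst i) * X = inverse (fst j) * X" "snd i * Z = snd j * Z"
      by (auto simp: ppoint_alt tau_def dg_def)
    then show "i = j" using p(2,3) by (simp add: prod_eq_iff)
  qed
  then show ?thesis by (simp add: card_image I_card)
qed

text \<open>\<open>pullback\<close> quantifies over all representatives and all coordinate vectors.
  Representatives agree at the moved points because the curve is invariant, and a change of vector
  scales numerator and denominator by the same power.\<close>

lemma pullback_frac:
  assumes i: "i \<in> I" and FG: "(F, G) \<in> proj_fractions C"
  shows "pullback C (act i) (proj_frac C F G) = proj_frac C (\<lambda>v. F (tau i v)) (\<lambda>v. G (tau i v))"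
proof (rule Set.set_eqI)
  fix q :: "('a vec4 \<Rightarrow> 'a) \<times> ('a vec4 \<Rightarrow> 'a)"
  obtain F' G' where q: "q = (F', G')" by (cases q)
  let ?D = "proj_fractions C"
  note tD = tau_D[OF i FG]
  have "(F', G') \<in> pullback C (act i) (proj_frac C F G) \<longleftrightarrow>
      (F', G') \<in> ?D \<and> (\<forall>v\<in>\<Union>C. F' v * G (tau i v) = F (tau i v) * G' v)"
  proof
    assume *: "(F', G') \<in> pullback C (act i) (proj_frac C F G)"
    have "(F, G) \<in> proj_frac C F G" unfolding proj_frac_def by (rule frac_self[OF FG])
    with * have **: "(F', G') \<in> ?D" "\<And>P v w. P \<in> C \<Longrightarrow> v \<in> P \<Longrightarrow> w \<in> act i P \<Longrightarrow> F' v * G w = F w * G' v"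
      unfolding pullback_def by auto
    have "F' v * G (tau i v) = F (tau i v) * G' v" if "v \<in> \<Union>C" for v
      using that **(2)[of _ v "tau i v"] by (auto simp: act_def)
    with **(1) show "(F', G') \<in> ?D \<and> (\<forall>v\<in>\<Union>C. F' v * G (tau i v) = F (tau i v) * G' v)" by blast
  next
    assume *: "(F', G') \<in> ?D \<and> (\<forall>v\<in>\<Union>C. F' v * G (tau i v) = F (tau i v) * G' v)"
    show "(F', G') \<in> pullback C (act i) (proj_frac C F G)"
      unfolding pullback_def
    proof (intro CollectI case_prodI conjI ballI)
      show "(F', G') \<in> ?D" using * by blast
      fix r assume "r \<in> proj_frac C F G"
      then obtain F1 G1 where r: "r = (F1, G1)" "(F1, G1) \<in> ?D" "eproj F1 / eproj G1 = eproj F / eproj G"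
        unfolding proj_frac_def using frac_mem_iff[OF FG] by (cases r) auto
      have eq1: "F1 (tau i v) * G (tau i v) = F (tau i v) * G1 (tau i v)" if "v \<in> \<Union>C" for v
        using frac_eq[OF r(2) FG] r(3) tau_C[OF i that] by blast
      have "(\<forall>v\<in>\<Union>C. F1 (tau i v) * G (tau i v) = F (tau i v) * G1 (tau i v))" using eq1 by blast
      then have "eproj (\<lambda>v. F1 (tau i v)) / eproj (\<lambda>v. G1 (tau i v)) = eproj (\<lambda>v. F (tau i v)) / eproj (\<lambda>v. G (tau i v))"
        using frac_eq[OF tau_D[OF i r(2)] tD] by blast
      moreover have "eproj F' / eproj G' = eproj (\<lambda>v. F (tau i v)) / eproj (\<lambda>v. G (tau i v))"
        using frac_eq[OF _ tD] * by blast
      ultimately have eq: "\<forall>v\<in>\<Union>C. F' v * G1 (tau i v) = F1 (tau i v) * G' v"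
        using frac_eq[of F' G'] tau_D[OF i r(2)] * by simp
      obtain m where m: "form m F1" "form m G1" using r(2) by (auto simp: proj_fractions_def)
      show "case r of (F, G) \<Rightarrow> \<forall>P\<in>C. \<forall>v\<in>P. \<forall>w\<in>act i P. F' v * G w = F w * G' v"
        unfolding r prod.case
      proof (intro ballI)
        fix P v w assume P: "P \<in> C" "v \<in> P" "w \<in> act i P"
        have "P = ppoint v" "v \<in> \<Union>C" using C_point[OF P(1,2)] .
        then have "w \<in> ppoint (tau i v)" using P(1,3) by (simp add: act_def tau_ppoint)
        then obtain s where s: "w = dg s s s s (tau i v)" by (auto simp: ppoint_alt)
        have "F' v * G1 (tau i v) = F1 (tau i v) * G' v" using eq \<open>v \<in> \<Union>C\<close> by blast
        then show "F' v * G1 w = F1 w * G' v"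
          unfolding s form_scale[OF m(1)] form_scale[OF m(2)] by (simp add: mult_ac)
      qed
    qed
  qed
  also have "\<dots> \<longleftrightarrow> (F', G') \<in> proj_frac C (\<lambda>v. F (tau i v)) (\<lambda>v. G (tau i v))"
    unfolding proj_frac_def frac_mem_iff[OF tD] using frac_eq[OF _ tD, of F' G'] by blast
  finally show "q \<in> pullback C (act i) (proj_frac C F G) \<longleftrightarrow>
      q \<in> proj_frac C (\<lambda>v. F (tau i v)) (\<lambda>v. G (tau i v))" by (simp add: q)
qed

lemma value_independent:
  assumes "i \<in> I" "ev P / ev Q = ev P' / ev Q'" "ev Q \<noteq> 0" "ev Q' \<noteq> 0"
  shows "evi i P / evi i Q = evi i P' / evi i Q'"
proof -
  have "ev (P * Q' - P' * Q) = 0"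
    using assms by (simp add: evt_simps[OF hom] frac_eq_eq)
  then have "evi i (P * Q' - P' * Q) = 0" using evi_0_iff assms by blast
  then have "evi i P * evi i Q' = evi i P' * evi i Q"
    by (simp add: ringhom_diff[OF ringhom_evi] ringhom_simps[OF ringhom_evi])
  then show ?thesis using evi_0_iff assms by (simp add: frac_eq_eq)
qed

text \<open>Turns invariance of a class of pairs of functions into an identity between values in
  \<open>'b\<close>.\<close>

lemma fixed_iff:
  assumes f: "f \<in> carrier (proj_function_field C)" and nf: "nu f = ev P / ev Q" and Q: "ev Q \<noteq> 0"
  shows "f \<in> fixed_field C (act ` I) \<longleftrightarrow> (\<forall>i\<in>I. evi i P / evi i Q = ev P / ev Q)"
proof -
  obtain F G where FG: "(F, G) \<in> proj_fractions C" "f = frac (\<Union>C) (proj_fractions C) F G"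
    using f unfolding proj_function_field_def by (rule carrierE)
  obtain m where m: "form m F" "form m G" "eproj G \<noteq> 0" using FG(1) by (auto simp: D_iff)
  obtain P1 Q1 where P1: "hform m F P1" "hform m G Q1" using form_hform[OF m(1)] form_hform[OF m(2)] by auto
  have e: "eproj F = ev P1" "eproj G = ev Q1" using eproj P1 by auto
  have n: "ev P1 / ev Q1 = ev P / ev Q" using nf nu_frac[OF FG(1)] FG(2) e by simp
  have pf: "f = proj_frac C F G" by (simp add: FG(2) proj_frac_def)
  have "pullback C (act i) f = f \<longleftrightarrow> evi i P / evi i Q = ev P / ev Q" if i: "i \<in> I" for i
  proof -
    have "eproj (\<lambda>v. F (tau i v)) = evi i P1" "eproj (\<lambda>v. G (tau i v)) = evi i Q1"
      using eproj[OF sb_hform[OF P1(1)]] eproj[OF sb_hform[OF P1(2)]] by (simp_all add: ev_sb)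
    then have "pullback C (act i) f = f \<longleftrightarrow> evi i P1 / evi i Q1 = ev P1 / ev Q1"
      unfolding pf pullback_frac[OF i FG(1)] unfolding proj_frac_def
      using frac_eq_iff[OF tau_D[OF i FG(1)] FG(1)] e by simp
    also have "evi i P1 / evi i Q1 = evi i P / evi i Q"
      by (rule value_independent[OF i n]) (use m e Q in auto)
    finally show ?thesis by (simp add: n)
  qed
  then show ?thesis using f by (auto simp: fixed_field_def)
qed

abbreviation "u \<equiv> x ^ e1"
abbreviation "v \<equiv> x * y"
abbreviation "w \<equiv> z ^ e2"

text \<open>The first condition says that \<open>i\<close> and \<open>j\<close> agree modulo
  \<open>e1\<close>. Then \<open>x ^ i * y ^ j\<close> is a power of \<open>v\<close> times a power
  of \<open>x ^ e1 = u\<close> or of \<open>y ^ e1 = v ^ e1 / u\<close>.\<close>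

lemma monomial_gen3:
  assumes "e1 dvd j + i * (e1 - 1)" "e2 dvd k"
  shows "x ^ i * y ^ j * z ^ k \<in> gen3 h u v w"
proof -
  note E = subfldD[OF subfld_gen3[OF hom]] subfld_more[OF subfld_gen3[OF hom]] gen3_gens(2)[OF hom, of u v w]
    gen3_gens(3)[OF hom, of v u w] gen3_gens(4)[OF hom, of w u v]
  have "j + i * (e1 - 1) + i = j + i * e1" using e0(1) by (cases e1) auto
  then have d: "int e1 dvd int j - int i"
  proof -
    have "int e1 dvd int (j + i * (e1 - 1))" using assms(1) by presburger
    moreover have "int (j + i * (e1 - 1)) = (int j - int i) + int i * int e1"
      using e0(1) by (cases e1) (auto simp: algebra_simps)
    ultimately show ?thesis by (metis dvd_add_left_iff dvd_triv_right)
  qed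
  have "x ^ i * y ^ j \<in> gen3 h u v w"
  proof (cases "j \<le> i")
    case True
    then have "e1 dvd i - j" using d by (metis int_dvd_int_iff of_nat_diff dvd_minus_iff minus_diff_eq)
    then obtain t where t: "i - j = e1 * t" by (elim dvdE)
    have "x ^ i = x ^ j * x ^ (e1 * t)" using True by (simp flip: power_add t)
    then have "x ^ i * y ^ j = v ^ j * u ^ t"
      by (simp add: power_mult power_mult_distrib)
    then show ?thesis using E by simp
  next
    case False
    then have "e1 dvd j - i" using d by (metis int_dvd_int_iff of_nat_diff nat_le_linear)
    then obtain t where t: "j - i = e1 * t" by (elim dvdE)
    have "y ^ (e1 * t) = v ^ (e1 * t) / u ^ t"
      using x_nz by (simp add: power_mult_distrib power_mult)
    moreover have "j = i + e1 * t" using False t by linarith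
    then have "y ^ j = y ^ i * y ^ (e1 * t)" by (simp only: power_add)
    ultimately have "x ^ i * y ^ j = v ^ i * (v ^ (e1 * t) / u ^ t)"
      by (simp add: power_mult_distrib)
    then show ?thesis using E by simp
  qed
  moreover obtain t where "k = e2 * t" using assms(2) by (elim dvdE)
  then have "z ^ k = w ^ t" by (simp add: power_mult)
  ultimately show ?thesis using E by simp
qed

text \<open>Summation over the group multiplies a monomial by two character sums, one for
  \<open>b\<close> and one for \<open>l\<close>; their product vanishes unless the monomial is
  invariant.\<close>

lemma average_gen3: "(\<Sum>i\<in>I. evi i P) \<in> gen3 h u v w"
proof (induction P rule: poly3_induct)
  case (add P Q)
  then show ?case
    by (simp add: ringhom_simps[OF ringhom_evi] sum.distrib subfldD(2)[OF subfld_gen3[OF hom]])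
next
  case (monom a i j k)
  \<comment> \<open>Writing the inverse as a nonnegative power puts the sum over \<open>b\<close>
    into the form of \<open>sum_roots1\<close>; hence the exponent
    \<open>j + i * (e1 - 1)\<close>.\<close>
  have inv: "inverse b = b ^ (e1 - 1)" if "b \<in> roots1 e1" for b :: 'a
  proof -
    have "b * b ^ (e1 - 1) = 1" using that e0 by (cases e1) (auto simp: roots1_def)
    then show ?thesis by (rule inverse_unique)
  qed
  have "(\<Sum>q\<in>I. evi q ([:[:[:a:]:]:] * pU ^ i * pV ^ j * pW ^ k)) =
     (\<Sum>(b, l)\<in>roots1 e1 \<times> roots1 e2. h (a * b ^ (j + i * (e1 - 1)) * l ^ k) * (x ^ i * y ^ j * z ^ k))"
    unfolding I_def
  proof (intro sum.cong refl, safe)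
    fix b l :: 'a assume "b \<in> roots1 e1" "l \<in> roots1 e2"
    have "evi (b, l) ([:[:[:a:]:]:] * pU ^ i * pV ^ j * pW ^ k) =
        h a * (h (inverse b) * x) ^ i * (h b * y) ^ j * (h l * z) ^ k"
      unfolding evi_def by (simp add: evt_simps[OF hom] evp_const hom del: mult_pCons_left)
    also have "\<dots> = h (a * ((inverse b) ^ i * b ^ j) * l ^ k) * (x ^ i * y ^ j * z ^ k)"
      by (simp add: power_mult_distrib ringhom_simps[OF hom] ringhom_power[OF hom] mult_ac)
    also have "(inverse b) ^ i * b ^ j = b ^ (j + i * (e1 - 1))"
      unfolding inv[OF \<open>b \<in> roots1 e1\<close>] by (simp add: power_add mult.commute flip: power_mult)
    finally show "evi (b, l) ([:[:[:a:]:]:] * pU ^ i * pV ^ j * pW ^ k) =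
      h (a * b ^ (j + i * (e1 - 1)) * l ^ k) * (x ^ i * y ^ j * z ^ k)" by (simp add: mult.assoc)
  qed
  also have "\<dots> = h (a * (\<Sum>b\<in>roots1 e1. b ^ (j + i * (e1 - 1))) * (\<Sum>l\<in>roots1 e2. l ^ k)) * (x ^ i * y ^ j * z ^ k)"
  proof -
    have "(\<Sum>(b, l)\<in>roots1 e1 \<times> roots1 e2. h (a * b ^ (j + i * (e1 - 1)) * l ^ k) * (x ^ i * y ^ j * z ^ k)) =
       h (\<Sum>(b, l)\<in>roots1 e1 \<times> roots1 e2. a * b ^ (j + i * (e1 - 1)) * l ^ k) * (x ^ i * y ^ j * z ^ k)"
      by (simp add: ringhom_sum[OF hom] sum_distrib_right case_prod_beta)
    also have "(\<Sum>(b, l)\<in>roots1 e1 \<times> roots1 e2. a * b ^ (j + i * (e1 - 1)) * l ^ k) =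
       (\<Sum>b\<in>roots1 e1. a * b ^ (j + i * (e1 - 1))) * (\<Sum>l\<in>roots1 e2. l ^ k)"
      by (simp add: sum_product sum.cartesian_product)
    finally show ?thesis by (simp only: sum_distrib_left)
  qed
  also have "\<dots> \<in> gen3 h u v w"
  proof (cases "e1 dvd j + i * (e1 - 1) \<and> e2 dvd k")
    case True
    then have "x ^ i * y ^ j * z ^ k \<in> gen3 h u v w" using monomial_gen3 by blast
    then show ?thesis by (rule subfldD(3)[OF subfld_gen3[OF hom] gen3_gens(1)[OF hom]])
  next
    case False
    then have "(\<Sum>b::'a\<in>roots1 e1. b ^ (j + i * (e1 - 1))) * (\<Sum>l\<in>roots1 e2. l ^ k) = 0"
      using sum_roots1[OF e0(1) e_char(1)] sum_roots1[OF e0(2) e_char(2)] by auto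
    then show ?thesis using subfld_more(1)[OF subfld_gen3[OF hom]] by (auto simp: mult.assoc ringhom_simps[OF hom])
  qed
  finally show ?case .
qed

text \<open>Multiplying numerator and denominator by the other conjugates of \<open>Q\<close> makes
  the denominator invariant, and with it the numerator. Up to the group order, which is invertible
  in k, each is its own average, and averages lie in \<open>gen3 h u v w\<close>.\<close>

theorem fixed_field_gen3:
  "fixed_field C (act ` I) = {f \<in> carrier (proj_function_field C). nu f \<in> gen3 h u v w}"
proof (intro equalityI subsetI)
  note E = subfldD[OF subfld_gen3[OF hom]] subfld_more[OF subfld_gen3[OF hom]]
  fix f assume ff: "f \<in> fixed_field C (act ` I)"
  then have f: "f \<in> carrier (proj_function_field C)" by (simp add: fixed_field_def)
  have "nu f \<in> gen3 h x y z" using f nu_image vals_gen3 unfolding proj_function_field_def by blast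
  then obtain P Q where PQ: "nu f = ev P / ev Q" "ev Q \<noteq> 0" by (auto simp: gen3_def)
  define R where "R = (\<Prod>i\<in>I - {(1, 1)}. sb i Q)"
  define Q1 where "Q1 = (\<Prod>i\<in>I. sb i Q)"
  have Q1: "ev Q1 = ev (Q * R)"
  proof -
    have "Q1 = sb (1, 1) Q * R" unfolding Q1_def R_def by (rule prod.remove) (auto simp: I_finite I_closed)
    then show ?thesis by (simp add: evt_simps[OF hom] ev_sb evi_one)
  qed
  have Q1nz: "ev Q1 \<noteq> 0"
    unfolding Q1_def by (simp add: evt_simps[OF hom] ev_sb I_finite evi_0_iff PQ(2))
  have n: "ev (P * R) / ev Q1 = ev P / ev Q"
    using Q1nz unfolding Q1 by (simp add: evt_simps[OF hom])
  have invQ: "evi j Q1 = ev Q1" if j: "j \<in> I" for j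
  proof -
    have "evi j Q1 = (\<Prod>i\<in>I. evi (mul j i) Q)"
      unfolding Q1_def by (simp add: ringhom_prod[OF ringhom_evi] evi_sb j)
    also have "\<dots> = (\<Prod>i\<in>I. evi i Q)"
      by (rule prod.reindex_bij_witness[of _ "mul (iv j)" "mul j"]) (use j I_closed mul_iv in auto)
    finally show ?thesis unfolding Q1_def by (simp add: evt_simps[OF hom] ev_sb)
  qed
  have fixed: "evi j (P * R) / evi j Q1 = ev (P * R) / ev Q1" if j: "j \<in> I" for j
    using fixed_iff[OF f _ Q1nz, of "P * R"] n PQ(1) ff j by simp
  have invP: "evi j (P * R) = ev (P * R)" if j: "j \<in> I" for j
    using fixed[OF j] Q1nz by (simp add: invQ[OF j])
  have card: "of_nat (card I) \<noteq> (0::'b)"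
    using e_char ringhom_eq_0_iff[OF hom] ringhom_of_nat[OF hom] unfolding I_card of_nat_mult by (metis mult_eq_0_iff)
  have "of_nat (card I) * ev (P * R) \<in> gen3 h u v w" "of_nat (card I) * ev Q1 \<in> gen3 h u v w"
    using average_gen3[of "P * R"] average_gen3[of Q1] invP invQ by simp_all
  then have "(of_nat (card I) * ev (P * R)) / (of_nat (card I) * ev Q1) \<in> gen3 h u v w" by (rule E(8))
  then have "ev (P * R) / ev Q1 \<in> gen3 h u v w" using card by simp
  then show "f \<in> {f \<in> carrier (proj_function_field C). nu f \<in> gen3 h u v w}" using n PQ f by simp
next
  fix f assume "f \<in> {f \<in> carrier (proj_function_field C). nu f \<in> gen3 h u v w}"
  then have f: "f \<in> carrier (proj_function_field C)" and "nu f \<in> gen3 h u v w" by auto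
  then obtain P Q where PQ: "nu f = evt h u v w P / evt h u v w Q" "evt h u v w Q \<noteq> 0" by (auto simp: gen3_def)
  \<comment> \<open>\<open>T\<close> substitutes the three invariant monomials, so an element of the
    generated field becomes a quotient of values of invariant polynomials in x, y, z.\<close>
  define T where "T = evt (\<lambda>a :: 'a. [:[:[:a:]:]:]) (pU ^ e1) (pU * pV) (pW ^ e2)"
  have T: "evt h x' y' z' (T P) = evt h (x' ^ e1) (x' * y') (z' ^ e2) P" for x' y' z' P
    unfolding T_def hom_evt[OF ringhom_evt[OF hom] ringhom_const3]
    by (simp add: evt_simps[OF hom] evp_const hom)
  have ti: "evi i (T P) = evt h u v w P" if i: "i \<in> I" for i P
  proof -
    have r: "fst i ^ e1 = 1" "inverse (fst i) ^ e1 = 1" "snd i ^ e2 = 1" "inverse (fst i) * fst i = 1"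
      using i I_nz[OF i] by (auto simp: I_def roots1_def power_inverse)
    have q1: "(h (inverse (fst i)) * x) ^ e1 = u"
      by (simp only: power_mult_distrib ringhom_power[OF hom, symmetric] r ringhom_simps[OF hom] mult_1)
    have "h (inverse (fst i)) * x * (h (fst i) * y) = h (inverse (fst i) * fst i) * v"
      by (simp only: ringhom_simps[OF hom] mult_ac)
    then have q2: "h (inverse (fst i)) * x * (h (fst i) * y) = v"
      by (simp only: r ringhom_simps[OF hom] mult_1)
    have q3: "(h (snd i) * z) ^ e2 = w"
      by (simp only: power_mult_distrib ringhom_power[OF hom, symmetric] r ringhom_simps[OF hom] mult_1)
    show ?thesis unfolding evi_def T q1 q2 q3 ..
  qed
  show "f \<in> fixed_field C (act ` I)"
    using fixed_iff[OF f, of "T P" "T Q"] PQ ti I_closed(3) by (simp add: T)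
qed

end

section \<open>Towers of two radical extensions\<close>

text \<open>Both the curve and its quotient have this shape. The second equation gives
  \<open>v = w ^ b / ev q\<close>, so \<open>v\<close> already lies in the Kummer extension
  generated by \<open>w\<close>.\<close>

locale tower = kummer h u w N f
  for h :: "'a::alg_closed_field \<Rightarrow> 'b::field" and u w N f +
  fixes v :: 'b and a b :: nat and p q :: "'a poly"
  assumes ab: "N = a * b" and va: "v ^ a = evp h u p" and wb: "w ^ b = v * evp h u q" and q0: "q \<noteq> 0"
begin

definition A :: "('a \<times> 'a \<times> 'a) set" where
  "A = {(U, V, W). V ^ a = poly p U \<and> W ^ b = V * poly q U}"

lemma ab0: "a > 0" "b > 0"
  using N0 ab by auto

lemma v_eq: "v = w ^ b / ev q"
  using wb q0 ev_eq_0_iff by simp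

lemma v_L: "v \<in> L"
  unfolding v_eq by (intro L_closed w_power_L Ku_L ev_Ku)

lemma gen3_L: "gen3 h u v w = L"
  by (rule gen3_eq_L[OF v_L])

text \<open>\<open>v ^ i * w ^ j\<close> is \<open>w ^ (b * i + j)\<close> up to a factor in k(u),
  and by division with remainder these exponents are distinct and below
  \<open>a * b\<close>.\<close>

lemma indep_tower:
  assumes "(\<Sum>i<a. \<Sum>j<b. ev (c i j) * v ^ i * w ^ j) = 0"
  shows "\<forall>i<a. \<forall>j<b. c i j = 0"
proof -
  let ?I = "{..<a} \<times> {..<b}"
  have "\<forall>x\<in>?I. (case x of (i, j) \<Rightarrow> ev (c i j)) = 0"
  proof (rule indep_over_reindex[OF indep_Ku subfld_Ku, where k = "\<lambda>(i, j). b * i + j"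
        and c = "\<lambda>(i, j). inverse (ev q ^ i)" and b = "\<lambda>(i, j). v ^ i * w ^ j"])
    show "inj_on (\<lambda>(i, j). b * i + j) ?I"
    proof (rule inj_onI, clarify)
      fix i j i' j' assume *: "j < b" "j' < b" "b * i + j = b * i' + j'"
      have "(b * i + j) div b = i" "(b * i' + j') div b = i'" using *(1,2) by simp_all
      then have "i = i'" using *(3) by simp
      then show "i = i' \<and> j = j'" using *(3) by simp
    qed
    show "(\<lambda>(i, j). b * i + j) ` ?I \<subseteq> {..<N}"
    proof
      fix k assume "k \<in> (\<lambda>(i, j). b * i + j) ` ?I"
      then obtain i j where k: "i < a" "j < b" "k = b * i + j" by auto
      have "b * Suc i \<le> b * a" using k(1) by (intro mult_le_mono2) simp
      then show "k \<in> {..<N}" using k(2,3) by (simp add: ab mult.commute)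
    qed
    fix x assume "x \<in> ?I"
    obtain i j where x: "x = (i, j)" by fastforce
    have "v ^ i * w ^ j = inverse (ev q ^ i) * w ^ (b * i + j)"
      unfolding v_eq power_divide power_add by (simp add: divide_inverse mult_ac flip: power_mult)
    then show "(case x of (i, j) \<Rightarrow> inverse (ev q ^ i)) \<in> Ku \<and> (case x of (i, j) \<Rightarrow> inverse (ev q ^ i)) \<noteq> 0 \<and>
        (case x of (i, j) \<Rightarrow> v ^ i * w ^ j) =
        (case x of (i, j) \<Rightarrow> inverse (ev q ^ i)) * w ^ (case x of (i, j) \<Rightarrow> b * i + j)"
      using q0 ev_eq_0_iff by (simp add: x Ku_closed ev_Ku)
    show "(case x of (i, j) \<Rightarrow> ev (c i j)) \<in> Ku" by (simp add: x ev_Ku)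
  next
    show "(\<Sum>x\<in>?I. (case x of (i, j) \<Rightarrow> ev (c i j)) * (case x of (i, j) \<Rightarrow> v ^ i * w ^ j)) = 0"
      using assms by (simp add: sum.cartesian_product case_prod_beta mult.assoc)
  qed simp
  then show ?thesis using ev_eq_0_iff by auto
qed

definition "E1 = pV ^ a - [:[:p:]:]"
definition "E2 = pW ^ b - pV * [:[:q:]:]"

lemma evt_E: "evt h u v w E1 = 0" "evt h u v w E2 = 0"
  by (simp_all add: E1_def E2_def evt_simps[OF hom] va wb del: mult_pCons_left mult_pCons_right)

lemma ideal_E:
  assumes "evt h u v w P = 0" shows "\<exists>X Y. P = X * E1 + Y * E2"
  using tower_ideal[OF hom ab0 va _ indep_tower assms, of 1 q] wb by (simp add: E1_def E2_def)

lemma eval3_E: "eval3 E1 (U, V, W) = V ^ a - poly p U" "eval3 E2 (U, V, W) = W ^ b - V * poly q U"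
  unfolding eval3_evt E1_def E2_def
  by (simp_all add: evt_simps[OF ringhom_id] evp_ident del: mult_pCons_left mult_pCons_right)

lemma A_zero_set: "A = zero_set {E2, E1}"
  by (auto simp: A_def zero_set_def eval3_E)

text \<open>Denominators can be taken in u alone; \<open>generic_point\<close> relies on this to
  find points where they do not vanish.\<close>

lemma L_polynomial:
  assumes "z \<in> L" shows "\<exists>P Q. Q \<noteq> 0 \<and> z = evt h u v w P / ev Q"
proof -
  define T where "T = {evt h u v w P / ev Q | P Q. Q \<noteq> 0}"
  note es = evt_simps[OF hom]
  have TI: "evt h u v w P / ev Q \<in> T" if "Q \<noteq> 0" for P Q using that by (auto simp: T_def)
  have T1: "x + y \<in> T" if "x \<in> T" "y \<in> T" for x y
  proof -
    from that obtain X P Y Q where *: "x = evt h u v w X / ev P" "P \<noteq> 0" "y = evt h u v w Y / ev Q" "Q \<noteq> 0"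
      by (auto simp: T_def)
    have "x + y = evt h u v w (X * [:[:Q:]:] + Y * [:[:P:]:]) / ev (P * Q)"
      using * ev_eq_0_iff by (simp add: es ev_simps add_frac_eq del: mult_pCons_left mult_pCons_right)
    moreover have "evt h u v w (X * [:[:Q:]:] + Y * [:[:P:]:]) / ev (P * Q) \<in> T"
      by (rule TI) (use * in simp)
    ultimately show ?thesis by (simp only:)
  qed
  have T0: "evt h u v w P \<in> T" for P using TI[of 1 P] by (simp add: ev_simps)
  have Tsum: "sum g I \<in> T" if "\<And>i. i \<in> I \<Longrightarrow> g i \<in> T" for g :: "nat \<Rightarrow> 'b" and I
    using that T0[of 0] by (induction I rule: infinite_finite_induct) (auto intro: T1 simp: es)
  obtain c where c: "z = lin c" "\<And>j. c j \<in> Ku" using assms by (elim L_E) blast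
  have "c j * w ^ j \<in> T" for j
  proof -
    obtain P Q where PQ: "c j = ev P / ev Q" "Q \<noteq> 0" using c(2)[of j] by (auto simp: Ku_def)
    have "c j * w ^ j = evt h u v w ([:[:P:]:] * pW ^ j) / ev Q"
      using PQ by (simp add: es del: mult_pCons_left mult_pCons_right)
    then show ?thesis using TI[OF PQ(2)] by simp
  qed
  then have "z \<in> T" unfolding c(1) lin_def by (intro Tsum) blast
  then show ?thesis by (auto simp: T_def)
qed

lemma nonzero_value:
  fixes Q :: "'a poly" assumes "Q \<noteq> 0" shows "\<exists>U. poly Q U \<noteq> 0"
proof (cases "Polynomial.degree Q = 0")
  case True
  then obtain c where "Q = [:c:]" by (rule degree_eq_zeroE)
  with assms show ?thesis by auto
next
  case False
  then have "Polynomial.degree (Q + [:- 1:]) > 0" by (subst degree_add_eq_left) auto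
  then obtain U where "poly (Q + [:- 1:]) U = 0" using alg_closed_imp_poly_has_root by blast
  then have "poly Q U = 1" by simp
  then show ?thesis by (intro exI[of _ U]) simp
qed

lemma A_above: "\<exists>V W. (U, V, W) \<in> A"
proof -
  obtain V where "V ^ a = poly p U" using nth_root_exists[OF ab0(1)] by blast
  moreover obtain W where "W ^ b = V * poly q U" using nth_root_exists[OF ab0(2)] by blast
  ultimately show ?thesis by (auto simp: A_def)
qed

text \<open>If \<open>P\<close> vanishes on \<open>A\<close> but not at \<open>(u, v, w)\<close>,
  its value has an inverse of the form \<open>P' / Q(u)\<close>, so \<open>P * P' = Q(U)\<close> on
  \<open>A\<close>. Every \<open>U\<close> lies below a point of \<open>A\<close>, and one with
  \<open>Q(U) \<noteq> 0\<close> gives a contradiction.\<close>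

theorem generic_point: "generic A h u v w"
  unfolding generic_def
proof (intro conjI allI iffI hom)
  fix P assume "evt h u v w P = 0"
  then obtain X Y where P: "P = X * E1 + Y * E2" using ideal_E by blast
  show "\<forall>s\<in>A. eval3 P s = 0" by (auto simp: P A_def eval3_simps eval3_E)
next
  fix P assume P: "\<forall>s\<in>A. eval3 P s = 0"
  show "evt h u v w P = 0"
  proof (rule ccontr)
    assume nz: "evt h u v w P \<noteq> 0"
    have "evt h u v w P \<in> L" using evt_in_gen3[OF hom] gen3_L by blast
    then have "inverse (evt h u v w P) \<in> L" by (rule L_closed(5))
    then obtain P' Q where Q: "Q \<noteq> 0" "inverse (evt h u v w P) = evt h u v w P' / ev Q"
      using L_polynomial by blast
    have "evt h u v w (P * P') = ev Q"
      using Q nz ev_eq_0_iff[of Q] by (simp add: evt_simps[OF hom] field_simps)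
    then have "evt h u v w (P * P' - [:[:Q:]:]) = 0"
      by (simp add: evt_simps[OF hom])
    then obtain X Y where XY: "P * P' - [:[:Q:]:] = X * E1 + Y * E2" using ideal_E by blast
    obtain U where U: "poly Q U \<noteq> 0" using nonzero_value[OF Q(1)] by blast
    obtain V W where A: "(U, V, W) \<in> A" using A_above by blast
    have "eval3 (P * P' - [:[:Q:]:]) (U, V, W) = 0"
      unfolding XY using A by (simp add: A_def eval3_simps eval3_E)
    then have "eval3 P (U, V, W) * eval3 P' (U, V, W) = poly Q U"
      by (simp add: eval3_simps) (simp add: eval3_evt evt_simps[OF ringhom_id] evp_ident)
    then show False using U P A by auto
  qed
qed

text \<open>By \<open>ideal_E\<close> this ideal is the kernel of evaluation at
  \<open>(u, v, w)\<close> in a field.\<close>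

theorem prime_E: "primeideal (Idl\<^bsub>ring_of_type_algebra\<^esub> {E2, E1}) ring_of_type_algebra"
proof -
  let ?R = "ring_of_type_algebra :: 'a poly poly poly ring"
  interpret R: cring ?R by (rule cring_from_type_algebra)
  let ?J = "{P. evt h u v w P = 0}"
  note es = evt_simps[OF hom] ringhom_uminus[OF ringhom_evt[OF hom]]
  have am: "\<ominus>\<^bsub>?R\<^esub> P = - P" for P
    by (rule R.minus_equality) (simp_all add: type_algebra_sel)
  have J: "ideal ?J ?R"
  proof (rule idealI)
    show "ring ?R" by (rule R.ring_axioms)
    show "subgroup ?J (add_monoid ?R)"
      by (rule R.add.subgroupI) (auto simp: type_algebra_sel es am intro!: exI[of _ 0])
  qed (auto simp: type_algebra_sel es)
  have "Idl\<^bsub>?R\<^esub> {E2, E1} = ?J"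
  proof
    show "Idl\<^bsub>?R\<^esub> {E2, E1} \<subseteq> ?J" by (rule R.genideal_minimal[OF J]) (simp add: evt_E)
    show "?J \<subseteq> Idl\<^bsub>?R\<^esub> {E2, E1}"
    proof
      fix P assume "P \<in> ?J"
      then obtain X Y where P: "P = X * E1 + Y * E2" using ideal_E by blast
      have I: "ideal (Idl\<^bsub>?R\<^esub> {E2, E1}) ?R" by (rule R.genideal_ideal) (simp add: type_algebra_sel)
      have "{E2, E1} \<subseteq> Idl\<^bsub>?R\<^esub> {E2, E1}" by (rule R.genideal_self) (simp add: type_algebra_sel)
      then have "X \<otimes>\<^bsub>?R\<^esub> E1 \<in> Idl\<^bsub>?R\<^esub> {E2, E1}" "Y \<otimes>\<^bsub>?R\<^esub> E2 \<in> Idl\<^bsub>?R\<^esub> {E2, E1}"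
        using ideal.I_l_closed[OF I] by (auto simp: type_algebra_sel)
      then have "X \<otimes>\<^bsub>?R\<^esub> E1 \<oplus>\<^bsub>?R\<^esub> Y \<otimes>\<^bsub>?R\<^esub> E2 \<in> Idl\<^bsub>?R\<^esub> {E2, E1}"
        using additive_subgroup.a_closed[OF ideal.axioms(1)[OF I]] by blast
      then show "P \<in> Idl\<^bsub>?R\<^esub> {E2, E1}" by (simp add: P type_algebra_sel)
    qed
  qed
  moreover have "primeideal ?J ?R"
  proof (rule primeidealI[OF J R.is_cring])
    have "1 \<notin> ?J" by (simp add: es)
    then show "carrier ?R \<noteq> ?J" by (auto simp: type_algebra_sel)
  qed (auto simp: type_algebra_sel es)
  ultimately show ?thesis by simp
qed

end

section \<open>Isomorphisms by comparison of values\<close>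

lemma ring_iso_via:
  fixes \<nu> :: "'g \<Rightarrow> 'b::field" and \<phi> :: "'f \<Rightarrow> 'b"
  assumes nu: "\<nu> \<in> ring_iso R (fldrec L)"
    and F: "field_embed F \<phi>" and H: "H \<subseteq> carrier F" "\<phi> ` H = L"
    and H1: "\<one>\<^bsub>F\<^esub> \<in> H" and Hc: "\<And>x y. x \<in> H \<Longrightarrow> y \<in> H \<Longrightarrow> x \<otimes>\<^bsub>F\<^esub> y \<in> H \<and> x \<oplus>\<^bsub>F\<^esub> y \<in> H"
  shows "\<exists>\<psi>\<in>ring_iso R (F\<lparr>carrier := H\<rparr>). \<forall>g\<in>carrier R. \<phi> (\<psi> g) = \<nu> g"
proof -
  interpret field_embed F \<phi> by (rule F)
  have inj: "inj_on \<phi> H" using inj H(1) inj_on_subset by blast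
  have n: "\<nu> \<in> ring_hom R (fldrec L)" "bij_betw \<nu> (carrier R) L"
    using nu by (auto simp: ring_iso_def)
  have nL: "\<nu> g \<in> L" if "g \<in> carrier R" for g using n(2) that by (auto simp: bij_betw_def)
  note nh = ring_hom_mult[OF n(1)] ring_hom_add[OF n(1)] ring_hom_one[OF n(1)]
  define \<psi> where "\<psi> g = the_inv_into H \<phi> (\<nu> g)" for g
  have p: "\<phi> (\<psi> g) = \<nu> g" "\<psi> g \<in> H" if "g \<in> carrier R" for g
    unfolding \<psi>_def using f_the_inv_into_f[OF inj] the_inv_into_into[OF inj] nL[OF that] H(2) by auto
  have u: "\<psi> g = x" if "x \<in> H" "\<nu> g = \<phi> x" for g x
    unfolding \<psi>_def that(2) by (rule the_inv_into_f_f[OF inj that(1)])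
  have "\<psi> \<in> ring_hom R (F\<lparr>carrier := H\<rparr>)"
    unfolding ring_hom_def
  proof (intro CollectI conjI allI impI)
    show "\<psi> \<in> carrier R \<rightarrow> carrier (F\<lparr>carrier := H\<rparr>)" using p by simp
    show "\<psi> \<one>\<^bsub>R\<^esub> = \<one>\<^bsub>F\<lparr>carrier := H\<rparr>\<^esub>"
      by (simp, rule u[OF H1]) (use nh(3) phi_one in \<open>simp add: type_algebra_sel\<close>)
    fix x y assume "x \<in> carrier R \<and> y \<in> carrier R"
    then have xy: "x \<in> carrier R" "y \<in> carrier R" by auto
    have c: "\<psi> x \<in> carrier F" "\<psi> y \<in> carrier F" using p(2) xy H(1) by auto
    show "\<psi> (x \<otimes>\<^bsub>R\<^esub> y) = \<psi> x \<otimes>\<^bsub>F\<lparr>carrier := H\<rparr>\<^esub> \<psi> y"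
      by (simp, rule u) (use Hc p xy nh(1) c in \<open>auto simp: type_algebra_sel phi_mult\<close>)
    show "\<psi> (x \<oplus>\<^bsub>R\<^esub> y) = \<psi> x \<oplus>\<^bsub>F\<lparr>carrier := H\<rparr>\<^esub> \<psi> y"
      by (simp, rule u) (use Hc p xy nh(2) c in \<open>auto simp: type_algebra_sel phi_add\<close>)
  qed
  moreover have "bij_betw \<psi> (carrier R) H"
  proof -
    have "bij_betw (the_inv_into H \<phi>) L H" using inj H(2) by (intro bij_betw_the_inv_into) (simp add: bij_betw_def)
    from bij_betw_trans[OF n(2) this] show ?thesis by (simp add: \<psi>_def[abs_def] comp_def)
  qed
  ultimately have "\<psi> \<in> ring_iso R (F\<lparr>carrier := H\<rparr>)" by (simp add: ring_iso_def)
  with p(1) show ?thesis by blast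
qed

lemma aff_fun_nu:
  assumes g: "generic A h x y z"
  shows "aff_fun A P \<in> carrier (aff_function_field A)"
    "frac_data.nu (eaff h x y z) (aff_fun A P) = evt h x y z P"
proof -
  interpret frac_data A "aff_fractions A" "\<lambda>_ F. \<exists>P. F = eval3 P" "eaff h x y z"
    by (rule aff_frac_data[OF g])
  have h: "ringhom h" using g by (simp add: generic_def)
  have one: "(\<lambda>s. 1) = eval3 (1 :: 'a poly poly poly)" by (auto simp: eval3_simps)
  have D: "(eval3 P, \<lambda>s. 1) \<in> aff_fractions A"
    by (auto simp: D_iff one eaff[OF g] evt_simps[OF h])
  then show "aff_fun A P \<in> carrier (aff_function_field A)"
    by (auto simp: aff_fun_def aff_function_field_def carrier_frac)
  show "nu (aff_fun A P) = evt h x y z P"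
    unfolding aff_fun_def nu_frac[OF D] unfolding one by (simp add: eaff[OF g] evt_simps[OF h])
qed

section \<open>A Laurent series model of the curve\<close>

text \<open>Independence follows from the automorphisms: they multiply the terms of a relation by
  distinct characters of the group of roots of unity, and \<open>sum_roots1\<close> isolates each
  term.\<close>

lemma kummerI:
  fixes h :: "'a::alg_closed_field \<Rightarrow> 'b::field"
  assumes hom: "ringhom h" and N: "N > 0" "of_nat N \<noteq> (0::'a)" and f: "f \<noteq> 0" "w ^ N = evp h u f"
    and trans: "\<And>p. evp h u p = 0 \<Longrightarrow> p = 0"
    and galois: "\<And>\<zeta>. \<zeta> ^ N = 1 \<Longrightarrow>
      \<exists>\<sigma>. ringhom \<sigma> \<and> (\<forall>a. \<sigma> (h a) = h a) \<and> \<sigma> u = u \<and> \<sigma> w = h \<zeta> * w"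
  shows "kummer h u w N f"
proof
  fix a assume s: "(\<Sum>j<N. evp h u (a j) * w ^ j) = 0"
  have w: "w \<noteq> 0" using f trans[of f] N(1) by (auto simp: zero_power)
  have tw: "(\<Sum>j<N. h (\<zeta> ^ j) * (evp h u (a j) * w ^ j)) = 0" if z1: "\<zeta> ^ N = 1" for \<zeta>
  proof -
    obtain \<sigma> where \<sigma>: "ringhom \<sigma>" "\<And>a. \<sigma> (h a) = h a" "\<sigma> u = u" "\<sigma> w = h \<zeta> * w"
      using galois[OF z1] by blast
    have "\<sigma> (evp h u p) = evp h u p" for p
      using hom_evp[OF \<sigma>(1) hom, of u p] by (simp add: \<sigma>(2,3))
    then have "\<sigma> (\<Sum>j<N. evp h u (a j) * w ^ j) = (\<Sum>j<N. h (\<zeta> ^ j) * (evp h u (a j) * w ^ j))"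
      by (simp add: ringhom_sum[OF \<sigma>(1)] ringhom_simps[OF \<sigma>(1)] ringhom_power[OF \<sigma>(1)] \<sigma>(4)
          ringhom_power[OF hom] power_mult_distrib mult_ac)
    then show ?thesis using s ringhom_simps(1)[OF \<sigma>(1)] by simp
  qed
  show "\<forall>j<N. a j = 0"
  proof (intro allI impI)
    fix i assume i: "i < N"
    have dv: "N dvd j + (N - i) \<longleftrightarrow> j = i" if "j < N" for j
    proof
      assume "N dvd j + (N - i)"
      then obtain k where k: "j + (N - i) = N * k" by (elim dvdE)
      have "N * k < N * 2" "0 < N * k" using that i k by linarith+
      then have "k = 1" by simp
      with k i show "j = i" by simp
    qed (use i in simp)
    have "0 = (\<Sum>\<zeta>\<in>roots1 N. h (\<zeta> ^ (N - i)) * (\<Sum>j<N. h (\<zeta> ^ j) * (evp h u (a j) * w ^ j)))"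
      by (rule sym, rule sum.neutral) (simp add: tw roots1_def)
    also have "\<dots> = (\<Sum>j<N. \<Sum>\<zeta>\<in>roots1 N. h (\<zeta> ^ (j + (N - i))) * (evp h u (a j) * w ^ j))"
      unfolding sum_distrib_left
      by (subst sum.swap) (simp add: power_add ringhom_simps[OF hom] mult_ac)
    also have "\<dots> = (\<Sum>j<N. if j = i then of_nat N * (evp h u (a j) * w ^ j) else 0)"
    proof (rule sum.cong[OF refl])
      fix j assume "j \<in> {..<N}"
      have "(\<Sum>\<zeta>\<in>roots1 N. h (\<zeta> ^ (j + (N - i))) * (evp h u (a j) * w ^ j)) =
          h (\<Sum>\<zeta>\<in>roots1 N. \<zeta> ^ (j + (N - i))) * (evp h u (a j) * w ^ j)"
        by (simp only: ringhom_sum[OF hom] sum_distrib_right)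
      then show "(\<Sum>\<zeta>\<in>roots1 N. h (\<zeta> ^ (j + (N - i))) * (evp h u (a j) * w ^ j)) =
          (if j = i then of_nat N * (evp h u (a j) * w ^ j) else 0)"
        using \<open>j \<in> {..<N}\<close> by (simp add: sum_roots1[OF N] dv ringhom_of_nat[OF hom] ringhom_simps[OF hom])
    qed
    also have "\<dots> = of_nat N * (evp h u (a i) * w ^ i)" using i by simp
    finally have "h (of_nat N) * (evp h u (a i) * w ^ i) = 0" by (simp add: ringhom_of_nat[OF hom])
    then have "evp h u (a i) = 0" using w N(2) by (simp add: ringhom_eq_0_iff[OF hom])
    then show "a i = 0" by (rule trans)
  qed
qed (use assms in auto)

text \<open>The polynomial splits over k, so one of its linear factors vanishes at
  \<open>x\<close>.\<close>

lemma algebraic_constant: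
  fixes h :: "'a::alg_closed_field \<Rightarrow> 'b::field"
  assumes h: "ringhom h" and "p \<noteq> 0" "evp h x p = 0"
  shows "x \<in> range h"
  using assms(2,3)
proof (induction "Polynomial.degree p" arbitrary: p rule: less_induct)
  case less
  show ?case
  proof (cases "Polynomial.degree p = 0")
    case True
    then obtain a where "p = [:a:]" by (rule degree_eq_zeroE)
    then show ?thesis using less.prems by (simp add: evp_const h ringhom_eq_0_iff)
  next
    case False
    then obtain r where "poly p r = 0" using alg_closed_imp_poly_has_root by blast
    then obtain q where q: "p = [:- r, 1:] * q" by (auto simp: poly_eq_0_iff_dvd)
    have qn: "q \<noteq> 0" using q less.prems by auto
    have "Polynomial.degree p = Polynomial.degree [:- r, 1:] + Polynomial.degree q"
      unfolding q by (rule degree_mult_eq) (use qn in auto)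
    then have lt: "Polynomial.degree q < Polynomial.degree p" by simp
    have "evp h x p = (x - h r) * evp h x q"
      unfolding q ringhom_simps(4)[OF ringhom_evp[OF h]]
      by (simp add: evp_pCons h ringhom_uminus ringhom_simps)
    then consider "x = h r" | "evp h x q = 0" using less.prems by auto
    then show ?thesis using less.hyps[OF lt qn] by cases auto
  qed
qed

lemma ringhom_fls_const: "ringhom (fls_const :: 'a::field \<Rightarrow> 'a fls)"
  by (rule ringhomI) (simp_all add: fls_eq_iff)

text \<open>Links evaluation of polynomials with composition of power series, so that compositional
  inverses can be used to solve polynomial equations.\<close>

lemma evp_fps:
  fixes s :: "'a::field fps"
  assumes "fps_nth s 0 = 0"
  shows "evp fls_const (fps_to_fls s) F = fps_to_fls (fps_compose (fps_of_poly F) s)"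
proof (induction F)
  case (pCons a p)
  have "fls_const a = fps_to_fls (fps_const a)" by simp
  then show ?case
    by (simp add: evp_pCons ringhom_fls_const pCons.IH fps_of_poly_pCons fps_compose_add_distrib
        fps_compose_mult_distrib[OF assms] assms fls_times_fps_to_fls mult.commute)
qed simp

text \<open>The sum \<open>S\<close> of the quotient equation. For \<open>c = n + 1\<close>,
  multiplied by X, it is also the quotient of \<open>X ^ (n^2) - X\<close> by
  \<open>X ^ (n + 1) - 1\<close>.\<close>

definition geom_poly :: "nat \<Rightarrow> nat \<Rightarrow> 'a::field poly" where
  "geom_poly n c = (\<Sum>i\<le>n - 2. [:0, 1:] ^ (i * c))"

text \<open>
  \<open>z ^ (n ^ 3 + 1)\<close> is a polynomial in \<open>x\<close> with a simple root at \<open>1\<close>, so \<open>z\<close> is a uniformizer at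
  \<open>x = 1\<close>: the polynomial is inverted as a power series in \<open>x - 1\<close>.
\<close>

theorem gk_model:
  fixes n :: nat
  assumes n: "n \<ge> 2" "of_nat n = (0::'a::alg_closed_field)"
  obtains x y z :: "'a::alg_closed_field fls" where
    "\<And>p. evp fls_const x p = 0 \<Longrightarrow> p = 0" "z \<noteq> 0"
    "z ^ (n\<^sup>2 - n + 1) = y * (x * evp fls_const x (geom_poly n (n + 1)))"
    "y ^ (n + 1) = x ^ (n + 1) - 1"
    "\<And>\<eta>. \<eta> ^ (n ^ 3 + 1) = 1 \<Longrightarrow>
       \<exists>\<sigma>. ringhom \<sigma> \<and> (\<forall>a. \<sigma> (fls_const a) = fls_const a) \<and> \<sigma> x = x \<and> \<sigma> z = fls_const \<eta> * z"
proof -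
  let ?N = "n ^ 3 + 1"
  note rh = ringhom_fls_const[where 'a = 'a]
  define p :: "'a poly" where "p = [:0, 1:] ^ (n + 1) - 1"
  define q :: "'a poly" where "q = [:0, 1:] * geom_poly n (n + 1)"
  define f where "f = p * q ^ (n + 1)"
  \<comment> \<open>The geometric sum has \<open>n - 1\<close> terms, each 1 at this point, and
    \<open>n\<close> is 0 in k.\<close>
  have q1: "poly q 1 = - 1"
  proof -
    have "poly q 1 = of_nat (n - 1)" using n(1) by (simp add: q_def geom_poly_def poly_sum)
    then show ?thesis using n by (simp add: of_nat_diff)
  qed
  \<comment> \<open>The derivative at 1 is \<open>n + 1\<close>, which is 1 in k; this is what makes
    the root simple.\<close>
  have p1: "poly p 1 = 0" "poly (pderiv p) 1 = 1"
    using n(2) by (simp_all add: p_def pderiv_diff pderiv_power pderiv_1 pderiv_pCons)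
  have f1: "poly f 1 = 0" "poly (pderiv f) 1 \<noteq> 0"
    by (simp_all add: f_def pderiv_mult p1 q1 del: power_Suc)
  define g where "g = pcompose f [:1, 1:]"
  define G where "G = fps_of_poly g"
  have G0: "fps_nth G 0 = 0"
    using f1(1) by (simp add: G_def g_def poly_pcompose flip: poly_0_coeff_0)
  have "fps_nth G 1 = Polynomial.coeff (pderiv g) 0" by (simp add: G_def coeff_pderiv)
  also have "\<dots> = poly (pderiv g) 0" by (simp add: poly_0_coeff_0)
  also have "\<dots> = poly (pderiv f) 1" by (simp add: g_def pderiv_pcompose poly_pcompose pderiv_pCons)
  finally have G1: "fps_nth G 1 \<noteq> 0" using f1(2) by simp
  have X0: "fps_nth ((fps_X :: 'a fps) ^ ?N) 0 = 0" by (simp add: fps_X_power_nth)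
  \<comment> \<open>\<open>G\<close> has a nonzero linear coefficient and so a compositional
    inverse; composing the inverse with the power of X solves \<open>G(s) = X ^ ?N\<close>.\<close>
  define s where "s = fps_compose (fps_inv G) (fps_X ^ ?N)"
  have inv0: "fps_nth (fps_inv G) 0 = 0" by (simp add: fps_inv_def)
  have s0: "fps_nth s 0 = 0" using inv0 by (simp add: s_def)
  have Gs: "fps_compose G s = fps_X ^ ?N"
    unfolding s_def fps_compose_assoc[OF X0 inv0] fps_inv_right[OF G0 G1]
    by (rule fps_X_fps_compose_startby0[OF X0])
  define x where "x = 1 + fps_to_fls s"
  have "x = evp fls_const (fps_to_fls s) [:1, 1:]" by (simp add: x_def evp_pCons rh)
  then have "evp fls_const x f = evp fls_const (fps_to_fls s) g"
    unfolding g_def evp_pcompose[OF rh] by simp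
  also have "\<dots> = fls_X ^ ?N"
    unfolding evp_fps[OF s0] G_def[symmetric] Gs fps_to_fls_power by simp
  finally have xf: "evp fls_const x f = fls_X ^ ?N" .
  \<comment> \<open>An algebraic \<open>x\<close> would be constant, and then so would
    \<open>f(x) = X ^ ?N\<close>.\<close>
  have trans: "r = 0" if "evp fls_const x r = 0" for r
  proof (rule ccontr)
    assume "r \<noteq> 0"
    then have "x \<in> range fls_const" using algebraic_constant[OF rh _ that] by blast
    then obtain c where "x = fls_const c" by blast
    then have "fls_X ^ ?N = fls_const (poly f c)" using xf evp_at_hom[OF rh] by simp
    then have "fls_nth (fls_X ^ ?N) (int ?N) = fls_nth (fls_const (poly f c)) (int ?N)" by simp
    moreover have "int ?N \<noteq> 0" by linarith
    ultimately show False unfolding fls_X_power_nth fls_const_nth by (simp only: if_False if_True one_neq_zero refl)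
  qed
  let ?q = "evp fls_const x q"
  have qx: "?q = x * evp fls_const x (geom_poly n (n + 1))"
    unfolding q_def ringhom_simps(4)[OF ringhom_evp[OF rh]] evp_X[OF rh] ..
  have q0: "?q \<noteq> 0" using trans[of q] q1 by auto
  \<comment> \<open>The equation between \<open>y\<close> and \<open>z = X\<close> holds by this
    choice; the other one results from \<open>f(x) = X ^ ?N\<close>, because \<open>f\<close> is
    \<open>p\<close> times the power \<open>n + 1\<close> of \<open>q\<close>.\<close>
  define y where "y = fls_X ^ (n\<^sup>2 - n + 1) / ?q"
  have N: "(n\<^sup>2 - n + 1) * (n + 1) = ?N"
  proof -
    have "n\<^sup>2 = n * (n - 1) + n" using n(1) by (cases n) (auto simp: power2_eq_square)
    then have "n\<^sup>2 - n = n * (n - 1)" by simp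
    moreover obtain m where "n = Suc m" using n(1) by (cases n) auto
    ultimately show ?thesis by (simp add: power3_eq_cube algebra_simps)
  qed
  have "evp fls_const x f = (x ^ (n + 1) - 1) * ?q ^ (n + 1)"
    unfolding f_def p_def ringhom_simps(4)[OF ringhom_evp[OF rh]] ringhom_power[OF ringhom_evp[OF rh]]
      ringhom_diff[OF ringhom_evp[OF rh]] evp_X[OF rh] ringhom_simps(2)[OF ringhom_evp[OF rh]] ..
  then have "y ^ (n + 1) = x ^ (n + 1) - 1"
    using q0 xf unfolding y_def power_divide power_mult[symmetric] N by simp
  moreover have "fls_X ^ (n\<^sup>2 - n + 1) = y * (x * evp fls_const x (geom_poly n (n + 1)))"
    using q0 unfolding qx[symmetric] y_def by simp
  moreover have "\<exists>\<sigma>. ringhom \<sigma> \<and> (\<forall>a. \<sigma> (fls_const a) = fls_const a) \<and> \<sigma> x = x \<and> \<sigma> fls_X = fls_const \<eta> * fls_X"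
    if \<eta>: "\<eta> ^ ?N = 1" for \<eta>
  proof -
    \<comment> \<open>\<open>s\<close> is a series in \<open>X ^ ?N\<close>, so replacing X by
      \<eta> X leaves \<open>s\<close>, and with it \<open>x\<close>, unchanged.\<close>
    let ?H = "fps_const \<eta> * fps_X"
    have H: "?H \<noteq> 0" "fps_nth ?H 0 = 0" using \<eta> by (auto simp: zero_power)
    have "fps_compose (fps_X ^ ?N) ?H = ?H ^ ?N" by (rule fps_X_power_compose[OF H(2)])
    also have "\<dots> = fps_X ^ ?N" unfolding power_mult_distrib fps_const_power \<eta> by simp
    finally have "fps_compose s ?H = s"
      unfolding s_def fps_compose_assoc[OF H(2) X0, symmetric] by simp
    then have "fls_compose_fps x ?H = x"
      using H by (simp add: x_def fls_compose_fps_add fls_compose_fps_to_fls)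
    moreover have "ringhom (\<lambda>F. fls_compose_fps F ?H)"
      using H by (intro ringhomI) (simp_all add: fls_compose_fps_add fls_compose_fps_mult)
    moreover have "fls_compose_fps fls_X ?H = fls_const \<eta> * fls_X"
      by (simp add: fls_times_fps_to_fls)
    ultimately show ?thesis by (intro exI[of _ "\<lambda>F. fls_compose_fps F ?H"]) simp
  qed
  ultimately show thesis using trans by (intro that[of x fls_X y]) auto
qed

section \<open>Branch points of the quotient equation\<close>

lemma order_power: "p \<noteq> 0 \<Longrightarrow> Polynomial.order b (p ^ k) = k * Polynomial.order b p"
  for p :: "'a::idom poly"
  by (induction k) (simp_all add: order_mult)

abbreviation "uX \<equiv> [:0, 1:] :: 'a::field poly"

lemma uX_power_minus_1:
  "poly (uX ^ m - 1) b = b ^ m - 1" "m > 0 \<Longrightarrow> uX ^ m - 1 \<noteq> (0 :: 'a::field poly)"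
  "m > 0 \<Longrightarrow> Polynomial.degree (uX ^ m - 1 :: 'a poly) = m"
proof -
  have e: "uX ^ m - 1 = (Polynomial.monom 1 m - 1 :: 'a poly)" by (simp add: monom_altdef)
  show "poly (uX ^ m - 1) b = b ^ m - 1" by simp
  show d: "m > 0 \<Longrightarrow> Polynomial.degree (uX ^ m - 1 :: 'a poly) = m"
    unfolding e by (rule degree_X_power_minus_1)
  show "m > 0 \<Longrightarrow> uX ^ m - 1 \<noteq> (0 :: 'a poly)" using d by fastforce
qed

lemma order_uX_power_minus_1:
  fixes b :: "'a::field"
  assumes "m > 0" "of_nat m \<noteq> (0::'a)"
  shows "Polynomial.order b (uX ^ m - 1) = (if b \<in> roots1 m then 1 else 0)"
proof (cases "b \<in> roots1 m")
  case True
  then have "b ^ m = 1" "b \<noteq> 0" using roots1_nz[OF assms(1)] by (auto simp: roots1_def)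
  then show ?thesis
    using True assms by (simp add: order_simple_root pderiv_diff pderiv_power pderiv_1 pderiv_pCons)
next
  case False
  then show ?thesis by (simp add: order_0I roots1_def)
qed

lemma geom_poly_mult:
  "n \<ge> 2 \<Longrightarrow> (uX ^ c - 1) * geom_poly n c = uX ^ (c * (n - 1)) - (1 :: 'a::field poly)"
proof -
  assume n: "n \<ge> 2"
  have "{..n - 2} = {..<n - 1}" using n by auto
  then have "geom_poly n c = (\<Sum>i<n - 1. (uX ^ c :: 'a poly) ^ i)"
    unfolding geom_poly_def by (simp only: power_mult[symmetric] mult.commute)
  then show ?thesis by (simp only: power_mult power_diff_1_eq)
qed

text \<open>The right-hand side for \<open>w ^ ((n + 1) * d)\<close>, found by raising
  \<open>w ^ d = v * S(u)\<close> to the power \<open>n + 1\<close> and eliminating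
  \<open>v\<close>.\<close>

definition quot_poly :: "nat \<Rightarrow> nat \<Rightarrow> 'a::field poly" where
  "quot_poly n c = (uX ^ (2 * c) - uX ^ c) * geom_poly n c ^ (n + 1)"

context
  fixes n c :: nat
  assumes n: "n \<ge> 2" "of_nat n = (0::'a::alg_closed_field)" and c: "c > 0" "of_nat c \<noteq> (0::'a)"
begin

abbreviation (input) "m \<equiv> c * (n - 1)"

text \<open>In k the number \<open>n - 1\<close> is -1, so \<open>c * (n - 1)\<close> stays nonzero
  there and the polynomial \<open>U ^ (c * (n - 1)) - 1\<close> is separable.\<close>

lemma m: "m > 0" "of_nat m \<noteq> (0::'a)"
  using n c by (simp_all add: of_nat_diff)

lemma geom_poly_nz: "geom_poly n c \<noteq> (0 :: 'a poly)"
  using geom_poly_mult[OF n(1), of c, where 'a = 'a] uX_power_minus_1(2)[OF m(1), where 'a = 'a] by auto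

lemma quot_poly_eq: "quot_poly n c = uX ^ c * ((uX ^ c - 1) * geom_poly n c ^ (n + 1) :: 'a poly)"
proof -
  have "uX ^ (2 * c) = (uX ^ c * uX ^ c :: 'a poly)" by (simp only: mult_2 power_add)
  then show ?thesis unfolding quot_poly_def by (simp only: algebra_simps mult_1_left mult_1_right)
qed

lemma quot_poly_nz: "quot_poly n c \<noteq> (0 :: 'a poly)"
  using geom_poly_nz uX_power_minus_1(2)[OF c(1), where 'a = 'a] by (simp add: quot_poly_eq)

lemma degree_quot_poly: "Polynomial.degree (quot_poly n c :: 'a poly) = c * (n * (n - 1))"
proof -
  let ?g = "geom_poly n c :: 'a poly"
  have "m = Polynomial.degree ((uX ^ c - 1) * ?g)"
    unfolding geom_poly_mult[OF n(1)] by (rule uX_power_minus_1(3)[OF m(1), symmetric])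
  also have "\<dots> = c + Polynomial.degree ?g"
    using geom_poly_nz uX_power_minus_1(2,3)[OF c(1), where 'a = 'a] by (subst degree_mult_eq) auto
  finally have g: "c + Polynomial.degree ?g = m" by simp
  have "Polynomial.degree (quot_poly n c :: 'a poly) = c + (c + (n + 1) * Polynomial.degree ?g)"
    unfolding quot_poly_eq
    using geom_poly_nz uX_power_minus_1(2,3)[OF c(1), where 'a = 'a]
    by (simp add: degree_mult_eq degree_power_eq del: power_Suc)
  moreover obtain k where k: "n = k + 2" using n(1) by (metis add.commute le_Suc_ex)
  moreover have "Polynomial.degree ?g = c * k" using g k by (simp add: algebra_simps)
  ultimately show ?thesis by (simp add: algebra_simps)
qed

lemma roots1_subset: "roots1 c \<subseteq> (roots1 m :: 'a set)"
  by (auto simp: roots1_def power_mult)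

text \<open>\<open>(U ^ c - 1) * S = U ^ (c * (n - 1)) - 1\<close> is separable, so \<open>S\<close>
  has simple zeros, namely at the roots of the right-hand side that are not roots of
  \<open>U ^ c - 1\<close>.\<close>

lemma order_quot_poly:
  "Polynomial.order b (quot_poly n c :: 'a poly) =
     (if b = 0 then c else if b \<in> roots1 c then 1 else if b \<in> roots1 m then n + 1 else 0)"
proof -
  let ?g = "geom_poly n c :: 'a poly"
  note nz = geom_poly_nz uX_power_minus_1(2)[OF c(1), where 'a = 'a]
  have "Polynomial.order b ((uX ^ c - 1) * ?g) = (if b \<in> roots1 m then 1 else 0)"
    unfolding geom_poly_mult[OF n(1)] by (rule order_uX_power_minus_1[OF m])
  then have 1: "Polynomial.order b (uX ^ c - 1) + Polynomial.order b ?g = (if b \<in> roots1 m then 1 else 0)"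
    using nz by (subst (asm) order_mult) auto
  have 2: "Polynomial.order b (uX ^ c) = (if b = 0 then c else 0)"
    using order_power_n_n[of "0 :: 'a" c] by (auto intro: order_0I)
  have "Polynomial.order b (quot_poly n c) =
      Polynomial.order b (uX ^ c) + (Polynomial.order b (uX ^ c - 1) + (n + 1) * Polynomial.order b ?g)"
    unfolding quot_poly_eq using nz by (simp add: order_mult order_power del: power_Suc)
  moreover have "0 \<notin> roots1 c" "0 \<notin> (roots1 m :: 'a set)"
    using roots1_nz[OF c(1)] roots1_nz[OF m(1)] by blast+
  ultimately show ?thesis
    using 1 2 order_uX_power_minus_1[OF c, of b] roots1_subset by (auto split: if_splits)
qed

lemma roots_quot_poly:
  "{b :: 'a. poly (quot_poly n c) b = 0} = insert 0 (roots1 c \<union> (roots1 m - roots1 c))"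
  using roots1_subset c(1) by (auto simp: order_root quot_poly_nz order_quot_poly split: if_splits)

lemma sum_quot_poly:
  fixes F :: "nat \<Rightarrow> int"
  shows "(\<Sum>b | poly (quot_poly n c) b = (0::'a). F (Polynomial.order b (quot_poly n c))) =
     F c + int c * F 1 + int (c * (n - 2)) * F (n + 1)"
proof -
  let ?o = "\<lambda>b::'a. Polynomial.order b (quot_poly n c)"
  have 0: "0 \<notin> roots1 c \<union> (roots1 m - roots1 c :: 'a set)"
    using roots1_nz[OF c(1)] roots1_nz[OF m(1)] by blast
  have fin: "finite (roots1 c :: 'a set)" "finite (roots1 m - roots1 c :: 'a set)"
    using finite_roots1[OF c(1)] finite_roots1[OF m(1)] by auto
  have "card (roots1 m - roots1 c :: 'a set) = m - c"
    using card_Diff_subset[OF fin(1) roots1_subset] by (simp only: card_roots1[OF c] card_roots1[OF m])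
  also have "m - c = c * (n - 2)" using n(1) by (simp add: diff_mult_distrib2)
  finally have card: "card (roots1 m - roots1 c :: 'a set) = c * (n - 2)" .
  have "(\<Sum>b | poly (quot_poly n c) b = (0::'a). F (?o b)) =
      F (?o 0) + ((\<Sum>b\<in>roots1 c. F (?o b)) + (\<Sum>b\<in>roots1 m - roots1 c. F (?o b)))"
    unfolding roots_quot_poly using 0 fin sum.union_disjoint[OF fin Diff_disjoint, of "\<lambda>b. F (?o b)"]
    by (subst sum.insert) (simp_all only: finite_UnI not_False_eq_True)
  also have "(\<Sum>b\<in>roots1 c. F (?o b)) = (\<Sum>b\<in>(roots1 c :: 'a set). F 1)"
    using 0 by (intro sum.cong) (auto simp: order_quot_poly)
  also have "(\<Sum>b\<in>roots1 m - roots1 c. F (?o b)) = (\<Sum>b\<in>(roots1 m - roots1 c :: 'a set). F (n + 1))"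
    using 0 by (intro sum.cong) (auto simp: order_quot_poly)
  finally show ?thesis
    by (simp only: order_quot_poly[of 0] if_True refl sum_constant card card_roots1[OF c] add.assoc of_nat_eq_id id_apply)
qed

end

text \<open>The factor \<open>c\<close> comes out by \<open>n + 1 = e1 * c\<close>. Next,
  \<open>d\<close> divides \<open>n * (n - 1) + 1\<close> and is coprime to
  \<open>n * (n - 1)\<close>, while \<open>e1\<close> is coprime to \<open>n\<close>. Finally
  \<open>e1\<close> divides \<open>(n - 1) + 2\<close>, which leaves the gcd with 2.\<close>

lemma gcd_genus:
  fixes n c d e1 :: nat
  assumes n: "n \<ge> 2" and c: "e1 * c = n + 1" and d: "d dvd n\<^sup>2 - n + 1"
  shows "gcd ((n + 1) * d) (c * (n * (n - 1))) = c * gcd 2 e1"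
proof -
  have sq: "n\<^sup>2 - n = n * (n - 1)" by (simp add: power2_eq_square diff_mult_distrib2)
  have 1: "coprime (n * (n - 1) + 1) (n * (n - 1))" by (rule coprime_add_one_left)
  then have "coprime d (n * (n - 1))" using d by (metis sq coprime_divisors dvd_refl)
  then have "gcd (e1 * d) (n * (n - 1)) = gcd e1 (n * (n - 1))"
    by (simp add: coprime_commute gcd_mult_left_right_cancel)
  also have "\<dots> = gcd e1 (n - 1)"
  proof -
    have "coprime (n + 1) n" by simp
    then have "coprime e1 n" by (metis c coprime_divisors dvd_triv_left dvd_refl)
    then show ?thesis by (rule gcd_mult_right_left_cancel)
  qed
  also have "\<dots> = gcd e1 2"
  proof -
    have "e1 * c = (n - 1) + 2" using c n by simp
    then have "gcd e1 (n - 1 + 2) = e1" by (metis gcd_nat.absorb1 dvd_triv_left)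
    show ?thesis
    proof (rule dvd_antisym)
      have a: "gcd e1 (n - 1) dvd (n - 1) + 2"
        using \<open>e1 * c = (n - 1) + 2\<close> by (metis dvd_mult2 gcd_dvd1)
      then have "gcd e1 (n - 1) dvd 2" using dvd_add_right_iff[of "gcd e1 (n - 1)" "n - 1" 2] by simp
      then show "gcd e1 (n - 1) dvd gcd e1 2" by simp
      have "gcd e1 2 dvd (n - 1) + 2"
        using \<open>e1 * c = (n - 1) + 2\<close> by (metis dvd_mult2 gcd_dvd1)
      then have "gcd e1 2 dvd n - 1" using dvd_add_left_iff[of "gcd e1 2" 2 "n - 1"] by simp
      then show "gcd e1 2 dvd gcd e1 (n - 1)" by simp
    qed
  qed
  finally have g: "gcd (e1 * d) (n * (n - 1)) = gcd 2 e1" by (simp add: gcd.commute)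
  have "(n + 1) * d = c * (e1 * d)" using c by (metis mult.assoc mult.commute)
  then show ?thesis using g by (simp add: gcd_mult_distrib_nat[symmetric])
qed

section \<open>The GK curve with its Laurent series point\<close>

locale gk =
  fixes n :: nat and x y z :: "'a::alg_closed_field fls"
  assumes n: "n \<ge> 2" "of_nat n = (0::'a)"
    and trans: "\<And>p. evp fls_const x p = 0 \<Longrightarrow> p = 0" and z_nz: "z \<noteq> 0"
    and zy: "z ^ (n\<^sup>2 - n + 1) = y * (x * evp fls_const x (geom_poly n (n + 1)))"
    and yx: "y ^ (n + 1) = x ^ (n + 1) - 1"
    and galois: "\<And>\<eta>. \<eta> ^ (n ^ 3 + 1) = 1 \<Longrightarrow>
       \<exists>\<sigma>. ringhom \<sigma> \<and> (\<forall>a. \<sigma> (fls_const a) = fls_const a) \<and> \<sigma> x = x \<and> \<sigma> z = fls_const \<eta> * z"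
begin

lemmas rh = ringhom_fls_const[where 'a = 'a]

lemma evps: "evp fls_const (t :: 'a fls) (p * q) = evp fls_const t p * evp fls_const t q"
  "evp fls_const t (p ^ k) = evp fls_const t p ^ k"
  "evp fls_const t (p - q) = evp fls_const t p - evp fls_const t q"
  "evp fls_const t 1 = 1" "evp fls_const t uX = t"
  "evp fls_const t (geom_poly n c) = (\<Sum>i\<le>n - 2. t ^ (i * c))"
  by (simp_all add: geom_poly_def ringhom_simps[OF ringhom_evp[OF rh]] ringhom_power[OF ringhom_evp[OF rh]]
    ringhom_diff[OF ringhom_evp[OF rh]] evp_X[OF rh] ringhom_sum[OF ringhom_evp[OF rh]])

lemma cube: "n ^ 3 + 1 = (n + 1) * (n\<^sup>2 - n + 1)"
proof -
  have "n\<^sup>2 - n = n * (n - 1)" by (simp add: power2_eq_square diff_mult_distrib2)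
  moreover obtain m where "n = Suc m" using n(1) by (cases n) auto
  ultimately show ?thesis by (simp add: power3_eq_cube algebra_simps)
qed

lemma of_nat_degrees: "of_nat (n + 1) = (1::'a)" "of_nat (n\<^sup>2 - n + 1) = (1::'a)"
proof -
  have "n\<^sup>2 - n = n * (n - 1)" by (simp add: power2_eq_square diff_mult_distrib2)
  then show "of_nat (n + 1) = (1::'a)" "of_nat (n\<^sup>2 - n + 1) = (1::'a)" using n(2) by simp_all
qed

text \<open>Raising the equation for \<open>z\<close> to the power \<open>n + 1\<close> eliminates
  \<open>y\<close> and leaves a Kummer equation over k(x).\<close>

lemma tower_curve:
  "tower fls_const x z (n ^ 3 + 1) ((uX ^ (n + 1) - 1) * (uX * geom_poly n (n + 1)) ^ (n + 1)) y
     (n + 1) (n\<^sup>2 - n + 1) (uX ^ (n + 1) - 1) (uX * geom_poly n (n + 1))"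
proof -
  let ?f = "(uX ^ (n + 1) - 1) * (uX * geom_poly n (n + 1)) ^ (n + 1) :: 'a poly"
  have "evp fls_const x ?f = y ^ (n + 1) * (x * evp fls_const x (geom_poly n (n + 1))) ^ (n + 1)"
    by (simp only: evps(1-5) yx)
  also have "\<dots> = z ^ (n ^ 3 + 1)"
    by (simp only: cube power_mult mult.commute[of "n + 1"] zy power_mult_distrib)
  finally have f: "z ^ (n ^ 3 + 1) = evp fls_const x ?f" by simp
  then have fn: "?f \<noteq> 0" using z_nz by fastforce
  have "kummer fls_const x z (n ^ 3 + 1) ?f"
  proof (rule kummerI[OF rh _ _ fn f trans galois])
    show "of_nat (n ^ 3 + 1) \<noteq> (0::'a)" unfolding cube of_nat_mult of_nat_degrees by simp
  qed auto
  then show ?thesis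
  proof (rule tower.intro, unfold_locales)
    show "uX * geom_poly n (n + 1) \<noteq> (0 :: 'a poly)" using fn by auto
  qed (simp_all only: cube evps(1-5) yx zy)
qed

text \<open>Where the denominator vanishes, both descriptions force \<open>V = 0\<close> and
  \<open>W = 0\<close>. Elsewhere the fraction is a geometric sum, by
  \<open>(n + 1) * (n - 1) + 1 = n^2\<close>.\<close>

lemma gk_affine_eq: "gk_affine n = tower.A (n + 1) (n\<^sup>2 - n + 1) (uX ^ (n + 1) - 1 :: 'a poly) (uX * geom_poly n (n + 1))"
proof -
  have "(V ^ (n + 1) = U ^ (n + 1) - 1 \<and> W ^ (n\<^sup>2 - n + 1) = V * (U * poly (geom_poly n (n + 1)) U)) \<longleftrightarrow>
      (W ^ (n\<^sup>2 - n + 1) = V * ((U ^ n\<^sup>2 - U) / (U ^ (n + 1) - 1)) \<and> V ^ (n + 1) = U ^ (n + 1) - 1)"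
    for U V W :: 'a
  proof (cases "U ^ (n + 1) - 1 = 0")
    case True
    then have "V = 0" if "V ^ (n + 1) = U ^ (n + 1) - 1" using that by (metis power_eq_0_iff)
    then show ?thesis by auto
  next
    case False
    have e: "(n + 1) * (n - 1) + 1 = n\<^sup>2"
      using n(1) by (cases n) (auto simp: power2_eq_square algebra_simps)
    have "poly ((uX ^ (n + 1) - 1) * geom_poly n (n + 1)) U = U ^ ((n + 1) * (n - 1)) - 1"
      by (simp only: geom_poly_mult[OF n(1)] uX_power_minus_1(1))
    then have "(U ^ (n + 1) - 1) * poly (geom_poly n (n + 1)) U = U ^ ((n + 1) * (n - 1)) - 1"
      by (simp only: poly_mult uX_power_minus_1(1))
    then have "U * poly (geom_poly n (n + 1)) U * (U ^ (n + 1) - 1) = U * (U ^ ((n + 1) * (n - 1)) - 1)"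
      by (metis mult.assoc mult.commute)
    also have "\<dots> = U ^ ((n + 1) * (n - 1) + 1) - U" by (simp add: algebra_simps)
    finally have "(U ^ n\<^sup>2 - U) / (U ^ (n + 1) - 1) = U * poly (geom_poly n (n + 1)) U"
      using False unfolding e by (metis nonzero_mult_div_cancel_right)
    then show ?thesis by auto
  qed
  then show ?thesis
    unfolding gk_affine_def tower.A_def[OF tower_curve] poly_mult uX_power_minus_1(1) by simp
qed

lemma generic_curve: "generic (gk_affine n) fls_const x y z"
  unfolding gk_affine_eq by (rule tower.generic_point[OF tower_curve])

end

section \<open>The tower of the quotient and its genus\<close>

locale gk_quot = gk +
  fixes c d e1 e2 :: nat
  assumes e1: "n + 1 = e1 * c" and e2: "n\<^sup>2 - n + 1 = e2 * d"
begin

lemma pos: "e1 > 0" "c > 0" "e2 > 0" "d > 0"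
proof -
  have "e1 * c \<noteq> 0" "e2 * d \<noteq> 0" unfolding e1[symmetric] e2[symmetric] by simp_all
  then show "e1 > 0" "c > 0" "e2 > 0" "d > 0" by simp_all
qed

lemma of_nats: "of_nat e1 \<noteq> (0::'a)" "of_nat c \<noteq> (0::'a)" "of_nat e2 \<noteq> (0::'a)" "of_nat d \<noteq> (0::'a)"
  using of_nat_degrees unfolding e1 e2 of_nat_mult by auto

lemma uc: "(x ^ e1) ^ c = x ^ (n + 1)"
  unfolding e1 power_mult ..

lemma geom_u: "evp fls_const (x ^ e1) (geom_poly n c) = evp fls_const x (geom_poly n (n + 1))"
  unfolding evps mult.commute[of _ c] mult.commute[of _ "n + 1"] power_mult uc ..

text \<open>If \<open>x ^ e1\<close> were algebraic it would be a constant \<open>a\<close>, and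
  \<open>x\<close> would be a root of \<open>X ^ e1 - a\<close>.\<close>

lemma u_trans: assumes "evp fls_const (x ^ e1) p = 0" shows "p = 0"
proof (rule ccontr)
  assume "p \<noteq> 0"
  then have "x ^ e1 \<in> range fls_const" using algebraic_constant[OF rh _ assms] by blast
  then obtain a where "x ^ e1 = fls_const a" by blast
  then have "evp fls_const x (uX ^ e1 - [:a:]) = 0" by (simp only: evps evp_const[OF rh] diff_self)
  then have "uX ^ e1 - [:a:] = 0" by (rule trans)
  then have "Polynomial.degree (uX ^ e1 :: 'a poly) = Polynomial.degree [:a:]" by simp
  then show False using pos(1) by (simp add: degree_power_eq)
qed

text \<open>With \<open>u ^ c = x ^ (n + 1)\<close> the equation for \<open>y\<close> gives
  \<open>v ^ (n + 1) = u ^ c * (u ^ c - 1)\<close>. The geometric sum depends on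
  \<open>x ^ (n + 1)\<close> only and is therefore a polynomial in u.\<close>

lemma tower_quot:
  "tower fls_const (x ^ e1) (z ^ e2) ((n + 1) * d) (quot_poly n c) (x * y)
     (n + 1) d (uX ^ (2 * c) - uX ^ c) (geom_poly n c)"
proof -
  let ?u = "x ^ e1"
  have p: "(x * y) ^ (n + 1) = evp fls_const ?u (uX ^ (2 * c) - uX ^ c)"
    unfolding evps power_mult_distrib yx mult.commute[of 2 c] power_mult uc
    by (simp add: algebra_simps power2_eq_square)
  have q: "(z ^ e2) ^ d = x * y * evp fls_const ?u (geom_poly n c)"
    unfolding geom_u power_mult[symmetric] e2[symmetric] zy by (simp only: mult_ac)
  have "(z ^ e2) ^ ((n + 1) * d) = ((z ^ e2) ^ d) ^ (n + 1)"
    by (simp only: power_mult[symmetric] mult_ac)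
  also have "\<dots> = evp fls_const ?u (quot_poly n c)"
    unfolding q power_mult_distrib[of "x * y"] p quot_poly_def evps(1,2) ..
  finally have f: "(z ^ e2) ^ ((n + 1) * d) = evp fls_const ?u (quot_poly n c)" .
  have "kummer fls_const ?u (z ^ e2) ((n + 1) * d) (quot_poly n c)"
  proof (rule kummerI[OF rh _ _ quot_poly_nz[OF n pos(2) of_nats(2)] f u_trans])
    show "of_nat ((n + 1) * d) \<noteq> (0::'a)" unfolding of_nat_mult of_nat_degrees using of_nats(4) by simp
    fix \<zeta> :: 'a assume \<zeta>: "\<zeta> ^ ((n + 1) * d) = 1"
    obtain \<eta> where \<eta>: "\<eta> ^ e2 = \<zeta>" using nth_root_exists[OF pos(3)] by blast
    have "n ^ 3 + 1 = e2 * ((n + 1) * d)" unfolding cube e2 by (simp only: mult_ac)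
    then have "\<eta> ^ (n ^ 3 + 1) = 1" using \<zeta> by (simp only: power_mult \<eta>)
    from galois[OF this] obtain \<sigma> where s: "ringhom \<sigma>" "\<forall>a. \<sigma> (fls_const a) = fls_const a"
      "\<sigma> x = x" "\<sigma> z = fls_const \<eta> * z" by blast
    have "\<sigma> ?u = ?u" "\<sigma> (z ^ e2) = fls_const \<zeta> * z ^ e2"
      using s(3,4) by (simp_all add: ringhom_power[OF s(1)] power_mult_distrib ringhom_power[OF rh] flip: \<eta>)
    then show "\<exists>\<sigma>. ringhom \<sigma> \<and> (\<forall>a. \<sigma> (fls_const a) = fls_const a) \<and> \<sigma> ?u = ?u \<and>
        \<sigma> (z ^ e2) = fls_const \<zeta> * z ^ e2" using s(1,2) by blast
  qed (use pos in auto)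
  then show ?thesis
  proof (rule tower.intro, unfold_locales)
    show "geom_poly n c \<noteq> (0 :: 'a poly)" by (rule geom_poly_nz[OF n pos(2) of_nats(2)])
  qed (simp_all only: p q)
qed

sublocale tower fls_const "x ^ e1" "z ^ e2" "(n + 1) * d" "quot_poly n c" "x * y"
    "n + 1" d "uX ^ (2 * c) - uX ^ c" "geom_poly n c"
  by (rule tower_quot)

lemma equations: "{E2, E1} = {pW ^ d - pV * (\<Sum>i\<le>n - 2. pU ^ (i * c)), pV ^ (n + 1) - (pU ^ (2 * c) - pU ^ c)}"
proof -
  have h: "ringhom (\<lambda>p :: 'a poly. [:[:p:]:])"
    by (rule ringhom_comp[OF ringhom_const_poly ringhom_const_poly])
  have "[:[:uX ^ k :: 'a poly:]:] = pU ^ k" for k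
    using ringhom_power[OF h, of uX k] by (simp add: pU_def)
  then have "[:[:geom_poly n c :: 'a poly:]:] = (\<Sum>i\<le>n - 2. pU ^ (i * c))"
    "[:[:uX ^ (2 * c) - uX ^ c :: 'a poly:]:] = pU ^ (2 * c) - pU ^ c"
    unfolding geom_poly_def ringhom_sum[OF h] ringhom_diff[OF h] by simp_all
  then show ?thesis unfolding E1_def E2_def by (simp only:)
qed

text \<open>With \<open>N = (n + 1) * d\<close>, the zero at 0 contributes \<open>N - c\<close>, the
  \<open>c\<close> simple zeros \<open>N - 1\<close> each, the other \<open>c * (n - 2)\<close>
  zeros \<open>N - (n + 1)\<close> each, and infinity \<open>N - c * gcd 2 e1\<close>.\<close>

lemma genus_value: "2 * G - 2 = int c * ((int d - 1) * int n ^ 2 + int n - int d - int (gcd 2 e1))"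
proof -
  let ?N = "(n + 1) * d"
  have 1: "gcd ?N c = c" "gcd ?N (n + 1) = n + 1"
    by (rule gcd_nat.absorb2, simp only: e1 mult.commute[of e1] mult.assoc dvd_triv_left)
       (rule gcd_nat.absorb2, rule dvd_triv_left)
  have "gcd ?N (c * (n * (n - 1))) = c * gcd 2 e1"
    by (rule gcd_genus[OF n(1) e1[symmetric]]) (simp only: e2 dvd_triv_right)
  then have "2 * G - 2 = - 2 * int ?N + ((int ?N - int c) + int c * (int ?N - 1) +
      int (c * (n - 2)) * (int ?N - int (n + 1))) + (int ?N - int (c * gcd 2 e1))"
    using genus_formula sum_quot_poly[OF n pos(2) of_nats(2), of "\<lambda>k. int ?N - int (gcd ?N k)"]
    by (simp only: degree_quot_poly[OF n pos(2) of_nats(2)] 1 gcd_1_nat of_nat_1)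
  moreover obtain k where "n = k + 2" using n(1) by (metis add.commute le_Suc_ex)
  ultimately show ?thesis by (simp add: algebra_simps power2_eq_square)
qed

end

lemma (in field_embed) field_embed_pre:
  assumes "subfld S"
  shows "field_embed (F\<lparr>carrier := pre S\<rparr>) \<phi>"
proof -
  note S = subfldD[OF assms]
  have "subring (pre S) F"
    by (rule F.subringI) (auto simp: pre_def S phi_one phi_a_inv phi_mult phi_add)
  then have "subfield (pre S) F"
    by (rule F.subfieldI') (auto simp: pre_def S phi_inv inv_closed)
  then have "Ring.field (F\<lparr>carrier := pre S\<rparr>)" by (rule F.subfield_iff(2))
  then show ?thesis
    using inj_on_subset[OF inj pre_sub]
    by (intro field_embed.intro) (auto simp: pre_def phi_mult phi_add phi_one)
qed

section \<open>The quotient curve\<close>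

context gk
begin

lemma x_nz: "x \<noteq> 0"
proof
  assume "x = 0"
  then have "evp fls_const x uX = 0" by (simp only: evps)
  from trans[OF this] show False by simp
qed

text \<open>The equations are written in \<open>X ^ (n + 1)\<close>, \<open>Y ^ (n + 1)\<close>,
  \<open>X * Y\<close> and a power of \<open>Z\<close>, each of which is fixed by the group.\<close>

lemma mem_affine: "(X, Y, Z :: 'a) \<in> gk_affine n \<longleftrightarrow>
    Y ^ (n + 1) = X ^ (n + 1) - 1 \<and> Z ^ (n\<^sup>2 - n + 1) = X * Y * (\<Sum>i\<le>n - 2. (X ^ (n + 1)) ^ i)"
proof -
  have "poly (geom_poly n (n + 1)) X = (\<Sum>i\<le>n - 2. (X ^ (n + 1)) ^ i)"
    unfolding geom_poly_def poly_sum poly_power mult.commute[of _ "n + 1"] power_mult by simp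
  then show ?thesis
    unfolding gk_affine_eq tower.A_def[OF tower_curve] poly_mult uX_power_minus_1(1)
    by (simp add: mult_ac del: power_Suc)
qed

end

context gk_quot
begin

sublocale D: diag_group "gk_affine n" fls_const x y z e1 e2
proof
  show "generic (gk_affine n) fls_const x y z" by (rule generic_curve)
  show "\<exists>X Y Z. (X, Y, Z) \<in> gk_affine n \<and> X \<noteq> (0::'a) \<and> Z \<noteq> 0"
  proof (rule ccontr)
    \<comment> \<open>Otherwise \<open>X * Z\<close> would vanish on the curve, while its generic
      value \<open>x * z\<close> is nonzero.\<close>
    assume "\<not> ?thesis"
    then have "\<forall>s\<in>gk_affine n. eval3 (pU * pW) s = (0::'a)"
      by (auto simp: eval3_evt evt_simps[OF ringhom_id])
    then have "evt fls_const x y z (pU * pW) = 0" using generic_curve unfolding generic_def by blast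
    then show False using x_nz z_nz by (simp add: evt_simps[OF rh])
  qed
  fix X Y Z b l :: 'a
  assume A: "(X, Y, Z) \<in> gk_affine n" and b: "b \<in> roots1 e1" and l: "l \<in> roots1 e2"
  have b1: "b ^ (n + 1) = 1" "b \<noteq> 0" using b roots1_nz[OF pos(1) b] unfolding e1 power_mult by (simp_all add: roots1_def)
  have l1: "l ^ (n\<^sup>2 - n + 1) = 1" using l unfolding e2 power_mult by (simp add: roots1_def)
  have "(inverse b * X) ^ (n + 1) = X ^ (n + 1)" "(b * Y) ^ (n + 1) = Y ^ (n + 1)"
    "(l * Z) ^ (n\<^sup>2 - n + 1) = Z ^ (n\<^sup>2 - n + 1)"
    unfolding power_mult_distrib power_inverse b1(1) l1 by simp_all
  moreover have "inverse b * X * (b * Y) = X * Y" using b1(2) by simp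
  ultimately show "(inverse b * X, b * Y, l * Z) \<in> gk_affine n"
    using A unfolding mem_affine by (simp only:)
qed (use pos of_nats x_nz in auto)

abbreviation "Cv \<equiv> gk_curve n :: 'a ppoint set"
abbreviation "FF \<equiv> proj_function_field Cv"
abbreviation "kk \<equiv> range (proj_const Cv)"
abbreviation "uu \<equiv> gk_x n [^]\<^bsub>FF\<^esub> e1"
abbreviation "vv \<equiv> gk_x n \<otimes>\<^bsub>FF\<^esub> gk_y n"
abbreviation "ww \<equiv> gk_z n [^]\<^bsub>FF\<^esub> e2"

lemma div: "(n + 1) div c = e1" "(n\<^sup>2 - n + 1) div d = e2"
  using pos unfolding e1 e2 by simp_all

lemma group_act: "gk_group n c d = D.act ` D.I"
proof -
  have t: "(\<lambda>(X, Y, Z, T). (inverse b * X, b * Y, l * Z, T)) = D.tau (b, l)" for b l :: 'a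
    by (auto simp: D.tau_def dg_def)
  show ?thesis
    unfolding gk_group_def div t D.act_def[abs_def] gk_curve_def D.I_def roots1_def by force
qed

lemma group_order: "card (gk_group n c d :: ('a ppoint \<Rightarrow> _) set) = (n ^ 3 + 1) div (c * d)"
proof -
  have "n ^ 3 + 1 = e1 * e2 * (c * d)" unfolding cube e1 e2 by (simp only: mult_ac)
  then show ?thesis using pos unfolding group_act D.card_act by simp
qed

lemma FF_def: "FF = frac_ring (\<Union>D.C) (proj_fractions D.C)"
  by (simp add: proj_function_field_def gk_curve_def)

sublocale FE: field_embed FF D.nu
  unfolding FF_def by (rule D.field_embed_nu)

lemmas coords = D.coordinate_functions[folded gk_curve_def, folded gk_x_def gk_y_def gk_z_def]

lemma constants: "kk \<subseteq> carrier FF" "D.nu ` kk = range fls_const"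
  using coords(1,2) by (auto simp: image_image)

lemma uvw: "uu \<in> carrier FF" "vv \<in> carrier FF" "ww \<in> carrier FF"
  "D.nu uu = x ^ e1" "D.nu vv = x * y" "D.nu ww = z ^ e2"
  using coords by (simp_all add: FE.phi_nat_pow FE.phi_mult)

lemma carrier_generated: "carrier FF = generate_field FF (kk \<union> {gk_x n, gk_y n, gk_z n})"
proof -
  have "D.nu ` carrier FF = gen3 fls_const x y z"
    unfolding FF_def D.nu_image D.vals_gen3 ..
  then have "carrier FF = FE.pre (gen3 fls_const x y z)" by (auto simp: FE.pre_def)
  then show ?thesis
    unfolding FE.generate_field_pre[OF rh constants coords(3,5,7)] coords by simp
qed

lemma fixed_pre: "fixed_field Cv (gk_group n c d) = FE.pre L"
  unfolding group_act gk_curve_def D.fixed_field_gen3 gen3_L FE.pre_def[unfolded gk_curve_def] ..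

lemma fixed_generated: "fixed_field Cv (gk_group n c d) = generate_field FF (kk \<union> {uu, vv, ww})"
  unfolding fixed_pre FE.generate_field_pre[OF rh constants uvw(1-3)] uvw gen3_L ..

lemma L_sub: "L \<subseteq> FE.img"
proof -
  have i: "FE.img = gen3 fls_const x y z"
    unfolding FE.img_def unfolding FF_def D.nu_image D.vals_gen3 ..
  note E = subfld_gen3[OF rh, of x y z] gen3_gens[OF rh]
  have "gen3 fls_const (x ^ e1) (x * y) (z ^ e2) \<subseteq> gen3 fls_const x y z"
    by (rule gen3_least[OF E(1) rh]) (auto intro!: subfld_more(4)[OF E(1)] subfldD(3)[OF E(1)] E(2-))
  then show ?thesis unfolding i gen3_L .
qed

lemma quotient: "quotient_function_field Cv (gk_group n c d) = FF\<lparr>carrier := FE.pre L\<rparr>"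
  unfolding quotient_function_field_def fixed_pre ..

lemma kk_pre: "kk \<subseteq> FE.pre L"
  using constants(1) coords(2) h_L by (auto simp: FE.pre_def)

text \<open>\<open>D.nu\<close> identifies the fixed field with \<open>L\<close> and so makes it an
  abstract copy of the Kummer extension k(u, w).\<close>

lemma quotient_genus: "genus kk (quotient_function_field Cv (gk_group n c d)) = G"
proof -
  have "kummer_embed fls_const (x ^ e1) (z ^ e2) ((n + 1) * d) (quot_poly n c)
      (FF\<lparr>carrier := FE.pre L\<rparr>) D.nu kk"
  proof (rule kummer_embed.intro[OF kummer_axioms FE.field_embed_pre[OF subfld_L]],
      rule kummer_embed_axioms.intro)
    show "kk \<subseteq> carrier (FF\<lparr>carrier := FE.pre L\<rparr>)" using kk_pre by simp
    show "D.nu ` kk = range fls_const" by (rule constants)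
    show "field_embed.img (FF\<lparr>carrier := FE.pre L\<rparr>) D.nu = L"
      unfolding field_embed.img_def[OF FE.field_embed_pre[OF subfld_L]]
      using FE.image_pre[OF L_sub] by simp
  qed
  from kummer_embed.genus_eq[OF this] show ?thesis unfolding quotient .
qed

text \<open>The generic points of the affine curve and of the GK curve have coordinates in the same
  Laurent series field, and the values of both function fields fill \<open>L\<close>. Matching equal
  values is the isomorphism; it sends coordinates to u, v, w because \<open>D.nu\<close> is
  injective.\<close>

lemma quotient_equations:
  "has_irreducible_affine_equations (quotient_function_field Cv (gk_group n c d)) (proj_const Cv) uu vv ww
     {pW ^ d - pV * (\<Sum>i\<le>n - 2. pU ^ (i * c)), pV ^ (n + 1) - (pU ^ (2 * c) - pU ^ c)}"
  unfolding equations[symmetric] has_irreducible_affine_equations_def A_zero_set[symmetric]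
proof (intro conjI prime_E)
  let ?e = "eaff fls_const (x ^ e1) (x * y) (z ^ e2)"
  interpret B: frac_data A "aff_fractions A" "\<lambda>_ F. \<exists>P. F = eval3 P" ?e
    by (rule aff_frac_data[OF generic_point])
  have "B.nu \<in> ring_iso (aff_function_field A) (fldrec L)"
    using B.nu_iso unfolding aff_vals[OF generic_point] gen3_L aff_function_field_def .
  then have "\<exists>\<psi>\<in>ring_iso (aff_function_field A) (FF\<lparr>carrier := FE.pre L\<rparr>).
      \<forall>g\<in>carrier (aff_function_field A). D.nu (\<psi> g) = B.nu g"
  proof (rule ring_iso_via[OF _ FE.field_embed_axioms FE.pre_sub FE.image_pre[OF L_sub]])
    show "\<one>\<^bsub>FF\<^esub> \<in> FE.pre L" using subfldD(1)[OF subfld_L] by (simp add: FE.pre_def FE.phi_one del: of_nat_Suc)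
    show "f \<otimes>\<^bsub>FF\<^esub> g \<in> FE.pre L \<and> f \<oplus>\<^bsub>FF\<^esub> g \<in> FE.pre L" if "f \<in> FE.pre L" "g \<in> FE.pre L" for f g
    proof -
      have c: "f \<in> carrier FF" "g \<in> carrier FF" and "D.nu f \<in> L" "D.nu g \<in> L"
        using that unfolding FE.pre_def by blast+
      then have "D.nu f * D.nu g \<in> L \<and> D.nu f + D.nu g \<in> L" using subfldD(2,3)[OF subfld_L] by blast
      then show ?thesis using c unfolding FE.pre_def by (simp add: FE.phi_mult FE.phi_add)
    qed
  qed
  then obtain \<psi> where psi: "\<psi> \<in> ring_iso (aff_function_field A) (FF\<lparr>carrier := FE.pre L\<rparr>)"
    "\<And>g. g \<in> carrier (aff_function_field A) \<Longrightarrow> D.nu (\<psi> g) = B.nu g" by blast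
  have val: "\<psi> (aff_fun A P) = f"
    if "f \<in> carrier FF" "D.nu f = evt fls_const (x ^ e1) (x * y) (z ^ e2) P" for P f
  proof -
    note a = aff_fun_nu[OF generic_point, of P]
    have "\<psi> (aff_fun A P) \<in> FE.pre L"
      using ring_hom_closed[OF _ a(1), of \<psi> "FF\<lparr>carrier := FE.pre L\<rparr>"] psi(1) by (simp add: ring_iso_def)
    then have "\<psi> (aff_fun A P) \<in> carrier FF" using FE.pre_sub by blast
    moreover have "D.nu (\<psi> (aff_fun A P)) = D.nu f" using psi(2)[OF a(1)] a(2) that(2) by simp
    ultimately show ?thesis using FE.phi_eq_iff that(1) by blast
  qed
  show "\<exists>\<phi>\<in>ring_iso (aff_function_field A) (quotient_function_field Cv (gk_group n c d)).
       (\<forall>a. \<phi> (aff_fun A [:[:[:a:]:]:]) = proj_const Cv a) \<and>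
       \<phi> (aff_fun A pU) = uu \<and> \<phi> (aff_fun A pV) = vv \<and> \<phi> (aff_fun A pW) = ww"
    unfolding quotient
  proof (intro bexI[OF _ psi(1)] conjI allI val uvw(1-3))
    show "proj_const Cv a \<in> carrier FF" for a by (rule coords)
    show "D.nu (proj_const Cv a) = evt fls_const (x ^ e1) (x * y) (z ^ e2) [:[:[:a:]:]:]" for a
      by (simp only: coords evt_gens[OF rh] evp_const[OF rh])
  qed (simp_all only: uvw evt_gens[OF rh])
qed

end

theorem mainTheorem5:
  fixes n p h c d :: nat
  assumes "Factorial_Ring.prime p" and "h \<ge> 1" and "n = p ^ h"
    and "CARD('q::{field, finite}) = n ^ 6"
    and "c dvd n + 1" and "d dvd n\<^sup>2 - n + 1"
  shows "let C = (gk_curve n :: 'q alg_closure ppoint set);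
             F = proj_function_field C;
             k = range (proj_const C);
             x = gk_x n; y = gk_y n; z = gk_z n;
             K = gk_group n c d;
             u = x [^]\<^bsub>F\<^esub> ((n + 1) div c);
             v = x \<otimes>\<^bsub>F\<^esub> y;
             w = z [^]\<^bsub>F\<^esub> ((n\<^sup>2 - n + 1) div d)
         in subgroup K (BijGroup C) \<and> card K = (n ^ 3 + 1) div (c * d) \<and>
            field F \<and> carrier F = generate_field F (k \<union> {x, y, z}) \<and>
            fixed_field C K = generate_field F (k \<union> {u, v, w}) \<and>
            has_irreducible_affine_equations (quotient_function_field C K) (proj_const C) u v w
              {pW ^ d - pV * (\<Sum>i\<le>n - 2. pU ^ (i * c)), pV ^ (n + 1) - (pU ^ (2 * c) - pU ^ c)} \<and>
            real_of_int (genus k (quotient_function_field C K)) =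
              real c / 2 * ((real d - 1) * real n ^ 2 + real n - real d
                             - real (gcd 2 ((n + 1) div c))) + 1"
proof -
  have n2: "n \<ge> 2"
  proof -
    have "2 \<le> p" using assms(1) by (rule prime_ge_2_nat)
    also have "p \<le> p ^ h" using \<open>2 \<le> p\<close> assms(2) by (intro self_le_power) auto
    finally show ?thesis using assms(3) by simp
  qed
  \<comment> \<open>\<open>n ^ 6\<close> is zero in the finite field, hence so is
    \<open>n\<close>.\<close>
  have "of_nat (CARD('q)) = (0::'q)" using CHAR_dvd_CARD[where 'a = 'q] by (simp add: of_nat_eq_0_iff_char_dvd)
  then have "of_nat n = (0::'q)" unfolding assms(4) by simp
  then have n0: "of_nat n = (0::'q alg_closure)" by (metis to_ac_0 to_ac_of_nat)
  obtain e1 where e1: "n + 1 = e1 * c" using assms(5) by (metis dvdE mult.commute)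
  obtain e2 where e2: "n\<^sup>2 - n + 1 = e2 * d" using assms(6) by (metis dvdE mult.commute)
  obtain x y z :: "'q alg_closure fls" where
    "\<And>p. evp fls_const x p = 0 \<Longrightarrow> p = 0" "z \<noteq> 0"
    "z ^ (n\<^sup>2 - n + 1) = y * (x * evp fls_const x (geom_poly n (n + 1)))"
    "y ^ (n + 1) = x ^ (n + 1) - 1"
    "\<And>\<eta>. \<eta> ^ (n ^ 3 + 1) = 1 \<Longrightarrow>
       \<exists>\<sigma>. ringhom \<sigma> \<and> (\<forall>a. \<sigma> (fls_const a) = fls_const a) \<and> \<sigma> x = x \<and> \<sigma> z = fls_const \<eta> * z"
    by (rule gk_model[OF n2 n0]) (rule that)
  then have "gk n x y z" by (rule gk.intro[OF n2 n0])
  then interpret gk_quot n x y z c d e1 e2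
    using e1 e2 by (intro gk_quot.intro gk_quot_axioms.intro)
  let ?q = "quotient_function_field Cv (gk_group n c d)"
  have "2 * real_of_int (genus kk ?q) - 2 =
      real c * ((real d - 1) * real n ^ 2 + real n - real d - real (gcd 2 e1))"
    unfolding quotient_genus
    using arg_cong[OF genus_value, of real_of_int] by simp
  then have g: "real_of_int (genus kk ?q) =
      real c / 2 * ((real d - 1) * real n ^ 2 + real n - real d - real (gcd 2 e1)) + 1"
    by (simp add: field_simps)
  have "subgroup (gk_group n c d) (BijGroup Cv)"
    using D.subgroup_act unfolding group_act gk_curve_def .
  then show ?thesis
    unfolding Let_def div
    using group_order FE.F carrier_generated fixed_generated quotient_equations g by blast
qed

end
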